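(* Let $\alpha\in(0,1)$ and $\beta=\alpha/2$. For $\varepsilon>0$ let $m(\varepsilon)\in\mathbb N_+$ with $m(\varepsilon)\to\infty$ and $\lim_{\varepsilon\to0}\varepsilon\,m(\varepsilon)^{2+2\alpha}=0$. Let $\theta_{\varepsilon,m(\varepsilon)}$ be the solution of the Galerkin equation $$d\theta_{\varepsilon,m}=-\Lambda^{2\alpha}\theta_{\varepsilon,m}\,dt-P_m\big(R^\perp\theta_{\varepsilon,m}\cdot\nabla\theta_{\varepsilon,m}\big)\,dt+\varepsilon^{1/2}P_m\Lambda^{\alpha}\,dW(t),\qquad m=m(\varepsilon),$$ with initial data $\theta_{\varepsilon,m(\varepsilon)}(0)\sim\mathcal G(0,\varepsilon P_{m(\varepsilon)}/2)$, and let $\mu_{\varepsilon,m(\varepsilon)}$ be its law on $\mathbb X_{\alpha,\alpha/2}$. Suppose $\theta$ is a weak solution of the skeleton equation $\partial_t\theta=-\Lambda^{2\alpha}\theta-R^\perp\theta\cdot\nabla\theta+\Lambda^\alpha g$ for some $g\in L^2([0,T];L^2(\mathbb T^2))$. (i) If $$\frac12\|\theta(T)\|_{L^2}^2+\int_0^T\|\theta(s)\|_{H^\alpha}^2ds>\frac12\|\theta(0)\|_{L^2}^2+\int_0^T\langle\Lambda^\alpha\theta,g\rangle ds,$$ then $$\inf_{\{G\text{ open in }\mathbb X_{\alpha,\alpha/2}:\ \theta\in G\}}\ \liminf_{\varepsilon\to0}\varepsilon\log\mu_{\varepsilon,m(\varepsilon)}(G)<-\mathcal I(\theta).$$ (ii)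 If $$\frac12\|\theta(T)\|_{L^2}^2+\int_0^T\|\theta(s)\|_{H^\alpha}^2ds<\frac12\|\theta(0)\|_{L^2}^2+\int_0^T\langle\Lambda^\alpha\theta,g\rangle ds,$$ then $$\inf_{\{G\text{ open in }\mathbb X_{\alpha,\alpha/2}:\ \mathfrak T_T\theta\in G\}}\ \liminf_{\varepsilon\to0}\varepsilon\log\mu_{\varepsilon,m(\varepsilon)}(G)<-\mathcal I(\mathfrak T_T\theta).$$
   Context: $\mathbb T^2=\mathbb R^2/\mathbb Z^2$, $T>0$ fixed. $H$ is the space of real mean-zero functions in $L^2(\mathbb T^2)$, $\langle\cdot,\cdot\rangle$ the $L^2$ inner product (also used for duality pairings). For $r\in\mathbb R$, $H^r(\mathbb T^2)$ is the space of mean-zero distributions with $\|f\|_{H^r}^2=\sum_{k\ne0}|2\pi k|^{2r}|\hat f(k)|^2<\infty$; $H^\infty=\bigcap_{r>0}H^r$; a subscript $w$ means weak topology. $\Lambda=(-\Delta)^{1/2}$, $R_j=\partial_j\Lambda^{-1}$, $R^\perp\theta=(-R_2\theta,R_1\theta)$. $$\mathbb X_{\alpha,\alpha/2}=L^2([0,T];H)\cap L^2_w([0,T];H^{\alpha})\cap C([0,T];H_w)$$ with the intersection topology. $(\mathfrak T_T\theta)(t)=-\theta(T-t)$. $W$ is a cylindrical Wiener process on $H$; $P_m$ is the orthogonal projection of $H$ onto $H_m$, the span of the Fourier modes with wave number $0<|k|\le m$; $\mathcal G(0,\varepsilon P_m/2)$ is the centred Gaussian measure on $H$ with covariance operator $\varepsilon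 P_m/2$; the initial data is independent of $W$. The Galerkin equation is an SDE in $H_m$ with a pathwise unique probabilistically strong solution. Nonlinearity. $[\Lambda,\partial_i\varphi]h:=\Lambda(\partial_i\varphi\,h)-\partial_i\varphi\,\Lambda h$, and $R^\perp\theta\cdot\nabla\theta=\nabla\cdot(\theta R^\perp\theta)$ is defined by $\langle R^\perp\theta\cdot\nabla\theta,\varphi\rangle:=-\frac12\langle R_2\theta,[\Lambda,\partial_1\varphi]\Lambda^{-1}\theta\rangle+\frac12\langle R_1\theta,[\Lambda,\partial_2\varphi]\Lambda^{-1}\theta\rangle$ for $\varphi\in H^\infty$ (the classical expression for smooth $\theta$). A weak solution of the skeleton equation with initial data $\theta_0\in H$ is $\theta\in L^\infty([0,T];H)\cap L^2([0,T];H^{\alpha})\cap C([0,T];H_w)$ such that for all $\varphi\in C^\infty([0,T];H^\infty)$, $t\in[0,T]$, $$\langle\theta(t),\varphi(t)\rangle=\langle\theta_0,\varphi(0)\rangle+\int_0^t\big(\langle\theta,\partial_s\varphi\rangle-\langle\theta,\Lambda^{2\alpha}\varphi\rangle-\langle R^\perp\theta\cdot\nabla\theta,\varphi\rangle+\langle\Lambda^{\alpha}\varphi,g\rangle\big)\,ds.$$ Rate function: $\mathcal I(\theta)=\|\theta(0)\|_H^2+\frac12\|\partial_t\theta+\Lambda^{2\alpha}\theta+R^\perp\theta\cdot\nabla\theta\|^2_{L^2([0,T];H^{-\alpha})}$ for $\theta\in\mathbb X_{\alpha,\alpha/2}$; the second term equals $\frac12\inf\|g\|^2_{L^2([0,T];H)}$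 over all $g\in L^2([0,T];H)$ for which $\theta$ is a weak solution of the skeleton equation ($+\infty$ if there is none). *)

theory Defs
  imports "HOL-Probability.Probability"
begin

section \<open>The Hilbert space \<open>L\<^sup>2\<close> of the flat torus\<close>

text \<open>The torus \<open>\<real>\<^sup>2/\<int>\<^sup>2\<close> is represented by its fundamental domain with Lebesgue measure.
  Periodicity is only visible through Fourier coefficients, which is how all Sobolev
  spaces and differential operators below are defined.\<close>

definition torus :: "(real \<times> real) measure" where
  "torus = restrict_space lborel ({0..<1} \<times> {0..<1})"

definition sq_integrable :: "(real \<times> real \<Rightarrow> real) \<Rightarrow> bool" where
  "sq_integrable f \<longleftrightarrow> f \<in> borel_measurable torus \<and> integrable torus (\<lambda>x. (f x)\<^sup>2)"

definition l2_rel :: "(real \<times> real \<Rightarrow> real) \<Rightarrow> (real \<times> real \<Rightarrow> real) \<Rightarrow> bool" where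
  "l2_rel f g \<longleftrightarrow> sq_integrable f \<and> sq_integrable g \<and> (AE x in torus. f x = g x)"

lemma sq_integrable_0: "sq_integrable (\<lambda>x. 0)"
  by (simp add: sq_integrable_def)

lemma sq_integrable_mult:
  assumes "sq_integrable f" "sq_integrable g"
  shows "integrable torus (\<lambda>x. f x * g x)"
proof (rule Bochner_Integration.integrable_bound)
  show "integrable torus (\<lambda>x. (f x)\<^sup>2 + (g x)\<^sup>2)"
    using assms by (simp add: sq_integrable_def)
  show "(\<lambda>x. f x * g x) \<in> borel_measurable torus"
    using assms by (auto simp: sq_integrable_def)
  have "\<bar>a * b\<bar> \<le> a\<^sup>2 + b\<^sup>2" for a b :: real
  proof -
    have "0 \<le> (\<bar>a\<bar> - \<bar>b\<bar>)\<^sup>2" by simp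
    then have "2 * (\<bar>a\<bar> * \<bar>b\<bar>) \<le> a\<^sup>2 + b\<^sup>2" by (simp add: power2_diff)
    moreover have "0 \<le> \<bar>a\<bar> * \<bar>b\<bar>" by simp
    ultimately show ?thesis by (simp only: abs_mult)
  qed
  then show "AE x in torus. norm (f x * g x) \<le> norm ((f x)\<^sup>2 + (g x)\<^sup>2)"
    by simp
qed

lemma sq_integrable_add:
  assumes "sq_integrable f" "sq_integrable g"
  shows "sq_integrable (\<lambda>x. f x + g x)"
  using assms sq_integrable_mult[OF assms]
  by (auto simp: sq_integrable_def power2_sum mult.assoc)

lemma sq_integrable_scale: "sq_integrable f \<Longrightarrow> sq_integrable (\<lambda>x. c * f x)"
  by (auto simp: sq_integrable_def power_mult_distrib)

quotient_type l2 = "real \<times> real \<Rightarrow> real" / partial: l2_rel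
proof (rule part_equivpI)
  show "\<exists>f. l2_rel f f"
    using sq_integrable_0 by (auto simp: l2_rel_def)
  show "symp l2_rel"
    by (auto simp: symp_def l2_rel_def)
  show "transp l2_rel"
    by (auto simp: transp_def l2_rel_def)
qed

instantiation l2 :: real_inner
begin

lift_definition zero_l2 :: l2 is "\<lambda>x. 0"
  by (simp add: l2_rel_def sq_integrable_0)

lift_definition plus_l2 :: "l2 \<Rightarrow> l2 \<Rightarrow> l2" is "\<lambda>f g x. f x + g x"
  by (auto simp: l2_rel_def sq_integrable_add)

lift_definition scaleR_l2 :: "real \<Rightarrow> l2 \<Rightarrow> l2" is "\<lambda>c f x. c * f x"
  by (auto simp: l2_rel_def sq_integrable_scale)

definition uminus_l2 :: "l2 \<Rightarrow> l2" where "uminus_l2 f = (-1) *\<^sub>R f"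
definition minus_l2 :: "l2 \<Rightarrow> l2 \<Rightarrow> l2" where "minus_l2 f g = f + (- g)"

lift_definition inner_l2 :: "l2 \<Rightarrow> l2 \<Rightarrow> real" is "\<lambda>f g. \<integral>x. f x * g x \<partial>torus"
  by (auto simp: l2_rel_def sq_integrable_def intro!: integral_cong_AE)

definition norm_l2 :: "l2 \<Rightarrow> real" where "norm_l2 f = sqrt (f \<bullet> f)"
definition sgn_l2 :: "l2 \<Rightarrow> l2" where "sgn_l2 f = inverse (norm f) *\<^sub>R f"
definition dist_l2 :: "l2 \<Rightarrow> l2 \<Rightarrow> real" where "dist_l2 f g = norm (f - g)"
definition uniformity_l2 :: "(l2 \<times> l2) filter" where
  "uniformity_l2 = (INF e\<in>{0<..}. principal {(x, y). dist x y < e})"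
definition open_l2 :: "l2 set \<Rightarrow> bool" where
  "open_l2 U \<longleftrightarrow> (\<forall>x\<in>U. eventually (\<lambda>(x', y). x' = x \<longrightarrow> y \<in> U) uniformity)"

instance
proof
  fix f g h :: l2 and a b :: real
  show "f + g + h = f + (g + h)"
    by transfer (simp add: l2_rel_def sq_integrable_add add.assoc)
  show "f + g = g + f"
    by transfer (simp add: l2_rel_def sq_integrable_add add.commute)
  show "0 + f = f"
    by transfer (simp add: l2_rel_def)
  show "- f + f = 0"
    unfolding uminus_l2_def
    by transfer (auto simp: l2_rel_def sq_integrable_0)
  show "f - g = f + - g"
    by (rule minus_l2_def)
  show "a *\<^sub>R (f + g) = a *\<^sub>R f + a *\<^sub>R g"
    by transfer (simp add: l2_rel_def sq_integrable_add sq_integrable_scale distrib_left)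
  show "(a + b) *\<^sub>R f = a *\<^sub>R f + b *\<^sub>R f"
    by transfer (simp add: l2_rel_def sq_integrable_add sq_integrable_scale distrib_right)
  show "a *\<^sub>R b *\<^sub>R f = (a * b) *\<^sub>R f"
    by transfer (simp add: l2_rel_def sq_integrable_scale mult.assoc)
  show "1 *\<^sub>R f = f"
    by transfer (simp add: l2_rel_def)
  show "sgn f = inverse (norm f) *\<^sub>R f" by (rule sgn_l2_def)
  show "dist f g = norm (f - g)" by (rule dist_l2_def)
  show "f \<bullet> g = g \<bullet> f"
    by transfer (simp add: mult.commute)
  show "(f + g) \<bullet> h = f \<bullet> h + g \<bullet> h"
    by transfer (simp add: l2_rel_def distrib_right sq_integrable_mult)
  show "(a *\<^sub>R f) \<bullet> g = a * (f \<bullet> g)"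
    by transfer (simp add: mult.assoc)
  show "0 \<le> f \<bullet> f"
    by transfer (simp add: integral_nonneg_AE)
  show "(f \<bullet> f = 0) = (f = 0)"
  proof transfer
    fix f assume "l2_rel f f"
    then have f: "sq_integrable f" by (simp add: l2_rel_def)
    have "(\<integral>x. f x * f x \<partial>torus) = 0 \<longleftrightarrow> (AE x in torus. f x * f x = 0)"
      using sq_integrable_mult[OF f f] by (intro integral_nonneg_eq_0_iff_AE) auto
    then show "((\<integral>x. f x * f x \<partial>torus) = 0) = l2_rel f (\<lambda>x. 0)"
      using f by (simp add: l2_rel_def sq_integrable_0)
  qed
  show "norm f = sqrt (f \<bullet> f)" by (rule norm_l2_def)
  show "(uniformity :: (l2 \<times> l2) filter) = (INF e\<in>{0<..}. principal {(x, y). dist x y < e})"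
    by (rule uniformity_l2_def)
  show "open U \<longleftrightarrow> (\<forall>x\<in>U. \<forall>\<^sub>F (x', y) in uniformity. x' = x \<longrightarrow> y \<in> U)" for U :: "l2 set"
    by (rule open_l2_def)
qed

end

definition to_l2 :: "(real \<times> real \<Rightarrow> real) \<Rightarrow> l2" where
  "to_l2 f = (if sq_integrable f then abs_l2 f else 0)"

text \<open>Pointwise product; it is \<open>0\<close> by convention if the product is not square integrable.\<close>

definition l2_mult :: "l2 \<Rightarrow> l2 \<Rightarrow> l2" where
  "l2_mult f g = to_l2 (\<lambda>x. rep_l2 f x * rep_l2 g x)"


section \<open>Fourier coefficients, Sobolev spaces and Fourier multipliers\<close>

text \<open>The phase \<open>2\<pi> k \<cdot> x\<close> of the Fourier mode with wave number \<open>k\<close>, and the Euclidean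
  length \<open>|k|\<close>.\<close>

definition phase :: "int \<times> int \<Rightarrow> real \<times> real \<Rightarrow> real" where
  "phase k x = 2 * pi * (of_int (fst k) * fst x + of_int (snd k) * snd x)"

definition wave_norm :: "int \<times> int \<Rightarrow> real" where
  "wave_norm k = sqrt ((of_int (fst k))\<^sup>2 + (of_int (snd k))\<^sup>2)"

lift_definition fourier :: "l2 \<Rightarrow> int \<times> int \<Rightarrow> complex" is
  "\<lambda>f k. \<integral>x. of_real (f x) * cis (- phase k x) \<partial>torus"
proof -
  fix f g assume fg: "l2_rel f g"
  have "(\<lambda>x. cis (- phase k x)) \<in> borel_measurable borel" for k
    unfolding phase_def by (intro borel_measurable_continuous_onI continuous_intros)
  then have "(\<lambda>x. cis (- phase k x)) \<in> borel_measurable torus" for k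
    unfolding torus_def by (intro measurable_restrict_space1) simp
  then show "(\<lambda>k. \<integral>x. of_real (f x) * cis (- phase k x) \<partial>torus)
      = (\<lambda>k. \<integral>x. of_real (g x) * cis (- phase k x) \<partial>torus)"
    using fg by (intro ext integral_cong_AE) (auto simp: l2_rel_def sq_integrable_def)
qed

definition cos_mode :: "int \<times> int \<Rightarrow> l2" where
  "cos_mode k = to_l2 (\<lambda>x. cos (phase k x))"

definition sin_mode :: "int \<times> int \<Rightarrow> l2" where
  "sin_mode k = to_l2 (\<lambda>x. sin (phase k x))"

definition H :: "l2 set" where
  "H = {f. fourier f (0, 0) = 0}"

text \<open>The weighted sum \<open>\<Sum>\<^sub>k\<^sub>\<noteq>\<^sub>0 |2\<pi>k|\<^sup>2\<^sup>r |c k|\<^sup>2\<close> behind the Sobolev norms is stated for a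
  coefficient family, since it is applied to functions and to distributions.\<close>

definition sobolev_finite :: "real \<Rightarrow> (int \<times> int \<Rightarrow> complex) \<Rightarrow> bool" where
  "sobolev_finite r c \<longleftrightarrow>
     (\<lambda>k. (2 * pi * wave_norm k) powr (2 * r) * (cmod (c k))\<^sup>2) summable_on (- {(0, 0)})"

definition sobolev_norm :: "real \<Rightarrow> (int \<times> int \<Rightarrow> complex) \<Rightarrow> real" where
  "sobolev_norm r c =
     sqrt (\<Sum>\<^sub>\<infinity>k\<in>- {(0, 0)}. (2 * pi * wave_norm k) powr (2 * r) * (cmod (c k))\<^sup>2)"

text \<open>Only for \<open>r \<ge> 0\<close> does the following describe all of \<open>H\<^sup>r\<close>: then a distribution with finite
  norm is a function in \<open>H\<close>. Negative orders are treated separately below.\<close>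

definition Hs :: "real \<Rightarrow> l2 set" where
  "Hs r = {f \<in> H. sobolev_finite r (fourier f)}"

definition Hs_norm :: "real \<Rightarrow> l2 \<Rightarrow> real" where
  "Hs_norm r f = sobolev_norm r (fourier f)"

definition Hs_inner :: "real \<Rightarrow> l2 \<Rightarrow> l2 \<Rightarrow> real" where
  "Hs_inner r f g =
     Re (\<Sum>\<^sub>\<infinity>k\<in>- {(0, 0)}. of_real ((2 * pi * wave_norm k) powr (2 * r))
          * (fourier f k * cnj (fourier g k)))"

definition Hinf :: "l2 set" where
  "Hinf = (\<Inter>r\<in>{0<..}. Hs r)"

text \<open>An element of \<open>l2\<close> is determined by its Fourier coefficients. If no element has the
  prescribed coefficients, the value is unspecified.\<close>

definition multiplier :: "(int \<times> int \<Rightarrow> complex) \<Rightarrow> l2 \<Rightarrow> l2" where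
  "multiplier \<sigma> f = (THE g. \<forall>k. fourier g k = \<sigma> k * fourier f k)"

text \<open>\<open>Lam s\<close> is \<open>\<Lambda>\<^sup>s = (-\<Delta>)\<^sup>s\<^sup>/\<^sup>2\<close>; it annihilates constants.\<close>

definition Lam :: "real \<Rightarrow> l2 \<Rightarrow> l2" where
  "Lam s = multiplier (\<lambda>k. if k = (0, 0) then 0 else of_real ((2 * pi * wave_norm k) powr s))"

definition partial1 :: "l2 \<Rightarrow> l2" where
  "partial1 = multiplier (\<lambda>k. 2 * of_real pi * \<i> * of_int (fst k))"

definition partial2 :: "l2 \<Rightarrow> l2" where
  "partial2 = multiplier (\<lambda>k. 2 * of_real pi * \<i> * of_int (snd k))"

definition Riesz1 :: "l2 \<Rightarrow> l2" where "Riesz1 f = partial1 (Lam (-1) f)"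
definition Riesz2 :: "l2 \<Rightarrow> l2" where "Riesz2 f = partial2 (Lam (-1) f)"

definition commutator :: "l2 \<Rightarrow> l2 \<Rightarrow> l2" where
  "commutator \<psi> h = Lam 1 (l2_mult \<psi> h) - l2_mult \<psi> (Lam 1 h)"

text \<open>\<open>nonlin \<theta>\<close> is the distribution \<open>R\<^sup>\<bottom>\<theta> \<cdot> \<nabla>\<theta>\<close>, as a functional on \<open>Hinf\<close>.\<close>

definition nonlin :: "l2 \<Rightarrow> l2 \<Rightarrow> real" where
  "nonlin \<theta> \<phi> =
     - (1/2) * (Riesz2 \<theta> \<bullet> commutator (partial1 \<phi>) (Lam (-1) \<theta>))
     + (1/2) * (Riesz1 \<theta> \<bullet> commutator (partial2 \<phi>) (Lam (-1) \<theta>))"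

text \<open>Mean-zero distributions are continuous linear functionals on the Frechet space \<open>Hinf\<close>.
  A function \<open>f \<in> H\<close> corresponds to \<open>\<lambda>\<phi>. f \<bullet> \<phi>\<close>, for which \<open>dist_fourier\<close> agrees with \<open>fourier\<close>
  away from \<open>0\<close>.\<close>

definition mean_zero_distribution :: "(l2 \<Rightarrow> real) \<Rightarrow> bool" where
  "mean_zero_distribution u \<longleftrightarrow>
     (\<forall>f\<in>Hinf. \<forall>g\<in>Hinf. u (f + g) = u f + u g) \<and>
     (\<forall>c. \<forall>f\<in>Hinf. u (c *\<^sub>R f) = c * u f) \<and>
     (\<exists>C. \<exists>r>0. \<forall>f\<in>Hinf. \<bar>u f\<bar> \<le> C * Hs_norm r f)"

definition dist_fourier :: "(l2 \<Rightarrow> real) \<Rightarrow> int \<times> int \<Rightarrow> complex" where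
  "dist_fourier u k = Complex (u (cos_mode k)) (- u (sin_mode k))"

definition Hs_dist :: "real \<Rightarrow> (l2 \<Rightarrow> real) set" where
  "Hs_dist r = {u. mean_zero_distribution u \<and> sobolev_finite r (dist_fourier u)}"

definition Hs_dist_norm :: "real \<Rightarrow> (l2 \<Rightarrow> real) \<Rightarrow> real" where
  "Hs_dist_norm r u = sobolev_norm r (dist_fourier u)"


section \<open>Path spaces\<close>

text \<open>\<open>L\<^sup>2([0,T]; L\<^sup>2(T\<^sup>2))\<close>, and the subspaces of \<open>H\<close>- and \<open>H\<^sup>r\<close>-valued functions (\<open>r \<ge> 0\<close>), as sets
  of representatives. As \<open>l2\<close> is separable, Borel measurability is strong measurability.\<close>

definition L2_L2 :: "real \<Rightarrow> (real \<Rightarrow> l2) set" where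
  "L2_L2 T = {f. f \<in> borel_measurable (lebesgue_on {0..T}) \<and>
                 integrable (lebesgue_on {0..T}) (\<lambda>t. (norm (f t))\<^sup>2)}"

definition L2_H :: "real \<Rightarrow> (real \<Rightarrow> l2) set" where
  "L2_H T = {f \<in> L2_L2 T. AE t in lebesgue_on {0..T}. f t \<in> H}"

definition Linf_H :: "real \<Rightarrow> (real \<Rightarrow> l2) set" where
  "Linf_H T = {f. f \<in> borel_measurable (lebesgue_on {0..T}) \<and>
                  (\<exists>C. AE t in lebesgue_on {0..T}. f t \<in> H \<and> norm (f t) \<le> C)}"

definition L2_Hs :: "real \<Rightarrow> real \<Rightarrow> (real \<Rightarrow> l2) set" where
  "L2_Hs T r = {f. f \<in> borel_measurable (lebesgue_on {0..T}) \<and>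
                   (AE t in lebesgue_on {0..T}. f t \<in> Hs r) \<and>
                   integrable (lebesgue_on {0..T}) (\<lambda>t. (Hs_norm r (f t))\<^sup>2)}"

text \<open>\<open>C([0,T]; H\<^sub>w)\<close>; paths are \<open>undefined\<close> outside \<open>[0,T]\<close>.\<close>

definition C_Hw :: "real \<Rightarrow> (real \<Rightarrow> l2) set" where
  "C_Hw T = {f \<in> extensional {0..T}. (\<forall>t\<in>{0..T}. f t \<in> H) \<and>
               (\<forall>y\<in>H. continuous_on {0..T} (\<lambda>t. f t \<bullet> y))}"

definition X_space :: "real \<Rightarrow> real \<Rightarrow> (real \<Rightarrow> l2) set" where
  "X_space \<alpha> T = L2_H T \<inter> L2_Hs T \<alpha> \<inter> C_Hw T"

text \<open>Subbases of the topologies induced by \<open>L\<^sup>2([0,T];H)\<close> (norm balls), by \<open>L\<^sup>2([0,T];H\<^sup>\<alpha>)\<close>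
  with its weak topology, and by \<open>C([0,T];H\<^sub>w)\<close> (uniform convergence with respect to the seminorms
  \<open>|\<langle>\<cdot>, y\<rangle>|\<close> of \<open>H\<^sub>w\<close>; the supremum over \<open>[0,T]\<close> is attained).\<close>

definition X_strong_subbase :: "real \<Rightarrow> real \<Rightarrow> (real \<Rightarrow> l2) set set" where
  "X_strong_subbase \<alpha> T =
     {{\<eta> \<in> X_space \<alpha> T. sqrt (\<integral>t. (norm (\<eta> t - \<xi> t))\<^sup>2 \<partial>lebesgue_on {0..T}) < \<rho>} |\<xi> \<rho>.
        \<xi> \<in> X_space \<alpha> T \<and> \<rho> > 0}"

definition X_weak_subbase :: "real \<Rightarrow> real \<Rightarrow> (real \<Rightarrow> l2) set set" where
  "X_weak_subbase \<alpha> T =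
     {{\<eta> \<in> X_space \<alpha> T. (\<integral>t. Hs_inner \<alpha> (\<eta> t) (\<psi> t) \<partial>lebesgue_on {0..T}) \<in> U} |\<psi> U.
        \<psi> \<in> L2_Hs T \<alpha> \<and> open U}"

definition X_cont_subbase :: "real \<Rightarrow> real \<Rightarrow> (real \<Rightarrow> l2) set set" where
  "X_cont_subbase \<alpha> T =
     {{\<eta> \<in> X_space \<alpha> T. \<forall>t\<in>{0..T}. \<bar>(\<eta> t - \<xi> t) \<bullet> y\<bar> < \<rho>} |\<xi> y \<rho>.
        \<xi> \<in> X_space \<alpha> T \<and> y \<in> H \<and> \<rho> > 0}"

definition X_topology :: "real \<Rightarrow> real \<Rightarrow> (real \<Rightarrow> l2) topology" where
  "X_topology \<alpha> T =
     topology_generated_by (X_strong_subbase \<alpha> T \<union> X_weak_subbase \<alpha> T \<union> X_cont_subbase \<alpha> T)"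

definition X_borel :: "real \<Rightarrow> real \<Rightarrow> (real \<Rightarrow> l2) measure" where
  "X_borel \<alpha> T = sigma (X_space \<alpha> T) {G. openin (X_topology \<alpha> T) G}"

definition time_reversal :: "real \<Rightarrow> (real \<Rightarrow> l2) \<Rightarrow> real \<Rightarrow> l2" where
  "time_reversal T \<theta> = restrict (\<lambda>t. - \<theta> (T - t)) {0..T}"


section \<open>The skeleton equation and the rate function\<close>

text \<open>\<open>C\<^sup>\<infinity>([0,T]; H\<^sup>\<infinity>)\<close>: all time derivatives \<open>D n\<close> exist with respect to every Sobolev norm
  (one-sided at the endpoints).\<close>

definition Cinf_Hinf :: "real \<Rightarrow> (real \<Rightarrow> l2) set" where
  "Cinf_Hinf T = {\<phi>. \<exists>D. D 0 = \<phi> \<and>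
     (\<forall>n. \<forall>t\<in>{0..T}. D n t \<in> Hinf \<and>
        (\<forall>r>0. ((\<lambda>s. Hs_norm r ((D n s - D n t) /\<^sub>R (s - t) - D (Suc n) t)) \<longlongrightarrow> 0)
                 (at t within {0..T})))}"

definition time_deriv :: "real \<Rightarrow> (real \<Rightarrow> l2) \<Rightarrow> real \<Rightarrow> l2" where
  "time_deriv T \<phi> s = vector_derivative \<phi> (at s within {0..T})"

definition weak_solution ::
    "real \<Rightarrow> real \<Rightarrow> l2 \<Rightarrow> (real \<Rightarrow> l2) \<Rightarrow> (real \<Rightarrow> l2) \<Rightarrow> bool" where
  "weak_solution \<alpha> T \<theta>0 g \<theta> \<longleftrightarrow>
     \<theta>0 \<in> H \<and> \<theta> \<in> Linf_H T \<inter> L2_Hs T \<alpha> \<inter> C_Hw T \<and>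
     (\<forall>\<phi>\<in>Cinf_Hinf T. \<forall>t\<in>{0..T}.
        \<theta> t \<bullet> \<phi> t = \<theta>0 \<bullet> \<phi> 0 +
          (\<integral>s. (\<theta> s \<bullet> time_deriv T \<phi> s - \<theta> s \<bullet> Lam (2 * \<alpha>) (\<phi> s) - nonlin (\<theta> s) (\<phi> s)
                 + Lam \<alpha> (\<phi> s) \<bullet> g s) \<partial>lebesgue_on {0..t}))"

text \<open>\<open>L\<^sup>2([0,T]; H\<^sup>r)\<close> for arbitrary real \<open>r\<close>, with distributions as values.\<close>

definition L2_Hs_dist :: "real \<Rightarrow> real \<Rightarrow> (real \<Rightarrow> l2 \<Rightarrow> real) set" where
  "L2_Hs_dist T r = {u. (\<forall>\<phi>\<in>Hinf. (\<lambda>t. u t \<phi>) \<in> borel_measurable (lebesgue_on {0..T})) \<and>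
     (AE t in lebesgue_on {0..T}. u t \<in> Hs_dist r) \<and>
     integrable (lebesgue_on {0..T}) (\<lambda>t. (Hs_dist_norm r (u t))\<^sup>2)}"

text \<open>\<open>u = \<partial>\<^sub>t\<theta> + \<Lambda>\<^sup>2\<^sup>\<alpha>\<theta> + R\<^sup>\<bottom>\<theta> \<cdot> \<nabla>\<theta>\<close> in the sense of distributions on \<open>(0,T)\<close> times the torus.\<close>

definition skeleton_residual ::
    "real \<Rightarrow> real \<Rightarrow> (real \<Rightarrow> l2) \<Rightarrow> (real \<Rightarrow> l2 \<Rightarrow> real) \<Rightarrow> bool" where
  "skeleton_residual \<alpha> T \<theta> u \<longleftrightarrow>
     (\<forall>\<phi>\<in>Cinf_Hinf T. (\<exists>\<delta>>0. \<forall>t\<in>{0..T}. t < \<delta> \<or> T - \<delta> < t \<longrightarrow> \<phi> t = 0) \<longrightarrow>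
        (\<integral>s. (- (\<theta> s \<bullet> time_deriv T \<phi> s) + \<theta> s \<bullet> Lam (2 * \<alpha>) (\<phi> s) + nonlin (\<theta> s) (\<phi> s))
              \<partial>lebesgue_on {0..T})
        = (\<integral>s. u s (\<phi> s) \<partial>lebesgue_on {0..T}))"

text \<open>The squared norm of the residual in \<open>L\<^sup>2([0,T]; H\<^sup>-\<^sup>\<alpha>)\<close>. The element \<open>u\<close> of that space
  representing the residual is unique almost everywhere; the infimum only serves to give \<open>\<infinity>\<close> if the
  residual is not in the space.\<close>

definition residual_norm_sq :: "real \<Rightarrow> real \<Rightarrow> (real \<Rightarrow> l2) \<Rightarrow> ereal" where
  "residual_norm_sq \<alpha> T \<theta> =
     (INF u\<in>{u \<in> L2_Hs_dist T (- \<alpha>). skeleton_residual \<alpha> T \<theta> u}.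
        ereal (\<integral>t. (Hs_dist_norm (- \<alpha>) (u t))\<^sup>2 \<partial>lebesgue_on {0..T}))"

definition rate_function :: "real \<Rightarrow> real \<Rightarrow> (real \<Rightarrow> l2) \<Rightarrow> ereal" where
  "rate_function \<alpha> T \<theta> = ereal ((norm (\<theta> 0))\<^sup>2) + ereal (1/2) * residual_norm_sq \<alpha> T \<theta>"


section \<open>Noise, initial data and the Galerkin equation\<close>

definition centred_normal :: "real \<Rightarrow> real measure" where
  "centred_normal v =
     (if v = 0 then return borel 0 else density lborel (\<lambda>x. ennreal (normal_density 0 (sqrt v) x)))"

text \<open>\<open>W t h\<close> stands for \<open>\<langle>W(t), h\<rangle>\<close>: a jointly Gaussian centred family with covariance
  \<open>min s t \<langle>h, h'\<rangle>\<close>, continuous in time. The covariance makes \<open>W t h\<close> almost surely linear in \<open>h\<close>.\<close>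

definition cylindrical_wiener :: "'a measure \<Rightarrow> (real \<Rightarrow> l2 \<Rightarrow> 'a \<Rightarrow> real) \<Rightarrow> bool" where
  "cylindrical_wiener M W \<longleftrightarrow>
     (\<forall>t\<ge>0. \<forall>h\<in>H. W t h \<in> borel_measurable M) \<and>
     (\<forall>h\<in>H. AE \<omega> in M. continuous_on {0..} (\<lambda>t. W t h \<omega>)) \<and>
     (\<forall>n (c :: nat \<Rightarrow> real) t h. (\<forall>i<n. 0 \<le> t i \<and> h i \<in> H) \<longrightarrow>
        distr M borel (\<lambda>\<omega>. \<Sum>i<n. c i * W (t i) (h i) \<omega>)
        = centred_normal (\<Sum>i<n. \<Sum>j<n. c i * c j * min (t i) (t j) * (h i \<bullet> h j)))"

definition independent_of_noise ::
    "'a measure \<Rightarrow> (real \<Rightarrow> l2 \<Rightarrow> 'a \<Rightarrow> real) \<Rightarrow> ('a \<Rightarrow> l2) \<Rightarrow> bool" where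
  "independent_of_noise M W \<xi> \<longleftrightarrow>
     prob_space.indep_set M
       {\<xi> -` A \<inter> space M |A. A \<in> sets borel}
       (sigma_sets (space M) {W t h -` B \<inter> space M |t h B. 0 \<le> t \<and> h \<in> H \<and> B \<in> sets borel})"

definition Hm :: "nat \<Rightarrow> l2 set" where
  "Hm m = span (\<Union>k\<in>{k. 0 < wave_norm k \<and> wave_norm k \<le> real m}. {cos_mode k, sin_mode k})"

definition Pm :: "nat \<Rightarrow> l2 \<Rightarrow> l2" where
  "Pm m f = (THE g. g \<in> Hm m \<and> (\<forall>h\<in>Hm m. (f - g) \<bullet> h = 0))"

text \<open>\<open>\<nu>\<close> is the centred Gaussian measure on \<open>H\<close> with covariance operator \<open>Q\<close>.\<close>

definition gaussian_on_H :: "(l2 \<Rightarrow> l2) \<Rightarrow> l2 measure \<Rightarrow> bool" where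
  "gaussian_on_H Q \<nu> \<longleftrightarrow>
     prob_space \<nu> \<and> sets \<nu> = sets borel \<and> (AE x in \<nu>. x \<in> H) \<and>
     (\<forall>h\<in>H. distr \<nu> borel (\<lambda>x. x \<bullet> h) = centred_normal (Q h \<bullet> h))"

text \<open>The noise is additive, so the equation is the pathwise integral equation, here tested
  against \<open>\<phi>\<close>; \<open>\<langle>P\<^sub>m \<Lambda>\<^sup>\<alpha> W(t), \<phi>\<rangle>\<close> means \<open>\<langle>W(t), \<Lambda>\<^sup>\<alpha> P\<^sub>m \<phi>\<rangle>\<close>, and likewise for the nonlinearity.\<close>

definition galerkin_solution ::
    "'a measure \<Rightarrow> (real \<Rightarrow> l2 \<Rightarrow> 'a \<Rightarrow> real) \<Rightarrow> real \<Rightarrow> real \<Rightarrow> real \<Rightarrow> nat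
      \<Rightarrow> ('a \<Rightarrow> real \<Rightarrow> l2) \<Rightarrow> bool" where
  "galerkin_solution M W \<alpha> T \<epsilon> m \<theta> \<longleftrightarrow>
     (\<forall>t\<in>{0..T}. (\<lambda>\<omega>. \<theta> \<omega> t) \<in> borel_measurable M) \<and>
     (\<forall>\<omega>\<in>space M. \<theta> \<omega> \<in> extensional {0..T} \<and> continuous_on {0..T} (\<theta> \<omega>) \<and>
        (\<forall>t\<in>{0..T}. \<theta> \<omega> t \<in> Hm m)) \<and>
     (\<forall>\<phi>\<in>H. AE \<omega> in M. \<forall>t\<in>{0..T}.
        \<theta> \<omega> t \<bullet> \<phi> = \<theta> \<omega> 0 \<bullet> \<phi>
          - (\<integral>s. Lam (2 * \<alpha>) (\<theta> \<omega> s) \<bullet> \<phi> \<partial>lebesgue_on {0..t})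
          - (\<integral>s. nonlin (\<theta> \<omega> s) (Pm m \<phi>) \<partial>lebesgue_on {0..t})
          + sqrt \<epsilon> * W t (Lam \<alpha> (Pm m \<phi>)) \<omega>)"

definition path_law ::
    "real \<Rightarrow> real \<Rightarrow> 'a measure \<Rightarrow> ('a \<Rightarrow> real \<Rightarrow> l2) \<Rightarrow> (real \<Rightarrow> l2) measure" where
  "path_law \<alpha> T M \<theta> = distr M (X_borel \<alpha> T) \<theta>"

definition elog :: "real \<Rightarrow> ereal" where
  "elog p = (if p = 0 then - \<infinity> else ereal (ln p))"

end

theory Submission
  imports Defs
begin

text \<open>Testing the Galerkin equation against a trigonometric polynomial that is piecewise constant in time,
  and adding \<open>c |\<theta>(T)|\<^sup>2\<close> with \<open>c < 1\<close>, gives a functional whose exponential moment at speed \<open>1/\<epsilon>\<close> is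
  computed along the Euler scheme, a finite Gaussian recursion: the nonlinearity does not change the energy,
  and the moment is at most \<open>exp (O(m\<^sup>2\<^sup>+\<^sup>2\<^sup>\<alpha>))\<close>, negligible under the scaling assumption. By Chebyshev's
  inequality every path \<open>\<theta>\<close> satisfies a local upper bound with rate arbitrarily close to
  \<open>|\<theta>(T)|\<^sup>2 + 1/2 \<integral>|g - 2 \<Lambda>\<^sup>\<alpha>\<theta>|\<^sup>2\<close>, the action of the reversed path started from \<open>-\<theta>(T)\<close>. It exceeds
  \<open>|\<theta>(0)|\<^sup>2 + 1/2 \<integral>|g|\<^sup>2\<close> by twice the energy defect, so (i) follows without reversing the stochastic
  equation. The time reversal of \<open>\<theta>\<close> is a weak solution with control \<open>(g - 2 \<Lambda>\<^sup>\<alpha>\<theta>)(T - \<cdot>)\<close>, whose energy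
  defect has the opposite sign; hence (ii).\<close>

text \<open>Everything rests on one exponential Chebyshev bound, so a moment is needed only from
  above and the tested functional only from below; nonnegative terms may be dropped on the way.
  After discretisation the moment is an iterated Gaussian integral over finitely many independent
  variables, and Fatou's lemma leads back to the paths; no stochastic integral occurs. The
  restriction \<open>c < 1\<close> comes from the initial datum: its modes have variance
  \<open>\<epsilon> / 2\<close>, so \<open>exp (c x^2 / \<epsilon>)\<close> has mean
  \<open>1 / sqrt (1 - c)\<close>, infinite exactly at \<open>c = 1\<close>, the value at which the
  functional becomes the action of the reversed path. Reversal shows in the dissipation:
  compensating the growth of \<open>c |\<theta>|^2\<close> replaces its coefficient 1 by
  \<open>1 - 2 c\<close>. Both squares in the rate are reached by duality, \<open>x^2\<close> as the
  supremum of \<open>2 y x - y^2\<close> and \<open>q^2 / 2\<close> as that of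
  \<open>w q - w^2 / 2\<close>: with \<open>y\<close> and \<open>w\<close> fixed and finitely many
  modes the functional is continuous in the topology of the path space, which the squares themselves
  are not.\<close>

section \<open>Independence from characteristic functions\<close>

context prob_space
begin

text \<open>Normalising \<open>w\<close> gives a probability density, and the hypothesis says that
  \<open>Y\<close> has the same characteristic function under it as under \<open>M\<close>; Levy
  uniqueness on the line then identifies the two laws. If the total weight is 0, both sides
  vanish.\<close>

lemma weighted_char_imp_indep:
 fixes w Y :: "'a \<Rightarrow> real"
 assumes w [measurable]: "w \<in> borel_measurable M"
  and w_bound: "\<And>z. 0 \<le> w z" "\<And>z. w z \<le> C"
  and Y [measurable]: "Y \<in> borel_measurable M"
  and B [measurable]: "B \<in> sets borel"
  and char: "\<And>s. expectation (\<lambda>z. of_real (w z) * cis (s * Y z))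
    = of_real (expectation w) * expectation (\<lambda>z. cis (s * Y z))"
 shows "expectation (\<lambda>z. w z * indicator B (Y z)) = expectation w * prob (Y -` B \<inter> space M)"
proof -
 have int_w: "integrable M w"
  using w_bound by (intro integrable_const_bound[where B=C]) auto
 define c where "c = expectation w"
 have c_nonneg: "0 \<le> c" unfolding c_def using w_bound by (intro integral_nonneg_AE) auto
 show ?thesis
 proof (cases "c = 0")
  case True
  then have "AE z in M. w z = 0"
   unfolding c_def using int_w w_bound by (subst (asm) integral_nonneg_eq_0_iff_AE) auto
  then have "expectation (\<lambda>z. w z * indicator B (Y z)) = expectation (\<lambda>z. 0)"
   by (intro integral_cong_AE) auto
  then show ?thesis using True by (simp add: c_def)
 next
  case False
  with c_nonneg have c: "0 < c" by simp
  define D where "D = density M (\<lambda>z. ennreal (w z / c))"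
  have D_sets [measurable_cong]: "sets D = sets M" by (simp add: D_def)
  have "prob_space D"
  proof
   have "emeasure D (space D) = (\<integral>\<^sup>+ z. ennreal (w z / c) \<partial>M)"
    unfolding D_def by (subst emeasure_density) (auto simp: indicator_def intro!: nn_integral_cong)
   also have "\<dots> = ennreal (expectation (\<lambda>z. w z / c))"
    using int_w w_bound c by (intro nn_integral_eq_integral) auto
   also have "\<dots> = 1" using c by (simp add: c_def)
   finally show "emeasure D (space D) = 1" .
  qed
  then interpret D: prob_space D .
  have YD: "Y \<in> measurable D borel" by measurable
  have int_D: "(\<integral>z. f z \<partial>D) = expectation (\<lambda>z. (w z / c) *\<^sub>R f z)"
   if "f \<in> borel_measurable M" for f :: "'a \<Rightarrow> 'b :: {banach, second_countable_topology}"
   unfolding D_def using that w_bound c by (intro integral_density) auto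
  have "distr D borel Y = distr M borel Y"
  proof (rule Levy_uniqueness)
   show "real_distribution (distr D borel Y)" "real_distribution (distr M borel Y)"
    using D.real_distribution_distr[OF YD] real_distribution_distr[OF Y] by auto
   show "char (distr D borel Y) = char (distr M borel Y)"
   proof
    fix s
    have "char (distr D borel Y) s = (\<integral>z. cis (s * Y z) \<partial>D)"
     unfolding char_def by (subst integral_distr[OF YD]) (auto simp: cis_conv_exp)
    also have "\<dots> = expectation (\<lambda>z. (w z / c) *\<^sub>R cis (s * Y z))"
     by (rule int_D) (simp add: cis_conv_exp)
    also have "\<dots> = expectation (\<lambda>z. of_real (1/c) * (of_real (w z) * cis (s * Y z)))"
     by (intro Bochner_Integration.integral_cong) (auto simp: scaleR_conv_of_real)
    also have "\<dots> = of_real (1/c) * expectation (\<lambda>z. of_real (w z) * cis (s * Y z))"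
     by (rule integral_mult_right_zero)
    also have "\<dots> = expectation (\<lambda>z. cis (s * Y z))"
     unfolding char using c by (simp add: c_def)
    also have "\<dots> = char (distr M borel Y) s"
     unfolding char_def by (subst integral_distr[OF Y]) (auto simp: cis_conv_exp)
    finally show "char (distr D borel Y) s = char (distr M borel Y) s" .
   qed
  qed
  then have "measure (distr D borel Y) B = measure (distr M borel Y) B" by simp
  then have "D.prob (Y -` B \<inter> space M) = prob (Y -` B \<inter> space M)"
   using YD by (simp add: measure_distr D_def)
  moreover have "D.prob (Y -` B \<inter> space M) = (\<integral>z. indicator B (Y z) \<partial>D)"
  proof -
   have "Y -` B \<inter> space M \<in> sets D" using measurable_sets[OF YD B] by (simp add: D_def)
   then have "D.prob (Y -` B \<inter> space M) = (\<integral>z. indicator (Y -` B \<inter> space M) z \<partial>D)" by simp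
   also have "\<dots> = (\<integral>z. indicator B (Y z) \<partial>D)"
    by (intro Bochner_Integration.integral_cong) (auto simp: D_def indicator_def)
   finally show ?thesis .
  qed
  moreover have "(\<integral>z. indicator B (Y z) \<partial>D)
    = expectation (\<lambda>z. (w z / c) *\<^sub>R (indicator B (Y z) :: real))"
   by (rule int_D) auto
  moreover have "\<dots> = expectation (\<lambda>z. w z * indicator B (Y z)) / c"
   by (simp add: divide_inverse mult.commute mult.left_commute)
  ultimately have "expectation (\<lambda>z. w z * indicator B (Y z)) / c = prob (Y -` B \<inter> space M)"
   by simp
  then show ?thesis using c by (simp add: field_simps c_def)
 qed
qed

lemma integrable_bounded_cis:
 assumes [measurable]: "(D :: 'a \<Rightarrow> real) \<in> borel_measurable M" "S \<in> borel_measurable M"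
  and D: "\<And>z. 0 \<le> D z" "\<And>z. D z \<le> 1"
 shows "integrable M (\<lambda>z. of_real (D z) * cis (S z))"
 using D by (intro integrable_const_bound[where B=1]) (auto simp: norm_mult cis_conv_exp)

text \<open>Kac's criterion. The oscillating factors are exchanged for indicators one coordinate at
  a time, so that uniqueness is used only for laws on the real line and never for vectors.\<close>

lemma indep_vars_char:
 fixes X :: "'i \<Rightarrow> 'a \<Rightarrow> real"
 assumes I: "finite I"
  and rv [measurable]: "\<And>i. i \<in> I \<Longrightarrow> X i \<in> borel_measurable M"
  and char: "\<And>u :: 'i \<Rightarrow> real. expectation (\<lambda>z. cis (\<Sum>i\<in>I. u i * X i z))
     = (\<Prod>i\<in>I. expectation (\<lambda>z. cis (u i * X i z)))"
 shows "indep_vars (\<lambda>_. borel) X I"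
proof -
 \<comment> \<open>The coordinates in \<open>J\<close> have already become indicators, those in
   \<open>I - J\<close> still oscillate with arbitrary frequencies. The case \<open>J = {}\<close>
   is the hypothesis, the case \<open>J = I\<close> the product formula for events.\<close>
 have main: "expectation (\<lambda>z. of_real (\<Prod>j\<in>J. indicator (B j) (X j z)) * cis (\<Sum>i\<in>I-J. u i * X i z))
   = of_real (\<Prod>j\<in>J. prob (X j -` B j \<inter> space M)) * (\<Prod>i\<in>I-J. expectation (\<lambda>z. cis (u i * X i z)))"
  if "J \<subseteq> I" "\<And>j. j \<in> J \<Longrightarrow> B j \<in> sets borel" for J B and u :: "'i \<Rightarrow> real"
 proof -
  have "finite J" using that I finite_subset by auto
  then show ?thesis using that
  proof (induction J arbitrary: u rule: finite_induct)
   case empty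
   then show ?case using char by simp
  next
   case (insert j J)
   have J: "J \<subseteq> I" "j \<in> I" "\<And>i. i \<in> J \<Longrightarrow> B i \<in> sets borel" "B j \<in> sets borel"
    using insert.prems by auto
   define R where "R = I - insert j J"
   have R: "finite R" "R \<subseteq> I" "j \<notin> R" "I - J = insert j R"
    using I J insert.hyps by (auto simp: R_def)
   have RI: "\<And>i. i \<in> R \<Longrightarrow> i \<in> I" using R by auto
   have JI: "\<And>i. i \<in> J \<Longrightarrow> i \<in> I" using J by auto
   define D where "D z = (\<Prod>i\<in>J. indicator (B i) (X i z) :: real)" for z
   have D_meas [measurable]: "D \<in> borel_measurable M"
    unfolding D_def using J JI rv
    by (intro borel_measurable_prod measurable_compose[OF rv] borel_measurable_indicator) auto
   have D01: "0 \<le> D z" "D z \<le> 1" for z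
    unfolding D_def by (auto intro!: prod_nonneg prod_le_1)
   define S where "S v z = (\<Sum>i\<in>R. v i * X i z)" for v z
   have S_meas [measurable]: "S v \<in> borel_measurable M" for v
    unfolding S_def using RI rv by (intro borel_measurable_sum borel_measurable_times) auto
   have Xj [measurable]: "X j \<in> borel_measurable M" using J by auto
   define p where "p = (\<Prod>i\<in>J. prob (X i -` B i \<inter> space M))"
   define E where "E v = (\<Prod>i\<in>R. expectation (\<lambda>z. cis (v i * X i z)))" for v
   have IH: "expectation (\<lambda>z. of_real (D z) * cis (S v z + s * X j z))
     = of_real p * E v * expectation (\<lambda>z. cis (s * X j z))" for v s
   proof -
    have "(\<Sum>i\<in>insert j R. (v(j := s)) i * X i z) = S v z + s * X j z" for z
     using R unfolding S_def by (auto simp: intro!: sum.cong)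
    moreover have "(\<Prod>i\<in>insert j R. expectation (\<lambda>z. cis ((v(j := s)) i * X i z)))
      = expectation (\<lambda>z. cis (s * X j z)) * E v"
     using R unfolding E_def by (auto simp: intro!: prod.cong)
    ultimately show ?thesis
     using insert.IH[of "v(j := s)"] J unfolding R D_def p_def
     by (simp add: mult_ac)
   qed
   have IH0: "expectation (\<lambda>z. of_real (D z) * cis (S v z)) = of_real p * E v" for v
    using IH[of v 0] by (simp add: prob_space)
   have S_uminus: "S (\<lambda>i. - v i) z = - S v z" for v z
    by (simp add: S_def sum_negf)
   have S_0: "S (\<lambda>_. 0) z = 0" for z by (simp add: S_def)
   have int [simp]: "integrable M (\<lambda>z. of_real (D z) * cis (S v z + s * X j z))" for v s
    using D01 by (intro integrable_bounded_cis) auto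
   \<comment> \<open>The nonnegative weights \<open>1 + cos (S + \<phi>)\<close> turn the oscillating factor into finite measures,
    to which one-dimensional uniqueness applies.\<close>
   have weight: "expectation (\<lambda>z. D z * (1 + cos (S u z + \<phi>)) * indicator (B j) (X j z))
     = expectation (\<lambda>z. D z * (1 + cos (S u z + \<phi>))) * prob (X j -` B j \<inter> space M)" for \<phi>
   proof (rule weighted_char_imp_indep[where C=2])
    have cos_cis: "of_real (D z * (1 + cos (S u z + \<phi>))) * cis (s * X j z)
     = of_real (D z) * cis (S (\<lambda>_. 0) z + s * X j z)
     + (cis \<phi> / 2) * (of_real (D z) * cis (S u z + s * X j z))
     + (cis (- \<phi>) / 2) * (of_real (D z) * cis (S (\<lambda>i. - u i) z + s * X j z))" for z s
    proof -
     have "complex_of_real (cos a) = (cis a + cis (- a)) / 2" for a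
      by (simp add: complex_eq_iff)
     then have "complex_of_real (cos (S u z + \<phi>)) = (cis (S u z) * cis \<phi> + cis (- S u z) * cis (-\<phi>)) / 2"
      by (simp add: cis_mult)
     then show ?thesis
      by (simp only: of_real_mult of_real_add of_real_1 S_0 S_uminus cis_mult[symmetric] cis_zero)
        (simp add: field_simps)
    qed
    have 1: "expectation (\<lambda>z. of_real (D z * (1 + cos (S u z + \<phi>))) * cis (s * X j z))
     = (of_real p * E (\<lambda>_. 0) + (cis \<phi> / 2) * (of_real p * E u) + (cis (- \<phi>) / 2) * (of_real p * E (\<lambda>i. - u i)))
       * expectation (\<lambda>z. cis (s * X j z))" for s
    proof -
     have "expectation (\<lambda>z. of_real (D z * (1 + cos (S u z + \<phi>))) * cis (s * X j z))
      = expectation (\<lambda>z. of_real (D z) * cis (S (\<lambda>_. 0) z + s * X j z))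
      + (cis \<phi> / 2) * expectation (\<lambda>z. of_real (D z) * cis (S u z + s * X j z))
      + (cis (- \<phi>) / 2) * expectation (\<lambda>z. of_real (D z) * cis (S (\<lambda>i. - u i) z + s * X j z))"
      unfolding cos_cis integral_mult_right_zero[symmetric]
      by (subst Bochner_Integration.integral_add[symmetric];
        (subst Bochner_Integration.integral_add[symmetric])?;
        intro refl Bochner_Integration.integrable_add int integrable_mult_right)
     then show ?thesis unfolding IH by (simp only: algebra_simps)
    qed
    have 2: "complex_of_real (expectation (\<lambda>z. D z * (1 + cos (S u z + \<phi>))))
     = of_real p * E (\<lambda>_. 0) + (cis \<phi> / 2) * (of_real p * E u) + (cis (- \<phi>) / 2) * (of_real p * E (\<lambda>i. - u i))"
    proof -
     have "expectation (\<lambda>z. complex_of_real (D z * (1 + cos (S u z + \<phi>))))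
      = of_real p * E (\<lambda>_. 0) + (cis \<phi> / 2) * (of_real p * E u) + (cis (- \<phi>) / 2) * (of_real p * E (\<lambda>i. - u i))"
      using 1[of 0] by (simp add: prob_space)
     then show ?thesis by (simp only: integral_complex_of_real)
    qed
    show "expectation (\<lambda>z. of_real (D z * (1 + cos (S u z + \<phi>))) * cis (s * X j z))
     = of_real (expectation (\<lambda>z. D z * (1 + cos (S u z + \<phi>)))) * expectation (\<lambda>z. cis (s * X j z))" for s
     unfolding 1 2 ..
    have c1: "0 \<le> 1 + cos a" "1 + cos a \<le> 2" for a :: real
     using cos_ge_minus_one[of a] cos_le_one[of a] by linarith+
    show "0 \<le> D z * (1 + cos (S u z + \<phi>))" for z using D01[of z] c1 by simp
    show "D z * (1 + cos (S u z + \<phi>)) \<le> 2" for z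
     using mult_mono[OF D01(2)[of z] c1(2)[of "S u z + \<phi>"]] c1 D01[of z] by simp
   qed (use J in auto)
   have plain: "expectation (\<lambda>z. D z * indicator (B j) (X j z))
     = expectation D * prob (X j -` B j \<inter> space M)"
   proof (rule weighted_char_imp_indep[where C=1])
    have 1: "expectation (\<lambda>z. of_real (D z) * cis (s * X j z)) = of_real p * E (\<lambda>_. 0) * expectation (\<lambda>z. cis (s * X j z))" for s
     using IH[of "\<lambda>_. 0" s] by (simp add: S_0)
    have 2: "complex_of_real (expectation D) = of_real p * E (\<lambda>_. 0)"
     using 1[of 0] by (simp add: prob_space)
    show "expectation (\<lambda>z. of_real (D z) * cis (s * X j z)) = of_real (expectation D) * expectation (\<lambda>z. cis (s * X j z))" for s
     unfolding 1 2 ..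
   qed (use J D01 in auto)
   have indB [measurable]: "(\<lambda>z. indicator (B j) (X j z) :: real) \<in> borel_measurable M"
    using J by (intro measurable_compose[OF Xj] borel_measurable_indicator) auto
   have bdd: "integrable M (\<lambda>z. D z * f z)" if [measurable]: "f \<in> borel_measurable M" and "\<And>z. \<bar>f z\<bar> \<le> 1" for f :: "'a \<Rightarrow> real"
    using D01 that(2) by (intro integrable_const_bound[where B=1]) (auto simp: abs_mult mult_le_one)
   have bdd1: "integrable M D" using bdd[of "\<lambda>_. 1"] by simp
   \<comment> \<open>Subtracting \<open>plain\<close> from \<open>weight\<close> removes the
     constant 1 that had been added to make the weight nonnegative.\<close>
   have cos_part: "expectation (\<lambda>z. D z * (cos (S u z + \<phi>) * indicator (B j) (X j z)))
     = expectation (\<lambda>z. D z * cos (S u z + \<phi>)) * prob (X j -` B j \<inter> space M)" for \<phi>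
   proof -
    have i1: "integrable M (\<lambda>z. D z * (cos (S u z + \<phi>) * indicator (B j) (X j z)))"
     by (rule bdd, measurable) (auto simp: abs_mult indicator_def)
    have i2: "integrable M (\<lambda>z. D z * cos (S u z + \<phi>))" by (rule bdd) auto
    have i3: "integrable M (\<lambda>z. D z * indicator (B j) (X j z))" by (rule bdd[OF indB]) (auto simp: indicator_def)
    have "expectation (\<lambda>z. D z * (1 + cos (S u z + \<phi>)) * indicator (B j) (X j z))
     = expectation (\<lambda>z. D z * indicator (B j) (X j z)) + expectation (\<lambda>z. D z * (cos (S u z + \<phi>) * indicator (B j) (X j z)))"
     using i1 i3 by (subst Bochner_Integration.integral_add[symmetric]) (auto simp: algebra_simps)
    moreover have "expectation (\<lambda>z. D z * (1 + cos (S u z + \<phi>))) = expectation D + expectation (\<lambda>z. D z * cos (S u z + \<phi>))"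
     using i2 bdd1 by (subst Bochner_Integration.integral_add[symmetric]) (auto simp: algebra_simps)
    ultimately show ?thesis using weight[of \<phi>] plain by (simp add: algebra_simps)
   qed
   have sin_cos: "sin a = cos (a + (- pi / 2))" for a :: real
    by (simp add: cos_diff)
   have sin_part: "expectation (\<lambda>z. D z * (sin (S u z) * indicator (B j) (X j z)))
     = expectation (\<lambda>z. D z * sin (S u z)) * prob (X j -` B j \<inter> space M)"
    using cos_part[of "- pi / 2"] unfolding sin_cos .
   have split: "expectation (\<lambda>z. of_real (D z) * (cis (S u z) * of_real (f z)))
     = of_real (expectation (\<lambda>z. D z * (cos (S u z) * f z))) + \<i> * of_real (expectation (\<lambda>z. D z * (sin (S u z) * f z)))"
    if [measurable]: "f \<in> borel_measurable M" and "\<And>z. \<bar>f z\<bar> \<le> 1" for f :: "'a \<Rightarrow> real"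
   proof -
    have i: "integrable M (\<lambda>z. D z * (cos (S u z) * f z))" "integrable M (\<lambda>z. D z * (sin (S u z) * f z))"
     using that(2) by (auto intro!: bdd simp: abs_mult mult_le_one)
    have "of_real (D z) * (cis (S u z) * of_real (f z))
     = of_real (D z * (cos (S u z) * f z)) + \<i> * of_real (D z * (sin (S u z) * f z))" for z
     by (simp add: complex_eq_iff)
    then have "expectation (\<lambda>z. of_real (D z) * (cis (S u z) * of_real (f z)))
     = expectation (\<lambda>z. of_real (D z * (cos (S u z) * f z)) + \<i> * of_real (D z * (sin (S u z) * f z)))"
     by (simp only:)
    also have "\<dots> = expectation (\<lambda>z. of_real (D z * (cos (S u z) * f z)))
      + expectation (\<lambda>z. \<i> * of_real (D z * (sin (S u z) * f z)))"
     using i by (intro Bochner_Integration.integral_add integrable_mult_right integrable_of_real)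
    finally show ?thesis
     by (simp only: integral_mult_right_zero integral_complex_of_real)
   qed
   have "expectation (\<lambda>z. of_real (D z) * (cis (S u z) * of_real (indicator (B j) (X j z))))
     = expectation (\<lambda>z. of_real (D z) * (cis (S u z) * of_real 1)) * of_real (prob (X j -` B j \<inter> space M))"
   proof -
    have "\<bar>indicator (B j) (X j z)\<bar> \<le> (1::real)" for z by (simp add: indicator_def)
    from split[OF indB this] split[of "\<lambda>_. 1"] show ?thesis
     using cos_part[of 0] sin_part by (simp only: add_0_right mult_1_right) (simp add: algebra_simps)
   qed
   also have "\<dots> = of_real p * E u * of_real (prob (X j -` B j \<inter> space M))"
    using IH0[of u] by simp
   finally show ?case
    using insert.hyps unfolding D_def p_def E_def S_def R_def
    by (simp add: mult_ac)
  qed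
 qed
 show ?thesis
  unfolding indep_vars_def2
 proof (intro conjI ballI)
  fix i assume "i \<in> I" then show "random_variable borel (X i)" by simp
 next
  show "indep_sets (\<lambda>i. {X i -` A \<inter> space M |A. A \<in> sets borel}) I"
  proof (cases "I = {}")
   case True then show ?thesis by (simp add: indep_sets_def)
  next
   case False
   show ?thesis
   proof (subst indep_sets_finite[OF False I])
    show "{X i -` A \<inter> space M |A. A \<in> sets borel} \<subseteq> events" if "i \<in> I" for i
     using rv[OF that] by (auto intro: measurable_sets)
    show "space M \<in> {X i -` A \<inter> space M |A. A \<in> sets borel}" if "i \<in> I" for i
     by (rule CollectI, rule exI[of _ UNIV]) auto
    show "\<forall>A\<in>\<Pi> i\<in>I. {X i -` A \<inter> space M |A. A \<in> sets borel}. prob (\<Inter> (A ` I)) = (\<Prod>j\<in>I. prob (A j))"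
    proof
     fix A assume "A \<in> (\<Pi> i\<in>I. {X i -` A \<inter> space M |A. A \<in> sets borel})"
     then have "\<forall>i\<in>I. \<exists>B. B \<in> sets borel \<and> A i = X i -` B \<inter> space M" by (auto simp: Pi_iff)
     then obtain B where B: "\<And>i. i \<in> I \<Longrightarrow> B i \<in> sets borel" "\<And>i. i \<in> I \<Longrightarrow> A i = X i -` B i \<inter> space M"
      by metis
     have ev: "A i \<in> events" if "i \<in> I" for i
      using B[OF that] rv[OF that] by (auto intro: measurable_sets)
     have Int: "\<Inter> (A ` I) \<in> events" using ev False I by (intro sets.finite_INT) auto
     have "expectation (\<lambda>z. of_real (\<Prod>j\<in>I. indicator (B j) (X j z))) = complex_of_real (\<Prod>j\<in>I. prob (X j -` B j \<inter> space M))"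
      using main[of I B] B(1) by simp
     then have "expectation (\<lambda>z. \<Prod>j\<in>I. indicator (B j) (X j z)) = (\<Prod>j\<in>I. prob (A j))"
      using B by (simp only: integral_complex_of_real of_real_eq_iff) simp
     moreover have "expectation (\<lambda>z. \<Prod>j\<in>I. indicator (B j) (X j z)) = expectation (indicator (\<Inter> (A ` I)) :: 'a \<Rightarrow> real)"
     proof (rule Bochner_Integration.integral_cong[OF refl])
      fix z assume w: "z \<in> space M"
      show "(\<Prod>j\<in>I. indicator (B j) (X j z)) = (indicator (\<Inter> (A ` I)) z :: real)"
      proof (cases "\<forall>j\<in>I. X j z \<in> B j")
       case True then show ?thesis using B w by (auto simp: indicator_def)
      next
       case F: False
       then obtain k where k: "k \<in> I" "X k z \<notin> B k" by auto
       then have "(\<Prod>j\<in>I. indicator (B j) (X j z) :: real) = 0"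
        using I by (intro prod_zero) (auto simp: indicator_def)
       moreover have "z \<notin> \<Inter> (A ` I)" using k B by auto
       ultimately show ?thesis by simp
      qed
     qed
     ultimately show "prob (\<Inter> (A ` I)) = (\<Prod>j\<in>I. prob (A j))"
      using Int by simp
    qed
   qed
  qed
 qed
qed

end

section \<open>Gaussian integrals\<close>

lemma sets_centred_normal [simp, measurable_cong]: "sets (centred_normal v) = sets borel"
 by (simp add: centred_normal_def)

lemma space_centred_normal [simp]: "space (centred_normal v) = UNIV"
 by (simp add: centred_normal_def)

lemma prob_space_centred_normal:
 assumes "0 \<le> v" shows "prob_space (centred_normal v)"
 using assms by (auto simp: centred_normal_def intro!: prob_space_return prob_space_normal_density)

text \<open>Completing the square: with \<open>s = 1 - 2 a v\<close> the integrand is a constant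
  times the normal density with mean \<open>k v / s\<close> and variance \<open>v / s\<close>.
  Finiteness requires \<open>s > 0\<close>.\<close>

lemma nn_integral_centred_normal_quadratic:
 assumes v: "0 < v" and s: "2 * a * v < 1"
 shows "(\<integral>\<^sup>+ x. ennreal (exp (k * x + a * x\<^sup>2)) \<partial>centred_normal v)
   = ennreal (exp (k\<^sup>2 * v / (2 * (1 - 2 * a * v))) / sqrt (1 - 2 * a * v))"
proof -
 define s where "s = 1 - 2 * a * v"
 have s0: "0 < s" using s by (simp add: s_def)
 define C where "C = exp (k\<^sup>2 * v / (2 * s)) / sqrt s"
 have C0: "0 \<le> C" using s0 by (simp add: C_def)
 have eq: "normal_density 0 (sqrt v) x * exp (k * x + a * x\<^sup>2)
   = C * normal_density (k * v / s) (sqrt (v / s)) x" for x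
 proof -
  have a: "a = (1 - s) / (2 * v)" using v by (simp add: s_def)
  have "- x\<^sup>2 / (2 * v) + (k * x + a * x\<^sup>2) = k\<^sup>2 * v / (2 * s) - (x - k * v / s)\<^sup>2 / (2 * (v / s))"
   unfolding a using v s0 by (simp add: field_simps power2_eq_square)
  then have e: "exp (- x\<^sup>2 / (2 * v)) * exp (k * x + a * x\<^sup>2)
    = exp (k\<^sup>2 * v / (2 * s)) * exp (- (x - k * v / s)\<^sup>2 / (2 * (v / s)))"
   by (simp flip: exp_add)
  have "1 / sqrt (2 * pi * v) = 1 / sqrt s * (1 / sqrt (2 * pi * (v / s)))"
   using v s0 by (simp add: real_sqrt_mult real_sqrt_divide)
  then show ?thesis using v s0 e
   unfolding normal_density_def C_def
   by (simp add: mult.assoc)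
 qed
 have "(\<integral>\<^sup>+ x. ennreal (exp (k * x + a * x\<^sup>2)) \<partial>centred_normal v)
   = (\<integral>\<^sup>+ x. ennreal (normal_density 0 (sqrt v) x) * ennreal (exp (k * x + a * x\<^sup>2)) \<partial>lborel)"
  using v by (simp add: centred_normal_def nn_integral_density)
 also have "\<dots> = (\<integral>\<^sup>+ x. ennreal C * ennreal (normal_density (k * v / s) (sqrt (v / s)) x) \<partial>lborel)"
  by (intro nn_integral_cong) (simp add: ennreal_mult'[symmetric] eq C0 normal_density_nonneg flip: ennreal_mult)
 also have "\<dots> = ennreal C * emeasure (density lborel (\<lambda>x. ennreal (normal_density (k * v / s) (sqrt (v / s)) x))) UNIV"
  by (simp add: nn_integral_cmult emeasure_density)
 also have "\<dots> = ennreal C"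
 proof -
  interpret prob_space "density lborel (\<lambda>x. ennreal (normal_density (k * v / s) (sqrt (v / s)) x))"
   using v s0 by (intro prob_space_normal_density) auto
  show ?thesis using emeasure_space_1 by simp
 qed
 finally show ?thesis by (simp add: C_def s_def)
qed

lemma char_centred_normal:
 assumes "0 \<le> v"
 shows "(\<integral>x. cis (t * x) \<partial>centred_normal v) = of_real (exp (- v * t\<^sup>2 / 2))"
proof (cases "v = 0")
 case True
 then show ?thesis
  unfolding centred_normal_def
  by (simp add: integral_return cis_conv_exp)
next
 case False
 then have v: "0 < v" using assms by simp
 have "(\<integral>x. cis (t * x) \<partial>centred_normal v) = (\<integral>x. normal_density 0 (sqrt v) x *\<^sub>R cis (t * x) \<partial>lborel)"
  using v unfolding centred_normal_def
  by (simp add: integral_density cis_conv_exp)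
 also have "\<dots> = \<bar>sqrt v\<bar> *\<^sub>R (\<integral>x. normal_density 0 (sqrt v) (0 + sqrt v * x) *\<^sub>R cis (t * (0 + sqrt v * x)) \<partial>lborel)"
  using v by (intro lborel_integral_real_affine) simp
 also have "\<dots> = (\<integral>x. \<bar>sqrt v\<bar> *\<^sub>R (normal_density 0 (sqrt v) (sqrt v * x) *\<^sub>R cis (t * (sqrt v * x))) \<partial>lborel)"
  by (simp only: integral_scaleR_right add_0_left)
 also have "\<dots> = (\<integral>x. std_normal_density x *\<^sub>R cis ((t * sqrt v) * x) \<partial>lborel)"
 proof (intro Bochner_Integration.integral_cong refl)
  fix x
  have "\<bar>sqrt v\<bar> * normal_density 0 (sqrt v) (sqrt v * x) = std_normal_density x"
   using v by (simp add: normal_density_def real_sqrt_mult power_mult_distrib)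
  then show "\<bar>sqrt v\<bar> *\<^sub>R (normal_density 0 (sqrt v) (sqrt v * x) *\<^sub>R cis (t * (sqrt v * x)))
   = std_normal_density x *\<^sub>R cis ((t * sqrt v) * x)"
   by (metis mult.assoc scaleR_scaleR)
 qed
 also have "\<dots> = char std_normal_distribution (t * sqrt v)"
  unfolding char_def by (subst integral_density) (auto simp: cis_conv_exp normal_density_nonneg)
 also have "\<dots> = of_real (exp (- v * t\<^sup>2 / 2))"
  using v by (simp add: char_std_normal_distribution power_mult_distrib mult.commute)
 finally show ?thesis .
qed

text \<open>A discrete exponential martingale. The coefficient \<open>K j i\<close> sees only the
  rows up to \<open>j\<close>, so the last row can be integrated first; the subtracted square is the
  part of the logarithm of this Gaussian integral that depends on \<open>K\<close>. Hence each row
  contributes the same constant, whatever the past, however nonlinear \<open>K\<close> may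
  be.\<close>

lemma nn_integral_sequential_quadratic:
 fixes \<nu> :: "nat \<times> 'i \<Rightarrow> real measure" and K :: "nat \<Rightarrow> 'i \<Rightarrow> (nat \<times> 'i \<Rightarrow> real) \<Rightarrow> real"
 assumes I: "finite I"
  and prob: "\<And>p. prob_space (\<nu> p)" and sets [measurable_cong, simp]: "\<And>p. sets (\<nu> p) = sets borel"
  and \<nu>_0: "\<And>i. i \<in> I \<Longrightarrow> \<nu> (0, i) = centred_normal v0"
  and \<nu>_Suc: "\<And>i j. i \<in> I \<Longrightarrow> \<nu> (Suc j, i) = centred_normal (v i)"
  and v0: "0 < v0" "2 * a0 * v0 < 1" and v: "\<And>i. i \<in> I \<Longrightarrow> 0 < v i" "\<And>i. i \<in> I \<Longrightarrow> 2 * a * v i < 1"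
  and K [measurable]: "\<And>j i. i \<in> I \<Longrightarrow> K j i \<in> borel_measurable (PiM ({..j} \<times> I) (\<lambda>_. borel))"
 shows "(\<integral>\<^sup>+ x. (\<Prod>i\<in>I. ennreal (exp (a0 * (x (0, i))\<^sup>2))) *
      (\<Prod>j<N. \<Prod>i\<in>I. ennreal (exp (K j i (restrict x ({..j} \<times> I)) * x (Suc j, i) + a * (x (Suc j, i))\<^sup>2
         - (K j i (restrict x ({..j} \<times> I)))\<^sup>2 * v i / (2 * (1 - 2 * a * v i)))))
      \<partial>PiM ({..N} \<times> I) \<nu>)
   = (\<Prod>i\<in>I. ennreal (1 / sqrt (1 - 2 * a0 * v0))) * (\<Prod>i\<in>I. ennreal (1 / sqrt (1 - 2 * a * v i))) ^ N"
proof -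
 interpret product_sigma_finite \<nu>
  by (simp add: product_sigma_finite_def prob prob_space_imp_sigma_finite)
 define F where "F j i y t = ennreal (exp (K j i y * t + a * t\<^sup>2 - (K j i y)\<^sup>2 * v i / (2 * (1 - 2 * a * v i))))"
  for j i y t
 have PiM_cong: "sets (PiM A \<nu>) = sets (PiM A (\<lambda>_. borel))" for A
  by (intro sets_PiM_cong) auto
 have \<nu>_meas: "measurable (\<nu> p) N = measurable borel N" for p and N :: "'x measure"
  by (intro measurable_cong_sets) auto
 have res [measurable]: "(\<lambda>x. restrict x ({..j} \<times> I)) \<in> measurable (PiM ({..N} \<times> I) \<nu>) (PiM ({..j} \<times> I) (\<lambda>_. borel))"
  if "j \<le> N" for j N
  using that unfolding measurable_cong_sets[OF PiM_cong refl]
  by (intro measurable_restrict_subset) auto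
 have Kr [measurable]: "(\<lambda>x. K j i (restrict x ({..j} \<times> I))) \<in> borel_measurable (PiM ({..N} \<times> I) \<nu>)"
  if "i \<in> I" "j \<le> N" for i j N
  using measurable_compose[OF res[OF that(2)] K[OF that(1)]] .
 have comp [measurable]: "(\<lambda>x. x p) \<in> borel_measurable (PiM A \<nu>)" if "p \<in> A" for p A
  using that unfolding measurable_cong_sets[OF PiM_cong refl]
  by (intro measurable_component_singleton) auto
 show ?thesis unfolding F_def[symmetric]
 proof (induction N)
  case 0
  have inj: "inj_on (Pair (0::nat)) I" by (auto simp: inj_on_def)
  have A0: "{..0::nat} \<times> I = Pair 0 ` I" by auto
  have "(\<integral>\<^sup>+ x. (\<Prod>i\<in>I. ennreal (exp (a0 * (x (0, i))\<^sup>2))) \<partial>PiM ({..0} \<times> I) \<nu>)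
    = (\<integral>\<^sup>+ x. (\<Prod>p\<in>{..0} \<times> I. (\<lambda>p t. ennreal (exp (a0 * t\<^sup>2))) p (x p)) \<partial>PiM ({..0} \<times> I) \<nu>)"
   unfolding A0 by (simp add: prod.reindex[OF inj])
  also have "\<dots> = (\<Prod>p\<in>{..0} \<times> I. \<integral>\<^sup>+ t. ennreal (exp (a0 * t\<^sup>2)) \<partial>\<nu> p)"
   using I by (intro product_nn_integral_prod) (auto simp: \<nu>_meas)
  also have "\<dots> = (\<Prod>i\<in>I. \<integral>\<^sup>+ t. ennreal (exp (a0 * t\<^sup>2)) \<partial>centred_normal v0)"
   unfolding A0 using \<nu>_0 by (simp add: prod.reindex[OF inj])
  also have "\<dots> = (\<Prod>i\<in>I. ennreal (1 / sqrt (1 - 2 * a0 * v0)))"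
   using nn_integral_centred_normal_quadratic[OF v0, of 0] by simp
  finally show ?case by simp
 next
  case (Suc N)
  let ?A = "{..N} \<times> I" and ?B = "{Suc N} \<times> I"
  define Z where "Z x = (\<Prod>i\<in>I. ennreal (exp (a0 * (x (0, i))\<^sup>2))) *
      (\<Prod>j<N. \<Prod>i\<in>I. F j i (restrict x ({..j} \<times> I)) (x (Suc j, i)))" for x
  have inj: "inj_on (Pair (Suc N)) I" by (auto simp: inj_on_def)
  have B: "?B = Pair (Suc N) ` I" by auto
  have pB: "(\<Prod>p\<in>?B. g p) = (\<Prod>i\<in>I. g (Suc N, i))" for g :: "nat \<times> 'i \<Rightarrow> ennreal"
   unfolding B by (simp add: prod.reindex[OF inj])
  have AB: "{..Suc N} \<times> I = ?A \<union> ?B" by (auto simp: atMost_Suc)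
  have one_step: "(\<integral>\<^sup>+ t. F j i y t \<partial>centred_normal (v i)) = ennreal (1 / sqrt (1 - 2 * a * v i))" if "i \<in> I" for j i y
  proof -
   define q where "q = (K j i y)\<^sup>2 * v i / (2 * (1 - 2 * a * v i))"
   have "(\<integral>\<^sup>+ t. F j i y t \<partial>centred_normal (v i))
     = (\<integral>\<^sup>+ t. ennreal (exp (- q)) * ennreal (exp (K j i y * t + a * t\<^sup>2)) \<partial>centred_normal (v i))"
    unfolding F_def q_def[symmetric]
    by (intro nn_integral_cong) (simp add: exp_diff exp_minus divide_inverse mult.commute flip: ennreal_mult)
   also have "\<dots> = ennreal (exp (- q)) * (\<integral>\<^sup>+ t. ennreal (exp (K j i y * t + a * t\<^sup>2)) \<partial>centred_normal (v i))"
    by (intro nn_integral_cmult) (simp add: measurable_cong_sets[OF sets_centred_normal refl])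
   also have "\<dots> = ennreal (1 / sqrt (1 - 2 * a * v i))"
    unfolding nn_integral_centred_normal_quadratic[OF v(1)[OF that] v(2)[OF that]] q_def[symmetric]
    using v(2)[OF that] by (simp add: exp_minus flip: ennreal_mult)
   finally show ?thesis .
  qed
  have ZF: "Z x * (\<Prod>i\<in>I. F N i (restrict x ({..N} \<times> I)) (x (Suc N, i)))
    = (\<Prod>i\<in>I. ennreal (exp (a0 * (x (0, i))\<^sup>2))) *
      (\<Prod>j<Suc N. \<Prod>i\<in>I. F j i (restrict x ({..j} \<times> I)) (x (Suc j, i)))" for x
   by (simp add: Z_def mult.assoc)
  have meas: "(\<lambda>x. Z x * (\<Prod>i\<in>I. F N i (restrict x ({..N} \<times> I)) (x (Suc N, i)))) \<in> borel_measurable (PiM (?A \<union> ?B) \<nu>)"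
   unfolding ZF unfolding F_def AB[symmetric]
   by (intro borel_measurable_times_ennreal borel_measurable_prod_ennreal measurable_compose[OF _ measurable_ennreal]
      borel_measurable_exp borel_measurable_diff borel_measurable_add borel_measurable_times borel_measurable_divide borel_measurable_power
      borel_measurable_const Kr comp) auto
  have "(\<integral>\<^sup>+ x. Z x * (\<Prod>i\<in>I. F N i (restrict x ({..N} \<times> I)) (x (Suc N, i))) \<partial>PiM ({..Suc N} \<times> I) \<nu>)
   = (\<integral>\<^sup>+ x. (\<integral>\<^sup>+ y. Z (merge ?A ?B (x, y)) * (\<Prod>i\<in>I. F N i (restrict (merge ?A ?B (x, y)) ({..N} \<times> I)) (merge ?A ?B (x, y) (Suc N, i)))
      \<partial>PiM ?B \<nu>) \<partial>PiM ?A \<nu>)"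
   unfolding AB using I meas by (intro product_nn_integral_fold) auto
  also have "\<dots> = (\<integral>\<^sup>+ x. Z x * (\<Prod>i\<in>I. ennreal (1 / sqrt (1 - 2 * a * v i))) \<partial>PiM ?A \<nu>)"
  proof (intro nn_integral_cong)
   fix x :: "nat \<times> 'i \<Rightarrow> real"
   \<comment> \<open>Earlier factors and all coefficients \<open>K j i\<close> with
     \<open>j \<le> N\<close> do not see the newly appended row, so for fixed \<open>x\<close> only
     the factors of row \<open>Suc N\<close> depend on \<open>y\<close>.\<close>
   have m1: "merge ?A ?B (x, y) (j, i) = x (j, i)" if "j \<le> N" "i \<in> I" for y :: "nat \<times> 'i \<Rightarrow> real" and i j
    using that by (simp add: merge_def)
   have m2: "merge ?A ?B (x, y) (Suc N, i) = y (Suc N, i)" if "i \<in> I" for y :: "nat \<times> 'i \<Rightarrow> real" and i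
    using that by (simp add: merge_def)
   have m3: "restrict (merge ?A ?B (x, y)) ({..j} \<times> I) = restrict x ({..j} \<times> I)" if "j \<le> N" for y :: "nat \<times> 'i \<Rightarrow> real" and j
    using that by (auto simp: merge_def restrict_def fun_eq_iff)
   have m4: "Z (merge ?A ?B (x, y)) = Z x" for y :: "nat \<times> 'i \<Rightarrow> real"
    unfolding Z_def by (intro arg_cong2[where f="(*)"] prod.cong refl) (simp_all add: m1 m3)
   have "(\<integral>\<^sup>+ y. Z (merge ?A ?B (x, y)) * (\<Prod>i\<in>I. F N i (restrict (merge ?A ?B (x, y)) ({..N} \<times> I)) (merge ?A ?B (x, y) (Suc N, i))) \<partial>PiM ?B \<nu>)
    = (\<integral>\<^sup>+ y. Z x * (\<Prod>p\<in>?B. (\<lambda>p t. F N (snd p) (restrict x ?A) t) p (y p)) \<partial>PiM ?B \<nu>)"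
    unfolding pB by (intro nn_integral_cong) (simp add: m4 m2 m3 cong: prod.cong)
   also have "\<dots> = Z x * (\<integral>\<^sup>+ y. (\<Prod>p\<in>?B. (\<lambda>p t. F N (snd p) (restrict x ?A) t) p (y p)) \<partial>PiM ?B \<nu>)"
    unfolding F_def
    by (intro nn_integral_cmult borel_measurable_prod_ennreal measurable_compose[OF _ measurable_ennreal]
      borel_measurable_exp borel_measurable_diff borel_measurable_add borel_measurable_times borel_measurable_power
      borel_measurable_const comp) auto
   also have "(\<integral>\<^sup>+ y. (\<Prod>p\<in>?B. (\<lambda>p t. F N (snd p) (restrict x ?A) t) p (y p)) \<partial>PiM ?B \<nu>)
     = (\<Prod>p\<in>?B. \<integral>\<^sup>+ t. F N (snd p) (restrict x ?A) t \<partial>\<nu> p)"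
    using I by (intro product_nn_integral_prod) (auto simp: F_def \<nu>_meas)
   also have "\<dots> = (\<Prod>i\<in>I. ennreal (1 / sqrt (1 - 2 * a * v i)))"
    unfolding pB using \<nu>_Suc one_step by simp
   finally show "(\<integral>\<^sup>+ y. Z (merge ?A ?B (x, y)) * (\<Prod>i\<in>I. F N i (restrict (merge ?A ?B (x, y)) ({..N} \<times> I)) (merge ?A ?B (x, y) (Suc N, i))) \<partial>PiM ?B \<nu>)
     = Z x * (\<Prod>i\<in>I. ennreal (1 / sqrt (1 - 2 * a * v i)))" .
  qed
  also have "\<dots> = (\<integral>\<^sup>+ x. Z x \<partial>PiM ?A \<nu>) * (\<Prod>i\<in>I. ennreal (1 / sqrt (1 - 2 * a * v i)))"
   unfolding Z_def F_def
   by (intro nn_integral_multc borel_measurable_times_ennreal borel_measurable_prod_ennreal measurable_compose[OF _ measurable_ennreal]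
      borel_measurable_exp borel_measurable_diff borel_measurable_add borel_measurable_times borel_measurable_divide borel_measurable_power
      borel_measurable_const Kr comp) auto
  finally show ?case
   using Suc.IH unfolding ZF Z_def by (simp only: prod.lessThan_Suc power_Suc2 mult.assoc)
 qed
qed

section \<open>Representatives and completeness of the space of square-integrable functions\<close>

lemma sq_integrable_rep_l2: "sq_integrable (rep_l2 f)"
 using Quotient_rep_reflp[OF Quotient_l2, of f] by (simp add: l2_rel_def)

lemma abs_rep_l2 [simp]: "abs_l2 (rep_l2 f) = f"
 by (rule Quotient_abs_rep[OF Quotient_l2])

lemma rep_abs_l2:
 assumes "sq_integrable u" shows "AE x in torus. rep_l2 (abs_l2 u) x = u x"
 using Quotient_rep_abs[OF Quotient_l2, of u] assms by (simp add: l2_rel_def)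

lemma inner_abs_l2:
 assumes "sq_integrable u" "sq_integrable v"
 shows "abs_l2 u \<bullet> abs_l2 v = (\<integral>x. u x * v x \<partial>torus)"
 by (rule inner_l2.abs_eq) (use assms in \<open>auto simp: l2_rel_def\<close>)

lemma inner_rep_l2: "f \<bullet> g = (\<integral>x. rep_l2 f x * rep_l2 g x \<partial>torus)"
 using inner_abs_l2[OF sq_integrable_rep_l2 sq_integrable_rep_l2, of f g] by simp

lemma abs_l2_eqI:
 assumes "sq_integrable u" "sq_integrable v" "AE x in torus. u x = v x"
 shows "abs_l2 u = abs_l2 v"
 using assms Quotient_rel[OF Quotient_l2, of u v] by (simp add: l2_rel_def)

lemma plus_abs_l2: "sq_integrable u \<Longrightarrow> sq_integrable v \<Longrightarrow> abs_l2 u + abs_l2 v = abs_l2 (\<lambda>x. u x + v x)"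
 by (rule plus_l2.abs_eq) (auto simp: l2_rel_def)

lemma scaleR_abs_l2: "sq_integrable u \<Longrightarrow> c *\<^sub>R abs_l2 u = abs_l2 (\<lambda>x. c * u x)"
 by (rule scaleR_l2.abs_eq) (auto simp: l2_rel_def)

lemma sq_integrable_diff: "sq_integrable u \<Longrightarrow> sq_integrable v \<Longrightarrow> sq_integrable (\<lambda>x. u x - v x)"
 using sq_integrable_add[of u "\<lambda>x. (-1) * v x"] sq_integrable_scale[of v "-1"] by simp

lemma diff_abs_l2:
 assumes "sq_integrable u" "sq_integrable v" shows "abs_l2 u - abs_l2 v = abs_l2 (\<lambda>x. u x - v x)"
proof -
 have "abs_l2 u - abs_l2 v = abs_l2 u + (-1) *\<^sub>R abs_l2 v" by simp
 also have "\<dots> = abs_l2 (\<lambda>x. u x + (-1) * v x)"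
  by (simp only: scaleR_abs_l2[OF assms(2)] plus_abs_l2[OF assms(1) sq_integrable_scale[OF assms(2)]])
 finally show ?thesis by simp
qed

lemma space_torus: "space torus = {0..<1} \<times> {0..<1}"
 by (simp add: torus_def space_restrict_space)

lemma sets_torus_Q [measurable]: "({0..<1} \<times> {0..<1} :: (real \<times> real) set) \<in> sets borel"
proof -
 have "({0..<1} \<times> {0..<1} :: (real \<times> real) set) \<in> sets (borel \<Otimes>\<^sub>M borel)" by measurable
 then show ?thesis by (simp only: borel_prod)
qed

lemma emeasure_torus: "emeasure torus (space torus) = 1"
proof -
 have "emeasure torus (space torus) = emeasure lborel ({0..<1} \<times> {0..<1} :: (real \<times> real) set)"
  unfolding space_torus unfolding torus_def by (subst emeasure_restrict_space) auto
 also have "\<dots> = emeasure (lborel \<Otimes>\<^sub>M lborel) ({0..<1::real} \<times> {0..<1::real})"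
  by (simp add: lborel_prod)
 also have "\<dots> = 1"
  by (subst lborel.emeasure_pair_measure_Times) auto
 finally show ?thesis .
qed

interpretation torus: prob_space torus
 by standard (rule emeasure_torus)

lemma measurable_torusI: "u \<in> borel_measurable borel \<Longrightarrow> u \<in> borel_measurable torus"
 unfolding torus_def by (intro measurable_restrict_space1) simp

lemma sq_integrable_bounded:
 assumes [measurable]: "u \<in> borel_measurable torus" and "\<And>x. x \<in> space torus \<Longrightarrow> \<bar>u x\<bar> \<le> C"
 shows "sq_integrable u"
proof -
 have "integrable torus (\<lambda>x. (u x)\<^sup>2)"
 proof (rule torus.integrable_const_bound[where B="C\<^sup>2"])
  show "AE x in torus. norm ((u x)\<^sup>2) \<le> C\<^sup>2"
  proof (intro AE_I2)
   fix x assume "x \<in> space torus"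
   then have "\<bar>u x\<bar>\<^sup>2 \<le> C\<^sup>2" using assms(2) by (intro power_mono) auto
   then show "norm ((u x)\<^sup>2) \<le> C\<^sup>2" by simp
  qed
 qed simp
 then show ?thesis by (simp add: sq_integrable_def)
qed

lemma norm_l2_sq: "(norm f)\<^sup>2 = (\<integral>x. (rep_l2 f x)\<^sup>2 \<partial>torus)"
 unfolding power2_norm_eq_inner inner_rep_l2 by (simp only: power2_eq_square)

lemma nn_integral_rep_l2_sq: "(\<integral>\<^sup>+ x. ennreal ((rep_l2 f x)\<^sup>2) \<partial>torus) = ennreal ((norm f)\<^sup>2)"
 unfolding norm_l2_sq using sq_integrable_rep_l2[of f]
 by (intro nn_integral_eq_integral) (auto simp: sq_integrable_def)

text \<open>Cauchy-Schwarz against the constant 1, the torus having measure 1. Thus increments that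
  are summable in norm are also summable almost everywhere.\<close>

lemma nn_integral_abs_rep_l2_le: "(\<integral>\<^sup>+ x. ennreal \<bar>rep_l2 f x\<bar> \<partial>torus) \<le> ennreal (norm f)"
proof -
 have f: "sq_integrable (rep_l2 f)" by (rule sq_integrable_rep_l2)
 then have m [measurable]: "rep_l2 f \<in> borel_measurable torus" by (simp add: sq_integrable_def)
 have a: "sq_integrable (\<lambda>x. \<bar>rep_l2 f x\<bar>)" using f by (auto simp: sq_integrable_def)
 have 1: "sq_integrable (\<lambda>x. 1)" by (rule sq_integrable_bounded[where C=1]) auto
 have "(\<integral>x. \<bar>rep_l2 f x\<bar> \<partial>torus) = abs_l2 (\<lambda>x. \<bar>rep_l2 f x\<bar>) \<bullet> abs_l2 (\<lambda>x. 1)"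
  by (simp add: inner_abs_l2[OF a 1])
 also have "\<dots> \<le> norm (abs_l2 (\<lambda>x. \<bar>rep_l2 f x\<bar>)) * norm (abs_l2 (\<lambda>x. 1))"
  by (rule norm_cauchy_schwarz)
 also have "norm (abs_l2 (\<lambda>x. 1)) = 1"
  by (simp add: norm_eq_sqrt_inner inner_abs_l2[OF 1 1] torus.prob_space)
 also have "norm (abs_l2 (\<lambda>x. \<bar>rep_l2 f x\<bar>)) = norm f"
  by (simp add: norm_eq_sqrt_inner inner_abs_l2[OF a a] inner_rep_l2[of f f])
 finally have "(\<integral>x. \<bar>rep_l2 f x\<bar> \<partial>torus) \<le> norm f" by simp
 moreover have "integrable torus (\<lambda>x. \<bar>rep_l2 f x\<bar>)"
  using sq_integrable_mult[OF a 1] by simp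
 ultimately show ?thesis
  by (subst nn_integral_eq_integral) (auto intro: ennreal_leI)
qed

instance l2 :: complete_space
proof
 fix X :: "nat \<Rightarrow> l2"
 assume X: "Cauchy X"
 \<comment> \<open>A subsequence with summable increments converges almost everywhere, and by Fatou in \<open>L\<^sup>2\<close>.\<close>
 have "\<exists>r. strict_mono r \<and> (\<forall>k. \<forall>m\<ge>r k. \<forall>n\<ge>r k. norm (X m - X n) < (1/2)^k)"
 proof -
  have "\<exists>N. \<forall>m\<ge>N. \<forall>n\<ge>N. norm (X m - X n) < (1/2)^k" for k
   using X unfolding Cauchy_def dist_norm by (auto simp: zero_less_power)
  then obtain N where N: "\<And>k m n. m \<ge> N k \<Longrightarrow> n \<ge> N k \<Longrightarrow> norm (X m - X n) < (1/2)^k" by metis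
  define r where "r k = (\<Sum>i\<le>k. Suc (N i))" for k
  have "strict_mono r" by (rule strict_monoI_Suc) (simp add: r_def)
  moreover have "N k \<le> r k" for k
  proof -
   have "Suc (N k) \<le> r k" unfolding r_def by (rule member_le_sum) auto
   then show ?thesis by simp
  qed
  ultimately show ?thesis using N by (meson order_trans)
 qed
 then obtain r where r: "strict_mono r" "\<And>k m n. m \<ge> r k \<Longrightarrow> n \<ge> r k \<Longrightarrow> norm (X m - X n) < (1/2)^k"
  by blast
 have rm: "r k \<le> r j" if "k \<le> j" for k j using that r(1) by (simp add: strict_mono_less_eq)
 define u where "u k = rep_l2 (X (r k))" for k
 have u: "sq_integrable (u k)" for k by (simp add: u_def sq_integrable_rep_l2)
 then have um [measurable]: "u k \<in> borel_measurable torus" for k by (simp add: sq_integrable_def)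
 have dist: "(\<integral>\<^sup>+ x. ennreal ((u j x - u k x)\<^sup>2) \<partial>torus) \<le> ennreal (((1/2)^k)\<^sup>2)" if "k \<le> j" for k j
 proof -
  have "X (r j) - X (r k) = abs_l2 (\<lambda>x. u j x - u k x)"
   using diff_abs_l2[OF u u, of j k] by (simp add: u_def)
  then have "AE x in torus. rep_l2 (X (r j) - X (r k)) x = u j x - u k x"
   using rep_abs_l2[OF sq_integrable_diff[OF u u], of j k] by simp
  then have "(\<integral>\<^sup>+ x. ennreal ((u j x - u k x)\<^sup>2) \<partial>torus) = (\<integral>\<^sup>+ x. ennreal ((rep_l2 (X (r j) - X (r k)) x)\<^sup>2) \<partial>torus)"
   by (intro nn_integral_cong_AE) auto
  also have "\<dots> = ennreal ((norm (X (r j) - X (r k)))\<^sup>2)" by (rule nn_integral_rep_l2_sq)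
  also have "\<dots> \<le> ennreal (((1/2)^k)\<^sup>2)"
   using r(2)[of k "r j" "r k"] rm[OF that] by (intro ennreal_leI power_mono) auto
  finally show ?thesis .
 qed
 have "(\<integral>\<^sup>+ x. (\<Sum>k. ennreal \<bar>u (Suc k) x - u k x\<bar>) \<partial>torus) = (\<Sum>k. \<integral>\<^sup>+ x. ennreal \<bar>u (Suc k) x - u k x\<bar> \<partial>torus)"
  by (intro nn_integral_suminf) auto
 also have "\<dots> \<le> (\<Sum>k. ennreal ((1/2)^k))"
 proof (intro suminf_le allI)
  fix k
  have "X (r (Suc k)) - X (r k) = abs_l2 (\<lambda>x. u (Suc k) x - u k x)"
   using diff_abs_l2[OF u u, of "Suc k" k] by (simp add: u_def)
  then have "AE x in torus. rep_l2 (X (r (Suc k)) - X (r k)) x = u (Suc k) x - u k x"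
   using rep_abs_l2[OF sq_integrable_diff[OF u u], of "Suc k" k] by simp
  then have "(\<integral>\<^sup>+ x. ennreal \<bar>u (Suc k) x - u k x\<bar> \<partial>torus) = (\<integral>\<^sup>+ x. ennreal \<bar>rep_l2 (X (r (Suc k)) - X (r k)) x\<bar> \<partial>torus)"
   by (intro nn_integral_cong_AE) auto
  also have "\<dots> \<le> ennreal (norm (X (r (Suc k)) - X (r k)))" by (rule nn_integral_abs_rep_l2_le)
  also have "\<dots> \<le> ennreal ((1/2)^k)"
   using r(2)[of k "r (Suc k)" "r k"] rm[of k "Suc k"] by (intro ennreal_leI) auto
  finally show "(\<integral>\<^sup>+ x. ennreal \<bar>u (Suc k) x - u k x\<bar> \<partial>torus) \<le> ennreal ((1/2)^k)" .
 qed auto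
 also have "\<dots> = ennreal 2"
 proof (rule suminf_ennreal_eq)
  show "(\<lambda>k. (1/2::real)^k) sums 2" using geometric_sums[of "1/2::real"] by simp
 qed simp
 also have "\<dots> < \<infinity>" by simp
 finally have "AE x in torus. (\<Sum>k. ennreal \<bar>u (Suc k) x - u k x\<bar>) \<noteq> \<infinity>"
  by (intro nn_integral_PInf_AE) (auto simp: top.not_eq_extremum)
 then have conv: "AE x in torus. (\<lambda>k. u k x) \<longlonglongrightarrow> lim (\<lambda>k. u k x)"
 proof eventually_elim
  case (elim x)
  then have "(\<Sum>k. ennreal \<bar>u (Suc k) x - u k x\<bar>) \<noteq> top" by simp
  then have "summable (\<lambda>k. \<bar>u (Suc k) x - u k x\<bar>)"
   by (intro summable_suminf_not_top) auto
  then have "summable (\<lambda>k. u (Suc k) x - u k x)" by (rule summable_rabs_cancel)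
  then have "convergent (\<lambda>n. \<Sum>k<n. u (Suc k) x - u k x)" by (simp add: summable_iff_convergent)
  then have "convergent (\<lambda>n. u n x - u 0 x)" by (simp only: sum_lessThan_telescope[of "\<lambda>k. u k x"])
  then obtain L where "(\<lambda>n. u n x - u 0 x) \<longlonglongrightarrow> L" by (auto simp: convergent_def)
  then have "(\<lambda>n. u n x - u 0 x + u 0 x) \<longlonglongrightarrow> L + u 0 x" by (intro tendsto_intros)
  then have "convergent (\<lambda>n. u n x)" by (auto simp: convergent_def)
  then show ?case by (simp add: convergent_LIMSEQ_iff)
 qed
 define v where "v x = lim (\<lambda>k. u k x)" for x
 have vm [measurable]: "v \<in> borel_measurable torus" unfolding v_def by measurable
 have close: "(\<integral>\<^sup>+ x. ennreal ((v x - u k x)\<^sup>2) \<partial>torus) \<le> ennreal (((1/2)^k)\<^sup>2)" for k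
 proof -
  have "(\<integral>\<^sup>+ x. ennreal ((v x - u k x)\<^sup>2) \<partial>torus) = (\<integral>\<^sup>+ x. liminf (\<lambda>j. ennreal ((u j x - u k x)\<^sup>2)) \<partial>torus)"
  proof (intro nn_integral_cong_AE, use conv in eventually_elim)
   case (elim x)
   then have "(\<lambda>j. ennreal ((u j x - u k x)\<^sup>2)) \<longlonglongrightarrow> ennreal ((v x - u k x)\<^sup>2)"
    unfolding v_def by (intro tendsto_intros)
   from lim_imp_Liminf[OF sequentially_bot this] show ?case by (rule sym)
  qed
  also have "\<dots> \<le> liminf (\<lambda>j. \<integral>\<^sup>+ x. ennreal ((u j x - u k x)\<^sup>2) \<partial>torus)"
   by (intro nn_integral_liminf) auto
  also have "\<dots> \<le> liminf (\<lambda>j. ennreal (((1/2)^k)\<^sup>2))"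
   by (intro Liminf_mono eventually_sequentiallyI[of k]) (rule dist)
  also have "\<dots> = ennreal (((1/2)^k)\<^sup>2)" by (rule Liminf_const) simp
  finally show ?thesis .
 qed
 have vu: "sq_integrable (\<lambda>x. v x - u k x)" for k
  using close[of k] unfolding sq_integrable_def
  by (auto intro!: integrableI_nonneg simp: le_less_trans[OF _ ennreal_less_top])
 have v: "sq_integrable v" using sq_integrable_add[OF vu[of 0] u[of 0]] by simp
 define V where "V = abs_l2 v"
 have VX: "norm (V - X (r k)) \<le> (1/2)^k" for k
 proof -
  have "V - X (r k) = abs_l2 (\<lambda>x. v x - u k x)"
   using diff_abs_l2[OF v u, of k] by (simp add: u_def V_def)
  then have "AE x in torus. rep_l2 (V - X (r k)) x = v x - u k x"
   using rep_abs_l2[OF vu, of k] by simp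
  then have "ennreal ((norm (V - X (r k)))\<^sup>2) = (\<integral>\<^sup>+ x. ennreal ((v x - u k x)\<^sup>2) \<partial>torus)"
   unfolding nn_integral_rep_l2_sq[symmetric] by (intro nn_integral_cong_AE) auto
  with close[of k] have "ennreal ((norm (V - X (r k)))\<^sup>2) \<le> ennreal (((1/2)^k)\<^sup>2)" by (simp only:)
  then have "(norm (V - X (r k)))\<^sup>2 \<le> ((1/2)^k)\<^sup>2" by (subst (asm) ennreal_le_iff) auto
  then show ?thesis by (rule power2_le_imp_le) simp
 qed
 have "(\<lambda>k. (1/2::real)^k) \<longlonglongrightarrow> 0" by (rule LIMSEQ_power_zero) simp
 then have "(\<lambda>k. V - X (r k)) \<longlonglongrightarrow> 0"
  by (rule Lim_null_comparison[rotated]) (use VX in simp)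
 then have "(\<lambda>k. V - (V - X (r k))) \<longlonglongrightarrow> V - 0" by (intro tendsto_intros)
 then have "(X \<circ> r) \<longlonglongrightarrow> V" by (simp add: o_def)
 with X r(1) have "X \<longlonglongrightarrow> V" by (rule Cauchy_converges_subseq)
 then show "convergent X" by (auto simp: convergent_def)
qed

instance l2 :: banach ..

section \<open>The Hartley basis of the torus\<close>

text \<open>The shift \<open>a\<close> makes one formula serve for cosine, for sine
  (\<open>a = - pi / 2\<close>) and for an inner integral, in which the other coordinate acts as a
  shift.\<close>

lemma integral_unit_interval_cos:
 "(\<integral>y. indicator {0..<1} y * cos (a + 2 * pi * of_int l * y) \<partial>lborel) = (if l = 0 then cos a else 0)"
proof -
 have "(\<integral>y. indicator {0..<1} y * cos (a + 2 * pi * of_int l * y) \<partial>lborel)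
   = (\<integral>y. indicator {0..1} y *\<^sub>R cos (a + 2 * pi * of_int l * y) \<partial>lborel)"
 proof (rule integral_cong_AE)
  have "AE y in lborel. y \<noteq> (1::real)" by (rule AE_lborel_singleton)
  then show "AE y in lborel. indicator {0..<1} y * cos (a + 2 * pi * of_int l * y) = indicator {0..1} y *\<^sub>R cos (a + 2 * pi * of_int l * y)"
   by eventually_elim (auto simp: indicator_def)
 qed auto
 also have "\<dots> = (if l = 0 then cos a else 0)"
 proof (cases "l = 0")
  case True
  then show ?thesis by simp
 next
  case False
  define F where "F y = sin (a + 2 * pi * of_int l * y) / (2 * pi * of_int l)" for y
  have "(\<integral>y. indicator {0..1} y *\<^sub>R cos (a + 2 * pi * of_int l * y) \<partial>lborel) = F 1 - F 0"
  proof (rule integral_FTC_atLeastAtMost)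
   fix y :: real
   have "(F has_real_derivative cos (a + 2 * pi * of_int l * y)) (at y within {0..1})"
    unfolding F_def using False by (auto intro!: derivative_eq_intros)
   then show "(F has_vector_derivative cos (a + 2 * pi * of_int l * y)) (at y within {0..1})"
    by (simp add: has_real_derivative_iff_has_vector_derivative)
  qed (auto intro!: continuous_intros)
  also have "F 1 = F 0"
  proof -
   have "sin (a + 2 * pi * of_int l) = sin a"
    using sin_add[of a "2 * pi * of_int l"] by simp
   then show ?thesis by (simp add: F_def)
  qed
  finally show ?thesis using False by simp
 qed
 finally show ?thesis .
qed

lemma integral_torus_lborel:
 fixes f :: "real \<times> real \<Rightarrow> real"
 shows "(\<integral>x. f x \<partial>torus) = (\<integral>x. indicator ({0..<1} \<times> {0..<1}) x * f x \<partial>lborel)"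
 unfolding torus_def using sets_torus_Q by (subst integral_restrict_space) auto

lemma integral_torus_cos:
 "(\<integral>x. cos (a + phase k x) \<partial>torus) = (if k = (0, 0) then cos a else 0)"
proof -
 obtain k1 k2 where k: "k = (k1, k2)" by (cases k)
 let ?g = "\<lambda>x y. indicator {0..<1} x * (indicator {0..<1} y * cos ((a + 2 * pi * of_int k1 * x) + 2 * pi * of_int k2 * y)) :: real"
 have eq: "indicator ({0..<1} \<times> {0..<1}) x * cos (a + phase k x) = ?g (fst x) (snd x)" for x
  by (cases x) (simp add: k phase_def indicator_times algebra_simps)
 have "integrable torus (\<lambda>x. cos (a + phase k x))"
  by (rule torus.integrable_const_bound[where B=1])
    (auto intro!: measurable_torusI borel_measurable_continuous_onI continuous_intros simp: phase_def)
 then have "integrable lborel (\<lambda>x. indicator ({0..<1} \<times> {0..<1}) x * cos (a + phase k x))"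
  unfolding torus_def using sets_torus_Q by (subst (asm) integrable_restrict_space) auto
 then have int: "integrable (lborel \<Otimes>\<^sub>M lborel) (\<lambda>x. ?g (fst x) (snd x))"
  unfolding eq by (simp add: lborel_prod)
 then have int': "integrable (lborel \<Otimes>\<^sub>M lborel) (\<lambda>(x, y). ?g x y)"
  by (simp add: case_prod_unfold)
 have "(\<integral>x. cos (a + phase k x) \<partial>torus) = (\<integral>x. ?g (fst x) (snd x) \<partial>(lborel \<Otimes>\<^sub>M lborel))"
  unfolding integral_torus_lborel eq by (simp add: lborel_prod)
 also have "\<dots> = (\<integral>x. (\<integral>y. ?g x y \<partial>lborel) \<partial>lborel)"
  using lborel_pair.integral_fst'[OF int] by simp
 also have "\<dots> = (\<integral>x. indicator {0..<1} x * (if k2 = 0 then cos (a + 2 * pi * of_int k1 * x) else 0) \<partial>lborel)"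
  unfolding integral_mult_right_zero integral_unit_interval_cos ..
 also have "\<dots> = (if k2 = 0 then \<integral>x. indicator {0..<1} x * cos (a + 2 * pi * of_int k1 * x) \<partial>lborel else 0)"
  by simp
 also have "\<dots> = (if k = (0, 0) then cos a else 0)"
  unfolding integral_unit_interval_cos by (simp add: k)
 finally show ?thesis .
qed

text \<open>The Hartley kernel. Cosine plus sine gives a real orthonormal basis with exactly one
  function for every wave number, so neither a half lattice nor pairs of functions have to be
  handled; \<open>k\<close> and \<open>- k\<close> together span the cosine and the sine.\<close>

definition casf :: "int \<times> int \<Rightarrow> real \<times> real \<Rightarrow> real" where
 "casf k x = cos (phase k x) + sin (phase k x)"

definition cas :: "int \<times> int \<Rightarrow> l2" where
 "cas k = abs_l2 (casf k)"

definition coef :: "l2 \<Rightarrow> int \<times> int \<Rightarrow> real" where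
 "coef f k = f \<bullet> cas k"

lemma phase_uminus [simp]: "phase (- k) x = - phase k x"
 by (simp add: phase_def algebra_simps)

lemma phase_add: "phase (k + l) x = phase k x + phase l x"
 by (simp add: phase_def algebra_simps)

lemma phase_diff: "phase (k - l) x = phase k x - phase l x"
 by (simp add: phase_def algebra_simps)

lemma phase_0 [simp]: "phase 0 x = 0" "phase (0, 0) x = 0"
 by (simp_all add: phase_def)

lemma continuous_phase [continuous_intros]: "continuous_on A (phase k)"
 unfolding phase_def by (intro continuous_intros)

lemma borel_measurable_phase [measurable]: "phase k \<in> borel_measurable torus"
 by (intro measurable_torusI borel_measurable_continuous_onI continuous_intros)

lemma borel_measurable_casf [measurable]: "casf k \<in> borel_measurable torus"
 unfolding casf_def by measurable

lemma abs_casf_le: "\<bar>casf k x\<bar> \<le> 2"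
 unfolding casf_def using abs_cos_le_one[of "phase k x"] abs_sin_le_one[of "phase k x"] by linarith

lemma sq_integrable_casf: "sq_integrable (casf k)"
 by (rule sq_integrable_bounded[where C=2]) (auto simp: abs_casf_le)

text \<open>The product equals \<open>cos (phase (k - l) x) + sin (phase (k + l) x)\<close>, and
  both parts are combinations of opposite Hartley modes. These four wave numbers are the source of
  every convolution formula for products and commutators.\<close>

lemma casf_mult:
 "casf k x * casf l x = (casf (k - l) x + casf (l - k) x + casf (k + l) x - casf (- (k + l)) x) / 2"
proof -
 have "casf k x * casf l x = cos (phase (k - l) x) + sin (phase (k + l) x)"
  by (simp add: casf_def phase_diff phase_add cos_diff sin_add algebra_simps)
 moreover have "casf (k - l) x + casf (l - k) x = 2 * cos (phase (k - l) x)"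
  using phase_uminus[of "k - l" x] by (simp add: casf_def)
 moreover have "casf (k + l) x - casf (- (k + l)) x = 2 * sin (phase (k + l) x)"
  unfolding casf_def phase_uminus by simp
 ultimately show ?thesis by simp
qed

lemma integral_casf: "(\<integral>x. casf k x \<partial>torus) = (if k = 0 then 1 else 0)"
proof -
 have sin: "sin (phase k x) = cos (- pi / 2 + phase k x)" for x by (simp add: cos_diff)
 have i: "integrable torus (\<lambda>x. cos (a + phase k x))" for a
  by (rule torus.integrable_const_bound[where B=1]) auto
 have "(\<integral>x. casf k x \<partial>torus) = (\<integral>x. cos (0 + phase k x) \<partial>torus) + (\<integral>x. cos (- pi / 2 + phase k x) \<partial>torus)"
  unfolding casf_def sin using i[of 0] i[of "- pi / 2"] by (subst Bochner_Integration.integral_add) auto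
 then show ?thesis unfolding integral_torus_cos by (auto simp: zero_prod_def)
qed

lemma integrable_casf: "integrable torus (casf k)"
 by (rule torus.integrable_const_bound[where B=2]) (auto simp: abs_casf_le)

lemma inner_cas_cas: "cas k \<bullet> cas l = (if k = l then 1 else 0)"
proof -
 have "cas k \<bullet> cas l = (\<integral>x. (casf (k - l) x + casf (l - k) x + casf (k + l) x - casf (- (k + l)) x) / 2 \<partial>torus)"
  unfolding cas_def inner_abs_l2[OF sq_integrable_casf sq_integrable_casf] casf_mult ..
 also have "\<dots> = ((\<integral>x. casf (k - l) x \<partial>torus) + (\<integral>x. casf (l - k) x \<partial>torus)
    + (\<integral>x. casf (k + l) x \<partial>torus) - (\<integral>x. casf (- (k + l)) x \<partial>torus)) / 2"
  using integrable_casf by simp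
 also have "\<dots> = (if k = l then 1 else 0)"
  unfolding integral_casf
  by (simp only: right_minus_eq neg_equal_0_iff_equal eq_commute[of l k]) simp
 finally show ?thesis .
qed

lemma norm_cas [simp]: "norm (cas k) = 1"
 by (simp add: norm_eq_sqrt_inner inner_cas_cas)

lemma coef_cas: "coef (cas k) l = (if k = l then 1 else 0)"
 by (simp add: coef_def inner_cas_cas)

lemma coef_add: "coef (f + g) k = coef f k + coef g k"
 and coef_diff: "coef (f - g) k = coef f k - coef g k"
 and coef_minus: "coef (- f) k = - coef f k"
 and coef_scaleR: "coef (c *\<^sub>R f) k = c * coef f k"
 and coef_zero: "coef 0 k = 0"
 by (simp_all add: coef_def inner_add_left inner_diff_left)

lemma coef_sum: "coef (sum f A) k = (\<Sum>i\<in>A. coef (f i) k)"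
 by (simp add: coef_def inner_sum_left)

lemmas coef_simps = coef_add coef_diff coef_minus coef_scaleR coef_zero coef_sum

lemma coef_abs_l2: "sq_integrable u \<Longrightarrow> coef (abs_l2 u) k = (\<integral>x. u x * casf k x \<partial>torus)"
 unfolding coef_def cas_def by (rule inner_abs_l2) (auto intro: sq_integrable_casf)

text \<open>Trigonometric functions separate points of the torus realised as a product of two circles.\<close>

definition trig_fun :: "(complex \<times> complex \<Rightarrow> real) \<Rightarrow> bool" where
 "trig_fun h \<longleftrightarrow> (\<exists>F c. finite F \<and> continuous_on UNIV h \<and>
   (\<forall>x. h (cis (2 * pi * fst x), cis (2 * pi * snd x)) = (\<Sum>k\<in>F. c k * casf k x)))"

lemma trig_funI:
 assumes "finite F" "continuous_on UNIV h"
  "\<And>x. h (cis (2 * pi * fst x), cis (2 * pi * snd x)) = (\<Sum>k\<in>F. c k * casf k x)"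
 shows "trig_fun h"
 using assms unfolding trig_fun_def by blast

lemma trig_fun_const: "trig_fun (\<lambda>_. c)"
 by (rule trig_funI[where F="{0}" and c="\<lambda>_. c"]) (auto simp: casf_def)

lemma trig_fun_add:
 assumes "trig_fun h" "trig_fun h'" shows "trig_fun (\<lambda>z. h z + h' z)"
proof -
 obtain F c where F: "finite F" "continuous_on UNIV h"
  "\<And>x. h (cis (2 * pi * fst x), cis (2 * pi * snd x)) = (\<Sum>k\<in>F. c k * casf k x)"
  using assms(1) unfolding trig_fun_def by blast
 obtain F' c' where F': "finite F'" "continuous_on UNIV h'"
  "\<And>x. h' (cis (2 * pi * fst x), cis (2 * pi * snd x)) = (\<Sum>k\<in>F'. c' k * casf k x)"
  using assms(2) unfolding trig_fun_def by blast
 show ?thesis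
 proof (rule trig_funI[where F="F \<union> F'" and c="\<lambda>k. (if k \<in> F then c k else 0) + (if k \<in> F' then c' k else 0)"])
  fix x
  have "(\<Sum>k\<in>F. c k * casf k x) = (\<Sum>k\<in>F \<union> F'. (if k \<in> F then c k else 0) * casf k x)"
   using F(1) F'(1) by (intro sum.mono_neutral_cong_left) auto
  moreover have "(\<Sum>k\<in>F'. c' k * casf k x) = (\<Sum>k\<in>F \<union> F'. (if k \<in> F' then c' k else 0) * casf k x)"
   using F(1) F'(1) by (intro sum.mono_neutral_cong_left) auto
  ultimately show "h (cis (2 * pi * fst x), cis (2 * pi * snd x)) + h' (cis (2 * pi * fst x), cis (2 * pi * snd x))
    = (\<Sum>k\<in>F \<union> F'. ((if k \<in> F then c k else 0) + (if k \<in> F' then c' k else 0)) * casf k x)"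
   unfolding F(3) F'(3) by (simp add: sum.distrib distrib_right)
 qed (use F F' in \<open>auto intro!: continuous_intros\<close>)
qed

lemma trig_fun_mult:
 assumes "trig_fun h" "trig_fun h'" shows "trig_fun (\<lambda>z. h z * h' z)"
proof -
 obtain F c where F: "finite F" "continuous_on UNIV h"
  "\<And>x. h (cis (2 * pi * fst x), cis (2 * pi * snd x)) = (\<Sum>k\<in>F. c k * casf k x)"
  using assms(1) unfolding trig_fun_def by blast
 obtain F' c' where F': "finite F'" "continuous_on UNIV h'"
  "\<And>x. h' (cis (2 * pi * fst x), cis (2 * pi * snd x)) = (\<Sum>k\<in>F'. c' k * casf k x)"
  using assms(2) unfolding trig_fun_def by blast
 define P where "P = F \<times> F'"
 define w where "w p = c (fst p) * c' (snd p) / 2" for p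
 \<comment> \<open>Different pairs may produce the same wave number; \<open>d\<close> therefore adds
   all contributions to a given \<open>q\<close> instead of indexing the sum by pairs.\<close>
 define Q where "Q = (\<lambda>p. fst p - snd p) ` P \<union> (\<lambda>p. snd p - fst p) ` P \<union> (\<lambda>p. fst p + snd p) ` P \<union> (\<lambda>p. - (fst p + snd p)) ` P"
 have fin: "finite P" "finite Q" using F F' by (auto simp: P_def Q_def)
 define d where "d q = (\<Sum>p\<in>P. w p * ((if q = fst p - snd p then 1 else 0) + (if q = snd p - fst p then 1 else 0)
   + (if q = fst p + snd p then 1 else 0) - (if q = - (fst p + snd p) then 1 else 0)))" for q
 show ?thesis
 proof (rule trig_funI[where F=Q and c=d])
  fix x
  have delta: "(\<Sum>q\<in>Q. (if q = r then 1 else 0) * casf q x) = casf r x" if "r \<in> Q" for r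
   using that fin(2) by (simp add: if_distrib[where f="\<lambda>t. t * _"] cong: if_cong)
  have "(\<Sum>q\<in>Q. d q * casf q x) = (\<Sum>p\<in>P. w p * ((\<Sum>q\<in>Q. (if q = fst p - snd p then 1 else 0) * casf q x)
    + (\<Sum>q\<in>Q. (if q = snd p - fst p then 1 else 0) * casf q x)
    + (\<Sum>q\<in>Q. (if q = fst p + snd p then 1 else 0) * casf q x)
    - (\<Sum>q\<in>Q. (if q = - (fst p + snd p) then 1 else 0) * casf q x)))"
   unfolding d_def sum_distrib_right
   by (subst sum.swap, intro sum.cong refl)
     (simp only: sum.distrib[symmetric] sum_subtractf[symmetric] sum_distrib_left distrib_right left_diff_distrib mult.assoc distrib_left right_diff_distrib)
  also have "\<dots> = (\<Sum>p\<in>P. w p * (casf (fst p - snd p) x + casf (snd p - fst p) x + casf (fst p + snd p) x - casf (- (fst p + snd p)) x))"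
  proof (intro sum.cong refl)
   fix p assume p: "p \<in> P"
   have "fst p - snd p \<in> Q" "snd p - fst p \<in> Q" "fst p + snd p \<in> Q" "- (fst p + snd p) \<in> Q"
    using p unfolding Q_def by blast+
   then show "w p * ((\<Sum>q\<in>Q. (if q = fst p - snd p then 1 else 0) * casf q x)
    + (\<Sum>q\<in>Q. (if q = snd p - fst p then 1 else 0) * casf q x)
    + (\<Sum>q\<in>Q. (if q = fst p + snd p then 1 else 0) * casf q x)
    - (\<Sum>q\<in>Q. (if q = - (fst p + snd p) then 1 else 0) * casf q x))
    = w p * (casf (fst p - snd p) x + casf (snd p - fst p) x + casf (fst p + snd p) x - casf (- (fst p + snd p)) x)"
    by (simp only: delta)
  qed
  also have "\<dots> = (\<Sum>p\<in>P. (c (fst p) * casf (fst p) x) * (c' (snd p) * casf (snd p) x))"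
  proof (intro sum.cong refl)
   fix p
   show "w p * (casf (fst p - snd p) x + casf (snd p - fst p) x + casf (fst p + snd p) x - casf (- (fst p + snd p)) x)
    = (c (fst p) * casf (fst p) x) * (c' (snd p) * casf (snd p) x)"
    using casf_mult[of "fst p" x "snd p"] by (simp add: w_def)
  qed
  also have "\<dots> = (\<Sum>k\<in>F. c k * casf k x) * (\<Sum>k\<in>F'. c' k * casf k x)"
   unfolding sum_product P_def sum.cartesian_product by (simp add: case_prod_unfold)
  finally show "h (cis (2 * pi * fst x), cis (2 * pi * snd x)) * h' (cis (2 * pi * fst x), cis (2 * pi * snd x))
    = (\<Sum>q\<in>Q. d q * casf q x)"
   unfolding F(3) F'(3) ..
 qed (use F F' fin in \<open>auto intro!: continuous_intros\<close>)
qed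

lemma trig_fun_coordinates:
 "trig_fun (\<lambda>z. Re (fst z))" "trig_fun (\<lambda>z. Im (fst z))" "trig_fun (\<lambda>z. Re (snd z))" "trig_fun (\<lambda>z. Im (snd z))"
proof -
 have p: "phase (1, 0) x = 2 * pi * fst x" "phase (0, 1) x = 2 * pi * snd x"
   "phase (- 1, 0) x = - (2 * pi * fst x)" "phase (0, - 1) x = - (2 * pi * snd x)" for x
  by (simp_all add: phase_def)
 show "trig_fun (\<lambda>z. Re (fst z))"
  by (rule trig_funI[where F="{(1, 0), (-1, 0)}" and c="\<lambda>_. 1/2"]) (auto intro!: continuous_intros simp: casf_def p field_simps)
 show "trig_fun (\<lambda>z. Im (fst z))"
  by (rule trig_funI[where F="{(1, 0), (-1, 0)}" and c="\<lambda>k. fst k / 2"]) (auto intro!: continuous_intros simp: casf_def p field_simps)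
 show "trig_fun (\<lambda>z. Re (snd z))"
  by (rule trig_funI[where F="{(0, 1), (0, -1)}" and c="\<lambda>_. 1/2"]) (auto intro!: continuous_intros simp: casf_def p field_simps)
 show "trig_fun (\<lambda>z. Im (snd z))"
  by (rule trig_funI[where F="{(0, 1), (0, -1)}" and c="\<lambda>k. snd k / 2"]) (auto intro!: continuous_intros simp: casf_def p field_simps)
qed

definition circles :: "real \<times> real \<Rightarrow> complex \<times> complex" where
 "circles x = (cis (2 * pi * fst x), cis (2 * pi * snd x))"

lemma continuous_circles [continuous_intros]: "continuous_on A circles"
 unfolding circles_def cis_conv_exp by (intro continuous_intros)

lemma cis_2pi_inj:
 assumes "cis (2 * pi * a) = cis (2 * pi * b)" "a \<in> {0..<1}" "b \<in> {0..<1}"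
 shows "a = b"
proof -
 have "sin (2 * pi * a) = sin (2 * pi * b) \<and> cos (2 * pi * a) = cos (2 * pi * b)"
  using assms(1) by (simp add: complex_eq_iff)
 then obtain n :: int where "2 * pi * a = 2 * pi * b + 2 * pi * n" by (auto simp: sin_cos_eq_iff)
 then have "2 * pi * a = 2 * pi * (b + n)" by (simp add: algebra_simps)
 then have n: "a = b + of_int n" by simp
 then have "\<bar>real_of_int n\<bar> < 1" using assms(2,3) by auto
 then have "n = 0" by simp
 with n show ?thesis by simp
qed

lemma circles_inj_on: "inj_on circles ({0..<1} \<times> {0..<1})"
proof (rule inj_onI)
 fix x y assume xy: "x \<in> {0..<1} \<times> {0..<1}" "y \<in> {0..<1} \<times> {0..<1}" "circles x = circles y"
 then have "fst x = fst y" "snd x = snd y"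
  using cis_2pi_inj[of "fst x" "fst y"] cis_2pi_inj[of "snd x" "snd y"] by (auto simp: circles_def)
 then show "x = y" by (simp add: prod_eq_iff)
qed

section \<open>Completeness of the Hartley system\<close>

context
 fixes f :: l2
 assumes coef_0: "\<And>k. coef f k = 0"
begin

lemma f_borel: "rep_l2 f \<in> borel_measurable torus"
 using sq_integrable_rep_l2[of f] by (simp add: sq_integrable_def)

lemma f_mult_bounded:
 assumes "u \<in> borel_measurable torus" "\<And>x. x \<in> space torus \<Longrightarrow> \<bar>u x\<bar> \<le> C"
 shows "integrable torus (\<lambda>x. rep_l2 f x * u x)"
 by (rule sq_integrable_mult[OF sq_integrable_rep_l2 sq_integrable_bounded[OF assms]])

lemma f_int: "integrable torus (rep_l2 f)"
 using f_mult_bounded[of "\<lambda>_. 1" 1] by simp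

lemma integral_trig_fun_0:
 assumes "trig_fun h" shows "(\<integral>x. rep_l2 f x * h (circles x) \<partial>torus) = 0"
proof -
 obtain F c where F: "finite F" "\<And>x. h (circles x) = (\<Sum>k\<in>F. c k * casf k x)"
  using assms unfolding trig_fun_def circles_def by blast
 have i: "integrable torus (\<lambda>x. rep_l2 f x * casf k x)" for k
  by (rule f_mult_bounded[where C=2]) (auto simp: abs_casf_le)
 have "(\<integral>x. rep_l2 f x * h (circles x) \<partial>torus) = (\<integral>x. (\<Sum>k\<in>F. c k * (rep_l2 f x * casf k x)) \<partial>torus)"
  by (simp add: F(2) sum_distrib_left mult_ac)
 also have "\<dots> = (\<Sum>k\<in>F. c k * (\<integral>x. rep_l2 f x * casf k x \<partial>torus))"
  using i by (subst Bochner_Integration.integral_sum) auto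
 also have "\<dots> = (\<Sum>k\<in>F. c k * coef f k)"
  using coef_abs_l2[OF sq_integrable_rep_l2, of f] by simp
 finally show ?thesis by (simp add: coef_0)
qed

text \<open>The fundamental domain is not compact and its functions need not be periodic. Composing
  with \<open>circles\<close> moves the problem to a product of two circles, where Stone-Weierstrass
  applies to trigonometric polynomials.\<close>

lemma integral_continuous_0:
 assumes h: "continuous_on UNIV h" and bd: "\<And>z. \<bar>h z\<bar> \<le> C"
 shows "(\<integral>x. rep_l2 f x * h (circles x) \<partial>torus) = 0"
proof -
 let ?S = "sphere 0 1 \<times> sphere 0 1 :: (complex \<times> complex) set"
 have hm: "(\<lambda>x. h (circles x)) \<in> borel_measurable torus" if "continuous_on UNIV h" for h :: "complex \<times> complex \<Rightarrow> real"
  by (intro measurable_torusI borel_measurable_continuous_onI continuous_on_compose2[OF that] continuous_intros) auto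
 define A where "A = (\<integral>x. \<bar>rep_l2 f x\<bar> \<partial>torus)"
 have A: "0 \<le> A" by (simp add: A_def)
 have "\<bar>\<integral>x. rep_l2 f x * h (circles x) \<partial>torus\<bar> \<le> e * A" if e: "0 < e" for e
 proof -
  have "\<exists>g. trig_fun g \<and> (\<forall>z\<in>?S. \<bar>h z - g z\<bar> < e)"
  proof (rule Stone_Weierstrass_HOL)
   show "compact ?S" by (intro compact_Times) auto
   show "continuous_on ?S h" using h continuous_on_subset by blast
   fix z w assume "z \<in> ?S \<and> w \<in> ?S \<and> z \<noteq> w"
   then consider "Re (fst z) \<noteq> Re (fst w)" | "Im (fst z) \<noteq> Im (fst w)" | "Re (snd z) \<noteq> Re (snd w)" | "Im (snd z) \<noteq> Im (snd w)"
    by (auto simp: prod_eq_iff complex_eq_iff)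
   then show "\<exists>g. trig_fun g \<and> g z \<noteq> g w"
    by cases (use trig_fun_coordinates in blast)+
  next
   fix g assume "trig_fun g" then show "continuous_on ?S g"
    unfolding trig_fun_def using continuous_on_subset by blast
  qed (use e in \<open>auto intro: trig_fun_const trig_fun_add trig_fun_mult\<close>)
  then obtain g where g: "trig_fun g" "\<And>z. z \<in> ?S \<Longrightarrow> \<bar>h z - g z\<bar> < e" by blast
  have cS: "circles x \<in> ?S" for x by (simp add: circles_def)
  have gc: "continuous_on UNIV g" using g(1) by (auto simp: trig_fun_def)
  have b1: "\<bar>g (circles x)\<bar> \<le> C + e" for x using g(2)[OF cS, of x] bd[of "circles x"] by linarith
  have i: "integrable torus (\<lambda>x. rep_l2 f x * h (circles x))" "integrable torus (\<lambda>x. rep_l2 f x * g (circles x))"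
   by (rule f_mult_bounded[OF hm[OF h] bd], rule f_mult_bounded[OF hm[OF gc] b1])
  have i2: "integrable torus (\<lambda>x. rep_l2 f x * (h (circles x) - g (circles x)))"
   using i by (simp add: right_diff_distrib)
  have "(\<integral>x. rep_l2 f x * h (circles x) \<partial>torus) = (\<integral>x. rep_l2 f x * (h (circles x) - g (circles x)) \<partial>torus)"
   using i integral_trig_fun_0[OF g(1)] by (simp add: right_diff_distrib)
  also have "\<bar>\<dots>\<bar> \<le> (\<integral>x. \<bar>rep_l2 f x * (h (circles x) - g (circles x))\<bar> \<partial>torus)"
   by (rule integral_abs_bound)
  also have "\<dots> \<le> (\<integral>x. e * \<bar>rep_l2 f x\<bar> \<partial>torus)"
  proof (rule integral_mono)
   show "integrable torus (\<lambda>x. \<bar>rep_l2 f x * (h (circles x) - g (circles x))\<bar>)" using i2 by simp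
   show "integrable torus (\<lambda>x. e * \<bar>rep_l2 f x\<bar>)" using f_int by simp
   fix x
   have "\<bar>rep_l2 f x\<bar> * \<bar>h (circles x) - g (circles x)\<bar> \<le> \<bar>rep_l2 f x\<bar> * e"
    using g(2)[OF cS, of x] by (intro mult_left_mono) auto
   then show "\<bar>rep_l2 f x * (h (circles x) - g (circles x))\<bar> \<le> e * \<bar>rep_l2 f x\<bar>"
    by (simp add: abs_mult mult.commute)
  qed
  also have "\<dots> = e * A" by (simp add: A_def)
  finally show ?thesis .
 qed
 note le = this
 have "\<bar>\<integral>x. rep_l2 f x * h (circles x) \<partial>torus\<bar> \<le> 0 + e" if "0 < e" for e
 proof -
  have "\<bar>\<integral>x. rep_l2 f x * h (circles x) \<partial>torus\<bar> \<le> e / (A + 1) * A"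
   using A that by (intro le) auto
  also have "\<dots> \<le> e" using A that by (simp add: field_simps)
  finally show ?thesis by simp
 qed
 then have "\<bar>\<integral>x. rep_l2 f x * h (circles x) \<partial>torus\<bar> \<le> 0" by (rule field_le_epsilon)
 then show ?thesis by simp
qed

lemma integral_compact_0:
 assumes K: "compact K" "K \<subseteq> {0..<1} \<times> {0..<1}"
 shows "(\<integral>x. rep_l2 f x * indicator K x \<partial>torus) = 0"
proof (cases "K = {}")
 case True then show ?thesis by simp
next
 case False
 have cK: "closed (circles ` K)" "circles ` K \<noteq> {}"
  using False by (auto intro!: compact_imp_closed compact_continuous_image[OF continuous_circles K(1)])
 define h where "h n z = max 0 (1 - real n * infdist z (circles ` K))" for n z
 have hc: "continuous_on UNIV (h n)" for n
  unfolding h_def by (intro continuous_intros)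
 have hb: "\<bar>h n z\<bar> \<le> 1" for n z
  unfolding h_def using infdist_nonneg[of z "circles ` K"] by auto
 have hm: "(\<lambda>x. h n (circles x)) \<in> borel_measurable torus" for n
  by (intro measurable_torusI borel_measurable_continuous_onI continuous_on_compose2[OF hc] continuous_intros) auto
 have lim: "(\<lambda>n. h n (circles x)) \<longlonglongrightarrow> indicator K x" if x: "x \<in> space torus" for x
 proof (cases "x \<in> K")
  case True
  then have "infdist (circles x) (circles ` K) = 0" by simp
  then show ?thesis using True by (simp add: h_def)
 next
  case F: False
  have "circles x \<notin> circles ` K"
   using F x K(2) inj_on_image_mem_iff[OF circles_inj_on, of x K] by (simp add: space_torus)
  then have pos: "0 < infdist (circles x) (circles ` K)"
   using infdist_pos_not_in_closed[OF cK] by simp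
  have "eventually (\<lambda>n. h n (circles x) = 0) sequentially"
  proof -
   obtain N :: nat where N: "1 / infdist (circles x) (circles ` K) < real N" using reals_Archimedean2 by blast
   show ?thesis
   proof (rule eventually_sequentiallyI[of N])
    fix n assume "N \<le> n"
    then have "1 / infdist (circles x) (circles ` K) \<le> real n" using N by linarith
    then have "1 \<le> real n * infdist (circles x) (circles ` K)" using pos by (simp add: field_simps)
    then show "h n (circles x) = 0" by (simp add: h_def)
   qed
  qed
  then show ?thesis using F by (simp add: tendsto_eventually)
 qed
 have "(\<lambda>n. \<integral>x. rep_l2 f x * h n (circles x) \<partial>torus) \<longlonglongrightarrow> (\<integral>x. rep_l2 f x * indicator K x \<partial>torus)"
 proof (rule integral_dominated_convergence[where w="\<lambda>x. \<bar>rep_l2 f x\<bar>"])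
  have "(indicator K :: real \<times> real \<Rightarrow> real) \<in> borel_measurable torus"
   using K(1) by (intro measurable_torusI borel_measurable_indicator) (auto intro: borel_compact)
  then show "(\<lambda>x. rep_l2 f x * indicator K x) \<in> borel_measurable torus" using f_borel by simp
  show "(\<lambda>x. rep_l2 f x * h n (circles x)) \<in> borel_measurable torus" for n using f_borel hm by simp
  show "AE x in torus. (\<lambda>n. rep_l2 f x * h n (circles x)) \<longlonglongrightarrow> rep_l2 f x * indicator K x"
   using lim by (intro AE_I2 tendsto_intros) auto
  show "AE x in torus. norm (rep_l2 f x * h n (circles x)) \<le> \<bar>rep_l2 f x\<bar>" for n
   using hb by (intro AE_I2) (simp add: abs_mult mult_left_le)
 qed (use f_int in simp)
 moreover have "(\<integral>x. rep_l2 f x * h n (circles x) \<partial>torus) = 0" for n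
  by (rule integral_continuous_0[OF hc hb])
 ultimately show ?thesis using LIMSEQ_unique[OF _ tendsto_const] by simp
qed

text \<open>The positive and the negative part of \<open>f\<close>, taken as densities, define two
  finite measures that agree on compact subsets of the half-open square, hence on closed sets, hence
  on all Borel sets; equal measures have equal densities almost everywhere.\<close>

lemma coef_0_imp_0: "f = 0"
proof -
 note f_borel [measurable]
 define P where "P = density torus (\<lambda>x. ennreal (rep_l2 f x))"
 define N where "N = density torus (\<lambda>x. ennreal (- rep_l2 f x))"
 define P' where "P' = distr P borel (\<lambda>x. x)"
 define N' where "N' = distr N borel (\<lambda>x. x)"
 have id_m: "(\<lambda>x. x) \<in> measurable torus borel" unfolding torus_def by (intro measurable_restrict_space1) simp
 have id_P: "(\<lambda>x. x) \<in> measurable P borel" and id_N: "(\<lambda>x. x) \<in> measurable N borel"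
  using id_m by (simp_all add: P_def N_def cong: measurable_cong_sets)
 have sp: "space P = space torus" "space N = space torus" by (simp_all add: P_def N_def)
 have st: "B \<inter> space torus \<in> sets torus" if "B \<in> sets borel" for B
  using measurable_sets[OF id_m that] by (simp add: vimage_def)
 have P': "emeasure P' B = (\<integral>\<^sup>+x. ennreal (rep_l2 f x) * indicator B x \<partial>torus)" if B: "B \<in> sets borel" for B
 proof -
  have "emeasure P' B = emeasure P (B \<inter> space torus)"
   unfolding P'_def by (subst emeasure_distr[OF id_P B]) (simp add: sp)
  also have "\<dots> = (\<integral>\<^sup>+x. ennreal (rep_l2 f x) * indicator (B \<inter> space torus) x \<partial>torus)"
   unfolding P_def using st[OF B] by (subst emeasure_density) auto
  also have "\<dots> = (\<integral>\<^sup>+x. ennreal (rep_l2 f x) * indicator B x \<partial>torus)"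
   by (intro nn_integral_cong) (auto simp: indicator_def)
  finally show ?thesis .
 qed
 have N': "emeasure N' B = (\<integral>\<^sup>+x. ennreal (- rep_l2 f x) * indicator B x \<partial>torus)" if B: "B \<in> sets borel" for B
 proof -
  have "emeasure N' B = emeasure N (B \<inter> space torus)"
   unfolding N'_def by (subst emeasure_distr[OF id_N B]) (simp add: sp)
  also have "\<dots> = (\<integral>\<^sup>+x. ennreal (- rep_l2 f x) * indicator (B \<inter> space torus) x \<partial>torus)"
   unfolding N_def using st[OF B] by (subst emeasure_density) auto
  also have "\<dots> = (\<integral>\<^sup>+x. ennreal (- rep_l2 f x) * indicator B x \<partial>torus)"
   by (intro nn_integral_cong) (auto simp: indicator_def)
  finally show ?thesis .
 qed
 have comp: "emeasure P' K = emeasure N' K" if K: "compact K" "K \<subseteq> {0..<1} \<times> {0..<1}" for K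
 proof -
  have Kb: "K \<in> sets borel" using K(1) by (rule borel_compact)
  have Km [measurable]: "(indicator K :: _ \<Rightarrow> real) \<in> borel_measurable torus"
   using Kb by (intro measurable_torusI borel_measurable_indicator)
  have i: "integrable torus (\<lambda>x. rep_l2 f x * indicator K x)"
   by (rule f_mult_bounded[where C=1, OF Km]) (auto simp: indicator_def)
  have e1: "ennreal (rep_l2 f x) * indicator K x = ennreal (rep_l2 f x * indicator K x)"
   "ennreal (- rep_l2 f x) * indicator K x = ennreal (- (rep_l2 f x * indicator K x))" for x
   by (auto simp: indicator_def)
  have fin: "(\<integral>\<^sup>+x. ennreal (rep_l2 f x * indicator K x) \<partial>torus) \<noteq> \<infinity>" "(\<integral>\<^sup>+x. ennreal (- (rep_l2 f x * indicator K x)) \<partial>torus) \<noteq> \<infinity>"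
   using i by (auto simp: real_integrable_def)
  have "enn2real (\<integral>\<^sup>+x. ennreal (rep_l2 f x * indicator K x) \<partial>torus) = enn2real (\<integral>\<^sup>+x. ennreal (- (rep_l2 f x * indicator K x)) \<partial>torus)"
   using integral_compact_0[OF K] unfolding real_lebesgue_integral_def[OF i] by simp
  moreover have "a = b" if "enn2real a = enn2real b" "a \<noteq> \<infinity>" "b \<noteq> \<infinity>" for a b
   using that by (cases a; cases b) auto
  ultimately show ?thesis
   unfolding P'[OF Kb] N'[OF Kb] e1 using fin by blast
 qed
 have PN': "P' = N'"
 proof (rule measure_eqI_generator_eq[where E="Collect closed" and \<Omega>=UNIV and A="\<lambda>_. UNIV"])
  show "Int_stable (Collect closed)" by (auto simp: Int_stable_def)
  show "sets P' = sigma_sets UNIV (Collect closed)" "sets N' = sigma_sets UNIV (Collect closed)"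
   by (simp_all add: P'_def N'_def borel_eq_closed)
  show "emeasure P' UNIV \<noteq> \<infinity>"
   using f_int P'[of UNIV] by (simp add: real_integrable_def)
  fix X :: "(real \<times> real) set" assume "X \<in> Collect closed"
  then have X: "closed X" by simp
  \<comment> \<open>The trace of a closed set on the half-open square need not be compact; closed
    squares of side \<open>1 - 1 / Suc n\<close> exhaust it from inside.\<close>
  define Kn where "Kn n = X \<inter> ({0..1 - 1 / Suc n} \<times> {0..1 - 1 / Suc n})" for n
  have Kn: "compact (Kn n)" "Kn n \<subseteq> {0..<1} \<times> {0..<1}" for n
  proof -
   have "compact ({0..1 - 1 / Suc n} \<times> {0..1 - 1 / Suc n} :: (real \<times> real) set)" by (intro compact_Times) auto
   then show "compact (Kn n)" unfolding Kn_def using X by (rule closed_Int_compact[rotated])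
   have "0 < 1 / real (Suc n)" by simp
   then have lt: "c < 1" if "c \<le> 1 - 1 / real (Suc n)" for c using that by linarith
   show "Kn n \<subseteq> {0..<1} \<times> {0..<1}" unfolding Kn_def by (auto simp del: of_nat_Suc intro: lt)
  qed
  have inc: "incseq Kn"
  proof (rule incseq_SucI)
   fix n
   have "1 - 1 / real (Suc n) \<le> 1 - 1 / real (Suc (Suc n))" by (simp add: field_simps)
   then show "Kn n \<le> Kn (Suc n)" unfolding Kn_def by (auto simp del: of_nat_Suc intro: order_trans)
  qed
  have un: "(\<Union>n. Kn n) = X \<inter> {0..<1} \<times> {0..<1}"
  proof
   show "(\<Union>n. Kn n) \<subseteq> X \<inter> {0..<1} \<times> {0..<1}" using Kn by (auto simp: Kn_def)
   show "X \<inter> {0..<1} \<times> {0..<1} \<subseteq> (\<Union>n. Kn n)"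
   proof
    fix x assume x: "x \<in> X \<inter> {0..<1} \<times> {0..<1}"
    define e where "e = 1 - max (fst x) (snd x)"
    have "0 < e" using x by (auto simp: e_def)
    then obtain n where "1 / real (Suc n) < e" using nat_approx_posE by blast
    then have "x \<in> Kn n" using x by (auto simp: Kn_def e_def simp del: of_nat_Suc)
    then show "x \<in> (\<Union>n. Kn n)" by blast
   qed
  qed
  have rng: "range Kn \<subseteq> sets borel" using Kn(1) by (auto intro: borel_compact)
  have Xb: "X \<in> sets borel" "X \<inter> {0..<1} \<times> {0..<1} \<in> sets borel" using X sets_torus_Q by auto
  have red: "emeasure P' X = emeasure P' (X \<inter> {0..<1} \<times> {0..<1})" "emeasure N' X = emeasure N' (X \<inter> {0..<1} \<times> {0..<1})"
   unfolding P'[OF Xb(1)] P'[OF Xb(2)] N'[OF Xb(1)] N'[OF Xb(2)]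
   by (auto intro!: nn_integral_cong simp: indicator_def space_torus)
  have "emeasure P' (\<Union>n. Kn n) = (SUP n. emeasure P' (Kn n))"
   using rng inc by (intro SUP_emeasure_incseq[symmetric]) (auto simp: P'_def)
  also have "\<dots> = (SUP n. emeasure N' (Kn n))" using comp[OF Kn] by simp
  also have "\<dots> = emeasure N' (\<Union>n. Kn n)"
   using rng inc by (intro SUP_emeasure_incseq) (auto simp: N'_def)
  finally show "emeasure P' X = emeasure N' X" unfolding red un .
 qed auto
 have "P = N"
 proof (rule measure_eqI)
  show "sets P = sets N" by (simp add: P_def N_def)
  fix A assume "A \<in> sets P"
  then have A: "A \<in> sets torus" by (simp add: P_def)
  then obtain B where B: "B \<in> sets borel" "A = B \<inter> space torus"
   by (auto simp: torus_def sets_restrict_space space_restrict_space)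
  have "emeasure P A = emeasure P' B" unfolding P'_def by (subst emeasure_distr[OF id_P B(1)]) (simp add: sp B)
  moreover have "emeasure N A = emeasure N' B" unfolding N'_def by (subst emeasure_distr[OF id_N B(1)]) (simp add: sp B)
  ultimately show "emeasure P A = emeasure N A" by (simp add: PN')
 qed
 then have "AE x in torus. ennreal (rep_l2 f x) = ennreal (- rep_l2 f x)"
  unfolding P_def N_def by (intro torus.density_unique) auto
 then have "AE x in torus. rep_l2 f x = 0"
 proof eventually_elim
  case (elim x)
  then have "max 0 (rep_l2 f x) = max 0 (- rep_l2 f x)" by (metis ennreal_max_0' max.commute ennreal_inj max.cobounded1 ennreal_max_0)
  then show ?case by (auto simp: max_def split: if_splits)
 qed
 then have "f \<bullet> f = (\<integral>x. 0 \<partial>torus)"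
  unfolding inner_rep_l2 by (intro integral_cong_AE) auto
 then show ?thesis by simp
qed

end

lemma coef_eqI: "(\<And>k. coef f k = coef g k) \<Longrightarrow> f = g"
 using coef_0_imp_0[of "f - g"] by (simp add: coef_diff)

lemma norm_sum_cas:
 assumes "finite F" shows "(norm (\<Sum>k\<in>F. b k *\<^sub>R cas k))\<^sup>2 = (\<Sum>k\<in>F. (b k)\<^sup>2)"
 using assms by (subst norm_sum_Pythagorean) (auto simp: pairwise_def orthogonal_def inner_cas_cas)

lemma bessel:
 assumes F: "finite F" shows "(\<Sum>k\<in>F. (coef f k)\<^sup>2) \<le> (norm f)\<^sup>2"
proof -
 define g where "g = (\<Sum>k\<in>F. coef f k *\<^sub>R cas k)"
 have fg: "f \<bullet> g = (\<Sum>k\<in>F. (coef f k)\<^sup>2)"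
  by (simp add: g_def inner_sum_right coef_def power2_eq_square)
 have gg: "g \<bullet> g = (\<Sum>k\<in>F. (coef f k)\<^sup>2)"
  using norm_sum_cas[OF F, of "coef f"] by (simp add: g_def power2_norm_eq_inner)
 have "0 \<le> (f - g) \<bullet> (f - g)" by simp
 also have "\<dots> = f \<bullet> f - 2 * (f \<bullet> g) + g \<bullet> g" by (simp add: inner_diff_left inner_diff_right inner_commute)
 finally show ?thesis using fg gg by (simp add: power2_norm_eq_inner)
qed

lemma summable_coef_sq: "(\<lambda>k. (coef f k)\<^sup>2) summable_on UNIV"
 by (rule nonneg_bounded_partial_sums_imp_summable_on[where C="(norm f)\<^sup>2"])
   (auto intro!: eventually_finite_subsets_at_top_weakI bessel)

lemma ex_mode_enumeration: "\<exists>e :: nat \<Rightarrow> int \<times> int. bij e"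
proof -
 have "infinite (UNIV :: (int \<times> int) set)" by (simp add: finite_prod infinite_UNIV_int)
 then have "bij_betw (from_nat_into (UNIV :: (int \<times> int) set)) UNIV UNIV"
  by (intro bij_betw_from_nat_into) auto
 then show ?thesis by blast
qed

text \<open>By orthonormality the Cauchy criterion for the vector series is the one for the scalar
  series of squares; continuity of the inner product then reads off the coefficients of the
  sum.\<close>

lemma riesz_fischer_sums:
 fixes e :: "nat \<Rightarrow> int \<times> int"
 assumes e: "bij e" and b: "(\<lambda>k. (b k)\<^sup>2) summable_on UNIV"
 shows "\<exists>g. (\<lambda>i. b (e i) *\<^sub>R cas (e i)) sums g \<and> (\<forall>k. coef g k = b k)"
proof -
 have "(\<lambda>i. (b (e i))\<^sup>2) summable_on UNIV"
  using b summable_on_reindex_bij_betw[OF e, of "\<lambda>k. (b k)\<^sup>2"] by simp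
 then have s: "summable (\<lambda>i. (b (e i))\<^sup>2)" by (rule summable_on_imp_summable)
 have inj: "inj_on e A" for A using e by (meson bij_is_inj inj_on_subset subset_UNIV)
 have "summable (\<lambda>i. b (e i) *\<^sub>R cas (e i))"
  unfolding summable_Cauchy
 proof (intro allI impI)
  fix ep :: real assume ep: "0 < ep"
  then obtain N where N: "\<And>m n. m \<ge> N \<Longrightarrow> norm (\<Sum>i=m..<n. (b (e i))\<^sup>2) < ep\<^sup>2"
   using s unfolding summable_Cauchy by (meson zero_less_power)
  have "norm (\<Sum>i=m..<n. b (e i) *\<^sub>R cas (e i)) < ep" if "m \<ge> N" for m n
  proof -
   have "(\<Sum>i=m..<n. b (e i) *\<^sub>R cas (e i)) = (\<Sum>k\<in>e ` {m..<n}. b k *\<^sub>R cas k)"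
    using inj by (simp add: sum.reindex)
   then have "(norm (\<Sum>i=m..<n. b (e i) *\<^sub>R cas (e i)))\<^sup>2 = (\<Sum>k\<in>e ` {m..<n}. (b k)\<^sup>2)"
    by (simp add: norm_sum_cas)
   also have "\<dots> = (\<Sum>i=m..<n. (b (e i))\<^sup>2)" using inj by (simp add: sum.reindex)
   also have "\<dots> < ep\<^sup>2" using N[OF that, of n] by (simp add: sum_nonneg)
   finally show ?thesis using ep by (meson less_imp_le power_less_imp_less_base)
  qed
  then show "\<exists>N. \<forall>m\<ge>N. \<forall>n. norm (\<Sum>i=m..<n. b (e i) *\<^sub>R cas (e i)) < ep" by blast
 qed
 then obtain g where g: "(\<lambda>i. b (e i) *\<^sub>R cas (e i)) sums g" by (auto simp: summable_def)
 have "coef g k = b k" for k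
 proof -
  obtain i0 where i0: "k = e i0" using e by (metis bij_pointE)
  have "(\<lambda>i. (b (e i) *\<^sub>R cas (e i)) \<bullet> cas k) sums (g \<bullet> cas k)"
   using bounded_linear.sums[OF bounded_linear_inner_left g] .
  moreover have "(b (e i) *\<^sub>R cas (e i)) \<bullet> cas k = (if i = i0 then b (e i) else 0)" for i
   using inj[of UNIV] by (auto simp: inner_cas_cas i0 inj_eq)
  ultimately have "(\<lambda>i. if i = i0 then b (e i) else 0) sums (g \<bullet> cas k)" by simp
  moreover have "(\<lambda>i. if i = i0 then b (e i) else 0) sums b (e i0)" by (rule sums_single)
  ultimately show ?thesis by (simp add: coef_def sums_unique2 i0)
 qed
 with g show ?thesis by blast
qed

lemma riesz_fischer:
 assumes "(\<lambda>k. (b k)\<^sup>2) summable_on UNIV" shows "\<exists>g. \<forall>k. coef g k = b k"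
 using ex_mode_enumeration riesz_fischer_sums[OF _ assms] by blast

lemma coef_sums: "bij e \<Longrightarrow> (\<lambda>i. coef f (e i) *\<^sub>R cas (e i)) sums f"
 using riesz_fischer_sums[OF _ summable_coef_sq, of e f] coef_eqI by metis

lemma parseval_sums: "bij e \<Longrightarrow> (\<lambda>i. coef f (e i) * coef g (e i)) sums (f \<bullet> g)"
 using bounded_linear.sums[OF bounded_linear_inner_left[of g] coef_sums[of e f]]
 by (simp add: coef_def inner_commute)

lemma summable_on_mult_sq:
 fixes a b :: "'k \<Rightarrow> real"
 assumes "(\<lambda>k. (a k)\<^sup>2) summable_on A" "(\<lambda>k. (b k)\<^sup>2) summable_on A"
 shows "(\<lambda>k. a k * b k) summable_on A"
proof (rule abs_summable_summable, rule summable_on_comparison_test)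
 show "(\<lambda>k. (a k)\<^sup>2 + (b k)\<^sup>2) summable_on A" using assms by (rule summable_on_add)
 fix k
 have "2 * (\<bar>a k\<bar> * \<bar>b k\<bar>) \<le> (a k)\<^sup>2 + (b k)\<^sup>2"
  using sum_squares_bound[of "\<bar>a k\<bar>" "\<bar>b k\<bar>"] by (simp add: mult.assoc)
 moreover have "0 \<le> \<bar>a k\<bar> * \<bar>b k\<bar>" by simp
 ultimately show "norm (a k * b k) \<le> (a k)\<^sup>2 + (b k)\<^sup>2" by (simp only: real_norm_def abs_mult)
qed simp

text \<open>Stated as an unordered sum over the lattice so that reflections and shifts of the wave
  number are mere reindexings.\<close>

lemma parseval: "((\<lambda>k. coef f k * coef g k) has_sum (f \<bullet> g)) UNIV"
proof -
 obtain e :: "nat \<Rightarrow> int \<times> int" where e: "bij e" using ex_mode_enumeration by blast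
 have s: "(\<lambda>k. coef f k * coef g k) summable_on UNIV"
  by (rule summable_on_mult_sq) (rule summable_coef_sq)+
 then have "((\<lambda>k. coef f k * coef g k) has_sum (infsum (\<lambda>k. coef f k * coef g k) UNIV)) UNIV" by simp
 then have "((\<lambda>i. coef f (e i) * coef g (e i)) has_sum (infsum (\<lambda>k. coef f k * coef g k) UNIV)) UNIV"
  using has_sum_reindex_bij_betw[OF e, of "\<lambda>k. coef f k * coef g k"] by simp
 then have "(\<lambda>i. coef f (e i) * coef g (e i)) sums (infsum (\<lambda>k. coef f k * coef g k) UNIV)"
  by (rule has_sum_imp_sums)
 with parseval_sums[OF e, of f g] have "infsum (\<lambda>k. coef f k * coef g k) UNIV = f \<bullet> g" by (rule sums_unique2[symmetric])
 with s show ?thesis by (metis has_sum_infsum)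
qed

lemma parseval_norm: "((\<lambda>k. (coef f k)\<^sup>2) has_sum (norm f)\<^sup>2) UNIV"
 using parseval[of f f] by (simp only: power2_norm_eq_inner power2_eq_square[of "coef _ _"])

section \<open>Fourier multipliers in Hartley coefficients\<close>

text \<open>The even part of the Hartley coefficient is the real part of the Fourier coefficient,
  its odd part is minus the imaginary part. Definitions made with complex Fourier coefficients pass
  to real coordinates through this identity.\<close>

lemma fourier_coef:
 "fourier f k = Complex ((coef f k + coef f (- k)) / 2) ((coef f (- k) - coef f k) / 2)"
proof -
 let ?u = "rep_l2 f"
 have u: "sq_integrable ?u" by (rule sq_integrable_rep_l2)
 have c: "sq_integrable (\<lambda>x. cos (phase k x))" "sq_integrable (\<lambda>x. sin (phase k x))"
  by (auto intro!: sq_integrable_bounded[where C=1])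
 have ic: "integrable torus (\<lambda>x. ?u x * cos (phase k x))" and isn: "integrable torus (\<lambda>x. ?u x * sin (phase k x))"
  using sq_integrable_mult[OF u c(1)] sq_integrable_mult[OF u c(2)] by auto
 define a b where "a = (\<integral>x. ?u x * cos (phase k x) \<partial>torus)" and "b = (\<integral>x. ?u x * sin (phase k x) \<partial>torus)"
 have ck: "coef f k = a + b"
  using coef_abs_l2[OF u, of k] ic isn by (simp add: casf_def distrib_left a_def b_def)
 have cmk: "coef f (- k) = a - b"
  using coef_abs_l2[OF u, of "- k"] ic isn by (simp add: casf_def right_diff_distrib a_def b_def)
 have "fourier f k = fourier (abs_l2 ?u) k" by simp
 also have "\<dots> = (\<integral>x. of_real (?u x) * cis (- phase k x) \<partial>torus)"
  using u by (subst fourier.abs_eq) (auto simp: l2_rel_def)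
 also have "\<dots> = (\<integral>x. of_real (?u x * cos (phase k x)) - \<i> * of_real (?u x * sin (phase k x)) \<partial>torus)"
  by (intro Bochner_Integration.integral_cong refl) (simp add: complex_eq_iff)
 also have "\<dots> = (\<integral>x. of_real (?u x * cos (phase k x)) \<partial>torus) - (\<integral>x. \<i> * of_real (?u x * sin (phase k x)) \<partial>torus)"
  using ic isn by (intro Bochner_Integration.integral_diff integrable_mult_right integrable_of_real)
 also have "\<dots> = of_real a - \<i> * of_real b"
  by (simp only: integral_mult_right_zero integral_complex_of_real a_def b_def)
 also have "\<dots> = Complex ((coef f k + coef f (- k)) / 2) ((coef f (- k) - coef f k) / 2)"
  unfolding ck cmk by (simp add: complex_eq_iff)
 finally show ?thesis .
qed

lemma coef_fourier: "coef f k = Re (fourier f k) - Im (fourier f k)"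
 by (simp add: fourier_coef field_simps)

lemma fourier_eqI: "(\<And>k. fourier f k = fourier g k) \<Longrightarrow> f = g"
 by (rule coef_eqI) (simp add: coef_fourier)

lemma cmod_fourier_sq: "(cmod (fourier f k))\<^sup>2 = ((coef f k)\<^sup>2 + (coef f (- k))\<^sup>2) / 2"
 by (simp add: fourier_coef cmod_power2) (simp add: power2_eq_square field_simps)

lemma multiplier_eqI:
 assumes "\<And>k. fourier g k = \<sigma> k * fourier f k" shows "multiplier \<sigma> f = g"
 unfolding multiplier_def using assms by (intro the_equality) (auto intro: fourier_eqI)

lemma H_iff: "f \<in> H \<longleftrightarrow> coef f 0 = 0"
 by (simp add: H_def fourier_coef complex_eq_iff zero_prod_def[symmetric])

definition om :: "int \<times> int \<Rightarrow> real" where "om k = 2 * pi * wave_norm k"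

text \<open>The symbol of \<open>Lam s\<close>, including its value at the origin. In particular
  \<open>lam 0\<close> is the indicator of \<open>k \<noteq> 0\<close>, and \<open>Lam 0\<close> is
  the projection onto \<open>H\<close> rather than the identity.\<close>

definition lam :: "real \<Rightarrow> int \<times> int \<Rightarrow> real" where
 "lam s k = (if k = 0 then 0 else om k powr s)"

lemma wave_norm_uminus [simp]: "wave_norm (- k) = wave_norm k"
 by (simp add: wave_norm_def)

lemma wave_norm_complex: "wave_norm k = cmod (Complex (of_int (fst k)) (of_int (snd k)))"
 by (simp add: wave_norm_def cmod_def)

lemma wave_norm_triangle: "wave_norm (k + l) \<le> wave_norm k + wave_norm l"
 using norm_triangle_ineq[of "Complex (of_int (fst k)) (of_int (snd k))" "Complex (of_int (fst l)) (of_int (snd l))"]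
 by (simp add: wave_norm_complex complex_add)

lemma wave_norm_nonneg [simp]: "0 \<le> wave_norm k" by (simp add: wave_norm_def)

lemma wave_norm_0_iff [simp]: "wave_norm k = 0 \<longleftrightarrow> k = 0"
 unfolding wave_norm_complex by (cases k) (auto simp: complex_eq_iff zero_prod_def)

lemma wave_norm_zero [simp]: "wave_norm 0 = 0" by simp

lemma wave_norm_ge_1: "k \<noteq> 0 \<Longrightarrow> 1 \<le> wave_norm k"
proof -
 assume "k \<noteq> 0"
 then have "1 \<le> (fst k)\<^sup>2 + (snd k)\<^sup>2"
  by (cases k) (auto simp: zero_prod_def int_one_le_iff_zero_less sum_power2_gt_zero_iff)
 then have "1 \<le> (of_int (fst k))\<^sup>2 + (of_int (snd k) :: real)\<^sup>2"
  by (metis of_int_1_le_iff of_int_add of_int_power)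
 then show ?thesis by (simp add: wave_norm_def)
qed

lemma abs_le_wave_norm: "\<bar>of_int (fst k)\<bar> \<le> wave_norm k" "\<bar>of_int (snd k)\<bar> \<le> wave_norm k"
 using abs_Re_le_cmod[of "Complex (of_int (fst k)) (of_int (snd k))"]
  abs_Im_le_cmod[of "Complex (of_int (fst k)) (of_int (snd k))"] by (simp_all add: wave_norm_complex)

lemma om_uminus [simp]: "om (- k) = om k" by (simp add: om_def)

lemma om_nonneg [simp]: "0 \<le> om k" by (simp add: om_def)

lemma om_0_iff [simp]: "om k = 0 \<longleftrightarrow> k = 0" by (simp add: om_def)

lemma om_pos: "k \<noteq> 0 \<Longrightarrow> 0 < om k"
 using om_nonneg[of k] om_0_iff[of k] by linarith

lemma om_ge_1: "k \<noteq> 0 \<Longrightarrow> 1 \<le> om k"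
 using wave_norm_ge_1[of k] pi_ge_two mult_mono[of 1 "2 * pi" 1 "wave_norm k"] by (simp add: om_def)

lemma om_triangle: "om (k + l) \<le> om k + om l"
 using mult_left_mono[OF wave_norm_triangle[of k l], of "2 * pi"] by (simp add: om_def distrib_left)

text \<open>The symbol of \<Lambda> is Lipschitz in the wave number. This is what makes its
  commutator with multiplication by a mode an operator of order zero.\<close>

lemma om_diff_le: "\<bar>om k - om l\<bar> \<le> om (k - l)"
 using om_triangle[of "k - l" l] om_triangle[of "l - k" k] om_uminus[of "k - l"] by simp

lemma lam_uminus [simp]: "lam s (- k) = lam s k" by (simp add: lam_def)

lemma lam_0 [simp]: "lam s 0 = 0" by (simp add: lam_def)

lemma lam_nonneg [simp]: "0 \<le> lam s k" by (simp add: lam_def)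

lemma lam_pos: "k \<noteq> 0 \<Longrightarrow> 0 < lam s k"
 using om_pos[of k] by (simp add: lam_def)

lemma lam_mult: "lam s k * lam t k = lam (s + t) k"
 by (simp add: lam_def powr_add)

lemma lam_1 [simp]: "lam 1 k = om k"
 using om_nonneg[of k] by (simp add: lam_def)

lemma lam_mono: "s \<le> t \<Longrightarrow> lam s k \<le> lam t k"
 using om_ge_1[of k] by (simp add: lam_def powr_mono)

lemma lam_zero_exponent: "k \<noteq> 0 \<Longrightarrow> lam 0 k = 1"
 using om_pos[of k] by (simp add: lam_def)

lemma lam_le_1: "s \<le> 0 \<Longrightarrow> lam s k \<le> 1"
 using lam_mono[of s 0 k] lam_zero_exponent[of k] by (cases "k = 0") auto

lemma lam_sq: "(lam s k)\<^sup>2 = lam (2 * s) k"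
 by (simp add: power2_eq_square lam_mult)

text \<open>Since \<open>multiplier\<close> is a definite description, \<open>Lam s f\<close> is
  known only when some element of \<open>l2\<close> has the required coefficients. This set is the
  natural domain; it does not ask for mean zero, as the symbol kills the constant mode.\<close>

definition Lam_dom :: "real \<Rightarrow> l2 set" where
 "Lam_dom s = {f. (\<lambda>k. (lam s k * coef f k)\<^sup>2) summable_on UNIV}"

lemma Lam_eqI:
 assumes "\<And>k. coef g k = lam s k * coef f k" shows "Lam s f = g"
 unfolding Lam_def
proof (rule multiplier_eqI)
 fix k :: "int \<times> int"
 have "(if k = (0, 0) then 0 else complex_of_real ((2 * pi * wave_norm k) powr s)) = of_real (lam s k)"
  by (simp add: lam_def om_def zero_prod_def)
 then show "fourier g k = (if k = (0, 0) then 0 else complex_of_real ((2 * pi * wave_norm k) powr s)) * fourier f k"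
  by (simp add: fourier_coef assms complex_eq_iff) (simp add: field_simps)
qed

lemma coef_Lam:
 assumes "f \<in> Lam_dom s" shows "coef (Lam s f) k = lam s k * coef f k"
proof -
 obtain g where g: "\<And>k. coef g k = lam s k * coef f k"
  using riesz_fischer[of "\<lambda>k. lam s k * coef f k"] assms unfolding Lam_dom_def by auto
 then have "Lam s f = g" by (rule Lam_eqI)
 with g show ?thesis by simp
qed

text \<open>Differentiating cosine plus sine gives cosine minus sine. In Hartley coordinates a
  derivative is thus a real factor combined with the reflection from \<open>k\<close> to
  \<open>- k\<close>, in place of multiplication by an imaginary number.\<close>

lemma partial1_eqI:
 assumes "\<And>k. coef g k = - (2 * pi * of_int (fst k)) * coef f (- k)" shows "partial1 f = g"
 unfolding partial1_def
 by (rule multiplier_eqI) (simp add: fourier_coef assms complex_eq_iff, simp add: field_simps)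

lemma partial2_eqI:
 assumes "\<And>k. coef g k = - (2 * pi * of_int (snd k)) * coef f (- k)" shows "partial2 f = g"
 unfolding partial2_def
 by (rule multiplier_eqI) (simp add: fourier_coef assms complex_eq_iff, simp add: field_simps)

lemma summable_on_sq_bound:
 fixes a b :: "'k \<Rightarrow> real"
 assumes "(\<lambda>k. (b k)\<^sup>2) summable_on A" "\<And>k. k \<in> A \<Longrightarrow> \<bar>a k\<bar> \<le> C * \<bar>b k\<bar>"
 shows "(\<lambda>k. (a k)\<^sup>2) summable_on A"
proof (rule summable_on_comparison_test)
 show "(\<lambda>k. C\<^sup>2 * (b k)\<^sup>2) summable_on A" using assms(1) by (rule summable_on_cmult_right)
 fix k assume "k \<in> A"
 then have "\<bar>a k\<bar>\<^sup>2 \<le> (C * \<bar>b k\<bar>)\<^sup>2" using assms(2) by (intro power_mono) auto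
 then show "(a k)\<^sup>2 \<le> C\<^sup>2 * (b k)\<^sup>2" by (simp add: power_mult_distrib)
qed simp

lemma Lam_dom_mono: "s \<le> t \<Longrightarrow> f \<in> Lam_dom t \<Longrightarrow> f \<in> Lam_dom s"
 unfolding Lam_dom_def
 by (auto intro!: summable_on_sq_bound[where C=1 and b="\<lambda>k. lam t k * coef f k"] mult_right_mono simp: abs_mult lam_mono)

lemma Lam_dom_nonpos: "s \<le> 0 \<Longrightarrow> f \<in> Lam_dom s"
 unfolding Lam_dom_def
 by (auto intro!: summable_on_sq_bound[where C=1 and b="coef f"] summable_coef_sq simp: abs_mult mult_left_le_one_le lam_le_1)

lemma Lam_dom_add: "f \<in> Lam_dom s \<Longrightarrow> g \<in> Lam_dom s \<Longrightarrow> f + g \<in> Lam_dom s"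
proof -
 assume f: "f \<in> Lam_dom s" and g: "g \<in> Lam_dom s"
 have "(\<lambda>k. (lam s k * coef (f + g) k)\<^sup>2) = (\<lambda>k. (coef (Lam s f + Lam s g) k)\<^sup>2)"
  by (simp add: coef_add coef_Lam f g distrib_left)
 then show ?thesis unfolding Lam_dom_def using summable_coef_sq by auto
qed

lemma Lam_dom_scaleR: "f \<in> Lam_dom s \<Longrightarrow> c *\<^sub>R f \<in> Lam_dom s"
proof -
 assume f: "f \<in> Lam_dom s"
 have "(\<lambda>k. (lam s k * coef (c *\<^sub>R f) k)\<^sup>2) = (\<lambda>k. (coef (c *\<^sub>R Lam s f) k)\<^sup>2)"
  by (simp add: coef_scaleR coef_Lam f mult_ac)
 then show ?thesis unfolding Lam_dom_def using summable_coef_sq by auto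
qed

lemma Lam_dom_zero [simp]: "0 \<in> Lam_dom s"
 by (simp add: Lam_dom_def coef_zero)

lemma Lam_dom_diff: "f \<in> Lam_dom s \<Longrightarrow> g \<in> Lam_dom s \<Longrightarrow> f - g \<in> Lam_dom s"
 using Lam_dom_add[of f s "(-1) *\<^sub>R g"] Lam_dom_scaleR[of g s "-1"] by simp

lemma Lam_dom_minus: "f \<in> Lam_dom s \<Longrightarrow> - f \<in> Lam_dom s"
 using Lam_dom_scaleR[of f s "-1"] by simp

lemma Lam_add: "f \<in> Lam_dom s \<Longrightarrow> g \<in> Lam_dom s \<Longrightarrow> Lam s (f + g) = Lam s f + Lam s g"
 by (rule coef_eqI) (simp add: coef_Lam coef_add Lam_dom_add distrib_left)

lemma Lam_scaleR: "f \<in> Lam_dom s \<Longrightarrow> Lam s (c *\<^sub>R f) = c *\<^sub>R Lam s f"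
 by (rule coef_eqI) (simp add: coef_Lam coef_scaleR Lam_dom_scaleR)

lemma Lam_minus: "f \<in> Lam_dom s \<Longrightarrow> Lam s (- f) = - Lam s f"
 using Lam_scaleR[of f s "-1"] by simp

lemma Lam_diff: "f \<in> Lam_dom s \<Longrightarrow> g \<in> Lam_dom s \<Longrightarrow> Lam s (f - g) = Lam s f - Lam s g"
 by (rule coef_eqI) (simp add: coef_Lam coef_diff Lam_dom_diff right_diff_distrib)

lemma coef_Lam_dom_cas: "cas k \<in> Lam_dom s"
proof -
 have "(\<lambda>l. (lam s l * coef (cas k) l)\<^sup>2) = (\<lambda>l. (coef (lam s k *\<^sub>R cas k) l)\<^sup>2)"
  by (auto simp: coef_cas coef_scaleR)
 then show ?thesis unfolding Lam_dom_def using summable_coef_sq by auto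
qed

lemma Lam_cas: "Lam s (cas k) = lam s k *\<^sub>R cas k"
 by (rule Lam_eqI) (simp add: coef_scaleR coef_cas)

lemma inner_Lam_Lam:
 assumes "f \<in> Lam_dom s" "g \<in> Lam_dom t" "g \<in> Lam_dom (s + t)"
 shows "Lam s f \<bullet> Lam t g = f \<bullet> Lam (s + t) g"
proof (rule has_sum_unique)
 show "((\<lambda>k. coef (Lam s f) k * coef (Lam t g) k) has_sum (Lam s f \<bullet> Lam t g)) UNIV" by (rule parseval)
 have "coef (Lam s f) k * coef (Lam t g) k = coef f k * coef (Lam (s + t) g) k" for k
  using assms by (simp add: coef_Lam lam_mult[symmetric])
 then show "((\<lambda>k. coef (Lam s f) k * coef (Lam t g) k) has_sum (f \<bullet> Lam (s + t) g)) UNIV"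
  using parseval[of f "Lam (s + t) g"] by simp
qed

lemma has_sum_reflect:
 fixes h :: "int \<times> int \<Rightarrow> 'a :: {comm_monoid_add, topological_space}"
 shows "((\<lambda>k. h (- k)) has_sum S) UNIV \<longleftrightarrow> (h has_sum S) UNIV"
proof -
 have "bij (uminus :: int \<times> int \<Rightarrow> int \<times> int)" by (rule bij_uminus)
 from has_sum_reindex_bij_betw[OF this, of h] show ?thesis by simp
qed

lemma has_sum_minus_origin:
 fixes h :: "int \<times> int \<Rightarrow> real"
 assumes "h 0 = 0" shows "(h has_sum S) (- {(0, 0)}) \<longleftrightarrow> (h has_sum S) UNIV"
 using assms by (intro has_sum_cong_neutral) (auto simp: zero_prod_def)

text \<open>The squared modulus of a Fourier coefficient is the mean of the squared Hartley
  coefficients at \<open>k\<close> and \<open>- k\<close>, and the Sobolev weight is even; so the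
  two weighted sums converge together.\<close>

lemma sobolev_finite_fourier_iff: "sobolev_finite r (fourier f) \<longleftrightarrow> f \<in> Lam_dom r"
proof -
 let ?w = "\<lambda>k. (lam r k * coef f k)\<^sup>2"
 have w: "(2 * pi * wave_norm k) powr (2 * r) * (cmod (fourier f k))\<^sup>2 = (?w k + ?w (- k)) / 2" if "k \<noteq> 0" for k
  using that by (simp add: cmod_fourier_sq power_mult_distrib lam_sq) (simp add: lam_def om_def distrib_left)
 have "sobolev_finite r (fourier f) \<longleftrightarrow> (\<lambda>k. (?w k + ?w (- k)) / 2) summable_on (- {(0, 0)})"
  unfolding sobolev_finite_def using w by (intro summable_on_cong) (auto simp: zero_prod_def)
 also have "\<dots> \<longleftrightarrow> (\<lambda>k. (?w k + ?w (- k)) / 2) summable_on UNIV"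
  unfolding summable_on_def by (subst has_sum_minus_origin) auto
 also have "\<dots> \<longleftrightarrow> ?w summable_on UNIV"
 proof
  assume "(\<lambda>k. (?w k + ?w (- k)) / 2) summable_on UNIV"
  then have "(\<lambda>k. 2 * ((?w k + ?w (- k)) / 2)) summable_on UNIV" by (rule summable_on_cmult_right)
  then show "?w summable_on UNIV" by (rule summable_on_comparison_test) auto
 next
  assume s: "?w summable_on UNIV"
  then have "(\<lambda>k. ?w (- k)) summable_on UNIV" unfolding summable_on_def by (subst has_sum_reflect)
  with s have "(\<lambda>k. ?w k + ?w (- k)) summable_on UNIV" by (rule summable_on_add)
  then have "(\<lambda>k. (1/2) * (?w k + ?w (- k))) summable_on UNIV" by (rule summable_on_cmult_right)
  then show "(\<lambda>k. (?w k + ?w (- k)) / 2) summable_on UNIV" by simp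
 qed
 finally show ?thesis by (simp add: Lam_dom_def)
qed

lemma Hs_iff: "f \<in> Hs r \<longleftrightarrow> f \<in> H \<and> f \<in> Lam_dom r"
 by (simp add: Hs_def sobolev_finite_fourier_iff)

lemma Hs_norm_eq:
 assumes "f \<in> Lam_dom r" shows "Hs_norm r f = norm (Lam r f)"
proof -
 let ?w = "\<lambda>k. (lam r k * coef f k)\<^sup>2"
 have w: "(2 * pi * wave_norm k) powr (2 * r) * (cmod (fourier f k))\<^sup>2 = (?w k + ?w (- k)) / 2" if "k \<noteq> 0" for k
  using that by (simp add: cmod_fourier_sq power_mult_distrib lam_sq) (simp add: lam_def om_def distrib_left)
 have s: "(?w has_sum (norm (Lam r f))\<^sup>2) UNIV"
  using parseval_norm[of "Lam r f"] by (simp add: coef_Lam[OF assms])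
 then have "((\<lambda>k. ?w (- k)) has_sum (norm (Lam r f))\<^sup>2) UNIV" by (subst has_sum_reflect)
 with s have "((\<lambda>k. ?w k + ?w (- k)) has_sum ((norm (Lam r f))\<^sup>2 + (norm (Lam r f))\<^sup>2)) UNIV" by (rule has_sum_add)
 then have "((\<lambda>k. (?w k + ?w (- k)) / 2) has_sum (((norm (Lam r f))\<^sup>2 + (norm (Lam r f))\<^sup>2) / 2)) UNIV"
  using has_sum_cmult_right[of _ _ _ "1/2"] by fastforce
 then have "((\<lambda>k. (?w k + ?w (- k)) / 2) has_sum (norm (Lam r f))\<^sup>2) (- {(0, 0)})"
  by (subst has_sum_minus_origin) auto
 then have "((\<lambda>k. (2 * pi * wave_norm k) powr (2 * r) * (cmod (fourier f k))\<^sup>2) has_sum (norm (Lam r f))\<^sup>2) (- {(0, 0)})"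
  by (rule has_sum_cong[THEN iffD1, rotated]) (auto simp: w zero_prod_def)
 then show ?thesis by (simp add: Hs_norm_def sobolev_norm_def infsumI)
qed

lemma Hinf_iff: "f \<in> Hinf \<longleftrightarrow> f \<in> H \<and> (\<forall>r. f \<in> Lam_dom r)"
proof
 assume f: "f \<in> Hinf"
 have "f \<in> Lam_dom r" for r
 proof -
  have "f \<in> Hs (max r 1)" using f by (simp add: Hinf_def)
  then show ?thesis using Lam_dom_mono[of r "max r 1" f] by (simp add: Hs_iff)
 qed
 moreover have "f \<in> H" using f by (auto simp: Hinf_def Hs_iff dest: bspec[of _ _ 1])
 ultimately show "f \<in> H \<and> (\<forall>r. f \<in> Lam_dom r)" by blast
qed (simp add: Hinf_def Hs_iff)

lemma cas_H: "k \<noteq> 0 \<Longrightarrow> cas k \<in> H"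
 by (simp add: H_iff coef_cas)

lemma cas_Hinf: "k \<noteq> 0 \<Longrightarrow> cas k \<in> Hinf"
 by (simp add: Hinf_iff cas_H coef_Lam_dom_cas)

lemma H_add: "f \<in> H \<Longrightarrow> g \<in> H \<Longrightarrow> f + g \<in> H"
 and H_minus: "f \<in> H \<Longrightarrow> - f \<in> H"
 and H_scaleR: "f \<in> H \<Longrightarrow> c *\<^sub>R f \<in> H"
 and H_zero: "0 \<in> H"
 by (simp_all add: H_iff coef_simps)

lemma Lam_H: "f \<in> Lam_dom s \<Longrightarrow> Lam s f \<in> H"
 by (simp add: H_iff coef_Lam)

lemma Hinf_add: "f \<in> Hinf \<Longrightarrow> g \<in> Hinf \<Longrightarrow> f + g \<in> Hinf"
 and Hinf_scaleR: "f \<in> Hinf \<Longrightarrow> c *\<^sub>R f \<in> Hinf"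
 and Hinf_zero: "0 \<in> Hinf"
 by (simp_all add: Hinf_iff H_add H_scaleR H_zero Lam_dom_add Lam_dom_scaleR)

lemma cos_mode_eq: "cos_mode k = (1/2) *\<^sub>R (cas k + cas (- k))"
proof -
 have "sq_integrable (\<lambda>x. cos (phase k x))" by (auto intro!: sq_integrable_bounded[where C=1])
 moreover have "(1/2) *\<^sub>R (cas k + cas (- k)) = abs_l2 (\<lambda>x. 1/2 * (casf k x + casf (- k) x))"
  unfolding cas_def plus_abs_l2[OF sq_integrable_casf sq_integrable_casf]
  by (rule scaleR_abs_l2) (intro sq_integrable_add sq_integrable_casf)
 moreover have "(\<lambda>x. 1/2 * (casf k x + casf (- k) x)) = (\<lambda>x. cos (phase k x))" by (auto simp: casf_def)
 ultimately show ?thesis by (simp add: cos_mode_def to_l2_def)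
qed

lemma sin_mode_eq: "sin_mode k = (1/2) *\<^sub>R (cas k - cas (- k))"
proof -
 have "sq_integrable (\<lambda>x. sin (phase k x))" by (auto intro!: sq_integrable_bounded[where C=1])
 moreover have "(1/2) *\<^sub>R (cas k - cas (- k)) = abs_l2 (\<lambda>x. 1/2 * (casf k x - casf (- k) x))"
  unfolding cas_def diff_abs_l2[OF sq_integrable_casf sq_integrable_casf]
  by (rule scaleR_abs_l2) (intro sq_integrable_diff sq_integrable_casf)
 moreover have "(\<lambda>x. 1/2 * (casf k x - casf (- k) x)) = (\<lambda>x. sin (phase k x))" by (auto simp: casf_def)
 ultimately show ?thesis by (simp add: sin_mode_def to_l2_def)
qed

lemma cas_eq_modes: "cas k = cos_mode k + sin_mode k"
 unfolding cos_mode_eq sin_mode_eq by (simp add: scaleR_add_right scaleR_diff_right flip: scaleR_add_left)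

section \<open>Galerkin spaces in Hartley coordinates\<close>

definition modes :: "nat \<Rightarrow> (int \<times> int) set" where
 "modes m = {k. 0 < wave_norm k \<and> wave_norm k \<le> real m}"

lemma modes_subset: "modes m \<subseteq> {- int m..int m} \<times> {- int m..int m}"
proof
 fix k assume "k \<in> modes m"
 then have "\<bar>real_of_int (fst k)\<bar> \<le> real m" "\<bar>real_of_int (snd k)\<bar> \<le> real m"
  using abs_le_wave_norm[of k] by (auto simp: modes_def)
 then have "\<bar>fst k\<bar> \<le> int m" "\<bar>snd k\<bar> \<le> int m" by linarith+
 then show "k \<in> {- int m..int m} \<times> {- int m..int m}" by (cases k) auto
qed

lemma finite_modes [simp]: "finite (modes m)"
 by (rule finite_subset[OF modes_subset]) auto

lemma card_modes_le: "card (modes m) \<le> (2 * m + 1)\<^sup>2"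
proof -
 have "card (modes m) \<le> card ({- int m..int m} \<times> {- int m..int m})"
  by (rule card_mono[OF _ modes_subset]) auto
 also have "\<dots> = (2 * m + 1)\<^sup>2"
  unfolding card_cartesian_product by (simp add: power2_eq_square) (simp add: nat_add_distrib nat_mult_distrib algebra_simps)?
 finally show ?thesis .
qed

lemma uminus_modes [simp]: "- k \<in> modes m \<longleftrightarrow> k \<in> modes m"
 by (simp add: modes_def)

lemma modes_nonzero: "k \<in> modes m \<Longrightarrow> k \<noteq> 0"
 by (auto simp: modes_def)

text \<open>The truncation is symmetric under \<open>k\<close> to \<open>- k\<close>, so cosine-sine
  pairs and pairs of opposite Hartley modes span the same space.\<close>

lemma Hm_eq_span: "Hm m = span (cas ` modes m)"
proof (rule antisym)
 show "Hm m \<subseteq> span (cas ` modes m)"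
  unfolding Hm_def
 proof (rule span_minimal)
  show "(\<Union>k\<in>{k. 0 < wave_norm k \<and> wave_norm k \<le> real m}. {cos_mode k, sin_mode k}) \<subseteq> span (cas ` modes m)"
  proof
   fix x assume "x \<in> (\<Union>k\<in>{k. 0 < wave_norm k \<and> wave_norm k \<le> real m}. {cos_mode k, sin_mode k})"
   then obtain k where k: "k \<in> modes m" "x = cos_mode k \<or> x = sin_mode k" by (auto simp: modes_def)
   then have "cas k \<in> span (cas ` modes m)" "cas (- k) \<in> span (cas ` modes m)"
    by (auto intro!: span_base)
   then show "x \<in> span (cas ` modes m)"
    using k(2) unfolding cos_mode_eq sin_mode_eq by (auto intro: span_scale span_add span_diff)
  qed
 qed (rule subspace_span)
 show "span (cas ` modes m) \<subseteq> Hm m"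
 proof (rule span_minimal)
  show "cas ` modes m \<subseteq> Hm m"
  proof
   fix x assume "x \<in> cas ` modes m"
   then obtain k where k: "k \<in> modes m" "x = cas k" by auto
   then have "cos_mode k \<in> Hm m" "sin_mode k \<in> Hm m"
    unfolding Hm_def modes_def by (auto intro!: span_base)
   then show "x \<in> Hm m" unfolding k(2) cas_eq_modes Hm_def by (rule span_add)
  qed
 qed (simp add: Hm_def)
qed

lemma Hm_coef_0:
 assumes "x \<in> Hm m" "k \<notin> modes m" shows "coef x k = 0"
proof -
 have "span (cas ` modes m) \<subseteq> {x. coef x k = 0}"
  using assms(2) by (intro span_minimal) (auto simp: subspace_def coef_simps coef_cas)
 then show ?thesis using assms(1) by (auto simp: Hm_eq_span)
qed

lemma Hm_expand: "x \<in> Hm m \<Longrightarrow> x = (\<Sum>k\<in>modes m. coef x k *\<^sub>R cas k)"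
 by (rule coef_eqI)
   (auto simp: coef_simps coef_cas if_distrib[where f="\<lambda>t. _ * t"] Hm_coef_0 cong: if_cong)

lemma sum_cas_Hm: "(\<Sum>k\<in>modes m. c k *\<^sub>R cas k) \<in> Hm m"
 unfolding Hm_eq_span by (intro span_sum span_scale span_base) auto

lemma cas_Hm: "k \<in> modes m \<Longrightarrow> cas k \<in> Hm m"
 unfolding Hm_eq_span by (intro span_base) auto

lemma Hm_H: "x \<in> Hm m \<Longrightarrow> x \<in> H"
 using Hm_coef_0[of x m 0] modes_nonzero[of 0 m] by (auto simp: H_iff)

lemma Pm_eq: "Pm m f = (\<Sum>k\<in>modes m. coef f k *\<^sub>R cas k)"
 unfolding Pm_def
proof (rule the_equality)
 let ?g = "\<Sum>k\<in>modes m. coef f k *\<^sub>R cas k"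
 have cg: "coef ?g k = (if k \<in> modes m then coef f k else 0)" for k
  by (auto simp: coef_simps coef_cas if_distrib[where f="\<lambda>t. _ * t"] cong: if_cong)
 have "(f - ?g) \<bullet> h = 0" if "h \<in> Hm m" for h
 proof -
  have "(f - ?g) \<bullet> h = (\<Sum>k\<in>modes m. coef h k * ((f - ?g) \<bullet> cas k))"
   by (subst Hm_expand[OF that]) (simp add: inner_sum_right)
  also have "\<dots> = 0" by (intro sum.neutral) (auto simp: coef_def[symmetric] coef_diff cg)
  finally show ?thesis .
 qed
 then show "?g \<in> Hm m \<and> (\<forall>h\<in>Hm m. (f - ?g) \<bullet> h = 0)" using sum_cas_Hm by blast
 fix g assume g: "g \<in> Hm m \<and> (\<forall>h\<in>Hm m. (f - g) \<bullet> h = 0)"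
 show "g = ?g"
 proof (rule coef_eqI)
  fix k show "coef g k = coef ?g k"
  proof (cases "k \<in> modes m")
   case True
   then have "(f - g) \<bullet> cas k = 0" using g cas_Hm by blast
   then show ?thesis unfolding cg using True by (simp add: coef_def inner_diff_left)
  next
   case False
   then show ?thesis unfolding cg using g Hm_coef_0[OF _ False, of g] by simp
  qed
 qed
qed

lemma Pm_cas: "k \<in> modes m \<Longrightarrow> Pm m (cas k) = cas k"
 using Hm_expand[OF cas_Hm] by (simp add: Pm_eq)

section \<open>The nonlinearity\<close>

lemma om_zero [simp]: "om 0 = 0" by simp

text \<open>With one bounded factor the default value of \<open>l2_mult\<close> is never reached.
  The representative chosen by \<open>rep_l2\<close> need not be bounded itself; it agrees with
  \<open>u\<close> only almost everywhere, hence the detour through square integrability of the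
  product of representatives.\<close>

lemma l2_mult_bounded:
 assumes u [measurable]: "u \<in> borel_measurable torus" and bd: "\<And>x. \<bar>u x\<bar> \<le> C"
 shows "sq_integrable (\<lambda>x. u x * rep_l2 h x)" "l2_mult (abs_l2 u) h = abs_l2 (\<lambda>x. u x * rep_l2 h x)"
proof -
 have h: "sq_integrable (rep_l2 h)" by (rule sq_integrable_rep_l2)
 then have hm [measurable]: "rep_l2 h \<in> borel_measurable torus" by (simp add: sq_integrable_def)
 have u_sq: "sq_integrable u" using bd by (rule sq_integrable_bounded[OF u])
 have "integrable torus (\<lambda>x. (u x * rep_l2 h x)\<^sup>2)"
 proof (rule Bochner_Integration.integrable_bound)
  show "integrable torus (\<lambda>x. C\<^sup>2 * (rep_l2 h x)\<^sup>2)" using h by (simp add: sq_integrable_def)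
  show "AE x in torus. norm ((u x * rep_l2 h x)\<^sup>2) \<le> norm (C\<^sup>2 * (rep_l2 h x)\<^sup>2)"
  proof (rule AE_I2)
   fix x
   have "\<bar>u x\<bar>\<^sup>2 \<le> C\<^sup>2" using bd by (intro power_mono) auto
   then show "norm ((u x * rep_l2 h x)\<^sup>2) \<le> norm (C\<^sup>2 * (rep_l2 h x)\<^sup>2)"
    by (simp add: power_mult_distrib mult_right_mono)
  qed
 qed simp
 then show uh: "sq_integrable (\<lambda>x. u x * rep_l2 h x)" by (simp add: sq_integrable_def)
 have ae: "AE x in torus. u x * rep_l2 h x = rep_l2 (abs_l2 u) x * rep_l2 h x"
  using rep_abs_l2[OF u_sq] by eventually_elim simp
 have rm [measurable]: "rep_l2 (abs_l2 u) \<in> borel_measurable torus"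
  using sq_integrable_rep_l2 by (simp add: sq_integrable_def)
 have sq: "sq_integrable (\<lambda>x. rep_l2 (abs_l2 u) x * rep_l2 h x)"
  unfolding sq_integrable_def
 proof
  show "integrable torus (\<lambda>x. (rep_l2 (abs_l2 u) x * rep_l2 h x)\<^sup>2)"
  proof (rule integrable_cong_AE_imp)
   show "integrable torus (\<lambda>x. (u x * rep_l2 h x)\<^sup>2)" using uh by (simp add: sq_integrable_def)
   show "AE x in torus. (u x * rep_l2 h x)\<^sup>2 = (rep_l2 (abs_l2 u) x * rep_l2 h x)\<^sup>2"
    using ae by eventually_elim (simp only:)
  qed simp
 qed simp
 then show "l2_mult (abs_l2 u) h = abs_l2 (\<lambda>x. u x * rep_l2 h x)"
  unfolding l2_mult_def to_l2_def using uh ae by (auto intro!: abs_l2_eqI)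
qed

lemma coef_l2_mult_bounded:
 assumes u: "u \<in> borel_measurable torus" "\<And>x. \<bar>u x\<bar> \<le> C"
 shows "coef (l2_mult (abs_l2 u) h) k = abs_l2 u \<bullet> l2_mult (cas k) h"
proof -
 have c: "sq_integrable (\<lambda>x. casf k x * rep_l2 h x)" "l2_mult (cas k) h = abs_l2 (\<lambda>x. casf k x * rep_l2 h x)"
  using l2_mult_bounded[OF borel_measurable_casf abs_casf_le] by (auto simp: cas_def)
 have "coef (l2_mult (abs_l2 u) h) k = (\<integral>x. u x * rep_l2 h x * casf k x \<partial>torus)"
  unfolding l2_mult_bounded(2)[OF u] by (rule coef_abs_l2[OF l2_mult_bounded(1)[OF u]])
 also have "\<dots> = (\<integral>x. u x * (casf k x * rep_l2 h x) \<partial>torus)" by (simp add: mult_ac)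
 also have "\<dots> = abs_l2 u \<bullet> l2_mult (cas k) h"
  unfolding c(2) by (intro inner_abs_l2[symmetric] c(1) sq_integrable_bounded[OF u])
 finally show ?thesis .
qed

text \<open>The \<open>k\<close>-th Hartley coefficient of the product of \<open>cas p\<close> with
  \<open>h\<close>: the four terms are the four wave numbers of \<open>casf_mult\<close>.\<close>

definition shift_coef :: "int \<times> int \<Rightarrow> int \<times> int \<Rightarrow> l2 \<Rightarrow> real" where
 "shift_coef p k h = (coef h (p - k) + coef h (k - p) + coef h (p + k) - coef h (- (p + k))) / 2"

lemma shift_coef_commute: "shift_coef p k h = shift_coef k p h"
 by (simp add: shift_coef_def add.commute)

lemma coef_mult_cas: "coef (l2_mult (cas p) h) k = shift_coef p k h"
proof -
 have h: "sq_integrable (rep_l2 h)" by (rule sq_integrable_rep_l2)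
 note b = l2_mult_bounded[OF borel_measurable_casf abs_casf_le, folded cas_def]
 have ch: "coef h q = (\<integral>x. rep_l2 h x * casf q x \<partial>torus)" for q
  using coef_abs_l2[OF h, of q] by simp
 have i: "integrable torus (\<lambda>x. rep_l2 h x * casf q x)" for q
  by (rule sq_integrable_mult[OF h sq_integrable_casf])
 have "coef (l2_mult (cas p) h) k = (\<integral>x. casf p x * rep_l2 h x * casf k x \<partial>torus)"
  unfolding b(2) by (rule coef_abs_l2[OF b(1)])
 also have "\<dots> = (\<integral>x. (rep_l2 h x * casf (p - k) x + rep_l2 h x * casf (k - p) x + rep_l2 h x * casf (p + k) x
   - rep_l2 h x * casf (- (p + k)) x) / 2 \<partial>torus)"
 proof (intro Bochner_Integration.integral_cong refl)
  fix x
  have "casf p x * rep_l2 h x * casf k x = rep_l2 h x * (casf p x * casf k x)" by simp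
  also have "\<dots> = (rep_l2 h x * casf (p - k) x + rep_l2 h x * casf (k - p) x + rep_l2 h x * casf (p + k) x
   - rep_l2 h x * casf (- (p + k)) x) / 2"
   unfolding casf_mult by (simp add: distrib_left right_diff_distrib)
  finally show "casf p x * rep_l2 h x * casf k x = (rep_l2 h x * casf (p - k) x + rep_l2 h x * casf (k - p) x + rep_l2 h x * casf (p + k) x
   - rep_l2 h x * casf (- (p + k)) x) / 2" .
 qed
 also have "\<dots> = shift_coef p k h"
  unfolding shift_coef_def ch using i by simp
 finally show ?thesis .
qed

text \<open>Functions with absolutely summable coefficients are bounded, hence multiply \<open>L\<^sup>2\<close>.\<close>

lemma abs_summable_bounded_rep:
 assumes e: "bij e" and s: "summable (\<lambda>i. \<bar>coef \<psi> (e i)\<bar>)"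
 shows "\<exists>u C. u \<in> borel_measurable torus \<and> (\<forall>x. \<bar>u x\<bar> \<le> C) \<and> \<psi> = abs_l2 u"
proof -
 define a where "a i = coef \<psi> (e i)" for i
 define u where "u x = (\<Sum>i. a i * casf (e i) x)" for x
 have s2: "summable (\<lambda>i. \<bar>a i\<bar> * 2)" using s unfolding a_def by (rule summable_mult2)
 have b: "\<bar>a i * casf (e i) x\<bar> \<le> \<bar>a i\<bar> * 2" for i x
  unfolding abs_mult by (intro mult_left_mono abs_casf_le) simp
 have sx: "summable (\<lambda>i. \<bar>a i * casf (e i) x\<bar>)" for x
  by (rule summable_comparison_test'[OF s2, of 0]) (use b in simp)
 have um: "u \<in> borel_measurable torus" unfolding u_def by measurable
 define C where "C = (\<Sum>i. \<bar>a i\<bar> * 2)"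
 have uC: "\<bar>u x\<bar> \<le> C" for x
 proof -
  have "\<bar>u x\<bar> \<le> (\<Sum>i. \<bar>a i * casf (e i) x\<bar>)" unfolding u_def by (rule summable_rabs[OF sx])
  also have "\<dots> \<le> C" unfolding C_def by (rule suminf_le[OF b sx s2])
  finally show ?thesis .
 qed
 have usq: "sq_integrable u" by (rule sq_integrable_bounded[OF um uC])
 have "\<psi> = abs_l2 u"
 proof (rule coef_eqI)
  fix k
  obtain i0 where i0: "k = e i0" using e by (metis bij_pointE)
  have "coef (abs_l2 u) k = (\<integral>x. u x * casf k x \<partial>torus)" by (rule coef_abs_l2[OF usq])
  also have "\<dots> = (\<integral>x. (\<Sum>i. a i * casf (e i) x * casf k x) \<partial>torus)"
   unfolding u_def using summable_rabs_cancel[OF sx]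
   by (intro Bochner_Integration.integral_cong refl suminf_mult2) auto
  also have "\<dots> = (\<Sum>i. \<integral>x. a i * casf (e i) x * casf k x \<partial>torus)"
  proof (rule integral_suminf)
   have b2: "\<bar>a i * casf (e i) x * casf k x\<bar> \<le> \<bar>a i\<bar> * 2 * 2" for i x
    unfolding abs_mult[of _ "casf k x"] using b[of i x] abs_casf_le[of k x] by (intro mult_mono) auto
   have s4: "summable (\<lambda>i. \<bar>a i\<bar> * 2 * 2)" using s2 by (rule summable_mult2)
   show int: "integrable torus (\<lambda>x. a i * casf (e i) x * casf k x)" for i
    using sq_integrable_mult[OF sq_integrable_scale[OF sq_integrable_casf] sq_integrable_casf] by simp
   show "AE x in torus. summable (\<lambda>i. norm (a i * casf (e i) x * casf k x))"
    by (intro AE_I2 summable_comparison_test'[OF s4, of 0]) (use b2 in simp)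
   show "summable (\<lambda>i. \<integral>x. norm (a i * casf (e i) x * casf k x) \<partial>torus)"
   proof (rule summable_comparison_test'[OF s4, of 0])
    fix i
    have "(\<integral>x. norm (a i * casf (e i) x * casf k x) \<partial>torus) \<le> (\<integral>x. \<bar>a i\<bar> * 2 * 2 \<partial>torus)"
     using int b2 by (intro integral_mono) auto
    then show "norm (\<integral>x. norm (a i * casf (e i) x * casf k x) \<partial>torus) \<le> \<bar>a i\<bar> * 2 * 2"
     by (simp add: torus.prob_space)
   qed
  qed
  also have "\<dots> = (\<Sum>i. a i * (cas (e i) \<bullet> cas k))"
   unfolding cas_def inner_abs_l2[OF sq_integrable_casf sq_integrable_casf] by (simp add: mult.assoc)
  also have "\<dots> = (\<Sum>i. if i = i0 then a i else 0)"
   using bij_is_inj[OF e] by (intro arg_cong[where f=suminf] ext) (auto simp: inner_cas_cas i0 inj_eq)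
  also have "\<dots> = a i0" by (rule sums_unique[OF sums_single, symmetric])
  finally show "coef \<psi> k = coef (abs_l2 u) k" by (simp add: a_def i0)
 qed
 with um uC show ?thesis by blast
qed

lemma coef_l2_mult_sums:
 assumes e: "bij e" and s: "summable (\<lambda>i. \<bar>coef \<psi> (e i)\<bar>)"
 shows "(\<lambda>i. coef \<psi> (e i) * shift_coef (e i) k h) sums coef (l2_mult \<psi> h) k"
proof -
 obtain u C where u: "u \<in> borel_measurable torus" "\<And>x. \<bar>u x\<bar> \<le> C" "\<psi> = abs_l2 u"
  using abs_summable_bounded_rep[OF assms] by blast
 have "coef (l2_mult \<psi> h) k = \<psi> \<bullet> l2_mult (cas k) h"
  unfolding u(3) by (rule coef_l2_mult_bounded[OF u(1,2)])
 moreover have "(\<lambda>i. coef \<psi> (e i) * coef (l2_mult (cas k) h) (e i)) sums (\<psi> \<bullet> l2_mult (cas k) h)"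
  by (rule parseval_sums[OF e])
 ultimately show ?thesis by (simp add: coef_mult_cas shift_coef_commute)
qed

text \<open>For mean-zero \<open>tet\<close> these are the coefficients of the commutator of
  \<Lambda> with multiplication by \<open>cas p\<close>, applied to \<open>Lam (-1) tet\<close>.
  Each shifted mode \<open>q\<close> carries the difference \<open>om k - om q\<close>, at most
  \<open>om p\<close> in modulus, so no regularity of \<open>tet\<close> is lost.\<close>

definition comm_coef :: "int \<times> int \<Rightarrow> l2 \<Rightarrow> int \<times> int \<Rightarrow> real" where
 "comm_coef p tet k = ((om k - om (p - k)) * (lam (-1) (p - k) * coef tet (p - k))
   + (om k - om (k - p)) * (lam (-1) (k - p) * coef tet (k - p))
   + (om k - om (p + k)) * (lam (-1) (p + k) * coef tet (p + k))
   - (om k - om (- (p + k))) * (lam (-1) (- (p + k)) * coef tet (- (p + k)))) / 2"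

text \<open>Each of the four shifts is a bijection of the lattice and preserves the sum of squares;
  the constant 4 is one factor 2 from Cauchy-Schwarz for four terms and another from four equal
  sums.\<close>

lemma four_shifts_sq:
 fixes b :: "int \<times> int \<Rightarrow> real"
 assumes b: "\<And>k. \<bar>b k\<bar> \<le> K * (\<bar>coef g (p - k)\<bar> + \<bar>coef g (k - p)\<bar> + \<bar>coef g (p + k)\<bar> + \<bar>coef g (- (p + k))\<bar>)"
  and K: "0 \<le> K"
 shows "(\<lambda>k. (b k)\<^sup>2) summable_on UNIV" "(\<Sum>\<^sub>\<infinity>k. (b k)\<^sup>2) \<le> (4 * K * norm g)\<^sup>2"
proof -
 let ?c = "\<lambda>k. (coef g k)\<^sup>2"
 have shift: "((\<lambda>k. ?c (\<sigma> k)) has_sum (norm g)\<^sup>2) UNIV" if "bij \<sigma>" for \<sigma>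
  using has_sum_reindex_bij_betw[OF that, of ?c] parseval_norm[of g] by simp
 have bijs: "bij (\<lambda>k. p - k)" "bij (\<lambda>k. k - p)" "bij (\<lambda>k. p + k)" "bij (\<lambda>k. - (p + k))"
  by (intro o_bij[where g="\<lambda>k. p - k"] o_bij[where g="\<lambda>k. k + p"] o_bij[where g="\<lambda>k. k - p"] o_bij[where g="\<lambda>k. - k - p"]; force)+
 have S: "((\<lambda>k. 4 * K\<^sup>2 * (?c (p - k) + ?c (k - p) + ?c (p + k) + ?c (- (p + k)))) has_sum
   (4 * K\<^sup>2 * ((norm g)\<^sup>2 + (norm g)\<^sup>2 + (norm g)\<^sup>2 + (norm g)\<^sup>2))) UNIV"
  by (intro has_sum_cmult_right has_sum_add shift bijs)
 have four: "(w + x + y + z)\<^sup>2 \<le> 4 * (w\<^sup>2 + x\<^sup>2 + y\<^sup>2 + z\<^sup>2)" for w x y z :: real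
 proof -
  have "4 * (w\<^sup>2 + x\<^sup>2 + y\<^sup>2 + z\<^sup>2) - (w + x + y + z)\<^sup>2
   = (w - x)\<^sup>2 + (w - y)\<^sup>2 + (w - z)\<^sup>2 + (x - y)\<^sup>2 + (x - z)\<^sup>2 + (y - z)\<^sup>2"
   by (simp add: power2_eq_square algebra_simps)
  moreover have "0 \<le> \<dots>" by simp
  ultimately show ?thesis by linarith
 qed
 have le: "(b k)\<^sup>2 \<le> 4 * K\<^sup>2 * (?c (p - k) + ?c (k - p) + ?c (p + k) + ?c (- (p + k)))" for k
 proof -
  have "(b k)\<^sup>2 = \<bar>b k\<bar>\<^sup>2" by simp
  also have "\<dots> \<le> (K * (\<bar>coef g (p - k)\<bar> + \<bar>coef g (k - p)\<bar> + \<bar>coef g (p + k)\<bar> + \<bar>coef g (- (p + k))\<bar>))\<^sup>2"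
   using b[of k] by (intro power_mono) auto
  also have "\<dots> \<le> K\<^sup>2 * (4 * (?c (p - k) + ?c (k - p) + ?c (p + k) + ?c (- (p + k))))"
   unfolding power_mult_distrib
   using four[of "\<bar>coef g (p - k)\<bar>" "\<bar>coef g (k - p)\<bar>" "\<bar>coef g (p + k)\<bar>" "\<bar>coef g (- (p + k))\<bar>"]
   by (intro mult_left_mono) auto
  finally show ?thesis by (simp only: mult_ac)
 qed
 show s: "(\<lambda>k. (b k)\<^sup>2) summable_on UNIV"
  by (rule summable_on_comparison_test[OF has_sum_imp_summable[OF S]]) (use le in auto)
 have "(\<Sum>\<^sub>\<infinity>k. (b k)\<^sup>2) \<le> 4 * K\<^sup>2 * ((norm g)\<^sup>2 + (norm g)\<^sup>2 + (norm g)\<^sup>2 + (norm g)\<^sup>2)"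
  by (rule has_sum_mono[OF has_sum_infsum[OF s] S le])
 then show "(\<Sum>\<^sub>\<infinity>k. (b k)\<^sup>2) \<le> (4 * K * norm g)\<^sup>2" by (simp add: power_mult_distrib)
qed

lemma comm_coef_le:
 "\<bar>comm_coef p tet k\<bar> \<le> om p / 2 * (\<bar>coef tet (p - k)\<bar> + \<bar>coef tet (k - p)\<bar> + \<bar>coef tet (p + k)\<bar> + \<bar>coef tet (- (p + k))\<bar>)"
proof -
 have t: "\<bar>(om k - om q) * (lam (-1) q * c)\<bar> \<le> om p * \<bar>c\<bar>" if "\<bar>om k - om q\<bar> \<le> om p" for q c
 proof -
  have "\<bar>lam (-1) q * c\<bar> \<le> \<bar>c\<bar>"
   unfolding abs_mult by (rule mult_left_le_one_le) (auto simp: lam_le_1)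
  then show ?thesis unfolding abs_mult[of "om k - om q"] using that by (intro mult_mono) auto
 qed
 have d: "\<bar>om k - om (p - k)\<bar> \<le> om p" "\<bar>om k - om (k - p)\<bar> \<le> om p" "\<bar>om k - om (p + k)\<bar> \<le> om p" "\<bar>om k - om (- (p + k))\<bar> \<le> om p"
  using om_diff_le[of k "k - p"] om_diff_le[of k "p + k"] om_uminus[of "k - p"] om_uminus[of "p + k"] by simp_all
 have abs4: "\<bar>(w + x + y - z) / 2\<bar> \<le> (A + B + C + D) / 2" if "\<bar>w\<bar> \<le> A" "\<bar>x\<bar> \<le> B" "\<bar>y\<bar> \<le> C" "\<bar>z\<bar> \<le> D"
  for w x y z A B C D :: real
  using abs_triangle_ineq[of w x] abs_triangle_ineq[of "w + x" y] abs_triangle_ineq4[of "w + x + y" z] that by simp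
 show ?thesis
  unfolding comm_coef_def
  using abs4[OF t[OF d(1)] t[OF d(2)] t[OF d(3)] t[OF d(4)]]
  by (simp only: distrib_left times_divide_eq_left add_divide_distrib)
qed

text \<open>Exists by Riesz-Fischer for every \<open>tet\<close>, without any domain condition. This
  gives a bounded linear operator on all of \<open>l2\<close> to work with, whereas
  \<open>commutator\<close> is built from unbounded multipliers.\<close>

definition comm :: "int \<times> int \<Rightarrow> l2 \<Rightarrow> l2" where
 "comm p tet = (SOME w. \<forall>k. coef w k = comm_coef p tet k)"

lemma coef_comm: "coef (comm p tet) k = comm_coef p tet k"
proof -
 have "\<exists>w. \<forall>k. coef w k = comm_coef p tet k"
  by (rule riesz_fischer, rule four_shifts_sq(1)[OF comm_coef_le]) simp
 then show ?thesis unfolding comm_def by (rule someI2_ex) blast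
qed

lemma norm_comm_le: "norm (comm p tet) \<le> 2 * om p * norm tet"
proof -
 have "(norm (comm p tet))\<^sup>2 = (\<Sum>\<^sub>\<infinity>k. (comm_coef p tet k)\<^sup>2)"
  using parseval_norm[of "comm p tet"] by (simp add: coef_comm infsumI)
 also have "\<dots> \<le> (4 * (om p / 2) * norm tet)\<^sup>2"
  by (rule four_shifts_sq(2)[OF comm_coef_le]) simp
 finally have "norm (comm p tet) \<le> 4 * (om p / 2) * norm tet" by (rule power2_le_imp_le) simp
 then show ?thesis by simp
qed

lemma comm_diff: "comm p (f - g) = comm p f - comm p g"
 by (rule coef_eqI) (simp add: coef_comm coef_diff comm_coef_def field_simps)

lemma comm_coef_eq:
 assumes "tet \<in> H" shows "comm_coef p tet k = om k * shift_coef p k (Lam (-1) tet) - shift_coef p k tet"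
proof -
 have c: "coef (Lam (-1) tet) q = lam (-1) q * coef tet q" for q by (simp add: coef_Lam Lam_dom_nonpos)
 have o: "coef tet q = om q * (lam (-1) q * coef tet q)" for q
  using lam_mult[of 1 q "-1"] lam_zero_exponent[of q] assms by (cases "q = 0") (auto simp: H_iff)
 have "shift_coef p k tet = (om (p - k) * (lam (-1) (p - k) * coef tet (p - k)) + om (k - p) * (lam (-1) (k - p) * coef tet (k - p))
   + om (p + k) * (lam (-1) (p + k) * coef tet (p + k)) - om (- (p + k)) * (lam (-1) (- (p + k)) * coef tet (- (p + k)))) / 2"
  unfolding shift_coef_def by (simp only: o[symmetric])
 then show ?thesis
  unfolding comm_coef_def shift_coef_def[of p k "Lam (-1) tet"] c
  by (simp only: left_diff_distrib distrib_left right_diff_distrib diff_divide_distrib add_divide_distrib times_divide_eq_right)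
qed

text \<open>The first summability makes \<open>\<psi>\<close> a bounded multiplier, the second makes
  the series of mode commutators converge absolutely in norm. Comparing coefficients, its sum
  \<open>G\<close> plus the product of \<open>\<psi>\<close> with \<open>tet\<close> has the
  coefficients required of \<Lambda> applied to the product of \<open>\<psi>\<close> with
  \<open>Lam (-1) tet\<close>, which also shows that this product lies in the domain of
  \<Lambda>.\<close>

lemma commutator_sums:
 assumes e: "bij e" and s: "summable (\<lambda>i. \<bar>coef \<psi> (e i)\<bar>)" "summable (\<lambda>i. \<bar>coef \<psi> (e i)\<bar> * om (e i))"
  and tet: "tet \<in> H"
 shows "(\<lambda>i. coef \<psi> (e i) *\<^sub>R comm (e i) tet) sums commutator \<psi> (Lam (-1) tet)"
proof -
 have "summable (\<lambda>i. \<bar>coef \<psi> (e i)\<bar> * om (e i) * (2 * norm tet))" using s(2) by (rule summable_mult2)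
 then have "summable (\<lambda>i. norm (coef \<psi> (e i) *\<^sub>R comm (e i) tet))"
 proof (rule summable_comparison_test'[where N=0])
  fix i
  have "\<bar>coef \<psi> (e i)\<bar> * norm (comm (e i) tet) \<le> \<bar>coef \<psi> (e i)\<bar> * (2 * om (e i) * norm tet)"
   by (intro mult_left_mono norm_comm_le) simp
  then show "norm (norm (coef \<psi> (e i) *\<^sub>R comm (e i) tet)) \<le> \<bar>coef \<psi> (e i)\<bar> * om (e i) * (2 * norm tet)"
   by (simp add: mult_ac)
 qed
 then have "summable (\<lambda>i. coef \<psi> (e i) *\<^sub>R comm (e i) tet)" by (rule summable_norm_cancel)
 then obtain G where G: "(\<lambda>i. coef \<psi> (e i) *\<^sub>R comm (e i) tet) sums G" by (auto simp: summable_def)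
 have cG: "om k * coef (l2_mult \<psi> (Lam (-1) tet)) k = coef (G + l2_mult \<psi> tet) k" for k
 proof -
  have "(\<lambda>i. (coef \<psi> (e i) *\<^sub>R comm (e i) tet) \<bullet> cas k) sums (G \<bullet> cas k)"
   using bounded_linear.sums[OF bounded_linear_inner_left G] .
  then have "(\<lambda>i. coef \<psi> (e i) * comm_coef (e i) tet k) sums coef G k"
   by (simp add: coef_comm[symmetric] coef_def)
  moreover have "(\<lambda>i. om k * (coef \<psi> (e i) * shift_coef (e i) k (Lam (-1) tet)) - coef \<psi> (e i) * shift_coef (e i) k tet)
    sums (om k * coef (l2_mult \<psi> (Lam (-1) tet)) k - coef (l2_mult \<psi> tet) k)"
   by (intro sums_diff sums_mult coef_l2_mult_sums[OF e s(1)])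
  moreover have "om k * (coef \<psi> (e i) * shift_coef (e i) k (Lam (-1) tet)) - coef \<psi> (e i) * shift_coef (e i) k tet
    = coef \<psi> (e i) * comm_coef (e i) tet k" for i
   by (simp add: comm_coef_eq[OF tet] algebra_simps)
  ultimately have "coef G k = om k * coef (l2_mult \<psi> (Lam (-1) tet)) k - coef (l2_mult \<psi> tet) k"
   using sums_unique2 by simp
  then show ?thesis by (simp add: coef_add)
 qed
 have "Lam 1 (l2_mult \<psi> (Lam (-1) tet)) = G + l2_mult \<psi> tet"
  by (rule Lam_eqI) (simp add: cG)
 moreover have "Lam 1 (Lam (-1) tet) = tet"
 proof (rule Lam_eqI)
  fix k show "coef tet k = lam 1 k * coef (Lam (-1) tet) k"
   using lam_mult[of 1 k "-1"] lam_zero_exponent[of k] tet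
   by (cases "k = 0") (auto simp: H_iff coef_Lam Lam_dom_nonpos)
 qed
 ultimately have "commutator \<psi> (Lam (-1) tet) = G" by (simp add: commutator_def)
 with G show ?thesis by simp
qed

lemma coef_partial:
 assumes "\<phi> \<in> Lam_dom 1"
 shows "coef (partial1 \<phi>) k = - (2 * pi * of_int (fst k)) * coef \<phi> (- k)"
  and "coef (partial2 \<phi>) k = - (2 * pi * of_int (snd k)) * coef \<phi> (- k)"
proof -
 have s: "(\<lambda>k. (om k * coef \<phi> (- k))\<^sup>2) summable_on UNIV"
  using assms has_sum_reflect[of "\<lambda>k. (om k * coef \<phi> k)\<^sup>2"] unfolding Lam_dom_def summable_on_def by simp
 have le: "\<bar>2 * pi * of_int (fst k)\<bar> \<le> om k" "\<bar>2 * pi * of_int (snd k)\<bar> \<le> om k" for k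
  using abs_le_wave_norm[of k] unfolding om_def abs_mult by auto
 have "(\<lambda>k. (- (2 * pi * of_int (fst k)) * coef \<phi> (- k))\<^sup>2) summable_on UNIV"
  by (rule summable_on_sq_bound[OF s, where C=1]) (use le(1) in \<open>auto simp: abs_mult intro!: mult_right_mono\<close>)
 then obtain g where g: "\<And>k. coef g k = - (2 * pi * of_int (fst k)) * coef \<phi> (- k)"
  using riesz_fischer[of "\<lambda>k. - (2 * pi * of_int (fst k)) * coef \<phi> (- k)"] by blast
 show "coef (partial1 \<phi>) k = - (2 * pi * of_int (fst k)) * coef \<phi> (- k)"
  using partial1_eqI[OF g] g by simp
 have "(\<lambda>k. (- (2 * pi * of_int (snd k)) * coef \<phi> (- k))\<^sup>2) summable_on UNIV"
  by (rule summable_on_sq_bound[OF s, where C=1]) (use le(2) in \<open>auto simp: abs_mult intro!: mult_right_mono\<close>)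
 then obtain g where g: "\<And>k. coef g k = - (2 * pi * of_int (snd k)) * coef \<phi> (- k)"
  using riesz_fischer[of "\<lambda>k. - (2 * pi * of_int (snd k)) * coef \<phi> (- k)"] by blast
 show "coef (partial2 \<phi>) k = - (2 * pi * of_int (snd k)) * coef \<phi> (- k)"
  using partial2_eqI[OF g] g by simp
qed

lemma Lam_minus1_dom_1: "Lam (-1) tet \<in> Lam_dom 1"
 unfolding Lam_dom_def
proof (rule CollectI, rule summable_on_sq_bound[OF summable_coef_sq[of tet], where C=1])
 fix k show "\<bar>lam 1 k * coef (Lam (-1) tet) k\<bar> \<le> 1 * \<bar>coef tet k\<bar>"
  using lam_mult[of 1 k "-1"] lam_zero_exponent[of k]
  by (cases "k = 0") (auto simp: coef_Lam Lam_dom_nonpos mult.assoc[symmetric])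
qed

lemma coef_Riesz:
 "coef (Riesz1 tet) k = - (2 * pi * of_int (fst k)) * (lam (-1) k * coef tet (- k))"
 "coef (Riesz2 tet) k = - (2 * pi * of_int (snd k)) * (lam (-1) k * coef tet (- k))"
 unfolding Riesz1_def Riesz2_def coef_partial[OF Lam_minus1_dom_1]
 by (simp_all add: coef_Lam Lam_dom_nonpos)

lemma Riesz_diff: "Riesz1 (f - g) = Riesz1 f - Riesz1 g" "Riesz2 (f - g) = Riesz2 f - Riesz2 g"
 by (rule coef_eqI, simp add: coef_Riesz coef_diff algebra_simps)+

lemma norm_Riesz_le: "norm (Riesz1 tet) \<le> norm tet" "norm (Riesz2 tet) \<le> norm tet"
proof -
 have S: "((\<lambda>k. (coef tet (- k))\<^sup>2) has_sum (norm tet)\<^sup>2) UNIV"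
  using parseval_norm[of tet] by (subst has_sum_reflect)
 have "\<bar>2 * pi * of_int (fst k)\<bar> * lam (-1) k \<le> 1 \<and> \<bar>2 * pi * of_int (snd k)\<bar> * lam (-1) k \<le> 1" for k
 proof -
  have "\<bar>2 * pi * of_int (fst k)\<bar> \<le> om k" "\<bar>2 * pi * of_int (snd k)\<bar> \<le> om k"
   using abs_le_wave_norm[of k] unfolding om_def abs_mult by auto
  then have "\<bar>2 * pi * of_int (fst k)\<bar> * lam (-1) k \<le> om k * lam (-1) k"
    "\<bar>2 * pi * of_int (snd k)\<bar> * lam (-1) k \<le> om k * lam (-1) k"
   by (auto intro: mult_right_mono)
  moreover have "om k * lam (-1) k \<le> 1"
   using lam_mult[of 1 k "-1"] lam_zero_exponent[of k] by (cases "k = 0") auto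
  ultimately show ?thesis by linarith
 qed
 note le = this
 have gen: "norm r \<le> norm tet" if "\<And>k. coef r k = - x k * (lam (-1) k * coef tet (- k))" "\<And>k. \<bar>x k\<bar> * lam (-1) k \<le> 1" for r x
 proof -
  have "(coef r k)\<^sup>2 \<le> (coef tet (- k))\<^sup>2" for k
  proof (rule abs_le_square_iff[THEN iffD1])
   have "\<bar>coef r k\<bar> = (\<bar>x k\<bar> * lam (-1) k) * \<bar>coef tet (- k)\<bar>" by (simp add: that(1) abs_mult)
   also have "\<dots> \<le> \<bar>coef tet (- k)\<bar>" by (rule mult_left_le_one_le) (use that(2) in auto)
   finally show "\<bar>coef r k\<bar> \<le> \<bar>coef tet (- k)\<bar>" .
  qed
  then have "(norm r)\<^sup>2 \<le> (norm tet)\<^sup>2" by (rule has_sum_mono[OF parseval_norm S])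
  then show ?thesis by (rule power2_le_imp_le) simp
 qed
 show "norm (Riesz1 tet) \<le> norm tet" "norm (Riesz2 tet) \<le> norm tet"
  using gen[OF coef_Riesz(1)] gen[OF coef_Riesz(2)] le by auto
qed

text \<open>\<open>nl p \<theta> \<theta>\<close> is the pairing of \<open>R\<^sup>\<bottom>\<theta> \<cdot> \<nabla>\<theta>\<close> with the \<open>p\<close>-th Hartley mode, polarised.\<close>

definition nl :: "int \<times> int \<Rightarrow> l2 \<Rightarrow> l2 \<Rightarrow> real" where
 "nl p tet \<eta> = pi * ((of_int (snd p) *\<^sub>R Riesz1 tet - of_int (fst p) *\<^sub>R Riesz2 tet) \<bullet> comm (- p) \<eta>)"

text \<open>One factor \<open>om p\<close> comes from differentiating the mode, the other from the
  commutator. For a fixed mode the nonlinearity is therefore bounded on the energy space and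
  continuous in its norm.\<close>

lemma abs_nl_le: "\<bar>nl p tet \<eta>\<bar> \<le> 2 * (om p)\<^sup>2 * norm tet * norm \<eta>"
proof -
 let ?r = "of_int (snd p) *\<^sub>R Riesz1 tet - of_int (fst p) *\<^sub>R Riesz2 tet"
 have "norm ?r \<le> norm (of_int (snd p) *\<^sub>R Riesz1 tet) + norm (of_int (fst p) *\<^sub>R Riesz2 tet)"
  by (rule norm_triangle_ineq4)
 also have "\<dots> \<le> wave_norm p * norm tet + wave_norm p * norm tet"
  unfolding norm_scaleR by (intro add_mono mult_mono abs_le_wave_norm norm_Riesz_le) auto
 finally have r: "norm ?r \<le> 2 * wave_norm p * norm tet" by simp
 have "\<bar>?r \<bullet> comm (- p) \<eta>\<bar> \<le> norm ?r * norm (comm (- p) \<eta>)" by (rule Cauchy_Schwarz_ineq2)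
 also have "\<dots> \<le> (2 * wave_norm p * norm tet) * (2 * om p * norm \<eta>)"
  using norm_comm_le[of "- p" \<eta>] by (intro mult_mono r) auto
 finally have "pi * \<bar>?r \<bullet> comm (- p) \<eta>\<bar> \<le> pi * ((2 * wave_norm p * norm tet) * (2 * om p * norm \<eta>))"
  by (intro mult_left_mono) auto
 then show ?thesis by (simp add: nl_def abs_mult om_def power2_eq_square mult_ac)
qed

lemma nl_diff_le:
 "\<bar>nl p tet tet - nl p \<eta> \<eta>\<bar> \<le> 2 * (om p)\<^sup>2 * norm (tet - \<eta>) * (norm tet + norm \<eta>)"
proof -
 have "nl p tet tet - nl p \<eta> \<eta> = nl p (tet - \<eta>) tet + nl p \<eta> (tet - \<eta>)"
  unfolding nl_def Riesz_diff comm_diff by (simp add: inner_simps algebra_simps)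
 also have "\<bar>\<dots>\<bar> \<le> 2 * (om p)\<^sup>2 * norm (tet - \<eta>) * norm tet + 2 * (om p)\<^sup>2 * norm \<eta> * norm (tet - \<eta>)"
  using abs_nl_le[of p "tet - \<eta>" tet] abs_nl_le[of p \<eta> "tet - \<eta>"] by linarith
 finally show ?thesis by (simp add: algebra_simps)
qed

lemma nonlin_sums:
 assumes e: "bij e" and \<phi>: "\<phi> \<in> Lam_dom 1" and s: "summable (\<lambda>i. (om (e i))\<^sup>2 * \<bar>coef \<phi> (e i)\<bar>)"
  and tet: "tet \<in> H"
 shows "(\<lambda>i. coef \<phi> (e i) * nl (e i) tet tet) sums nonlin tet \<phi>"
proof -
 \<comment> \<open>A derivative reflects the wave number; enumerating its coefficients by
   \<open>- e i\<close> lines them up with those of \<open>\<phi>\<close> at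
   \<open>e i\<close>.\<close>
 define e' where "e' i = - e i" for i
 have e': "bij e'" unfolding e'_def
  using bij_comp[OF e bij_uminus] by (simp add: o_def)
 have om1: "om k \<le> (om k)\<^sup>2" for k
  using om_ge_1[of k] by (cases "k = 0") (auto simp: power2_eq_square)
 have s1: "summable (\<lambda>i. om (e i) * \<bar>coef \<phi> (e i)\<bar>)"
  by (rule summable_comparison_test'[OF s, of 0]) (auto simp: abs_mult intro!: mult_right_mono om1)
 have p1: "coef (partial1 \<phi>) (e' i) = (2 * pi * of_int (fst (e i))) * coef \<phi> (e i)"
  and p2: "coef (partial2 \<phi>) (e' i) = (2 * pi * of_int (snd (e i))) * coef \<phi> (e i)" for i
  unfolding coef_partial[OF \<phi>] by (simp_all add: e'_def)
 have le: "\<bar>2 * pi * of_int (fst k)\<bar> \<le> om k" "\<bar>2 * pi * of_int (snd k)\<bar> \<le> om k" for k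
  using abs_le_wave_norm[of k] unfolding om_def abs_mult by auto
 have sp: "summable (\<lambda>i. \<bar>x i * coef \<phi> (e i)\<bar>) \<and> summable (\<lambda>i. \<bar>x i * coef \<phi> (e i)\<bar> * om (e' i))"
  if x: "\<And>i. \<bar>x i\<bar> \<le> om (e i)" for x :: "nat \<Rightarrow> real"
 proof
  show "summable (\<lambda>i. \<bar>x i * coef \<phi> (e i)\<bar>)"
   by (rule summable_comparison_test'[OF s1, of 0]) (auto simp: abs_mult intro!: mult_right_mono x)
  show "summable (\<lambda>i. \<bar>x i * coef \<phi> (e i)\<bar> * om (e' i))"
  proof (rule summable_comparison_test'[OF s, of 0])
   fix i
   have "\<bar>x i\<bar> * (\<bar>coef \<phi> (e i)\<bar> * om (e i)) \<le> om (e i) * (\<bar>coef \<phi> (e i)\<bar> * om (e i))"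
    by (intro mult_right_mono x) simp
   then show "norm (\<bar>x i * coef \<phi> (e i)\<bar> * om (e' i)) \<le> (om (e i))\<^sup>2 * \<bar>coef \<phi> (e i)\<bar>"
    by (simp add: e'_def abs_mult power2_eq_square mult_ac)
  qed
 qed
 have c1: "(\<lambda>i. coef (partial1 \<phi>) (e' i) *\<^sub>R comm (e' i) tet) sums commutator (partial1 \<phi>) (Lam (-1) tet)"
  using sp[of "\<lambda>i. 2 * pi * of_int (fst (e i))"] le(1) by (intro commutator_sums[OF e' _ _ tet]) (auto simp: p1)
 have c2: "(\<lambda>i. coef (partial2 \<phi>) (e' i) *\<^sub>R comm (e' i) tet) sums commutator (partial2 \<phi>) (Lam (-1) tet)"
  using sp[of "\<lambda>i. 2 * pi * of_int (snd (e i))"] le(2) by (intro commutator_sums[OF e' _ _ tet]) (auto simp: p2)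
 have "(\<lambda>i. - (1/2) * (Riesz2 tet \<bullet> (coef (partial1 \<phi>) (e' i) *\<^sub>R comm (e' i) tet))
    + (1/2) * (Riesz1 tet \<bullet> (coef (partial2 \<phi>) (e' i) *\<^sub>R comm (e' i) tet))) sums nonlin tet \<phi>"
  unfolding nonlin_def
  by (intro sums_add sums_mult bounded_linear.sums[OF bounded_linear_inner_right c1] bounded_linear.sums[OF bounded_linear_inner_right c2])
 moreover have "- (1/2) * (Riesz2 tet \<bullet> (coef (partial1 \<phi>) (e' i) *\<^sub>R comm (e' i) tet))
    + (1/2) * (Riesz1 tet \<bullet> (coef (partial2 \<phi>) (e' i) *\<^sub>R comm (e' i) tet)) = coef \<phi> (e i) * nl (e i) tet tet" for i
  unfolding p1 p2 by (simp add: nl_def e'_def inner_simps algebra_simps)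
 ultimately show ?thesis by simp
qed

lemma nonlin_finite:
 assumes F: "finite F" "\<And>k. k \<notin> F \<Longrightarrow> coef \<phi> k = 0" and tet: "tet \<in> H"
 shows "nonlin tet \<phi> = (\<Sum>k\<in>F. coef \<phi> k * nl k tet tet)"
proof -
 obtain e :: "nat \<Rightarrow> int \<times> int" where e: "bij e" using ex_mode_enumeration by blast
 have fin: "finite (e -` F)" using F(1) e by (meson bij_is_inj finite_vimageI)
 have "(\<lambda>k. (lam 1 k * coef \<phi> k)\<^sup>2) summable_on UNIV"
  using F summable_on_finite[OF F(1)] by (subst summable_on_cong_neutral[where T=F and g="\<lambda>k. (lam 1 k * coef \<phi> k)\<^sup>2"]) auto
 then have d: "\<phi> \<in> Lam_dom 1" by (simp add: Lam_dom_def)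
 have "summable (\<lambda>i. (om (e i))\<^sup>2 * \<bar>coef \<phi> (e i)\<bar>)"
  by (rule summable_finite[OF fin]) (use F in auto)
 from nonlin_sums[OF e d this tet] have A: "(\<lambda>i. coef \<phi> (e i) * nl (e i) tet tet) sums nonlin tet \<phi>" .
 have B: "(\<lambda>i. coef \<phi> (e i) * nl (e i) tet tet) sums (\<Sum>i\<in>e -` F. coef \<phi> (e i) * nl (e i) tet tet)"
  by (rule sums_finite[OF fin]) (use F in auto)
 have "(\<Sum>i\<in>e -` F. coef \<phi> (e i) * nl (e i) tet tet) = (\<Sum>k\<in>F. coef \<phi> k * nl k tet tet)"
 proof -
  have "e ` (e -` F) = F" using e by (simp add: bij_is_surj surj_image_vimage_eq)
  moreover have "inj_on e (e -` F)" using e by (meson bij_is_inj inj_on_subset subset_UNIV)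
  ultimately show ?thesis using sum.reindex[of e "e -` F" "\<lambda>k. coef \<phi> k * nl k tet tet"] by simp
 qed
 then show ?thesis using sums_unique2[OF A B] by simp
qed

lemma nonlin_cas: "tet \<in> H \<Longrightarrow> nonlin tet (cas k) = nl k tet tet"
 using nonlin_finite[of "{k}" "cas k" tet] by (simp add: coef_cas)

lemma inner_finite_coef:
 assumes "finite F" "\<And>k. k \<notin> F \<Longrightarrow> coef f k = 0"
 shows "f \<bullet> g = (\<Sum>k\<in>F. coef f k * coef g k)"
proof (rule has_sum_unique[OF parseval])
 show "((\<lambda>k. coef f k * coef g k) has_sum (\<Sum>k\<in>F. coef f k * coef g k)) UNIV"
  using assms by (intro has_sum_finite_neutralI) auto
qed

section \<open>Conservation of energy by the truncated nonlinearity\<close>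

definition cross :: "int \<times> int \<Rightarrow> int \<times> int \<Rightarrow> real" where
 "cross p k = of_int (snd p) * of_int (fst k) - of_int (fst p) * of_int (snd k)"

text \<open>Twice the integral over the torus of the product of \<open>casf (- p)\<close>,
  \<open>casf (- k)\<close> and \<open>casf q\<close>: the signs record which of the four resonances
  a triple of modes satisfies.\<close>

definition triad :: "int \<times> int \<Rightarrow> int \<times> int \<Rightarrow> int \<times> int \<Rightarrow> real" where
 "triad p k q = of_bool (q = k - p) + of_bool (q = p - k) + of_bool (q = - (p + k)) - of_bool (q = p + k)"

text \<open>On each resonance \<open>q\<close> is \<open>k\<close> or zero times \<open>k\<close>
  plus or minus \<open>p\<close>, so the determinants \<open>cross q k\<close> and
  \<open>cross p k\<close> agree up to sign; exchanging \<open>p\<close> and \<open>q\<close>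
  interchanges two of the resonances, and the signs are such that everything cancels.\<close>

lemma triad_cancel: "cross p k * triad p k q + cross q k * triad q k p = 0"
proof -
 have eqs: "p = k - q \<longleftrightarrow> q = k - p" "p = q - k \<longleftrightarrow> q = p + k" "p = - (q + k) \<longleftrightarrow> q = - (p + k)" "p = q + k \<longleftrightarrow> q = p - k"
  by (auto simp: algebra_simps)
 have "cross (k - p) k = - cross p k" by (simp add: cross_def algebra_simps)
 then have 1: "q = k - p \<Longrightarrow> cross q k = - cross p k" by (simp only:)
 have "cross (p - k) k = cross p k" by (simp add: cross_def algebra_simps)
 then have 2: "q = p - k \<Longrightarrow> cross q k = cross p k" by (simp only:)
 have "cross (- (p + k)) k = - cross p k" by (simp add: cross_def algebra_simps)
 then have 3: "q = - (p + k) \<Longrightarrow> cross q k = - cross p k" by (simp only:)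
 have "cross (p + k) k = cross p k" by (simp add: cross_def algebra_simps)
 then have 4: "q = p + k \<Longrightarrow> cross q k = cross p k" by (simp only:)
 have "cross p k * triad p k q + cross q k * triad q k p =
   (cross p k + cross q k) * of_bool (q = k - p) + (cross p k - cross q k) * of_bool (q = p - k)
   + (cross p k + cross q k) * of_bool (q = - (p + k)) - (cross p k - cross q k) * of_bool (q = p + k)"
  unfolding triad_def eqs by (simp add: algebra_simps)
 also have "\<dots> = 0"
 proof -
  have "(cross p k + cross q k) * of_bool (q = k - p) = 0" using 1 by (cases "q = k - p") auto
  moreover have "(cross p k - cross q k) * of_bool (q = p - k) = 0" using 2 by (cases "q = p - k") auto
  moreover have "(cross p k + cross q k) * of_bool (q = - (p + k)) = 0" using 3 by (cases "q = - (p + k)") auto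
  moreover have "(cross p k - cross q k) * of_bool (q = p + k) = 0" using 4 by (cases "q = p + k") auto
  ultimately show ?thesis by linarith
 qed
 finally show ?thesis .
qed

text \<open>With \<open>y\<close> the coefficients of \<open>Lam (-1) x\<close>, that is, of the
  stream function, the cubic sum splits into a part weighted by \<open>om p * om k\<close> and a
  part weighted by \<open>om p * om q\<close>. The first is antisymmetric in \<open>p\<close> and
  \<open>k\<close> because the determinant is, the second in \<open>p\<close> and \<open>q\<close>
  by \<open>triad_cancel\<close>; the finite symmetric set of modes lets the indices be
  exchanged.\<close>

lemma nl_energy:
 assumes x: "x \<in> Hm m"
 shows "(\<Sum>p\<in>modes m. coef x p * nl p x x) = 0"
proof -
 let ?F = "modes m"
 define y where "y k = lam (-1) k * coef x k" for k
 have y0: "y k = 0" if "k \<notin> ?F" for k using Hm_coef_0[OF x that] by (simp add: y_def)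
 have xy: "coef x p = om p * y p" for p
  using lam_mult[of 1 p "-1"] lam_zero_exponent[of p] Hm_H[OF x] by (cases "p = 0") (auto simp: H_iff y_def)
 have delta: "(om k - om r) * y r = (\<Sum>q\<in>?F. (om k - om q) * of_bool (q = r) * y q)" for k r
  by (cases "r \<in> ?F") (auto simp: y0 of_bool_def if_distrib[where f="\<lambda>t. _ * t * _"] cong: if_cong)
 have comm: "comm_coef (- p) x (- k) = (\<Sum>q\<in>?F. (om k - om q) * triad p k q * y q) / 2" for p k
 proof -
  have "comm_coef (- p) x (- k) = ((om k - om (k - p)) * y (k - p) + (om k - om (p - k)) * y (p - k)
    + (om k - om (- (p + k))) * y (- (p + k)) - (om k - om (p + k)) * y (p + k)) / 2"
   unfolding comm_coef_def y_def by (simp add: algebra_simps)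
  also have "\<dots> = (\<Sum>q\<in>?F. (om k - om q) * triad p k q * y q) / 2"
   unfolding delta triad_def
   by (simp add: sum.distrib[symmetric] sum_subtractf[symmetric] distrib_left distrib_right left_diff_distrib right_diff_distrib)
  finally show ?thesis .
 qed
 have nl: "nl p x x = pi\<^sup>2 * (\<Sum>k\<in>?F. \<Sum>q\<in>?F. cross p k * y k * ((om k - om q) * triad p k q * y q))" for p
 proof -
  let ?r = "of_int (snd p) *\<^sub>R Riesz1 x - of_int (fst p) *\<^sub>R Riesz2 x"
  have r: "coef ?r k = 2 * pi * cross p (- k) * y (- k)" for k
   by (simp add: coef_simps coef_Riesz y_def cross_def algebra_simps)
  have "?r \<bullet> comm (- p) x = (\<Sum>k\<in>?F. coef ?r k * comm_coef (- p) x k)"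
   by (subst inner_finite_coef[where F="?F"]) (auto simp: r y0 coef_comm)
  also have "\<dots> = (\<Sum>k\<in>?F. coef ?r (- k) * comm_coef (- p) x (- k))"
   by (rule sum.reindex_bij_witness[of _ uminus uminus]) auto
  also have "\<dots> = (\<Sum>k\<in>?F. pi * (\<Sum>q\<in>?F. cross p k * y k * ((om k - om q) * triad p k q * y q)))"
   unfolding r comm by (intro sum.cong refl) (simp add: sum_distrib_left mult_ac)
  finally show ?thesis by (simp add: nl_def sum_distrib_left power2_eq_square mult_ac)
 qed
 define A where "A p k q = om p * om k * cross p k * triad p k q * (y p * y k * y q)" for p k q
 define B where "B p k q = om p * om q * cross p k * triad p k q * (y p * y k * y q)" for p k q
 have SA: "(\<Sum>p\<in>?F. \<Sum>k\<in>?F. \<Sum>q\<in>?F. A p k q) = 0"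
 proof -
  have "A k p q = - A p k q" for p k q
  proof -
   have "cross k p = - cross p k" by (simp add: cross_def)
   moreover have "triad k p q = triad p k q" by (simp add: triad_def add.commute)
   ultimately show ?thesis by (simp add: A_def mult_ac)
  qed
  then have "(\<Sum>p\<in>?F. \<Sum>k\<in>?F. \<Sum>q\<in>?F. A k p q) = - (\<Sum>p\<in>?F. \<Sum>k\<in>?F. \<Sum>q\<in>?F. A p k q)"
   unfolding sum_negf[symmetric] by (intro sum.cong refl)
  moreover have "(\<Sum>p\<in>?F. \<Sum>k\<in>?F. \<Sum>q\<in>?F. A k p q) = (\<Sum>p\<in>?F. \<Sum>k\<in>?F. \<Sum>q\<in>?F. A p k q)"
   by (rule sum.swap)
  ultimately show ?thesis by simp
 qed
 have SB: "(\<Sum>p\<in>?F. \<Sum>k\<in>?F. \<Sum>q\<in>?F. B p k q) = 0"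
 proof -
  have "B q k p = - B p k q" for p k q
  proof -
   have "B p k q + B q k p = om p * om q * (y p * y k * y q) * (cross p k * triad p k q + cross q k * triad q k p)"
    by (simp add: B_def algebra_simps)
   then show ?thesis unfolding triad_cancel by simp
  qed
  then have "(\<Sum>p\<in>?F. \<Sum>k\<in>?F. \<Sum>q\<in>?F. B q k p) = - (\<Sum>p\<in>?F. \<Sum>k\<in>?F. \<Sum>q\<in>?F. B p k q)"
   unfolding sum_negf[symmetric] by (intro sum.cong refl)
  moreover have "(\<Sum>p\<in>?F. \<Sum>k\<in>?F. \<Sum>q\<in>?F. B q k p) = (\<Sum>p\<in>?F. \<Sum>k\<in>?F. \<Sum>q\<in>?F. B p k q)"
  proof -
   have "(\<Sum>p\<in>?F. \<Sum>k\<in>?F. \<Sum>q\<in>?F. B q k p) = (\<Sum>p\<in>?F. \<Sum>q\<in>?F. \<Sum>k\<in>?F. B q k p)"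
    by (intro sum.cong refl sum.swap)
   also have "\<dots> = (\<Sum>q\<in>?F. \<Sum>p\<in>?F. \<Sum>k\<in>?F. B q k p)" by (rule sum.swap)
   also have "\<dots> = (\<Sum>q\<in>?F. \<Sum>k\<in>?F. \<Sum>p\<in>?F. B q k p)" by (intro sum.cong refl sum.swap)
   finally show ?thesis .
  qed
  ultimately show ?thesis by simp
 qed
 have "(\<Sum>p\<in>?F. coef x p * nl p x x) = pi\<^sup>2 * (\<Sum>p\<in>?F. \<Sum>k\<in>?F. \<Sum>q\<in>?F. A p k q - B p k q)"
  unfolding nl sum_distrib_left xy
  by (intro sum.cong refl) (simp add: A_def B_def algebra_simps)
 also have "\<dots> = 0" by (simp add: sum_subtractf SA SB)
 finally show ?thesis .
qed

section \<open>Lattice sums and the nonlinearity against smooth test functions\<close>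

lemma summable_on_int_inverse_squares: "(\<lambda>n::int. 1 / (1 + (of_int n)\<^sup>2) :: real) summable_on UNIV"
proof -
 let ?f = "\<lambda>n::int. 1 / (1 + (of_int n)\<^sup>2) :: real"
 have s: "summable (\<lambda>n::nat. 1 / (1 + (real n)\<^sup>2))"
 proof (rule summable_comparison_test'[OF inverse_power_summable[of 2, where 'a=real], of 1])
  fix n :: nat assume "1 \<le> n"
  then have "0 < real n ^ 2" by simp
  then have "inverse (1 + real n ^ 2) \<le> inverse (real n ^ 2)" by (intro le_imp_inverse_le) auto
  then show "norm (1 / (1 + (real n)\<^sup>2)) \<le> inverse (real n ^ 2)" by (simp add: divide_inverse)
 qed simp
 then have "(\<lambda>n::nat. 1 / (1 + (real n)\<^sup>2)) summable_on UNIV"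
  by (subst summable_on_UNIV_nonneg_real_iff) auto
 then have 1: "?f summable_on range int"
  by (subst summable_on_reindex) (auto simp: o_def)
 have "summable (\<lambda>n::nat. 1 / (1 + (real (Suc n))\<^sup>2))" using s by (subst summable_Suc_iff)
 then have "(\<lambda>n::nat. 1 / (1 + (real (Suc n))\<^sup>2)) summable_on UNIV"
  by (subst summable_on_UNIV_nonneg_real_iff) auto
 moreover have "(\<lambda>n::nat. 1 / (1 + (real (Suc n))\<^sup>2)) = ?f \<circ> (\<lambda>n. - int (Suc n))"
  by (auto simp: o_def power2_eq_square algebra_simps)
 ultimately have 2: "?f summable_on range (\<lambda>n. - int (Suc n))"
  by (subst summable_on_reindex) (auto simp: inj_on_def)
 have "range int \<union> range (\<lambda>n. - int (Suc n)) = UNIV"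
 proof -
  have "z \<in> range int \<union> range (\<lambda>n. - int (Suc n))" for z
   by (cases z rule: int_cases) auto
  then show ?thesis by blast
 qed
 moreover have "?f summable_on (range int \<union> range (\<lambda>n. - int (Suc n)))"
  by (rule summable_on_Un_disjoint[OF 1 2]) auto
 ultimately show ?thesis by simp
qed

text \<open>With \<open>a\<close>, \<open>b\<close> the squared components and
  \<open>a + b \<ge> 1\<close>, one has \<open>(1 + a) * (1 + b) \<le> (2 * (a + b))^2\<close>. So
  the fourth inverse power is dominated by 4 times a product of one-dimensional summable
  weights.\<close>

lemma summable_lam_minus4: "lam (-4) summable_on UNIV"
proof -
 let ?f = "\<lambda>n::int. 1 / (1 + (of_int n)\<^sup>2) :: real"
 define C where "C = infsum ?f UNIV"
 have C: "sum ?f A \<le> C" if "finite A" for A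
  unfolding C_def using that by (intro finite_sum_le_infsum summable_on_int_inverse_squares) auto
 have "0 \<le> C" using C[of "{}"] by simp
 have "(\<lambda>k. ?f (fst k) * ?f (snd k)) summable_on UNIV"
 proof (rule nonneg_bounded_partial_sums_imp_summable_on[where C="C * C"])
  show "\<forall>\<^sub>F X in finite_subsets_at_top UNIV. (\<Sum>k\<in>X. ?f (fst k) * ?f (snd k)) \<le> C * C"
  proof (rule eventually_finite_subsets_at_top_weakI)
   fix X :: "(int \<times> int) set" assume X: "finite X" "X \<subseteq> UNIV"
   have "(\<Sum>k\<in>X. ?f (fst k) * ?f (snd k)) \<le> (\<Sum>k\<in>fst ` X \<times> snd ` X. ?f (fst k) * ?f (snd k))"
    using X by (intro sum_mono2) (auto simp: subset_fst_snd)
   also have "\<dots> = sum ?f (fst ` X) * sum ?f (snd ` X)"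
    by (simp add: sum_product sum.cartesian_product case_prod_unfold)
   also have "\<dots> \<le> C * C" using X(1) by (intro mult_mono C \<open>0 \<le> C\<close> sum_nonneg) auto
   finally show "(\<Sum>k\<in>X. ?f (fst k) * ?f (snd k)) \<le> C * C" .
  qed
 qed auto
 then have S: "(\<lambda>k. 4 * (?f (fst k) * ?f (snd k))) summable_on UNIV" by (rule summable_on_cmult_right)
 show ?thesis
 proof (rule summable_on_comparison_test[OF S])
  fix k :: "int \<times> int"
  show "lam (-4) k \<le> 4 * (?f (fst k) * ?f (snd k))"
  proof (cases "k = 0")
   case False
   define a b where "a = (of_int (fst k) :: real)\<^sup>2" and "b = (of_int (snd k) :: real)\<^sup>2"
   have ab: "0 \<le> a" "0 \<le> b" by (simp_all add: a_def b_def)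
   have w2: "(wave_norm k)\<^sup>2 = a + b" by (simp add: wave_norm_def a_def b_def)
   have "1 \<le> (wave_norm k)\<^sup>2" using wave_norm_ge_1[OF False] by simp
   then have ab1: "1 \<le> a + b" by (simp add: w2)
   have "(1 + a) * (1 + b) \<le> (2 * (a + b)) * (2 * (a + b))"
    using ab ab1 by (intro mult_mono) auto
   also have "\<dots> = 4 * (wave_norm k)^4" using w2 by (simp add: power4_eq_xxxx power2_eq_square mult_ac flip: w2)
   also have "\<dots> \<le> 4 * (om k)^4"
    using pi_ge_two mult_right_mono[of 1 "2 * pi" "wave_norm k"] unfolding om_def by (intro mult_left_mono power_mono) auto
   finally have "(1 + a) * (1 + b) \<le> 4 * (om k)^4" .
   moreover have "lam (-4) k = 1 / (om k)^4"
    unfolding lam_def if_not_P[OF False] by (simp only: powr_minus_divide powr_numeral[OF om_nonneg])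
   moreover have "0 < (om k)^4" using om_pos[OF False] by (rule zero_less_power)
   ultimately have "4 / (4 * (om k)^4) \<le> 4 / ((1 + a) * (1 + b)) \<and> lam (-4) k = 4 / (4 * (om k)^4)"
    using ab by (intro conjI divide_left_mono mult_pos_pos) auto
   then show ?thesis by (simp add: a_def[symmetric] b_def[symmetric])
  qed simp
 qed simp
qed

text \<open>The weight of order 2 is split as order 4 on the coefficient times order -2; Young's
  inequality leaves a square summable for smooth \<open>\<phi>\<close> and the summable weight of
  order -4.\<close>

lemma om_sq_coef_le: "(om k)\<^sup>2 * \<bar>coef \<phi> k\<bar> \<le> (lam 4 k * coef \<phi> k)\<^sup>2 + lam (-4) k"
proof (cases "k = 0")
 case False
 have "(om k)\<^sup>2 = lam 2 k" using lam_sq[of 1 k] by simp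
 then have "(om k)\<^sup>2 * \<bar>coef \<phi> k\<bar> = \<bar>lam 4 k * coef \<phi> k\<bar> * lam (-2) k"
  using lam_mult[of 4 k "-2"] by (simp add: abs_mult mult_ac)
 also have "\<dots> \<le> (lam 4 k * coef \<phi> k)\<^sup>2 + (lam (-2) k)\<^sup>2"
 proof -
  have "2 * (\<bar>lam 4 k * coef \<phi> k\<bar> * lam (-2) k) \<le> (lam 4 k * coef \<phi> k)\<^sup>2 + (lam (-2) k)\<^sup>2"
   using sum_squares_bound[of "\<bar>lam 4 k * coef \<phi> k\<bar>" "lam (-2) k"] by (simp add: mult.assoc)
  moreover have "0 \<le> \<bar>lam 4 k * coef \<phi> k\<bar> * lam (-2) k" by simp
  ultimately show ?thesis by linarith
 qed
 finally show ?thesis by (simp add: lam_sq)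
qed simp

definition lam4_total :: real where "lam4_total = infsum (lam (-4)) UNIV"

lemma Hinf_nonlin:
 assumes \<phi>: "\<phi> \<in> Hinf" and e: "bij e"
 shows "summable (\<lambda>i. (om (e i))\<^sup>2 * \<bar>coef \<phi> (e i)\<bar>)"
  and "(\<Sum>i. (om (e i))\<^sup>2 * \<bar>coef \<phi> (e i)\<bar>) \<le> (norm (Lam 4 \<phi>))\<^sup>2 + lam4_total"
proof -
 have d: "\<phi> \<in> Lam_dom 4" using \<phi> by (simp add: Hinf_iff)
 have S: "((\<lambda>k. (lam 4 k * coef \<phi> k)\<^sup>2 + lam (-4) k) has_sum ((norm (Lam 4 \<phi>))\<^sup>2 + lam4_total)) UNIV"
  using parseval_norm[of "Lam 4 \<phi>"] summable_lam_minus4 unfolding lam4_total_def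
  by (intro has_sum_add) (auto simp: coef_Lam[OF d])
 then have "((\<lambda>i. (lam 4 (e i) * coef \<phi> (e i))\<^sup>2 + lam (-4) (e i)) has_sum ((norm (Lam 4 \<phi>))\<^sup>2 + lam4_total)) UNIV"
  using has_sum_reindex_bij_betw[OF e, of "\<lambda>k. (lam 4 k * coef \<phi> k)\<^sup>2 + lam (-4) k"] by simp
 then have s: "(\<lambda>i. (lam 4 (e i) * coef \<phi> (e i))\<^sup>2 + lam (-4) (e i)) sums ((norm (Lam 4 \<phi>))\<^sup>2 + lam4_total)"
  by (rule has_sum_imp_sums)
 show 1: "summable (\<lambda>i. (om (e i))\<^sup>2 * \<bar>coef \<phi> (e i)\<bar>)"
  by (rule summable_comparison_test'[OF sums_summable[OF s], of 0]) (use om_sq_coef_le in \<open>simp add: abs_mult\<close>)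
 show "(\<Sum>i. (om (e i))\<^sup>2 * \<bar>coef \<phi> (e i)\<bar>) \<le> (norm (Lam 4 \<phi>))\<^sup>2 + lam4_total"
  unfolding sums_unique[OF s] by (rule suminf_le[OF om_sq_coef_le 1 sums_summable[OF s]])
qed

text \<open>Not homogeneous in \<open>\<phi>\<close>, because Young's inequality was used above. It
  serves to bound the nonlinearity in time along a bounded path and a continuous family of test
  functions, for which this is enough.\<close>

lemma abs_nonlin_le:
 assumes \<phi>: "\<phi> \<in> Hinf" and tet: "tet \<in> H"
 shows "\<bar>nonlin tet \<phi>\<bar> \<le> 2 * (norm tet)\<^sup>2 * ((norm (Lam 4 \<phi>))\<^sup>2 + lam4_total)"
proof -
 obtain e :: "nat \<Rightarrow> int \<times> int" where e: "bij e" using ex_mode_enumeration by blast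
 note s = Hinf_nonlin[OF \<phi> e]
 have N: "(\<lambda>i. coef \<phi> (e i) * nl (e i) tet tet) sums nonlin tet \<phi>"
  using \<phi> by (intro nonlin_sums[OF e _ s(1) tet]) (simp add: Hinf_iff)
 have le: "\<bar>coef \<phi> (e i) * nl (e i) tet tet\<bar> \<le> 2 * (norm tet)\<^sup>2 * ((om (e i))\<^sup>2 * \<bar>coef \<phi> (e i)\<bar>)" for i
 proof -
  have "\<bar>coef \<phi> (e i)\<bar> * \<bar>nl (e i) tet tet\<bar> \<le> \<bar>coef \<phi> (e i)\<bar> * (2 * (om (e i))\<^sup>2 * norm tet * norm tet)"
   by (intro mult_left_mono abs_nl_le) simp
  then show ?thesis by (simp add: abs_mult power2_eq_square mult_ac)
 qed
 have s2: "summable (\<lambda>i. 2 * (norm tet)\<^sup>2 * ((om (e i))\<^sup>2 * \<bar>coef \<phi> (e i)\<bar>))" using s(1) by (rule summable_mult)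
 have s3: "summable (\<lambda>i. \<bar>coef \<phi> (e i) * nl (e i) tet tet\<bar>)"
  by (rule summable_comparison_test'[OF s2, of 0]) (use le in simp)
 have "\<bar>nonlin tet \<phi>\<bar> \<le> (\<Sum>i. \<bar>coef \<phi> (e i) * nl (e i) tet tet\<bar>)"
  unfolding sums_unique[OF N] by (rule summable_rabs[OF s3])
 also have "\<dots> \<le> (\<Sum>i. 2 * (norm tet)\<^sup>2 * ((om (e i))\<^sup>2 * \<bar>coef \<phi> (e i)\<bar>))"
  by (rule suminf_le[OF le s3 s2])
 also have "\<dots> = 2 * (norm tet)\<^sup>2 * (\<Sum>i. (om (e i))\<^sup>2 * \<bar>coef \<phi> (e i)\<bar>)" by (rule suminf_mult[OF s(1)])
 also have "\<dots> \<le> 2 * (norm tet)\<^sup>2 * ((norm (Lam 4 \<phi>))\<^sup>2 + lam4_total)" by (intro mult_left_mono s(2)) simp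
 finally show ?thesis .
qed

section \<open>The Euler scheme of a quadratic system\<close>

text \<open>The Riemann sum is the integral of a step function, so dominated convergence applies.
  Measurability of \<open>g\<close> is a consequence: it is a pointwise limit of step functions on
  \<open>{0..<T}\<close>, and the end point, where the cell index would be \<open>N n\<close>, is a
  null set.\<close>

lemma riemann_sums_tendsto:
 fixes G :: "nat \<Rightarrow> nat \<Rightarrow> real" and g :: "real \<Rightarrow> real" and N :: "nat \<Rightarrow> nat"
 assumes T: "0 < T" and N: "\<And>n. 0 < N n"
  and bound: "eventually (\<lambda>n. \<forall>j<N n. \<bar>G n j\<bar> \<le> C) sequentially"
  and lim: "\<And>s :: real. s \<in> {0..<T} \<Longrightarrow> (\<lambda>n. G n (nat \<lfloor>s * N n / T\<rfloor>)) \<longlonglongrightarrow> g s"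
 shows "(\<lambda>n. T / N n * (\<Sum>j<N n. G n j)) \<longlonglongrightarrow> (\<integral>s. g s \<partial>lebesgue_on {0..T})"
proof -
 let ?M = "lebesgue_on {0..T}"
 obtain n1 where n1: "\<And>n j. n \<ge> n1 \<Longrightarrow> j < N n \<Longrightarrow> \<bar>G n j\<bar> \<le> C"
  using bound unfolding eventually_sequentially by blast
 have C: "0 \<le> C" using n1[of n1 0] N[of n1] by force
 define A where "A n j = {real j * T / N n ..< real (Suc j) * T / N n}" for n j
 define F where "F n s = (\<Sum>j<N n. G n j * indicator (A n j) s)" for n s
 have A_iff: "s \<in> A n j \<longleftrightarrow> j = nat \<lfloor>s * N n / T\<rfloor>" if s: "s \<in> {0..<T}" for s :: real and n j
 proof -
  have "s \<in> A n j \<longleftrightarrow> real j \<le> s * N n / T \<and> s * N n / T < real j + 1"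
   using T N[of n] unfolding A_def by (simp add: field_simps)
  also have "\<dots> \<longleftrightarrow> \<lfloor>s * N n / T\<rfloor> = int j" unfolding floor_eq_iff by simp
  also have "\<dots> \<longleftrightarrow> j = nat \<lfloor>s * N n / T\<rfloor>"
  proof -
   have "0 \<le> \<lfloor>s * N n / T\<rfloor>" using s T by simp
   then show ?thesis by linarith
  qed
  finally show ?thesis .
 qed
 have idx: "nat \<lfloor>s * N n / T\<rfloor> < N n" if s: "s \<in> {0..<T}" for s :: real and n
 proof -
  have "s * N n / T < N n" using s T N[of n] by (simp add: field_simps)
  then have "\<lfloor>s * N n / T\<rfloor> < int (N n)" by (simp add: floor_less_iff)
  then show ?thesis using N[of n] by linarith
 qed
 have F_eq: "F n s = G n (nat \<lfloor>s * N n / T\<rfloor>)" if s: "s \<in> {0..<T}" for s :: real and n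
 proof -
  have "F n s = (\<Sum>j<N n. if j = nat \<lfloor>s * N n / T\<rfloor> then G n j else 0)"
   unfolding F_def using A_iff[OF s] by (intro sum.cong refl) (auto simp: indicator_def)
  then show ?thesis using idx[OF s] by simp
 qed
 have emb: "real (Suc j) * T / N n \<le> T" if "j < N n" for j n
 proof -
  have "real (Suc j) * T \<le> real (N n) * T" using that T by (intro mult_right_mono) auto
  then show ?thesis using N[of n] by (simp add: field_simps)
 qed
 have Asub: "A n j \<subseteq> {0..T}" if "j < N n" for j n
 proof
  fix s assume "s \<in> A n j"
  then have "real j * T / N n \<le> s" "s < real (Suc j) * T / N n" unfolding A_def atLeastLessThan_iff by blast+
  moreover have "0 \<le> real j * T / N n" using T by simp
  ultimately show "s \<in> {0..T}" using emb[OF that] unfolding atLeastAtMost_iff by linarith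
 qed
 have A_meas: "A n j \<in> sets ?M" if "j < N n" for j n
  using Asub[OF that] by (auto simp: sets_restrict_space A_def)
 have A_measure: "measure ?M (A n j) = T / N n" if "j < N n" for j n
 proof -
  have "measure ?M (A n j) = measure lebesgue (A n j)"
   using Asub[OF that] by (intro measure_restrict_space) auto
  also have "\<dots> = T / N n"
   unfolding A_def using T N[of n] by (simp add: field_simps measure_lborel_Ico)
  finally show ?thesis .
 qed
 have fin: "finite_measure ?M" by (rule finite_measure_lebesgue_on) auto
 interpret finite_measure ?M by (rule fin)
 have F_int: "(\<integral>s. F n s \<partial>?M) = T / N n * (\<Sum>j<N n. G n j)" for n
 proof -
  have "(\<integral>s. F n s \<partial>?M) = (\<Sum>j<N n. G n j * measure ?M (A n j))"
   unfolding F_def using A_meas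
   by (subst Bochner_Integration.integral_sum) (auto simp: Int_absorb2[OF Asub] less_top[symmetric])
  then show ?thesis using A_measure by (simp add: sum_distrib_left mult.commute)
 qed
 have F_meas: "F n \<in> borel_measurable ?M" for n
  unfolding F_def using A_meas by (intro borel_measurable_sum borel_measurable_times) auto
 have ae: "AE s in ?M. s \<in> {0..<T}"
 proof -
  have "AE s in lebesgue. s \<noteq> T" using AE_lborel_singleton[of T] by (rule AE_completion)
  then show ?thesis by (subst AE_restrict_space_iff) (auto elim!: eventually_mono)
 qed
 have limF: "AE s in ?M. (\<lambda>n. F (n + n1) s) \<longlonglongrightarrow> indicator {0..<T} s * g s"
  using ae
 proof eventually_elim
  case (elim s)
  then have "(\<lambda>n. F n s) \<longlonglongrightarrow> g s" using lim[OF elim] F_eq[OF elim] by simp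
  then have "(\<lambda>n. F (n + n1) s) \<longlonglongrightarrow> g s" by (rule LIMSEQ_ignore_initial_segment)
  then show ?case using elim by simp
 qed
 have g_meas: "(\<lambda>s. indicator {0..<T} s * g s) \<in> borel_measurable ?M"
 proof (rule borel_measurable_LIMSEQ_real[where u="\<lambda>n s. indicator {0..<T} s * F n s"])
  fix s assume "s \<in> space ?M"
  show "(\<lambda>n. indicator {0..<T} s * F n s) \<longlonglongrightarrow> indicator {0..<T} s * g s"
   using lim[of s] F_eq[of s] by (cases "s \<in> {0..<T}") auto
 next
  fix n
  have "{0..<T} \<in> sets ?M" by (auto simp: sets_restrict_space)
  then show "(\<lambda>s. indicator {0..<T} s * F n s) \<in> borel_measurable ?M" using F_meas by simp
 qed
 have "(\<lambda>n. \<integral>s. F (n + n1) s \<partial>?M) \<longlonglongrightarrow> (\<integral>s. indicator {0..<T} s * g s \<partial>?M)"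
 proof (rule integral_dominated_convergence[where w="\<lambda>_. C"])
  show "AE s in ?M. norm (F (n + n1) s) \<le> C" for n
   using ae by eventually_elim (use F_eq idx n1[of "n + n1"] in auto)
 qed (use F_meas g_meas limF in auto)
 then have "(\<lambda>n. T / N n * (\<Sum>j<N n. G n j)) \<longlonglongrightarrow> (\<integral>s. indicator {0..<T} s * g s \<partial>?M)"
  unfolding F_int by (rule LIMSEQ_offset)
 moreover have "(\<integral>s. indicator {0..<T} s * g s \<partial>?M) = (\<integral>s. g s \<partial>?M)"
 proof -
  have "(\<lambda>s. indicator {0..<T} s * g s + indicator {T} s * g T) \<in> borel_measurable ?M"
  proof -
   have "{T} \<in> sets ?M" using T by (auto simp: sets_restrict_space)
   then show ?thesis using g_meas by simp
  qed
  moreover have "indicator {0..<T} s * g s + indicator {T} s * g T = g s" if "s \<in> space ?M" for s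
   using that by (auto simp: indicator_def)
  ultimately have "g \<in> borel_measurable ?M" by (subst measurable_cong[of _ _ g, symmetric]) auto
  moreover have "AE s in ?M. indicator {0..<T} s * g s = g s" using ae by eventually_elim simp
  ultimately show ?thesis using g_meas by (intro integral_cong_AE)
 qed
 ultimately show ?thesis by simp
qed

text \<open>What the exponential estimate uses of the Galerkin equation: finitely many modes,
  positive damping and a quadratic term that does no work.\<close>

locale quadratic_drift =
 fixes I :: "'i set" and lm :: "'i \<Rightarrow> real" and B :: "'i \<Rightarrow> 'i \<Rightarrow> 'i \<Rightarrow> real"
 assumes finite_I: "finite I" and lm_pos: "\<And>i. i \<in> I \<Longrightarrow> 0 < lm i"
  and energy: "\<And>x :: 'i \<Rightarrow> real. (\<Sum>i\<in>I. x i * (\<Sum>j\<in>I. \<Sum>k\<in>I. B i j k * x j * x k)) = 0"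
begin

definition drift :: "('i \<Rightarrow> real) \<Rightarrow> 'i \<Rightarrow> real" where
 "drift x i = - lm i * x i - (\<Sum>j\<in>I. \<Sum>k\<in>I. B i j k * x j * x k)"

lemma drift_energy: "(\<Sum>i\<in>I. x i * drift x i) = - (\<Sum>i\<in>I. lm i * (x i)\<^sup>2)"
 using energy[of x] by (simp add: drift_def right_diff_distrib sum_subtractf sum_negf power2_eq_square mult_ac)

lemma drift_tendsto [tendsto_intros]:
 assumes "\<And>i. i \<in> I \<Longrightarrow> ((\<lambda>n. x n i) \<longlongrightarrow> y i) F" "i \<in> I"
 shows "((\<lambda>n. drift (x n) i) \<longlongrightarrow> drift y i) F"
 unfolding drift_def using assms by (intro tendsto_intros) auto

lemma drift_continuous:
 assumes "\<And>i. i \<in> I \<Longrightarrow> continuous_on S (\<lambda>s. x s i)" "i \<in> I"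
 shows "continuous_on S (\<lambda>s. drift (x s) i)"
 unfolding drift_def using assms by (intro continuous_intros) auto

lemma drift_lipschitz:
 assumes R: "0 \<le> R"
 obtains L where "0 \<le> L"
  "\<And>x y i. (\<And>k. k \<in> I \<Longrightarrow> \<bar>x k\<bar> \<le> R) \<Longrightarrow> (\<And>k. k \<in> I \<Longrightarrow> \<bar>y k\<bar> \<le> R) \<Longrightarrow> i \<in> I \<Longrightarrow>
    \<bar>drift x i - drift y i\<bar> \<le> L * (\<Sum>k\<in>I. \<bar>x k - y k\<bar>)"
proof
 define L where "L = (\<Sum>i\<in>I. lm i + (\<Sum>j\<in>I. \<Sum>k\<in>I. 2 * R * \<bar>B i j k\<bar>))"
 have nn: "0 \<le> lm i + (\<Sum>j\<in>I. \<Sum>k\<in>I. 2 * R * \<bar>B i j k\<bar>)" if "i \<in> I" for i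
  using lm_pos[OF that] R by (intro add_nonneg_nonneg sum_nonneg) auto
 show "0 \<le> L" unfolding L_def by (intro sum_nonneg nn)
 fix x y :: "'i \<Rightarrow> real" and i
 assume x: "\<And>k. k \<in> I \<Longrightarrow> \<bar>x k\<bar> \<le> R" and y: "\<And>k. k \<in> I \<Longrightarrow> \<bar>y k\<bar> \<le> R" and i: "i \<in> I"
 define D where "D = (\<Sum>k\<in>I. \<bar>x k - y k\<bar>)"
 have D: "\<bar>x k - y k\<bar> \<le> D" if "k \<in> I" for k
  unfolding D_def using that finite_I by (intro member_le_sum) auto
 have D0: "0 \<le> D" unfolding D_def by (intro sum_nonneg) auto
 have trm: "\<bar>B i j k * x j * x k - B i j k * y j * y k\<bar> \<le> 2 * R * \<bar>B i j k\<bar> * D" if "j \<in> I" "k \<in> I" for j k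
 proof -
  have "B i j k * x j * x k - B i j k * y j * y k = B i j k * (x j * (x k - y k) + (x j - y j) * y k)"
   by (simp add: algebra_simps)
  also have "\<bar>\<dots>\<bar> \<le> \<bar>B i j k\<bar> * (\<bar>x j\<bar> * \<bar>x k - y k\<bar> + \<bar>x j - y j\<bar> * \<bar>y k\<bar>)"
   unfolding abs_mult by (intro mult_left_mono order_trans[OF abs_triangle_ineq]) (auto simp: abs_mult)
  also have "\<dots> \<le> \<bar>B i j k\<bar> * (R * D + D * R)"
   using that x y D R D0 by (intro mult_left_mono add_mono mult_mono) auto
  finally show ?thesis by (simp add: mult_ac)
 qed
 have "\<bar>drift x i - drift y i\<bar> \<le> \<bar>lm i * (x i - y i)\<bar> + \<bar>\<Sum>j\<in>I. \<Sum>k\<in>I. B i j k * x j * x k - B i j k * y j * y k\<bar>"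
  unfolding drift_def by (simp add: sum_subtractf algebra_simps)
 also have "\<dots> \<le> lm i * D + (\<Sum>j\<in>I. \<Sum>k\<in>I. 2 * R * \<bar>B i j k\<bar> * D)"
 proof (rule add_mono)
  show "\<bar>lm i * (x i - y i)\<bar> \<le> lm i * D"
   using D[OF i] lm_pos[OF i] by (simp add: abs_mult)
  show "\<bar>\<Sum>j\<in>I. \<Sum>k\<in>I. B i j k * x j * x k - B i j k * y j * y k\<bar> \<le> (\<Sum>j\<in>I. \<Sum>k\<in>I. 2 * R * \<bar>B i j k\<bar> * D)"
   by (intro order_trans[OF sum_abs] sum_mono trm)
 qed
 also have "\<dots> = (lm i + (\<Sum>j\<in>I. \<Sum>k\<in>I. 2 * R * \<bar>B i j k\<bar>)) * D"
  by (simp add: sum_distrib_right distrib_right)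
 also have "\<dots> \<le> L * D"
  unfolding L_def using i finite_I nn by (intro mult_right_mono[OF _ D0] member_le_sum) auto
 finally show "\<bar>drift x i - drift y i\<bar> \<le> L * (\<Sum>k\<in>I. \<bar>x k - y k\<bar>)" unfolding D_def .
qed

text \<open>The variables \<open>\<xi> (0, i)\<close> are the initial data and
  \<open>\<xi> (Suc j, i)\<close> the noise increments of step \<open>j\<close>; the scheme is a
  polynomial map of these finitely many variables.\<close>

primrec euler :: "real \<Rightarrow> (nat \<times> 'i \<Rightarrow> real) \<Rightarrow> nat \<Rightarrow> 'i \<Rightarrow> real" where
 "euler dt \<xi> 0 = (\<lambda>i. \<xi> (0, i))"
| "euler dt \<xi> (Suc j) = (\<lambda>i. euler dt \<xi> j i + dt * drift (euler dt \<xi> j) i + \<xi> (Suc j, i))"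

definition solves :: "real \<Rightarrow> (real \<Rightarrow> 'i \<Rightarrow> real) \<Rightarrow> (real \<Rightarrow> 'i \<Rightarrow> real) \<Rightarrow> bool" where
 "solves T X w \<longleftrightarrow> (\<forall>i\<in>I. continuous_on {0..T} (\<lambda>t. X t i)) \<and>
   (\<forall>i\<in>I. \<forall>t\<in>{0..T}. X t i = X 0 i + integral {0..t} (\<lambda>s. drift (X s) i) + w t i)"

definition increments :: "real \<Rightarrow> (real \<Rightarrow> 'i \<Rightarrow> real) \<Rightarrow> (real \<Rightarrow> 'i \<Rightarrow> real) \<Rightarrow> nat \<times> 'i \<Rightarrow> real" where
 "increments dt X w p = (case fst p of 0 \<Rightarrow> X 0 (snd p) | Suc j \<Rightarrow> w (real (Suc j) * dt) (snd p) - w (real j * dt) (snd p))"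

lemma bounded_coordinates:
 assumes cont: "\<And>i. i \<in> I \<Longrightarrow> continuous_on {0..T} (\<lambda>t :: real. X t i :: real)"
 obtains R where "0 \<le> R" "\<And>i t. i \<in> I \<Longrightarrow> t \<in> {0..T} \<Longrightarrow> \<bar>X t i\<bar> \<le> R"
proof -
 have "\<exists>R\<ge>0. \<forall>i\<in>I. \<forall>t\<in>{0..T}. \<bar>X t i\<bar> \<le> R"
 proof -
  have "\<forall>i\<in>I. \<exists>R. \<forall>t\<in>{0..T}. \<bar>X t i\<bar> \<le> R"
  proof
   fix i assume "i \<in> I"
   then have "compact ((\<lambda>t. X t i) ` {0..T})" using cont by (intro compact_continuous_image) auto
   then have "bounded ((\<lambda>t. X t i) ` {0..T})" by (rule compact_imp_bounded)
   then show "\<exists>R. \<forall>t\<in>{0..T}. \<bar>X t i\<bar> \<le> R" by (auto simp: bounded_iff)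
  qed
  then obtain R where R: "\<And>i t. i \<in> I \<Longrightarrow> t \<in> {0..T} \<Longrightarrow> \<bar>X t i\<bar> \<le> R i" by metis
  show ?thesis
  proof (intro exI conjI ballI)
   show "0 \<le> (\<Sum>i\<in>I. \<bar>R i\<bar>)" by (intro sum_nonneg) auto
   fix i t assume it: "i \<in> I" "t \<in> {0..T}"
   then have "\<bar>X t i\<bar> \<le> \<bar>R i\<bar>" using R by force
   also have "\<dots> \<le> (\<Sum>i\<in>I. \<bar>R i\<bar>)" using it finite_I by (intro member_le_sum) auto
   finally show "\<bar>X t i\<bar> \<le> (\<Sum>i\<in>I. \<bar>R i\<bar>)" .
  qed
 qed
 then show ?thesis using that by blast
qed

text \<open>Scheme and solution receive the same noise increments, so their difference is driven by
  the drift alone and a discrete Gronwall argument is pathwise. Paths are merely continuous, hence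
  the modulus of continuity of \<open>X\<close> takes the place of a rate.\<close>

lemma euler_converges:
 assumes T: "0 < T" and sol: "solves T X w" and e: "0 < e"
 obtains N0 :: nat where "\<And>(N :: nat) j. N \<ge> N0 \<Longrightarrow> 0 < N \<Longrightarrow> j \<le> N \<Longrightarrow>
  (\<Sum>i\<in>I. \<bar>euler (T / N) (increments (T / N) X w) j i - X (real j * (T / N)) i\<bar>) \<le> e"
proof -
 have cont: "\<And>i. i \<in> I \<Longrightarrow> continuous_on {0..T} (\<lambda>t. X t i)"
  and eq: "\<And>i t. i \<in> I \<Longrightarrow> t \<in> {0..T} \<Longrightarrow> X t i = X 0 i + integral {0..t} (\<lambda>s. drift (X s) i) + w t i"
  using sol unfolding solves_def by blast+
 obtain R where R: "0 \<le> R" "\<And>i t. i \<in> I \<Longrightarrow> t \<in> {0..T} \<Longrightarrow> \<bar>X t i\<bar> \<le> R"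
  by (rule bounded_coordinates[OF cont]) blast+
 have R1: "0 \<le> R + 1" using R(1) by simp
 obtain L where L: "0 \<le> L"
  "\<And>x y i. (\<And>k. k \<in> I \<Longrightarrow> \<bar>x k\<bar> \<le> R + 1) \<Longrightarrow> (\<And>k. k \<in> I \<Longrightarrow> \<bar>y k\<bar> \<le> R + 1) \<Longrightarrow> i \<in> I \<Longrightarrow>
    \<bar>drift x i - drift y i\<bar> \<le> L * (\<Sum>k\<in>I. \<bar>x k - y k\<bar>)"
  by (rule drift_lipschitz[OF R1]) blast
 define c where "c = real (card I) * L"
 have c: "0 \<le> c" using L(1) by (simp add: c_def)
 \<comment> \<open>Chosen so that after the Gronwall factor \<open>exp (c * T)\<close> the error is
   at most \<open>e\<close> and also at most 1.\<close>
 define \<eta> where "\<eta> = min e 1 / exp (c * T)"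
 have \<eta>: "0 < \<eta>" using e by (simp add: \<eta>_def)
 have "\<exists>\<delta>>0. \<forall>s\<in>{0..T}. \<forall>t\<in>{0..T}. \<bar>s - t\<bar> < \<delta> \<longrightarrow> (\<Sum>i\<in>I. \<bar>X s i - X t i\<bar>) \<le> \<eta>"
 proof -
  have "\<forall>i\<in>I. \<exists>\<delta>>0. \<forall>s\<in>{0..T}. \<forall>t\<in>{0..T}. \<bar>s - t\<bar> < \<delta> \<longrightarrow> \<bar>X s i - X t i\<bar> \<le> \<eta> / (card I + 1)"
  proof
   fix i assume "i \<in> I"
   then have "uniformly_continuous_on {0..T} (\<lambda>t. X t i)" using cont by (intro compact_uniformly_continuous) auto
   moreover have "0 < \<eta> / (card I + 1)" using \<eta> by simp
   ultimately obtain \<delta> where "\<delta> > 0" "\<And>s t. s \<in> {0..T} \<Longrightarrow> t \<in> {0..T} \<Longrightarrow> dist t s < \<delta> \<Longrightarrow> dist (X t i) (X s i) < \<eta> / (card I + 1)"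
    unfolding uniformly_continuous_on_def by blast
   then show "\<exists>\<delta>>0. \<forall>s\<in>{0..T}. \<forall>t\<in>{0..T}. \<bar>s - t\<bar> < \<delta> \<longrightarrow> \<bar>X s i - X t i\<bar> \<le> \<eta> / (card I + 1)"
    by (intro exI[of _ \<delta>]) (auto simp: dist_real_def intro!: less_imp_le)
  qed
  then obtain \<delta> where \<delta>: "\<And>i. i \<in> I \<Longrightarrow> \<delta> i > 0"
   "\<And>i s t. i \<in> I \<Longrightarrow> s \<in> {0..T} \<Longrightarrow> t \<in> {0..T} \<Longrightarrow> \<bar>s - t\<bar> < \<delta> i \<Longrightarrow> \<bar>X s i - X t i\<bar> \<le> \<eta> / (card I + 1)"
   by metis
  define \<delta>0 where "\<delta>0 = Min (insert 1 (\<delta> ` I))"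
  have "\<delta>0 > 0" unfolding \<delta>0_def using \<delta>(1) finite_I by (subst Min_gr_iff) auto
  moreover have "(\<Sum>i\<in>I. \<bar>X s i - X t i\<bar>) \<le> \<eta>" if st: "s \<in> {0..T}" "t \<in> {0..T}" "\<bar>s - t\<bar> < \<delta>0" for s t
  proof -
   have "\<delta>0 \<le> \<delta> i" if "i \<in> I" for i unfolding \<delta>0_def using that finite_I by (intro Min_le) auto
   then have "(\<Sum>i\<in>I. \<bar>X s i - X t i\<bar>) \<le> (\<Sum>i\<in>I. \<eta> / (card I + 1))"
    using st by (intro sum_mono \<delta>(2)) force+
   also have "\<dots> \<le> \<eta>" using \<eta> by (simp add: field_simps)
   finally show ?thesis .
  qed
  ultimately show ?thesis by blast
 qed
 then obtain \<delta> where \<delta>: "\<delta> > 0" "\<And>s t. s \<in> {0..T} \<Longrightarrow> t \<in> {0..T} \<Longrightarrow> \<bar>s - t\<bar> < \<delta> \<Longrightarrow> (\<Sum>i\<in>I. \<bar>X s i - X t i\<bar>) \<le> \<eta>"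
  by blast
 obtain N0 :: nat where N0: "T / \<delta> < real N0" using reals_Archimedean2 by blast
 show ?thesis
 proof (rule that[of N0])
  fix N j :: nat assume N: "N \<ge> N0" "0 < N" and j: "j \<le> N"
  define dt where "dt = T / N"
  have dt: "0 < dt" using T N by (simp add: dt_def)
  have dt\<delta>: "dt < \<delta>"
  proof -
   have "T / \<delta> < real N" using N0 N by linarith
   then show ?thesis using N \<delta>(1) by (simp add: dt_def field_simps)
  qed
  define Y where "Y = euler dt (increments dt X w)"
  define E where "E j = (\<Sum>i\<in>I. \<bar>Y j i - X (real j * dt) i\<bar>)" for j
  have tT: "real j * dt \<in> {0..T}" if "j \<le> N" for j
  proof -
   have "real j * dt \<le> real N * dt" using that dt by (intro mult_right_mono) auto
   moreover have "real N * dt = T" using N by (simp add: dt_def)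
   ultimately show ?thesis using dt by simp
  qed
  have pow: "(1 + c * dt) ^ j \<le> exp (c * T)" if "j \<le> N" for j
  proof -
   have "(1 + c * dt) ^ j \<le> exp (c * dt) ^ j"
    using c dt by (intro power_mono) (auto simp: add.commute)
   also have "\<dots> = exp (c * (real j * dt))" by (simp add: exp_of_nat_mult[symmetric] mult_ac)
   also have "\<dots> \<le> exp (c * T)" using tT[OF that] c by (auto intro: mult_left_mono)
   finally show ?thesis .
  qed
  have small: "\<eta> * ((1 + c * dt) ^ j - 1) \<le> min e 1" if "j \<le> N" for j
  proof -
   have "\<eta> * ((1 + c * dt) ^ j - 1) \<le> \<eta> * exp (c * T)" using pow[OF that] \<eta> by (intro mult_left_mono) auto
   also have "\<dots> = min e 1" by (simp add: \<eta>_def)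
   finally show ?thesis .
  qed
  have main: "E j \<le> \<eta> * ((1 + c * dt) ^ j - 1)" if "j \<le> N" for j
   using that
  proof (induction j)
   case 0
   then show ?case by (simp add: E_def Y_def increments_def)
  next
   case (Suc j)
   then have jN: "j \<le> N" and IH: "E j \<le> \<eta> * ((1 + c * dt) ^ j - 1)" by auto
   \<comment> \<open>The quadratic drift is only locally Lipschitz; an error of at most 1 keeps the
     scheme in the box of size \<open>R + 1\<close> on which the constant \<open>L\<close> is
     valid.\<close>
   have Ej1: "E j \<le> 1" using IH small[OF jN] by linarith
   let ?a = "real j * dt" and ?b = "real (Suc j) * dt"
   have ab: "?a \<le> ?b" "?b - ?a = dt" using dt by (auto simp: algebra_simps)
   have Ybd: "\<bar>Y j k\<bar> \<le> R + 1" if "k \<in> I" for k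
   proof -
    have "\<bar>Y j k - X ?a k\<bar> \<le> E j" unfolding E_def using that finite_I by (intro member_le_sum) auto
    then show ?thesis using R(2)[OF that tT[OF jN]] Ej1 by linarith
   qed
   have step: "\<bar>Y (Suc j) i - X ?b i\<bar> \<le> \<bar>Y j i - X ?a i\<bar> + dt * (L * (E j + \<eta>))" if i: "i \<in> I" for i
   proof -
    have dc: "continuous_on {0..T} (\<lambda>s. drift (X s) i)" using cont i by (intro drift_continuous) auto
    have int: "(\<lambda>s. drift (X s) i) integrable_on {u..v}" if "{u..v} \<subseteq> {0..T}" for u v
     using dc that by (intro integrable_continuous_interval) (rule continuous_on_subset)
    have sub: "{?a..?b} \<subseteq> {0..T}" "{0..?b} \<subseteq> {0..T}" using tT[OF Suc.prems] tT[OF jN] by auto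
    have "integral {0..?b} (\<lambda>s. drift (X s) i) = integral {0..?a} (\<lambda>s. drift (X s) i) + integral {?a..?b} (\<lambda>s. drift (X s) i)"
     using Henstock_Kurzweil_Integration.integral_combine[of 0 ?a ?b "\<lambda>s. drift (X s) i"] ab dt int[OF sub(2)] by simp
    then have "X ?b i = X ?a i + integral {?a..?b} (\<lambda>s. drift (X s) i) + (w ?b i - w ?a i)"
     using eq[OF i tT[OF Suc.prems]] eq[OF i tT[OF jN]] by linarith
    moreover have "Y (Suc j) i = Y j i + dt * drift (Y j) i + (w ?b i - w ?a i)"
     by (simp add: Y_def increments_def)
    ultimately have "Y (Suc j) i - X ?b i = (Y j i - X ?a i) + (dt * drift (Y j) i - integral {?a..?b} (\<lambda>s. drift (X s) i))"
     by simp
    also have "dt * drift (Y j) i - integral {?a..?b} (\<lambda>s. drift (X s) i) = integral {?a..?b} (\<lambda>s. drift (Y j) i - drift (X s) i)"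
     using ab int[OF sub(1)] by (subst Henstock_Kurzweil_Integration.integral_diff) auto
    finally have "\<bar>Y (Suc j) i - X ?b i\<bar> \<le> \<bar>Y j i - X ?a i\<bar> + \<bar>integral {?a..?b} (\<lambda>s. drift (Y j) i - drift (X s) i)\<bar>"
     by linarith
    also have "\<bar>integral {?a..?b} (\<lambda>s. drift (Y j) i - drift (X s) i)\<bar> \<le> L * (E j + \<eta>) * (?b - ?a)"
    proof -
     have "norm (integral {?a..?b} (\<lambda>s. drift (Y j) i - drift (X s) i)) \<le> L * (E j + \<eta>) * (?b - ?a)"
     proof (rule integral_bound[OF ab(1)])
      show "continuous_on {?a..?b} (\<lambda>s. drift (Y j) i - drift (X s) i)"
       using dc sub(1) by (intro continuous_intros) (rule continuous_on_subset)
      fix s assume s: "s \<in> {?a..?b}"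
      then have sT: "s \<in> {0..T}" using sub(1) by blast
      have "\<bar>drift (Y j) i - drift (X s) i\<bar> \<le> L * (\<Sum>k\<in>I. \<bar>Y j k - X s k\<bar>)"
       using Ybd R(2)[OF _ sT] by (intro L(2) i) force+
      also have "(\<Sum>k\<in>I. \<bar>Y j k - X s k\<bar>) \<le> E j + (\<Sum>k\<in>I. \<bar>X ?a k - X s k\<bar>)"
       unfolding E_def sum.distrib[symmetric] by (intro sum_mono) linarith
      also have "(\<Sum>k\<in>I. \<bar>X ?a k - X s k\<bar>) \<le> \<eta>"
       using s ab dt\<delta> by (intro \<delta>(2) tT[OF jN] sT) auto
      finally show "norm (drift (Y j) i - drift (X s) i) \<le> L * (E j + \<eta>)"
       using L(1) by (simp add: mult_left_mono)
     qed
     then show ?thesis by simp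
    qed
    finally show ?thesis unfolding ab(2) by (simp add: mult_ac)
   qed
   have "E (Suc j) \<le> (\<Sum>i\<in>I. \<bar>Y j i - X ?a i\<bar> + dt * (L * (E j + \<eta>)))"
    unfolding E_def[of "Suc j"] by (intro sum_mono step)
   also have "\<dots> = E j + c * dt * (E j + \<eta>)"
    by (simp add: sum.distrib E_def c_def mult_ac)
   also have "\<dots> = (1 + c * dt) * (E j + \<eta>) - \<eta>" by (simp add: algebra_simps)
   also have "\<dots> \<le> (1 + c * dt) * (\<eta> * (1 + c * dt) ^ j) - \<eta>"
    using IH c dt by (intro diff_right_mono mult_left_mono) (auto simp: algebra_simps)
   also have "\<dots> = \<eta> * ((1 + c * dt) ^ Suc j - 1)" by (simp add: algebra_simps)
   finally show ?case .
  qed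
  show "(\<Sum>i\<in>I. \<bar>euler (T / N) (increments (T / N) X w) j i - X (real j * (T / N)) i\<bar>) \<le> e"
   using main[OF j] small[OF j] unfolding E_def Y_def dt_def by linarith
 qed
qed

end

text \<open>When each coarse cell is divided into \<open>k\<close> fine ones, the index of a fine
  cell divided by \<open>k\<close> is the index of the coarse cell containing it.\<close>

lemma nat_floor_mult_div:
 assumes "0 \<le> (x :: real)" "0 < k"
 shows "nat \<lfloor>x * real k\<rfloor> div k = nat \<lfloor>x\<rfloor>"
proof -
 have "\<lfloor>x * real k / real_of_int (int k)\<rfloor> = \<lfloor>x * real k\<rfloor> div int k"
  by (rule floor_divide_real_eq_div) simp
 then have "\<lfloor>x\<rfloor> = \<lfloor>x * real k\<rfloor> div int k" using assms by simp
 then have "nat \<lfloor>x\<rfloor> = nat (\<lfloor>x * real k\<rfloor> div int k)" by simp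
 also have "\<dots> = nat \<lfloor>x * real k\<rfloor> div k" using assms by (simp add: nat_div_distrib)
 finally show ?thesis by simp
qed

context quadratic_drift
begin

text \<open>The coefficient of the next noise increment once \<open>\<psi>\<close> has been added to
  the expansion of \<open>c\<close> times the squared scheme. With \<open>l\<close> steps per cell
  of the coarse grid, \<open>j div l\<close> is the cell of step \<open>j\<close>.\<close>

definition control :: "real \<Rightarrow> (nat \<Rightarrow> 'i \<Rightarrow> real) \<Rightarrow> nat \<Rightarrow> real \<Rightarrow> nat \<Rightarrow> 'i \<Rightarrow> (nat \<times> 'i \<Rightarrow> real) \<Rightarrow> real" where
 "control c \<psi> l dt j i \<xi> = \<psi> (j div l) i + 2 * c * euler dt \<xi> j i"

text \<open>After division by \<epsilon> this is the logarithm of the integrand of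
  \<open>nn_integral_sequential_quadratic\<close>: the coefficient \<open>c\<close> of the squares
  becomes \<open>c / \<epsilon>\<close>, the increments have variance
  \<open>\<epsilon> * lm i * dt\<close>, and \<epsilon> drops out of the denominator of the
  compensator.\<close>

definition exponent :: "real \<Rightarrow> (nat \<Rightarrow> 'i \<Rightarrow> real) \<Rightarrow> nat \<Rightarrow> nat \<Rightarrow> real \<Rightarrow> (nat \<times> 'i \<Rightarrow> real) \<Rightarrow> real" where
 "exponent c \<psi> l N dt \<xi> = (\<Sum>i\<in>I. c * (\<xi> (0, i))\<^sup>2) + (\<Sum>j<N. \<Sum>i\<in>I. control c \<psi> l dt j i \<xi> * \<xi> (Suc j, i)
   + c * (\<xi> (Suc j, i))\<^sup>2 - lm i * dt * (control c \<psi> l dt j i \<xi>)\<^sup>2 / (2 * (1 - 2 * c * lm i * dt)))"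

text \<open>Insert the increment of the scheme for \<open>\<xi>\<close>: the squares telescope to
  the final energy, the drift contributes \<open>- 2 c\<close> times its product with the new state,
  and the only remainder is \<open>c * (dt * drift)^2\<close>, which is nonnegative and
  dropped.\<close>

lemma exponent_ge:
 assumes c: "0 \<le> c"
 shows "(\<Sum>i\<in>I. c * (euler dt \<xi> N i)\<^sup>2) + (\<Sum>j<N. \<Sum>i\<in>I. \<psi> (j div l) i * \<xi> (Suc j, i))
   + dt * (\<Sum>j<N. \<Sum>i\<in>I. - 2 * c * (euler dt \<xi> (Suc j) i * drift (euler dt \<xi> j) i)
       - lm i * (control c \<psi> l dt j i \<xi>)\<^sup>2 / (2 * (1 - 2 * c * lm i * dt)))
  \<le> exponent c \<psi> l N dt \<xi>"
proof (induction N)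
 case 0
 then show ?case by (simp add: exponent_def)
next
 case (Suc N)
 let ?Y = "euler dt \<xi>" and ?K = "\<lambda>i. control c \<psi> l dt N i \<xi>"
 let ?b = "drift (?Y N)"
 have "(\<Sum>i\<in>I. c * (?Y (Suc N) i)\<^sup>2 - c * (?Y N i)\<^sup>2 + \<psi> (N div l) i * \<xi> (Suc N, i)
   + dt * (- 2 * c * (?Y (Suc N) i * ?b i) - lm i * (?K i)\<^sup>2 / (2 * (1 - 2 * c * lm i * dt))))
  \<le> (\<Sum>i\<in>I. ?K i * \<xi> (Suc N, i) + c * (\<xi> (Suc N, i))\<^sup>2 - lm i * dt * (?K i)\<^sup>2 / (2 * (1 - 2 * c * lm i * dt)))"
 proof (rule sum_mono)
  fix i
  have "?K i * \<xi> (Suc N, i) + c * (\<xi> (Suc N, i))\<^sup>2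
    = \<psi> (N div l) i * \<xi> (Suc N, i) + c * (?Y (Suc N) i)\<^sup>2 - c * (?Y N i)\<^sup>2 - 2 * c * dt * (?Y (Suc N) i * ?b i) + c * (dt * ?b i)\<^sup>2"
   unfolding control_def euler.simps by (simp add: power2_eq_square algebra_simps)
  moreover have "0 \<le> c * (dt * ?b i)\<^sup>2" using c by simp
  ultimately show "c * (?Y (Suc N) i)\<^sup>2 - c * (?Y N i)\<^sup>2 + \<psi> (N div l) i * \<xi> (Suc N, i)
   + dt * (- 2 * c * (?Y (Suc N) i * ?b i) - lm i * (?K i)\<^sup>2 / (2 * (1 - 2 * c * lm i * dt)))
   \<le> ?K i * \<xi> (Suc N, i) + c * (\<xi> (Suc N, i))\<^sup>2 - lm i * dt * (?K i)\<^sup>2 / (2 * (1 - 2 * c * lm i * dt))"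
   by (simp add: algebra_simps)
 qed
 with Suc.IH show ?case
  unfolding exponent_def sum.lessThan_Suc sum.distrib sum_subtractf distrib_left sum_distrib_left[symmetric] right_diff_distrib
  by linarith
qed

text \<open>The limit of the lower bound on \<open>exponent\<close>, after the energy identity has
  cancelled the nonlinear work. From the dissipation there would remain
  \<open>2 * c * (1 - c)\<close> times its integral; being nonnegative, it is left out.\<close>

definition energy_functional :: "real \<Rightarrow> (nat \<Rightarrow> 'i \<Rightarrow> real) \<Rightarrow> nat \<Rightarrow> real \<Rightarrow> (real \<Rightarrow> 'i \<Rightarrow> real) \<Rightarrow> (real \<Rightarrow> 'i \<Rightarrow> real) \<Rightarrow> real" where
 "energy_functional c \<psi> n0 T X w = (\<Sum>i\<in>I. c * (X T i)\<^sup>2)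
   + (\<Sum>r<n0. \<Sum>i\<in>I. \<psi> r i * (w (real (Suc r) * (T / n0)) i - w (real r * (T / n0)) i))
   - (\<integral>s. (\<Sum>i\<in>I. lm i * (2 * c * \<psi> (nat \<lfloor>s * real n0 / T\<rfloor>) i * X s i + (\<psi> (nat \<lfloor>s * real n0 / T\<rfloor>) i)\<^sup>2 / 2)) \<partial>lebesgue_on {0..T})"

text \<open>Only a lower bound in the limit is required, since the moment is estimated from above.
  All terms of \<open>exponent_ge\<close> converge along the refined grids, and what is discarded
  has the right sign for \<open>c\<close> between 0 and 1.\<close>

lemma exponent_liminf:
 assumes T: "0 < T" and sol: "solves T X w" and c: "0 \<le> c" "c \<le> 1" and n0: "0 < n0" and e: "0 < e"
 shows "eventually (\<lambda>n. energy_functional c \<psi> n0 T X w - e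
   \<le> exponent c \<psi> (Suc n) (n0 * Suc n) (T / (n0 * Suc n)) (increments (T / (n0 * Suc n)) X w)) sequentially"
proof -
 \<comment> \<open>Every grid refines the coarse grid of \<open>n0\<close> cells, so
   \<open>\<psi>\<close> is constant on the cells and no error arises at its jumps.\<close>
 define N where "N n = n0 * Suc n" for n
 define dt where "dt n = T / N n" for n
 define \<xi> where "\<xi> n = increments (dt n) X w" for n
 define Y where "Y n = euler (dt n) (\<xi> n)" for n
 have N: "0 < N n" "n < N n" for n
 proof -
  have "1 * Suc n \<le> n0 * Suc n" using n0 by (intro mult_le_mono1) simp
  then show "0 < N n" "n < N n" using n0 by (simp_all add: N_def)
 qed
 have dt: "0 < dt n" for n using T N by (simp add: dt_def)
 have N_lim: "filterlim N at_top sequentially"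
  by (rule filterlim_at_top_mono[OF filterlim_ident]) (intro always_eventually allI less_imp_le N(2))
 have dt_lim: "dt \<longlonglongrightarrow> 0"
 proof -
  have "filterlim (\<lambda>n. real (N n)) at_top sequentially"
   by (rule filterlim_compose[OF filterlim_real_sequentially N_lim])
  then show ?thesis unfolding dt_def by (rule real_tendsto_divide_at_top[OF tendsto_const])
 qed
 have cont: "\<And>i. i \<in> I \<Longrightarrow> continuous_on {0..T} (\<lambda>t. X t i)" using sol unfolding solves_def by blast
 obtain R where R: "0 \<le> R" "\<And>i t. i \<in> I \<Longrightarrow> t \<in> {0..T} \<Longrightarrow> \<bar>X t i\<bar> \<le> R"
  by (rule bounded_coordinates[OF cont]) blast+
 have conv: "eventually (\<lambda>n. \<forall>j\<le>N n. \<forall>i\<in>I. \<bar>Y n j i - X (real j * dt n) i\<bar> \<le> \<delta>) sequentially" if \<delta>: "0 < \<delta>" for \<delta>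
 proof -
  obtain N0 where N0: "\<And>M j. M \<ge> N0 \<Longrightarrow> 0 < M \<Longrightarrow> j \<le> M \<Longrightarrow>
   (\<Sum>i\<in>I. \<bar>euler (T / real M) (increments (T / real M) X w) j i - X (real j * (T / real M)) i\<bar>) \<le> \<delta>"
   by (rule euler_converges[OF T sol \<delta>]) blast
  have "eventually (\<lambda>n. N0 \<le> N n) sequentially" using N_lim unfolding filterlim_at_top by blast
  then show ?thesis
  proof eventually_elim
   case (elim n)
   show ?case
   proof (intro allI impI ballI)
    fix j i assume j: "j \<le> N n" and i: "i \<in> I"
    have "\<bar>Y n j i - X (real j * dt n) i\<bar> \<le> (\<Sum>i\<in>I. \<bar>Y n j i - X (real j * dt n) i\<bar>)"
     using i finite_I by (intro member_le_sum) auto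
    also have "\<dots> \<le> \<delta>" using N0[OF elim N(1) j] by (simp add: Y_def \<xi>_def dt_def)
    finally show "\<bar>Y n j i - X (real j * dt n) i\<bar> \<le> \<delta>" .
   qed
  qed
 qed
 have tT: "real j * dt n \<in> {0..T}" if "j \<le> N n" for j n
 proof -
  have "real j * dt n \<le> real (N n) * dt n" using that dt[of n] by (intro mult_right_mono) auto
  moreover have "real (N n) * dt n = T" using N[of n] by (simp add: dt_def)
  ultimately show ?thesis using dt[of n] by simp
 qed
 have Ybd: "eventually (\<lambda>n. \<forall>j\<le>N n. \<forall>i\<in>I. \<bar>Y n j i\<bar> \<le> R + 1) sequentially"
  using conv[OF zero_less_one]
 proof eventually_elim
  case (elim n)
  show ?case
  proof (intro allI impI ballI)
   fix j i assume "j \<le> N n" "i \<in> I"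
   then have "\<bar>Y n j i - X (real j * dt n) i\<bar> \<le> 1" "\<bar>X (real j * dt n) i\<bar> \<le> R" using elim R(2) tT by auto
   then show "\<bar>Y n j i\<bar> \<le> R + 1" by linarith
  qed
 qed
 define J where "J s n = nat \<lfloor>s * real (N n) / T\<rfloor>" for s n
 have J: "J s n < N n" "real (J s n) * dt n \<le> s" "s < real (Suc (J s n)) * dt n" if s: "s \<in> {0..<T}" for s n
 proof -
  have "0 \<le> s * real (N n) / T" using s T by simp
  then have fl: "real (J s n) \<le> s * real (N n) / T" "s * real (N n) / T < real (J s n) + 1"
   unfolding J_def by linarith+
  have "s * real (N n) / T < real (N n)" using s T N[of n] by (simp add: field_simps)
  then show "J s n < N n" using fl(1) by linarith
  show "real (J s n) * dt n \<le> s" "s < real (Suc (J s n)) * dt n"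
   using fl T N[of n] by (simp_all add: dt_def field_simps)
 qed
 have Ylim: "(\<lambda>n. Y n (k n) i) \<longlonglongrightarrow> X s i"
  if s: "s \<in> {0..<T}" and i: "i \<in> I" and k: "\<And>n. k n \<le> N n" "\<And>n. \<bar>real (k n) * dt n - s\<bar> \<le> dt n" for s i k
 proof -
  have "(\<lambda>n. real (k n) * dt n - s) \<longlonglongrightarrow> 0"
   by (rule Lim_null_comparison[OF _ dt_lim]) (use k(2) in simp)
  then have "(\<lambda>n. real (k n) * dt n) \<longlonglongrightarrow> s" by (rule LIM_zero_cancel)
  then have 1: "(\<lambda>n. X (real (k n) * dt n) i) \<longlonglongrightarrow> X s i"
   using s k(1) tT by (intro continuous_on_tendsto_compose[OF cont[OF i]]) auto
  have "(\<lambda>n. Y n (k n) i - X (real (k n) * dt n) i) \<longlonglongrightarrow> 0"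
  proof (rule tendstoI)
   fix \<delta> :: real assume "0 < \<delta>"
   then have "0 < \<delta> / 2" by simp
   from conv[OF this] show "eventually (\<lambda>n. dist (Y n (k n) i - X (real (k n) * dt n) i) 0 < \<delta>) sequentially"
   proof eventually_elim
    case (elim n)
    then have "\<bar>Y n (k n) i - X (real (k n) * dt n) i\<bar> \<le> \<delta> / 2" using k(1) i by blast
    then show ?case using \<open>0 < \<delta>\<close> by simp
   qed
  qed
  from tendsto_add[OF this 1] show ?thesis by simp
 qed
 have abs_step: "\<bar>real (J s n) * dt n - s\<bar> \<le> dt n" "\<bar>real (Suc (J s n)) * dt n - s\<bar> \<le> dt n" if "s \<in> {0..<T}" for s n
  using J(2,3)[OF that, of n] by (auto simp: algebra_simps)
 have div: "J s n div Suc n = nat \<lfloor>s * real n0 / T\<rfloor>" if s: "s \<in> {0..<T}" for s n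
 proof -
  have "s * real (N n) / T = (s * real n0 / T) * real (Suc n)" by (simp only: N_def of_nat_mult times_divide_eq_left mult.assoc)
  moreover have "0 \<le> s * real n0 / T" using s T by simp
  ultimately show ?thesis unfolding J_def by (simp only: nat_floor_mult_div zero_less_Suc)
 qed
 define G where "G n j = (\<Sum>i\<in>I. - 2 * c * (Y n (Suc j) i * drift (Y n j) i)
       - lm i * (control c \<psi> (Suc n) (dt n) j i (\<xi> n))\<^sup>2 / (2 * (1 - 2 * c * lm i * dt n)))" for n j
 \<comment> \<open>The factor 0 stands for the limit of \<open>dt n\<close>; written this way the
   limit of \<open>G\<close> follows term by term.\<close>
 define g where "g s = (\<Sum>i\<in>I. - 2 * c * (X s i * drift (X s) i)
       - lm i * (\<psi> (nat \<lfloor>s * real n0 / T\<rfloor>) i + 2 * c * X s i)\<^sup>2 / (2 * (1 - 2 * c * lm i * 0)))" for s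
 have G_lim: "(\<lambda>n. G n (J s n)) \<longlonglongrightarrow> g s" if s: "s \<in> {0..<T}" for s
  unfolding G_def g_def control_def div[OF s] Y_def[symmetric]
  using s J[OF s] abs_step[OF s] by (intro tendsto_intros Ylim dt_lim) (auto simp: Suc_le_eq less_imp_le)
 have R1: "0 \<le> R + 1" using R by simp
 obtain L where L: "0 \<le> L"
  "\<And>x y i. (\<And>k. k \<in> I \<Longrightarrow> \<bar>x k\<bar> \<le> R + 1) \<Longrightarrow> (\<And>k. k \<in> I \<Longrightarrow> \<bar>y k\<bar> \<le> R + 1) \<Longrightarrow> i \<in> I \<Longrightarrow>
    \<bar>drift x i - drift y i\<bar> \<le> L * (\<Sum>k\<in>I. \<bar>x k - y k\<bar>)"
  by (rule drift_lipschitz[OF R1]) blast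
 define D where "D = L * (\<Sum>k\<in>I. R + 1)"
 have D: "\<bar>drift x i\<bar> \<le> D" if "\<And>k. k \<in> I \<Longrightarrow> \<bar>x k\<bar> \<le> R + 1" "i \<in> I" for x i
 proof -
  have "drift (\<lambda>_. 0) i = 0" by (simp add: drift_def)
  then have "\<bar>drift x i\<bar> \<le> L * (\<Sum>k\<in>I. \<bar>x k\<bar>)" using L(2)[of x "\<lambda>_. 0" i] that R1 by simp
  also have "\<dots> \<le> D" unfolding D_def using L(1) that by (intro mult_left_mono sum_mono) auto
  finally show ?thesis .
 qed
 define P where "P = (\<Sum>r<n0. \<Sum>i\<in>I. \<bar>\<psi> r i\<bar>)"
 have P: "\<bar>\<psi> r i\<bar> \<le> P" if "r < n0" "i \<in> I" for r i
 proof -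
  have "\<bar>\<psi> r i\<bar> \<le> (\<Sum>i\<in>I. \<bar>\<psi> r i\<bar>)" using that finite_I by (intro member_le_sum) auto
  also have "\<dots> \<le> P" unfolding P_def using that by (intro member_le_sum[of r "{..<n0}" "\<lambda>r. \<Sum>i\<in>I. \<bar>\<psi> r i\<bar>"]) (auto intro!: sum_nonneg)
  finally show ?thesis .
 qed
 have den: "eventually (\<lambda>n. \<forall>i\<in>I. 1 \<le> 2 * (1 - 2 * c * lm i * dt n)) sequentially"
 proof (intro eventually_ball_finite[OF finite_I] ballI)
  fix i
  have "(\<lambda>n. 2 * (1 - 2 * c * lm i * dt n)) \<longlonglongrightarrow> 2 * (1 - 2 * c * lm i * 0)" by (intro tendsto_intros dt_lim)
  then have "eventually (\<lambda>n. 1 < 2 * (1 - 2 * c * lm i * dt n)) sequentially"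
   by (rule order_tendstoD(1)) simp
  then show "eventually (\<lambda>n. 1 \<le> 2 * (1 - 2 * c * lm i * dt n)) sequentially"
   by eventually_elim simp
 qed
 have G_bound: "eventually (\<lambda>n. \<forall>j<N n. \<bar>G n j\<bar> \<le> (\<Sum>i\<in>I. 2 * c * ((R + 1) * D) + lm i * (P + 2 * c * (R + 1))\<^sup>2)) sequentially"
  using Ybd den
 proof eventually_elim
  case (elim n)
  show ?case
  proof (intro allI impI)
   fix j assume j: "j < N n"
   show "\<bar>G n j\<bar> \<le> (\<Sum>i\<in>I. 2 * c * ((R + 1) * D) + lm i * (P + 2 * c * (R + 1))\<^sup>2)"
    unfolding G_def
   proof (intro order_trans[OF sum_abs] sum_mono)
    fix i assume i: "i \<in> I"
    let ?K = "control c \<psi> (Suc n) (dt n) j i (\<xi> n)" and ?d = "2 * (1 - 2 * c * lm i * dt n)"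
    have Y1: "\<bar>Y n j k\<bar> \<le> R + 1" "\<bar>Y n (Suc j) k\<bar> \<le> R + 1" if "k \<in> I" for k using elim(1) j that by auto
    have "j div Suc n < n0" using j n0 by (simp add: N_def less_mult_imp_div_less)
    then have "\<bar>?K\<bar> \<le> P + 2 * c * (R + 1)"
     unfolding control_def Y_def[symmetric]
     using P[OF _ i, of "j div Suc n"] Y1(1)[OF i] c mult_left_mono[OF Y1(1)[OF i], of "2 * c"]
     by (intro order_trans[OF abs_triangle_ineq] add_mono) (auto simp: abs_mult)
    then have K2: "?K\<^sup>2 \<le> (P + 2 * c * (R + 1))\<^sup>2" by (metis abs_ge_zero power2_abs power_mono)
    have d: "1 \<le> ?d" using elim(2) i by blast
    have dv: "x / d \<le> x" "0 \<le> x / d" if "0 \<le> x" "1 \<le> d" for x d :: real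
     using that mult_left_mono[OF that(2,1)] by (auto simp: divide_le_eq)
    have x0: "0 \<le> lm i * ?K\<^sup>2" using lm_pos[OF i] by simp
    have "lm i * ?K\<^sup>2 / ?d \<le> lm i * ?K\<^sup>2" by (rule dv(1)[OF x0 d])
    also have "\<dots> \<le> lm i * (P + 2 * c * (R + 1))\<^sup>2" using K2 lm_pos[OF i] by (simp add: mult_left_mono)
    finally have 1: "lm i * ?K\<^sup>2 / ?d \<le> lm i * (P + 2 * c * (R + 1))\<^sup>2" .
    have 0: "0 \<le> lm i * ?K\<^sup>2 / ?d" by (rule dv(2)[OF x0 d])
    have "\<bar>Y n (Suc j) i * drift (Y n j) i\<bar> \<le> (R + 1) * D"
     unfolding abs_mult using Y1 D[of "Y n j"] i R1 by (intro mult_mono) auto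
    then have "\<bar>- 2 * c * (Y n (Suc j) i * drift (Y n j) i)\<bar> \<le> 2 * c * ((R + 1) * D)"
     using c by (simp add: abs_mult mult_left_mono)
    then show "\<bar>- 2 * c * (Y n (Suc j) i * drift (Y n j) i) - lm i * ?K\<^sup>2 / ?d\<bar>
      \<le> 2 * c * ((R + 1) * D) + lm i * (P + 2 * c * (R + 1))\<^sup>2"
     using 0 1 by linarith
   qed
  qed
 qed
 have RS: "(\<lambda>n. dt n * (\<Sum>j<N n. G n j)) \<longlonglongrightarrow> (\<integral>s. g s \<partial>lebesgue_on {0..T})"
  unfolding dt_def using riemann_sums_tendsto[OF T N(1) G_bound G_lim[unfolded J_def]] .
 have endp: "(\<lambda>n. Y n (N n) i) \<longlonglongrightarrow> X T i" if i: "i \<in> I" for i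
 proof (rule tendstoI)
  fix \<delta> :: real assume "0 < \<delta>"
  then have "0 < \<delta> / 2" by simp
  from conv[OF this] show "eventually (\<lambda>n. dist (Y n (N n) i) (X T i) < \<delta>) sequentially"
  proof eventually_elim
   case (elim n)
   then have "\<bar>Y n (N n) i - X (real (N n) * dt n) i\<bar> \<le> \<delta> / 2" using i by blast
   moreover have "real (N n) * dt n = T" using N[of n] by (simp add: dt_def)
   ultimately show ?case using \<open>0 < \<delta>\<close> by (simp add: dist_real_def)
  qed
 qed
 \<comment> \<open>Within a coarse cell \<open>\<psi>\<close> is constant, so the fine increments of
   the noise telescope and the tested noise does not depend on \<open>n\<close> at all.\<close>
 have tele: "(\<Sum>j<N n. \<Sum>i\<in>I. \<psi> (j div Suc n) i * \<xi> n (Suc j, i))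
   = (\<Sum>r<n0. \<Sum>i\<in>I. \<psi> r i * (w (real (Suc r) * (T / n0)) i - w (real r * (T / n0)) i))" for n
 proof -
  have "(\<Sum>j<N n. \<Sum>i\<in>I. \<psi> (j div Suc n) i * \<xi> n (Suc j, i))
   = (\<Sum>r<n0. \<Sum>j = r * Suc n..<r * Suc n + Suc n. \<Sum>i\<in>I. \<psi> (j div Suc n) i * \<xi> n (Suc j, i))"
   unfolding N_def by (rule sum.nat_group[symmetric])
  also have "\<dots> = (\<Sum>r<n0. \<Sum>i\<in>I. \<psi> r i * (w (real (Suc r) * (T / n0)) i - w (real r * (T / n0)) i))"
  proof (intro sum.cong refl)
   fix r
   have "(\<Sum>j = r * Suc n..<r * Suc n + Suc n. \<Sum>i\<in>I. \<psi> (j div Suc n) i * \<xi> n (Suc j, i))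
    = (\<Sum>j = r * Suc n..<r * Suc n + Suc n. \<Sum>i\<in>I. \<psi> r i * (w (real (Suc j) * dt n) i - w (real j * dt n) i))"
   proof (intro sum.cong refl)
    fix j i assume "j \<in> {r * Suc n..<r * Suc n + Suc n}"
    then have "j div Suc n = r" by (intro div_nat_eqI) (auto simp: mult.commute)
    then show "\<psi> (j div Suc n) i * \<xi> n (Suc j, i) = \<psi> r i * (w (real (Suc j) * dt n) i - w (real j * dt n) i)"
     by (simp add: \<xi>_def increments_def)
   qed
   also have "\<dots> = (\<Sum>i\<in>I. \<psi> r i * (\<Sum>j = r * Suc n..<r * Suc n + Suc n. w (real (Suc j) * dt n) i - w (real j * dt n) i))"
    unfolding sum_distrib_left by (rule sum.swap)
   also have "\<dots> = (\<Sum>i\<in>I. \<psi> r i * (w (real (Suc r) * (T / n0)) i - w (real r * (T / n0)) i))"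
   proof (intro sum.cong refl arg_cong[where f="\<lambda>t. _ * t"])
    fix i
    have "(\<Sum>j = r * Suc n..<r * Suc n + Suc n. w (real (Suc j) * dt n) i - w (real j * dt n) i)
     = w (real (r * Suc n + Suc n) * dt n) i - w (real (r * Suc n) * dt n) i"
     using sum_Suc_diff'[of "r * Suc n" "r * Suc n + Suc n" "\<lambda>j. w (real j * dt n) i"] by simp
    moreover have "real (r * Suc n + Suc n) * dt n = real (Suc r) * (T / n0)" "real (r * Suc n) * dt n = real r * (T / n0)"
    proof -
     have cancel: "(a * k) * (T / (real n0 * k)) = a * (T / n0)" if "k \<noteq> 0" for a k :: real using that by simp
     have "real (r * Suc n + Suc n) = real (Suc r) * real (Suc n)" "real (r * Suc n) = real r * real (Suc n)"
      unfolding of_nat_mult[symmetric] by simp_all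
     then show "real (r * Suc n + Suc n) * dt n = real (Suc r) * (T / n0)" "real (r * Suc n) * dt n = real r * (T / n0)"
      unfolding dt_def N_def of_nat_mult[of n0] using cancel[of "real (Suc n)"] by (simp_all only: of_nat_neq_0 not_False_eq_True)
    qed
    ultimately show "(\<Sum>j = r * Suc n..<r * Suc n + Suc n. w (real (Suc j) * dt n) i - w (real j * dt n) i)
      = w (real (Suc r) * (T / n0)) i - w (real r * (T / n0)) i" by simp
   qed
   finally show "(\<Sum>j = r * Suc n..<r * Suc n + Suc n. \<Sum>i\<in>I. \<psi> (j div Suc n) i * \<xi> n (Suc j, i))
    = (\<Sum>i\<in>I. \<psi> r i * (w (real (Suc r) * (T / n0)) i - w (real r * (T / n0)) i))" .
  qed
  finally show ?thesis .
 qed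
 define S where "S = (\<Sum>r<n0. \<Sum>i\<in>I. \<psi> r i * (w (real (Suc r) * (T / n0)) i - w (real r * (T / n0)) i))"
 have lim: "(\<lambda>n. (\<Sum>i\<in>I. c * (Y n (N n) i)\<^sup>2) + S + dt n * (\<Sum>j<N n. G n j))
   \<longlonglongrightarrow> (\<Sum>i\<in>I. c * (X T i)\<^sup>2) + S + (\<integral>s. g s \<partial>lebesgue_on {0..T})"
  by (intro tendsto_intros RS endp)
 let ?h = "\<lambda>s. \<Sum>i\<in>I. lm i * (2 * c * \<psi> (nat \<lfloor>s * real n0 / T\<rfloor>) i * X s i + (\<psi> (nat \<lfloor>s * real n0 / T\<rfloor>) i)\<^sup>2 / 2)"
 \<comment> \<open>By the energy identity the drift term becomes \<open>2 * c\<close> times the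
   dissipation. The square in the compensator takes back \<open>2 * c^2\<close> times it, and
   \<open>c \<le> 1\<close> makes the difference nonnegative.\<close>
 have ge: "- (\<integral>s. ?h s \<partial>lebesgue_on {0..T}) \<le> (\<integral>s. g s \<partial>lebesgue_on {0..T})"
 proof -
  let ?M = "lebesgue_on {0..T}"
  have g_eq: "g s = (\<Sum>i\<in>I. lm i * (2 * c * (X s i)\<^sup>2 - (\<psi> (nat \<lfloor>s * real n0 / T\<rfloor>) i + 2 * c * X s i)\<^sup>2 / 2))" for s
  proof -
   have "g s = - 2 * c * (\<Sum>i\<in>I. X s i * drift (X s) i) - (\<Sum>i\<in>I. lm i * (\<psi> (nat \<lfloor>s * real n0 / T\<rfloor>) i + 2 * c * X s i)\<^sup>2 / 2)"
    unfolding g_def sum_subtractf sum_distrib_left by simp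
   then show ?thesis unfolding drift_energy
    by (simp add: sum_distrib_left right_diff_distrib sum_subtractf sum_negf mult_ac)
  qed
  have Xm: "(\<lambda>s. X s i) \<in> borel_measurable ?M" if "i \<in> I" for i
   using cont[OF that] by (intro continuous_imp_measurable_on_sets_lebesgue) auto
  have \<psi>m: "(\<lambda>s. \<psi> (nat \<lfloor>s * real n0 / T\<rfloor>) i) \<in> borel_measurable ?M" for i
  proof -
   have "(\<lambda>s. \<psi> (nat \<lfloor>s * real n0 / T\<rfloor>) i) \<in> borel_measurable borel" by measurable
   then have "(\<lambda>s. \<psi> (nat \<lfloor>s * real n0 / T\<rfloor>) i) \<in> borel_measurable lebesgue" by (intro measurable_completion) simp
   then show ?thesis by (rule measurable_restrict_space1)
  qed
  have fin: "finite_measure ?M" by (rule finite_measure_lebesgue_on) auto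
  interpret finite_measure ?M by (rule fin)
  \<comment> \<open>At \<open>s = T\<close> the cell index equals \<open>n0\<close>, outside the
    range covered by \<open>P\<close>; the extra summand bounds \<open>\<psi> n0\<close>.\<close>
  define P' where "P' = P + (\<Sum>i\<in>I. \<bar>\<psi> n0 i\<bar>)"
  have \<psi>b: "\<bar>\<psi> (nat \<lfloor>s * real n0 / T\<rfloor>) i\<bar> \<le> P'" if "s \<in> {0..T}" "i \<in> I" for s i
  proof -
   have "s * real n0 / T \<le> n0" using that T by (simp add: field_simps mult_right_mono)
   then have "nat \<lfloor>s * real n0 / T\<rfloor> \<le> n0" by linarith
   moreover have "0 \<le> P" unfolding P_def by (intro sum_nonneg) auto
   moreover have "\<bar>\<psi> n0 i\<bar> \<le> (\<Sum>i\<in>I. \<bar>\<psi> n0 i\<bar>)" using that finite_I by (intro member_le_sum) auto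
   moreover have "0 \<le> (\<Sum>i\<in>I. \<bar>\<psi> n0 i\<bar>)" by (intro sum_nonneg) auto
   ultimately show ?thesis
    using P[OF _ that(2), of "nat \<lfloor>s * real n0 / T\<rfloor>"] unfolding P'_def
    by (cases "nat \<lfloor>s * real n0 / T\<rfloor> = n0") (simp, linarith)
  qed
  have int: "integrable ?M (\<lambda>s. a s * b s)" if "a \<in> borel_measurable ?M" "b \<in> borel_measurable ?M"
   "\<And>s. s \<in> {0..T} \<Longrightarrow> \<bar>a s\<bar> \<le> A1" "\<And>s. s \<in> {0..T} \<Longrightarrow> \<bar>b s\<bar> \<le> B1" for a b :: "real \<Rightarrow> real" and A1 B1
  proof (rule integrable_const_bound[where B="A1 * B1"])
   show "AE s in ?M. norm (a s * b s) \<le> A1 * B1"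
   proof (rule AE_I2)
    fix s assume "s \<in> space ?M"
    then have s: "s \<in> {0..T}" by simp
    have "0 \<le> A1" using that(3)[OF s] by linarith
    then show "norm (a s * b s) \<le> A1 * B1"
     using that(3)[OF s] that(4)[OF s] by (simp add: abs_mult mult_mono)
   qed
  qed (use that in measurable)
  have i1: "integrable ?M (\<lambda>s. \<psi> (nat \<lfloor>s * real n0 / T\<rfloor>) i * X s i)" "integrable ?M (\<lambda>s. (\<psi> (nat \<lfloor>s * real n0 / T\<rfloor>) i)\<^sup>2)"
    "integrable ?M (\<lambda>s. (X s i)\<^sup>2)" if "i \<in> I" for i
   unfolding power2_eq_square
   by (rule int[OF \<psi>m Xm[OF that] \<psi>b R(2)], use that in auto)
     (rule int[OF \<psi>m \<psi>m \<psi>b \<psi>b] int[OF Xm[OF that] Xm[OF that] R(2) R(2)], use that in auto)+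
  have "(\<integral>s. - ?h s \<partial>?M) \<le> (\<integral>s. g s \<partial>?M)"
  proof (rule integral_mono)
   have "integrable ?M (\<lambda>s. \<Sum>i\<in>I. - lm i * (2 * c * (\<psi> (nat \<lfloor>s * real n0 / T\<rfloor>) i * X s i) + (\<psi> (nat \<lfloor>s * real n0 / T\<rfloor>) i)\<^sup>2 / 2))"
    using i1 by (intro Bochner_Integration.integrable_sum integrable_mult_right Bochner_Integration.integrable_add integrable_divide) auto
   then show "integrable ?M (\<lambda>s. - ?h s)" by (simp add: sum_negf mult.assoc)
   have "integrable ?M (\<lambda>s. \<Sum>i\<in>I. lm i * ((2 * c - 2 * c\<^sup>2) * (X s i)\<^sup>2 - (\<psi> (nat \<lfloor>s * real n0 / T\<rfloor>) i)\<^sup>2 / 2 - 2 * c * (\<psi> (nat \<lfloor>s * real n0 / T\<rfloor>) i * X s i)))"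
    using i1 by (intro Bochner_Integration.integrable_sum integrable_mult_right Bochner_Integration.integrable_diff integrable_divide) auto
   moreover have "(2 * c - 2 * c\<^sup>2) * x\<^sup>2 - y\<^sup>2 / 2 - 2 * c * (y * x) = 2 * c * x\<^sup>2 - (y + 2 * c * x)\<^sup>2 / 2" for x y :: real
    by (simp add: power2_eq_square field_simps)
   ultimately show "integrable ?M g" unfolding g_eq by simp
   fix s
   show "- ?h s \<le> g s"
    unfolding g_eq sum_negf[symmetric]
   proof (rule sum_mono)
    fix i assume i: "i \<in> I"
    let ?p = "\<psi> (nat \<lfloor>s * real n0 / T\<rfloor>) i" and ?x = "X s i"
    have "c\<^sup>2 \<le> c" using c by (simp add: power2_eq_square mult_left_le)
    then have "0 \<le> (2 * c - 2 * c\<^sup>2) * ?x\<^sup>2" by simp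
    then have "- (2 * c * ?p * ?x + ?p\<^sup>2 / 2) \<le> 2 * c * ?x\<^sup>2 - (?p + 2 * c * ?x)\<^sup>2 / 2"
     by (simp add: power2_eq_square field_simps)
    then show "- (lm i * (2 * c * ?p * ?x + ?p\<^sup>2 / 2)) \<le> lm i * (2 * c * ?x\<^sup>2 - (?p + 2 * c * ?x)\<^sup>2 / 2)"
     unfolding mult_minus_right[symmetric] by (rule mult_left_mono) (use lm_pos[OF i] in simp)
   qed
  qed
  then show ?thesis by simp
 qed
 have E_le: "energy_functional c \<psi> n0 T X w \<le> (\<Sum>i\<in>I. c * (X T i)\<^sup>2) + S + (\<integral>s. g s \<partial>lebesgue_on {0..T})"
  using ge unfolding energy_functional_def S_def by linarith
 have "eventually (\<lambda>n. energy_functional c \<psi> n0 T X w - e < (\<Sum>i\<in>I. c * (Y n (N n) i)\<^sup>2) + S + dt n * (\<Sum>j<N n. G n j)) sequentially"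
  using E_le e by (intro order_tendstoD(1)[OF lim]) linarith
 then show ?thesis
 proof eventually_elim
  case (elim n)
  have "(\<Sum>i\<in>I. c * (Y n (N n) i)\<^sup>2) + S + dt n * (\<Sum>j<N n. G n j) \<le> exponent c \<psi> (Suc n) (N n) (dt n) (\<xi> n)"
   using exponent_ge[OF c(1), where \<xi>="\<xi> n" and dt="dt n" and N="N n" and \<psi>=\<psi> and l="Suc n"]
   unfolding tele S_def[symmetric] G_def Y_def .
  then show ?case using elim by (simp add: \<xi>_def dt_def N_def)
 qed
qed

end

context quadratic_drift
begin

lemma drift_cong: "(\<And>k. k \<in> I \<Longrightarrow> x k = y k) \<Longrightarrow> i \<in> I \<Longrightarrow> drift x i = drift y i"
 unfolding drift_def by (auto intro!: sum.cong)

text \<open>Adaptedness: step \<open>j\<close> depends only on the rows up to \<open>j\<close>. This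
  is what permits the rows to be integrated one after the other.\<close>

lemma euler_restrict:
 assumes "j \<le> l" "i \<in> I"
 shows "euler dt (restrict x ({..l} \<times> I)) j i = euler dt x j i"
 using assms
proof (induction j arbitrary: i)
 case 0 then show ?case by simp
next
 case (Suc j)
 then have "drift (euler dt (restrict x ({..l} \<times> I)) j) i = drift (euler dt x j) i"
  by (intro drift_cong Suc.IH) auto
 moreover have "restrict x ({..l} \<times> I) (Suc j, i) = x (Suc j, i)" using Suc.prems by simp
 moreover have "euler dt (restrict x ({..l} \<times> I)) j i = euler dt x j i" using Suc.prems by (intro Suc.IH) auto
 ultimately show ?case unfolding euler.simps by (simp only:)
qed

lemma exponent_restrict: "exponent c \<psi> l N dt (restrict x ({..N} \<times> I)) = exponent c \<psi> l N dt x"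
 unfolding exponent_def control_def
 by (intro arg_cong2[where f="(+)"] sum.cong refl) (auto simp: euler_restrict)

lemma euler_measurable:
 assumes "i \<in> I"
 shows "(\<lambda>x. euler dt x j i) \<in> borel_measurable (PiM ({..j} \<times> I) (\<lambda>_. borel))"
proof -
 have "(\<lambda>x. euler dt x j i) \<in> borel_measurable (PiM ({..l} \<times> I) (\<lambda>_. borel))" if "j \<le> l" "i \<in> I" for j l i
  using that
 proof (induction j arbitrary: i)
  case 0
  then show ?case by simp
 next
  case (Suc j)
  then show ?case unfolding euler.simps drift_def
   by (intro borel_measurable_add borel_measurable_diff borel_measurable_times borel_measurable_sum
     borel_measurable_const measurable_component_singleton Suc.IH) auto
 qed
 then show ?thesis using assms by blast
qed

text \<open>Markov's inequality is applied to the lower limit of the exponentials, not to a single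
  one, since convergence along a path has no uniform rate; Fatou bounds its mean by the limit of
  moments that are known exactly once the step is small. \<open>A\<close> need not be
  measurable.\<close>

lemma probability_bound:
 fixes M :: "'a measure" and X w :: "'a \<Rightarrow> real \<Rightarrow> 'i \<Rightarrow> real"
 assumes M: "prob_space M" and I_ne: "I \<noteq> {}" and T: "0 < T" and eps: "0 < ep"
  and c: "0 \<le> c" "c < 1" and n0: "0 < n0" and e: "0 < e"
  and sol: "AE z in M. solves T (X z) (w z)"
  and indep: "\<And>N. 0 < N \<Longrightarrow> prob_space.indep_vars M (\<lambda>_. borel)
    (\<lambda>p z. increments (T / real N) (X z) (w z) p) ({..N} \<times> I)"
  and law_0: "\<And>N i. 0 < N \<Longrightarrow> i \<in> I \<Longrightarrow>
    distr M borel (\<lambda>z. increments (T / real N) (X z) (w z) (0, i)) = centred_normal (ep / 2)"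
  and law_Suc: "\<And>N j i. j < N \<Longrightarrow> i \<in> I \<Longrightarrow>
    distr M borel (\<lambda>z. increments (T / real N) (X z) (w z) (Suc j, i)) = centred_normal (ep * lm i * (T / real N))"
  and A: "AE z in M. z \<in> A \<longrightarrow> \<kappa> \<le> energy_functional c \<psi> n0 T (X z) (w z)"
 shows "emeasure M A \<le> ennreal (exp ((e - \<kappa>) / ep) * ((1 / sqrt (1 - c)) ^ card I * exp (c * T * (\<Sum>i\<in>I. lm i))))"
proof -
 interpret prob_space M by fact
 define N where "N n = n0 * Suc n" for n
 define dt where "dt n = T / real (N n)" for n
 have N: "0 < N n" "n \<le> N n" for n
 proof -
  have "1 * Suc n \<le> n0 * Suc n" using n0 by (intro mult_le_mono1) simp
  then show "0 < N n" "n \<le> N n" using n0 by (simp_all add: N_def)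
 qed
 have dt: "0 < dt n" for n using T N by (simp add: dt_def)
 have N_lim: "filterlim N at_top sequentially"
  by (rule filterlim_at_top_mono[OF filterlim_ident]) (intro always_eventually allI N(2))
 have dt_lim: "dt \<longlonglongrightarrow> 0"
  unfolding dt_def
  by (rule real_tendsto_divide_at_top[OF tendsto_const filterlim_compose[OF filterlim_real_sequentially N_lim]])
 define \<xi> where "\<xi> n z = (\<lambda>p. increments (dt n) (X z) (w z) p)" for n z
 define E where "E n x = exponent c \<psi> (Suc n) (N n) (dt n) x" for n x
 define Z where "Z n z = ennreal (exp (E n (\<xi> n z) / ep))" for n z
 define R where "R n z = restrict (\<xi> n z) ({..N n} \<times> I)" for n z
 have ind: "indep_vars (\<lambda>_. borel) (\<lambda>p z. \<xi> n z p) ({..N n} \<times> I)" for n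
  using indep[OF N(1)] by (simp add: \<xi>_def dt_def)
 have rv: "(\<lambda>z. \<xi> n z p) \<in> borel_measurable M" if "p \<in> {..N n} \<times> I" for n p
  using ind[of n] that unfolding indep_vars_def by auto
 \<comment> \<open>The point mass at indices outside \<open>I\<close> only makes every factor a
   probability measure, as the product construction demands.\<close>
 define \<nu> where "\<nu> n p = (if snd p \<in> I then (if fst p = 0 then centred_normal (ep / 2) else centred_normal (ep * lm (snd p) * dt n)) else return borel 0)" for n and p :: "nat \<times> 'i"
 have \<nu>_sets [simp]: "sets (\<nu> n p) = sets borel" for n p by (simp add: \<nu>_def)
 have \<nu>_prob: "prob_space (\<nu> n p)" for n p
  unfolding \<nu>_def using eps lm_pos dt[of n]
  by (auto intro!: prob_space_centred_normal prob_space_return mult_nonneg_nonneg less_imp_le)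
 have R_meas: "R n \<in> measurable M (PiM ({..N n} \<times> I) (\<lambda>_. borel))" for n
  unfolding R_def restrict_def by (rule measurable_restrict[unfolded restrict_def]) (use rv in auto)
 have law: "distr M (PiM ({..N n} \<times> I) (\<lambda>_. borel)) (R n) = PiM ({..N n} \<times> I) (\<nu> n)" for n
 proof -
  have "distr M (PiM ({..N n} \<times> I) (\<lambda>_. borel)) (R n)
    = PiM ({..N n} \<times> I) (\<lambda>p. distr M borel (\<lambda>z. \<xi> n z p))"
   unfolding R_def
   using indep_vars_iff_distr_eq_PiM'[of "{..N n} \<times> I" "\<lambda>p z. \<xi> n z p" "\<lambda>_. borel"] ind[of n] rv I_ne by auto
  also have "\<dots> = PiM ({..N n} \<times> I) (\<nu> n)"
  proof (rule PiM_cong[OF refl])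
   fix p assume p: "p \<in> {..N n} \<times> I"
   show "distr M borel (\<lambda>z. \<xi> n z p) = \<nu> n p"
   proof (cases "fst p")
    case 0
    then show ?thesis using p law_0[OF N(1)[of n], of "snd p"] by (cases p) (simp add: \<xi>_def \<nu>_def dt_def)
   next
    case (Suc j)
    then show ?thesis using p law_Suc[of j "N n" "snd p"] by (cases p) (simp add: \<xi>_def \<nu>_def dt_def)
   qed
  qed
  finally show ?thesis .
 qed
 have comp: "(\<lambda>x. x p) \<in> borel_measurable (PiM ({..N n} \<times> I) (\<lambda>_. borel))" if "p \<in> {..N n} \<times> I" for n p
  using that by (rule measurable_component_singleton)
 have ctl: "(\<lambda>x. control c \<psi> l D j i x) \<in> borel_measurable (PiM ({..j} \<times> I) (\<lambda>_. borel))" if "i \<in> I" for l D j i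
  unfolding control_def using euler_measurable[OF that] by (intro borel_measurable_add borel_measurable_times) auto
 have ctl': "(\<lambda>x. control c \<psi> l D j i x) \<in> borel_measurable (PiM ({..N n} \<times> I) (\<lambda>_. borel))" if "i \<in> I" "j \<le> N n" for l D j i n
 proof -
  have "(\<lambda>x. restrict x ({..j} \<times> I)) \<in> measurable (PiM ({..N n} \<times> I) (\<lambda>_. borel)) (PiM ({..j} \<times> I) (\<lambda>_. borel))"
   using that by (intro measurable_restrict_subset) auto
  from measurable_compose[OF this ctl[OF that(1)]] show ?thesis
   using that by (simp add: control_def euler_restrict)
 qed
 have E_meas: "E n \<in> borel_measurable (PiM ({..N n} \<times> I) (\<lambda>_. borel))" for n
  unfolding E_def exponent_def
  by (intro borel_measurable_add borel_measurable_sum borel_measurable_diff borel_measurable_times borel_measurable_divide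
    borel_measurable_power borel_measurable_const comp ctl') auto
 have Z_R: "Z n z = ennreal (exp (E n (R n z) / ep))" for n z
  by (simp add: Z_def R_def E_def exponent_restrict)
 have Em: "(\<lambda>x. ennreal (exp (E n x / ep))) \<in> borel_measurable (PiM ({..N n} \<times> I) (\<lambda>_. borel))" for n
  using E_meas by measurable
 have Z_meas [measurable]: "Z n \<in> borel_measurable M" for n
  using measurable_compose[OF R_meas Em] by (simp add: Z_R[symmetric])
 define C where "C n = (\<Prod>i\<in>I. 1 / sqrt (1 - c)) * (\<Prod>i\<in>I. 1 / sqrt (1 - 2 * c * lm i * dt n)) ^ N n" for n
 have den: "eventually (\<lambda>n. \<forall>i\<in>I. 0 < 1 - 2 * c * lm i * dt n) sequentially"
 proof (intro eventually_ball_finite[OF finite_I] ballI)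
  fix i
  have "(\<lambda>n. 1 - 2 * c * lm i * dt n) \<longlonglongrightarrow> 1 - 2 * c * lm i * 0" by (intro tendsto_intros dt_lim)
  then show "eventually (\<lambda>n. 0 < 1 - 2 * c * lm i * dt n) sequentially"
   by (rule order_tendstoD(1)) simp
 qed
 have Z_int: "eventually (\<lambda>n. (\<integral>\<^sup>+ z. Z n z \<partial>M) = ennreal (C n)) sequentially"
  using den
 proof eventually_elim
  case (elim n)
  let ?K = "\<lambda>j i x. control c \<psi> (Suc n) (dt n) j i x / ep" and ?v = "\<lambda>i. ep * lm i * dt n"
  have "(\<integral>\<^sup>+ z. Z n z \<partial>M) = (\<integral>\<^sup>+ x. ennreal (exp (E n x / ep)) \<partial>distr M (PiM ({..N n} \<times> I) (\<lambda>_. borel)) (R n))"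
   unfolding Z_R using Em by (intro nn_integral_distr[symmetric] R_meas) (simp only: measurable_distr_eq1)
  also have "\<dots> = (\<integral>\<^sup>+ x. (\<Prod>i\<in>I. ennreal (exp (c / ep * (x (0, i))\<^sup>2))) *
      (\<Prod>j<N n. \<Prod>i\<in>I. ennreal (exp (?K j i (restrict x ({..j} \<times> I)) * x (Suc j, i) + c / ep * (x (Suc j, i))\<^sup>2
         - (?K j i (restrict x ({..j} \<times> I)))\<^sup>2 * ?v i / (2 * (1 - 2 * (c / ep) * ?v i)))))
      \<partial>PiM ({..N n} \<times> I) (\<nu> n))"
   unfolding law
  proof (intro nn_integral_cong)
   fix x
   have "E n x / ep = (\<Sum>i\<in>I. c / ep * (x (0, i))\<^sup>2) + (\<Sum>j<N n. \<Sum>i\<in>I. ?K j i (restrict x ({..j} \<times> I)) * x (Suc j, i) + c / ep * (x (Suc j, i))\<^sup>2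
         - (?K j i (restrict x ({..j} \<times> I)))\<^sup>2 * ?v i / (2 * (1 - 2 * (c / ep) * ?v i)))"
    unfolding E_def exponent_def add_divide_distrib sum_divide_distrib
   proof (intro arg_cong2[where f="(+)"] sum.cong refl)
    fix i j assume i: "i \<in> I"
    have K: "control c \<psi> (Suc n) (dt n) j i (restrict x ({..j} \<times> I)) = control c \<psi> (Suc n) (dt n) j i x"
     using i by (simp add: control_def euler_restrict)
    have v: "2 * (c / ep) * ?v i = 2 * c * lm i * dt n" using eps by simp
    have "(k / ep)\<^sup>2 * (ep * l * d) / q = (l * d * k\<^sup>2 / q) / ep" for k l d q :: real
     using eps by (simp add: power2_eq_square mult_ac)
    then show "(control c \<psi> (Suc n) (dt n) j i x * x (Suc j, i) + c * (x (Suc j, i))\<^sup>2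
      - lm i * dt n * (control c \<psi> (Suc n) (dt n) j i x)\<^sup>2 / (2 * (1 - 2 * c * lm i * dt n))) / ep
     = ?K j i (restrict x ({..j} \<times> I)) * x (Suc j, i) + c / ep * (x (Suc j, i))\<^sup>2
         - (?K j i (restrict x ({..j} \<times> I)))\<^sup>2 * ?v i / (2 * (1 - 2 * (c / ep) * ?v i))"
     unfolding K v by (simp add: diff_divide_distrib add_divide_distrib)
   qed simp
   then show "ennreal (exp (E n x / ep)) = (\<Prod>i\<in>I. ennreal (exp (c / ep * (x (0, i))\<^sup>2))) *
      (\<Prod>j<N n. \<Prod>i\<in>I. ennreal (exp (?K j i (restrict x ({..j} \<times> I)) * x (Suc j, i) + c / ep * (x (Suc j, i))\<^sup>2
         - (?K j i (restrict x ({..j} \<times> I)))\<^sup>2 * ?v i / (2 * (1 - 2 * (c / ep) * ?v i)))))"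
    by (simp add: exp_add exp_sum finite_I prod_ennreal prod_nonneg ennreal_mult)
  qed
  also have "\<dots> = (\<Prod>i\<in>I. ennreal (1 / sqrt (1 - 2 * (c / ep) * (ep / 2)))) * (\<Prod>i\<in>I. ennreal (1 / sqrt (1 - 2 * (c / ep) * ?v i))) ^ N n"
  proof (rule nn_integral_sequential_quadratic[OF finite_I])
   show "0 < ep / 2" "2 * (c / ep) * (ep / 2) < 1" using eps c by auto
   show "0 < ?v i" if "i \<in> I" for i using eps lm_pos[OF that] dt[of n] by simp
   show "2 * (c / ep) * ?v i < 1" if "i \<in> I" for i
   proof -
    have "2 * (c / ep) * ?v i = 2 * c * lm i * dt n" using eps by simp
    then show ?thesis using elim that by force
   qed
   show "?K j i \<in> borel_measurable (PiM ({..j} \<times> I) (\<lambda>_. borel))" if "i \<in> I" for j i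
    using ctl[OF that] by (intro borel_measurable_divide) auto
  qed (auto simp: \<nu>_prob, auto simp: \<nu>_def)
  also have "\<dots> = ennreal (C n)"
  proof -
   have v: "2 * (c / ep) * ?v i = 2 * c * lm i * dt n" "2 * (c / ep) * (ep / 2) = c" for i using eps by simp_all
   have nn: "0 \<le> 1 / sqrt (1 - c)" "\<And>i. i \<in> I \<Longrightarrow> 0 \<le> 1 / sqrt (1 - 2 * c * lm i * dt n)"
    using c elim by (auto simp: less_imp_le)
   have p: "(\<Prod>i\<in>I. ennreal (1 / sqrt (1 - c))) = ennreal (\<Prod>i\<in>I. 1 / sqrt (1 - c))"
    "(\<Prod>i\<in>I. ennreal (1 / sqrt (1 - 2 * c * lm i * dt n))) = ennreal (\<Prod>i\<in>I. 1 / sqrt (1 - 2 * c * lm i * dt n))"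
    using nn by (intro prod_ennreal; blast)+
   have q: "0 \<le> (\<Prod>i\<in>I. 1 / sqrt (1 - c))" "0 \<le> (\<Prod>i\<in>I. 1 / sqrt (1 - 2 * c * lm i * dt n))"
    using nn by (intro prod_nonneg; blast)+
   show ?thesis
    unfolding v p C_def ennreal_power[OF q(2)] by (rule ennreal_mult[symmetric, OF q(1) zero_le_power[OF q(2)]])
  qed
  finally show ?case .
 qed
 \<comment> \<open>Each mode contributes \<open>(1 - 2 * c * lm i * T / N) ^ N\<close> to the power
   -1/2, which tends to \<open>exp (c * T * lm i)\<close>. Here the trace of the damping enters,
   later to be beaten by the scaling of \<open>m\<close>.\<close>
 have C_lim: "C \<longlonglongrightarrow> (1 / sqrt (1 - c)) ^ card I * exp (c * T * (\<Sum>i\<in>I. lm i))"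
 proof -
  have one: "(\<lambda>n. (1 / sqrt (1 - 2 * c * lm i * dt n)) ^ N n) \<longlonglongrightarrow> exp (c * T * lm i)" for i
  proof -
   have "(\<lambda>n. (1 + (- 2 * c * lm i * T) / real (N n)) ^ N n) \<longlonglongrightarrow> exp (- 2 * c * lm i * T)"
    by (rule filterlim_compose[OF tendsto_exp_limit_sequentially N_lim])
   then have "(\<lambda>n. 1 / sqrt ((1 + (- 2 * c * lm i * T) / real (N n)) ^ N n)) \<longlonglongrightarrow> 1 / sqrt (exp (- 2 * c * lm i * T))"
    by (intro tendsto_intros) auto
   moreover have "1 / sqrt (exp (- 2 * c * lm i * T)) = exp (c * T * lm i)"
   proof -
    have "exp (- 2 * c * lm i * T) = (exp (- (c * T * lm i)))\<^sup>2" by (simp add: exp_double[symmetric] power2_eq_square flip: exp_add)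
    then show ?thesis by (simp add: exp_minus inverse_eq_divide)
   qed
   moreover have "1 / sqrt ((1 + (- 2 * c * lm i * T) / real (N n)) ^ N n) = (1 / sqrt (1 - 2 * c * lm i * dt n)) ^ N n" for n
    by (simp add: real_sqrt_power power_one_over dt_def)
   ultimately show ?thesis by simp
  qed
  have "(\<lambda>n. (\<Prod>i\<in>I. 1 / sqrt (1 - c)) * (\<Prod>i\<in>I. (1 / sqrt (1 - 2 * c * lm i * dt n)) ^ N n))
    \<longlonglongrightarrow> (\<Prod>i\<in>I. 1 / sqrt (1 - c)) * (\<Prod>i\<in>I. exp (c * T * lm i))"
   by (intro tendsto_intros one)
  then show ?thesis
   unfolding C_def by (simp add: prod_power_distrib sum_distrib_left exp_sum finite_I)
 qed
 \<comment> \<open>A measurable set containing \<open>A\<close> up to a null set, in the form to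
   which Markov's inequality applies.\<close>
 define S where "S = {z \<in> space M. 1 \<le> ennreal (exp ((e - \<kappa>) / ep)) * liminf (\<lambda>n. Z n z)}"
 have lim_meas: "(\<lambda>z. liminf (\<lambda>n. Z n z)) \<in> borel_measurable M" by measurable
 have "emeasure M A \<le> emeasure M S"
 proof (rule emeasure_mono_AE)
  show "S \<in> sets M" unfolding S_def using lim_meas by measurable
  show "AE z in M. z \<in> A \<longrightarrow> z \<in> S"
   using A sol AE_space
  proof eventually_elim
   case (elim z)
   show ?case
   proof
    assume "z \<in> A"
    then have \<kappa>: "\<kappa> \<le> energy_functional c \<psi> n0 T (X z) (w z)" using elim by blast
    have "eventually (\<lambda>n. energy_functional c \<psi> n0 T (X z) (w z) - e \<le> E n (\<xi> n z)) sequentially"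
     using exponent_liminf[OF T elim(2) c(1) less_imp_le[OF c(2)] n0 e, of \<psi>]
     unfolding E_def \<xi>_def dt_def N_def of_nat_mult by simp
    then have "eventually (\<lambda>n. ennreal (exp ((\<kappa> - e) / ep)) \<le> Z n z) sequentially"
    proof eventually_elim
     case (elim n)
     then have "(\<kappa> - e) / ep \<le> E n (\<xi> n z) / ep" using \<kappa> eps by (intro divide_right_mono) auto
     then show ?case unfolding Z_def by (intro ennreal_leI) simp
    qed
    then have "ennreal (exp ((\<kappa> - e) / ep)) \<le> liminf (\<lambda>n. Z n z)" by (rule Liminf_bounded)
    then have "ennreal (exp ((e - \<kappa>) / ep)) * ennreal (exp ((\<kappa> - e) / ep)) \<le> ennreal (exp ((e - \<kappa>) / ep)) * liminf (\<lambda>n. Z n z)"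
     by (rule mult_left_mono) simp
    moreover have "ennreal (exp ((e - \<kappa>) / ep)) * ennreal (exp ((\<kappa> - e) / ep)) = 1"
    proof -
     have "exp ((e - \<kappa>) / ep) * exp ((\<kappa> - e) / ep) = 1"
      unfolding exp_add[symmetric] add_divide_distrib[symmetric] by simp
     then show ?thesis by (simp flip: ennreal_mult)
    qed
    ultimately show "z \<in> S" using elim(3) by (simp add: S_def)
   qed
  qed
 qed
 also have "emeasure M S \<le> ennreal (exp ((e - \<kappa>) / ep)) * (\<integral>\<^sup>+ z. liminf (\<lambda>n. Z n z) * indicator (space M) z \<partial>M)"
  unfolding S_def using lim_meas by (intro nn_integral_Markov_inequality) measurable
 also have "(\<integral>\<^sup>+ z. liminf (\<lambda>n. Z n z) * indicator (space M) z \<partial>M) = (\<integral>\<^sup>+ z. liminf (\<lambda>n. Z n z) \<partial>M)"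
  by (intro nn_integral_cong) simp
 also have "\<dots> \<le> liminf (\<lambda>n. \<integral>\<^sup>+ z. Z n z \<partial>M)" by (intro nn_integral_liminf) simp
 also have "\<dots> = ennreal ((1 / sqrt (1 - c)) ^ card I * exp (c * T * (\<Sum>i\<in>I. lm i)))"
 proof (rule lim_imp_Liminf)
  have "(\<lambda>n. ennreal (C n)) \<longlonglongrightarrow> ennreal ((1 / sqrt (1 - c)) ^ card I * exp (c * T * (\<Sum>i\<in>I. lm i)))"
   using C_lim by (rule tendsto_ennrealI)
  then show "(\<lambda>n. \<integral>\<^sup>+ z. Z n z \<partial>M) \<longlonglongrightarrow> ennreal ((1 / sqrt (1 - c)) ^ card I * exp (c * T * (\<Sum>i\<in>I. lm i)))"
   by (rule Lim_transform_eventually) (use Z_int in \<open>auto elim: eventually_mono\<close>)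
 qed simp
 finally show ?thesis using c by (simp add: ennreal_mult mult_left_mono)
qed

end

section \<open>The Galerkin equation\<close>

lemma Hm_Hinf: "x \<in> Hm m \<Longrightarrow> x \<in> Hinf"
proof -
 assume x: "x \<in> Hm m"
 have "x \<in> Lam_dom r" for r
  unfolding Lam_dom_def
  using summable_on_finite[OF finite_modes, of "\<lambda>k. (lam r k * coef x k)\<^sup>2" m] Hm_coef_0[OF x]
  by (subst (asm) summable_on_cong_neutral[where T=UNIV and g="\<lambda>k. (lam r k * coef x k)\<^sup>2"]) auto
 then show ?thesis using Hm_H[OF x] by (simp add: Hinf_iff)
qed

lemma nl_linear: "linear (\<lambda>tet. nl p tet \<eta>)" "linear (nl p tet)"
proof -
 have R: "Riesz1 (f + g) = Riesz1 f + Riesz1 g" "Riesz2 (f + g) = Riesz2 f + Riesz2 g"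
  "Riesz1 (c *\<^sub>R f) = c *\<^sub>R Riesz1 f" "Riesz2 (c *\<^sub>R f) = c *\<^sub>R Riesz2 f" for f g c
  by (rule coef_eqI, simp add: coef_Riesz coef_simps algebra_simps)+
 have C: "comm q (f + g) = comm q f + comm q g" "comm q (c *\<^sub>R f) = c *\<^sub>R comm q f" for q f g c
  by (rule coef_eqI, simp add: coef_comm coef_simps comm_coef_def field_simps)+
 show "linear (\<lambda>tet. nl p tet \<eta>)" "linear (nl p tet)"
  unfolding nl_def by (rule linearI; simp add: R C inner_simps algebra_simps)+
qed

lemma nl_expand:
 "nl p (\<Sum>j\<in>F. x j *\<^sub>R cas j) (\<Sum>k\<in>F. x k *\<^sub>R cas k) = (\<Sum>j\<in>F. \<Sum>k\<in>F. nl p (cas j) (cas k) * x j * x k)"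
proof -
 have "nl p (\<Sum>j\<in>F. x j *\<^sub>R cas j) (\<Sum>k\<in>F. x k *\<^sub>R cas k) = (\<Sum>j\<in>F. nl p (x j *\<^sub>R cas j) (\<Sum>k\<in>F. x k *\<^sub>R cas k))"
  by (rule linear_sum[OF nl_linear(1)])
 then show ?thesis unfolding linear_sum[OF nl_linear(2)]
  by (simp add: linear_cmul[OF nl_linear(1)] linear_cmul[OF nl_linear(2)] mult_ac)
qed

lemma nl_Hm: "x \<in> Hm m \<Longrightarrow> nl p x x = (\<Sum>j\<in>modes m. \<Sum>k\<in>modes m. nl p (cas j) (cas k) * coef x j * coef x k)"
 using nl_expand[of p "coef x" "modes m"] Hm_expand[of x m] by simp

lemma galerkin_quadratic_drift: "quadratic_drift (modes m) (lam (2 * al)) (\<lambda>i j k. nl i (cas j) (cas k))"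
proof
 show "0 < lam (2 * al) i" if "i \<in> modes m" for i using lam_pos modes_nonzero[OF that] by simp
 fix x :: "int \<times> int \<Rightarrow> real"
 let ?v = "\<Sum>k\<in>modes m. x k *\<^sub>R cas k"
 have v: "?v \<in> Hm m" by (rule sum_cas_Hm)
 have cv: "coef ?v k = x k" if "k \<in> modes m" for k
  using that by (simp add: coef_simps coef_cas if_distrib[where f="\<lambda>t. _ * t"] cong: if_cong)
 have "(\<Sum>i\<in>modes m. coef ?v i * nl i ?v ?v) = 0" by (rule nl_energy[OF v])
 then show "(\<Sum>i\<in>modes m. x i * (\<Sum>j\<in>modes m. \<Sum>k\<in>modes m. nl i (cas j) (cas k) * x j * x k)) = 0"
  unfolding nl_expand by (simp add: cv)
qed simp

lemma (in prob_space) expectation_cis_centred_normal: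
 assumes X: "X \<in> borel_measurable M" and d: "distr M borel X = centred_normal v" and v: "0 \<le> v"
 shows "expectation (\<lambda>w. cis (t * X w)) = of_real (exp (- v * t\<^sup>2 / 2))"
proof -
 have "expectation (\<lambda>w. cis (t * X w)) = (\<integral>x. cis (t * x) \<partial>distr M borel X)"
  using X by (intro integral_distr[symmetric]) (auto simp: cis_conv_exp)
 then show ?thesis unfolding d using char_centred_normal[OF v] by simp
qed

lemma cylindrical_wiener_sum:
 assumes W: "cylindrical_wiener M W" and A: "finite A" and t: "\<And>p. p \<in> A \<Longrightarrow> 0 \<le> t p \<and> h p \<in> H"
 shows "distr M borel (\<lambda>w. \<Sum>p\<in>A. c p * W (t p) (h p) w)
  = centred_normal (\<Sum>p\<in>A. \<Sum>q\<in>A. c p * c q * min (t p) (t q) * (h p \<bullet> h q))"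
proof -
 obtain b where b: "bij_betw b {0..<card A} A" using ex_bij_betw_nat_finite[OF A] by blast
 then have b': "bij_betw b {..<card A} A" by (simp add: atLeast0LessThan)
 have tb: "0 \<le> t (b i) \<and> h (b i) \<in> H" if "i < card A" for i
  using t bij_betwE[OF b'] that by auto
 have W3: "\<forall>n (c :: nat \<Rightarrow> real) t h. (\<forall>i<n. 0 \<le> t i \<and> h i \<in> H) \<longrightarrow>
    distr M borel (\<lambda>w. \<Sum>i<n. c i * W (t i) (h i) w)
    = centred_normal (\<Sum>i<n. \<Sum>j<n. c i * c j * min (t i) (t j) * (h i \<bullet> h j))"
  using W unfolding cylindrical_wiener_def by (elim conjE)
 have "distr M borel (\<lambda>w. \<Sum>i<card A. c (b i) * W (t (b i)) (h (b i)) w)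
   = centred_normal (\<Sum>i<card A. \<Sum>j<card A. c (b i) * c (b j) * min (t (b i)) (t (b j)) * (h (b i) \<bullet> h (b j)))"
  by (rule W3[THEN spec[of _ "card A"], THEN spec[of _ "\<lambda>i. c (b i)"], THEN spec[of _ "\<lambda>i. t (b i)"],
     THEN spec[of _ "\<lambda>i. h (b i)"], THEN mp]) (use tb in blast)
 moreover have "(\<Sum>i<card A. c (b i) * W (t (b i)) (h (b i)) w) = (\<Sum>p\<in>A. c p * W (t p) (h p) w)" for w
  by (rule sum.reindex_bij_betw[OF b'])
 moreover have "(\<Sum>i<card A. \<Sum>j<card A. c (b i) * c (b j) * min (t (b i)) (t (b j)) * (h (b i) \<bullet> h (b j)))
   = (\<Sum>p\<in>A. \<Sum>q\<in>A. c p * c q * min (t p) (t q) * (h p \<bullet> h q))"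
  using sum.reindex_bij_betw[OF b', of "\<lambda>p. \<Sum>q\<in>A. c p * c q * min (t p) (t q) * (h p \<bullet> h q)"]
   sum.reindex_bij_betw[OF b', of "\<lambda>q. c p * c q * min (t p) (t q) * (h p \<bullet> h q)" for p] by simp
 ultimately show ?thesis by simp
qed

text \<open>The covariance of Brownian increments over cells \<open>j\<close> and \<open>k\<close>:
  disjoint cells are uncorrelated, and one cell has variance \<open>dt\<close>.\<close>

lemma min_increment:
 assumes "0 \<le> (dt :: real)"
 shows "min (real (Suc j) * dt) (real (Suc k) * dt) - min (real (Suc j) * dt) (real k * dt)
   - min (real j * dt) (real (Suc k) * dt) + min (real j * dt) (real k * dt) = (if j = k then dt else 0)"
proof -
 have m: "min (real a * dt) (real b * dt) = real (min a b) * dt" for a b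
 proof (cases "a \<le> b")
  case True
  then have "real a * dt \<le> real b * dt" using assms by (intro mult_right_mono) auto
  then show ?thesis using True by (simp add: min_def)
 next
  case False
  then have "real b * dt \<le> real a * dt" using assms by (intro mult_right_mono) auto
  then show ?thesis using False by (simp add: min_def)
 qed
 have "real (min (Suc j) (Suc k)) - real (min (Suc j) k) - real (min j (Suc k)) + real (min j k) = (if j = k then 1 else 0)"
  by (cases j k rule: linorder_cases) (simp_all add: min_absorb1 min_absorb2 Suc_leI)
 then have "(real (min (Suc j) (Suc k)) - real (min (Suc j) k) - real (min j (Suc k)) + real (min j k)) * dt = (if j = k then dt else 0)"
  by simp
 then show ?thesis unfolding m by (simp only: left_diff_distrib distrib_right)
qed

text \<open>Both variables generate smaller \<sigma>-algebras than those assumed independent: the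
  first is a continuous function of \<open>\<xi>\<close>, the second a finite sum of generators of
  the noise \<sigma>-algebra.\<close>

lemma (in prob_space) independent_of_noise_indep_var:
 assumes ind: "independent_of_noise M W \<xi>" and \<xi>: "\<xi> \<in> borel_measurable M"
  and W: "\<And>t h. 0 \<le> t \<Longrightarrow> h \<in> H \<Longrightarrow> W t h \<in> borel_measurable M"
  and A: "finite A" and t: "\<And>p. p \<in> A \<Longrightarrow> 0 \<le> t p \<and> h p \<in> H"
 shows "indep_var borel (\<lambda>w. \<xi> w \<bullet> x) borel (\<lambda>w. \<Sum>p\<in>A. c p * W (t p) (h p) w)"
proof -
 let ?gen = "{W t h -` B \<inter> space M |t h B. 0 \<le> t \<and> h \<in> H \<and> B \<in> sets borel}"
 let ?X = "\<lambda>w. \<xi> w \<bullet> x" and ?Y = "\<lambda>w. \<Sum>p\<in>A. c p * W (t p) (h p) w"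
 have inner_m: "(\<lambda>y. y \<bullet> x) \<in> borel_measurable borel"
  by (intro borel_measurable_continuous_onI continuous_intros)
 have X: "?X \<in> borel_measurable M" using measurable_compose[OF \<xi> inner_m] .
 have Y: "?Y \<in> borel_measurable M" using W t by (intro borel_measurable_sum borel_measurable_times) auto
 define \<Sigma> where "\<Sigma> = sigma (space M) ?gen"
 have gen_sub: "?gen \<subseteq> Pow (space M)" by auto
 have sets_\<Sigma>: "sets \<Sigma> = sigma_sets (space M) ?gen" unfolding \<Sigma>_def using gen_sub by (rule sets_measure_of)
 have space_\<Sigma>: "space \<Sigma> = space M" unfolding \<Sigma>_def using gen_sub by (rule space_measure_of)
 have W\<Sigma>: "W s g \<in> borel_measurable \<Sigma>" if "0 \<le> s" "g \<in> H" for s g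
 proof (rule measurableI)
  fix B :: "real set" assume "B \<in> sets borel"
  then have "W s g -` B \<inter> space M \<in> ?gen" using that by blast
  then show "W s g -` B \<inter> space \<Sigma> \<in> sets \<Sigma>" unfolding space_\<Sigma> sets_\<Sigma> by (rule sigma_sets.Basic)
 qed simp
 have Y\<Sigma>: "?Y \<in> borel_measurable \<Sigma>" using W\<Sigma> t by (intro borel_measurable_sum borel_measurable_times) auto
 have subY: "sigma_sets (space M) {?Y -` B \<inter> space M |B. B \<in> sets borel} \<subseteq> sigma_sets (space M) ?gen"
 proof (rule sigma_sets_mono)
  show "{?Y -` B \<inter> space M |B. B \<in> sets borel} \<subseteq> sigma_sets (space M) ?gen"
   using measurable_sets[OF Y\<Sigma>] unfolding space_\<Sigma> sets_\<Sigma> by blast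
 qed
 define V where "V = vimage_algebra (space M) \<xi> borel"
 have sets_V: "sets V = {\<xi> -` B \<inter> space M |B. B \<in> sets borel}" unfolding V_def by (rule sets_vimage_algebra2) simp
 have space_V: "space V = space M" by (simp add: V_def)
 have subX: "sigma_sets (space M) {?X -` B \<inter> space M |B. B \<in> sets borel} \<subseteq> {\<xi> -` B \<inter> space M |B. B \<in> sets borel}"
 proof -
  have "{?X -` B \<inter> space M |B. B \<in> sets borel} \<subseteq> sets V"
  proof
   fix S assume "S \<in> {?X -` B \<inter> space M |B. B \<in> sets borel}"
   then obtain B where B: "B \<in> sets borel" "S = ?X -` B \<inter> space M" by blast
   have "(\<lambda>y. y \<bullet> x) -` B \<in> sets borel" using measurable_sets[OF inner_m B(1)] by simp
   moreover have "S = \<xi> -` ((\<lambda>y. y \<bullet> x) -` B) \<inter> space M" unfolding B(2) by auto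
   ultimately show "S \<in> sets V" unfolding sets_V by blast
  qed
  then have "sigma_sets (space V) {?X -` B \<inter> space M |B. B \<in> sets borel} \<subseteq> sets V" by (rule sets.sigma_sets_subset)
  then show ?thesis unfolding sets_V space_V .
 qed
 have "indep_set {\<xi> -` B \<inter> space M |B. B \<in> sets borel} (sigma_sets (space M) ?gen)"
  using ind unfolding independent_of_noise_def .
 then have "indep_set (sigma_sets (space M) {?X -` B \<inter> space M |B. B \<in> sets borel}) (sigma_sets (space M) {?Y -` B \<inter> space M |B. B \<in> sets borel})"
  unfolding indep_set_def by (rule indep_sets_mono_sets) (use subX subY in \<open>auto split: bool.split\<close>)
 then show ?thesis unfolding indep_var_eq using X Y by simp
qed

locale galerkin = prob_space M for M :: "'a measure" +
 fixes W :: "real \<Rightarrow> l2 \<Rightarrow> 'a \<Rightarrow> real" and al T ep :: real and m :: nat and \<Theta> :: "'a \<Rightarrow> real \<Rightarrow> l2"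
 assumes T_pos: "0 < T" and eps_pos: "0 < ep" and m_pos: "0 < m"
  and wiener: "cylindrical_wiener M W"
  and solution: "galerkin_solution M W al T ep m \<Theta>"
  and initial: "gaussian_on_H (\<lambda>h. (ep / 2) *\<^sub>R Pm m h) (distr M borel (\<lambda>w. \<Theta> w 0))"
  and independent: "independent_of_noise M W (\<lambda>w. \<Theta> w 0)"
begin

sublocale quadratic_drift "modes m" "lam (2 * al)" "\<lambda>i j k. nl i (cas j) (cas k)"
 by (rule galerkin_quadratic_drift)

definition X :: "'a \<Rightarrow> real \<Rightarrow> int \<times> int \<Rightarrow> real" where
 "X w t i = coef (\<Theta> w t) i"

definition noise :: "'a \<Rightarrow> real \<Rightarrow> int \<times> int \<Rightarrow> real" where
 "noise w t i = sqrt ep * W t (lam al i *\<^sub>R cas i) w"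

lemma \<Theta>_Hm: "w \<in> space M \<Longrightarrow> t \<in> {0..T} \<Longrightarrow> \<Theta> w t \<in> Hm m"
 and \<Theta>_continuous: "w \<in> space M \<Longrightarrow> continuous_on {0..T} (\<Theta> w)"
 using solution unfolding galerkin_solution_def by auto

lemma X_continuous: "w \<in> space M \<Longrightarrow> continuous_on {0..T} (\<lambda>t. X w t i)"
 unfolding X_def coef_def by (intro continuous_intros \<Theta>_continuous)

lemma drift_X:
 assumes "w \<in> space M" "t \<in> {0..T}"
 shows "drift (X w t) i = - lam (2 * al) i * X w t i - nl i (\<Theta> w t) (\<Theta> w t)"
 unfolding drift_def nl_Hm[OF \<Theta>_Hm[OF assms]] X_def ..

text \<open>The exceptional null set of the equation depends on the test function. Only the finitely
  many modes of \<open>Hm m\<close> are tested, so one null set serves all of them, and on them the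
  projection acts as the identity.\<close>

lemma AE_solves: "AE w in M. solves T (X w) (noise w)"
proof -
 have "AE w in M. \<forall>i\<in>modes m. \<forall>t\<in>{0..T}.
    \<Theta> w t \<bullet> cas i = \<Theta> w 0 \<bullet> cas i
     - (\<integral>s. Lam (2 * al) (\<Theta> w s) \<bullet> cas i \<partial>lebesgue_on {0..t})
     - (\<integral>s. nonlin (\<Theta> w s) (Pm m (cas i)) \<partial>lebesgue_on {0..t})
     + sqrt ep * W t (Lam al (Pm m (cas i))) w"
 proof (rule AE_finite_allI[OF finite_modes])
  fix i assume "i \<in> modes m"
  then have "cas i \<in> H" using cas_H modes_nonzero by blast
  then show "AE w in M. \<forall>t\<in>{0..T}.
    \<Theta> w t \<bullet> cas i = \<Theta> w 0 \<bullet> cas i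
     - (\<integral>s. Lam (2 * al) (\<Theta> w s) \<bullet> cas i \<partial>lebesgue_on {0..t})
     - (\<integral>s. nonlin (\<Theta> w s) (Pm m (cas i)) \<partial>lebesgue_on {0..t})
     + sqrt ep * W t (Lam al (Pm m (cas i))) w"
   using solution unfolding galerkin_solution_def by (elim conjE) (erule bspec)
 qed
 then show ?thesis using AE_space
 proof eventually_elim
  case (elim w)
  show ?case
   unfolding solves_def
  proof (intro conjI ballI)
   fix i show "continuous_on {0..T} (\<lambda>t. X w t i)" by (rule X_continuous[OF elim(2)])
  next
   fix i t assume i: "i \<in> modes m" and t: "t \<in> {0..T}"
   have sub: "{0..t} \<subseteq> {0..T}" using t by auto
   have c1: "continuous_on {0..t} (\<lambda>s. lam (2 * al) i * X w s i)"
    using continuous_on_subset[OF X_continuous[OF elim(2)] sub] by (intro continuous_intros) auto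
   have "continuous_on {0..T} (\<lambda>s. - lam (2 * al) i * X w s i - drift (X w s) i)"
    using X_continuous[OF elim(2)] i by (intro continuous_intros drift_continuous) auto
   then have "continuous_on {0..T} (\<lambda>s. nl i (\<Theta> w s) (\<Theta> w s))"
    by (rule continuous_on_eq) (simp add: drift_X[OF elim(2)])
   then have c2: "continuous_on {0..t} (\<lambda>s. nl i (\<Theta> w s) (\<Theta> w s))" using sub by (rule continuous_on_subset)
   have leb: "(\<integral>s. f s \<partial>lebesgue_on {0..t}) = integral {0..t} f" if "continuous_on {0..t} f" for f :: "real \<Rightarrow> real"
    using that by (intro lebesgue_integral_eq_integral continuous_imp_integrable_real) auto
   have "(\<integral>s. Lam (2 * al) (\<Theta> w s) \<bullet> cas i \<partial>lebesgue_on {0..t}) = (\<integral>s. lam (2 * al) i * X w s i \<partial>lebesgue_on {0..t})"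
   proof (intro Bochner_Integration.integral_cong refl)
    fix s assume "s \<in> space (lebesgue_on {0..t})"
    then have "\<Theta> w s \<in> Lam_dom (2 * al)" using \<Theta>_Hm[OF elim(2), of s] sub Hm_Hinf by (auto simp: Hinf_iff)
    then show "Lam (2 * al) (\<Theta> w s) \<bullet> cas i = lam (2 * al) i * X w s i"
     using coef_Lam by (simp add: coef_def X_def)
   qed
   then have 1: "(\<integral>s. Lam (2 * al) (\<Theta> w s) \<bullet> cas i \<partial>lebesgue_on {0..t}) = integral {0..t} (\<lambda>s. lam (2 * al) i * X w s i)"
    using leb[OF c1] by simp
   have "(\<integral>s. nonlin (\<Theta> w s) (Pm m (cas i)) \<partial>lebesgue_on {0..t}) = (\<integral>s. nl i (\<Theta> w s) (\<Theta> w s) \<partial>lebesgue_on {0..t})"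
   proof (intro Bochner_Integration.integral_cong refl)
    fix s assume "s \<in> space (lebesgue_on {0..t})"
    then have "\<Theta> w s \<in> H" using \<Theta>_Hm[OF elim(2), of s] sub Hm_H by auto
    then show "nonlin (\<Theta> w s) (Pm m (cas i)) = nl i (\<Theta> w s) (\<Theta> w s)" by (simp add: Pm_cas[OF i] nonlin_cas)
   qed
   then have 2: "(\<integral>s. nonlin (\<Theta> w s) (Pm m (cas i)) \<partial>lebesgue_on {0..t}) = integral {0..t} (\<lambda>s. nl i (\<Theta> w s) (\<Theta> w s))"
    using leb[OF c2] by simp
   have "integral {0..t} (\<lambda>s. drift (X w s) i) = integral {0..t} (\<lambda>s. - (lam (2 * al) i * X w s i) - nl i (\<Theta> w s) (\<Theta> w s))"
    using drift_X[OF elim(2)] sub by (intro Henstock_Kurzweil_Integration.integral_cong) auto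
   also have "\<dots> = - integral {0..t} (\<lambda>s. lam (2 * al) i * X w s i) - integral {0..t} (\<lambda>s. nl i (\<Theta> w s) (\<Theta> w s))"
    using integrable_continuous_interval[OF c1] integrable_continuous_interval[OF c2]
    by (subst Henstock_Kurzweil_Integration.integral_diff) (auto simp: integrable_neg_iff)
   finally show "X w t i = X w 0 i + integral {0..t} (\<lambda>s. drift (X w s) i) + noise w t i"
    using elim(1)[rule_format, OF i t] unfolding 1 2 by (simp add: X_def coef_def noise_def Pm_cas[OF i] Lam_cas)
  qed
 qed
qed

lemma \<Theta>_0_measurable: "(\<lambda>w. \<Theta> w 0) \<in> borel_measurable M"
 using solution T_pos unfolding galerkin_solution_def by auto

lemma initial_law: "distr M borel (\<lambda>w. \<Theta> w 0 \<bullet> (\<Sum>i\<in>modes m. u i *\<^sub>R cas i)) = centred_normal (ep / 2 * (\<Sum>i\<in>modes m. (u i)\<^sup>2))"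
proof -
 let ?h = "\<Sum>i\<in>modes m. u i *\<^sub>R cas i"
 have h: "?h \<in> Hm m" by (rule sum_cas_Hm)
 have ch: "coef ?h k = (if k \<in> modes m then u k else 0)" for k
  by (auto simp: coef_simps coef_cas if_distrib[where f="\<lambda>t. _ * t"] cong: if_cong)
 have Ph: "Pm m ?h = ?h" unfolding Pm_eq using ch by simp
 have "?h \<bullet> ?h = (\<Sum>i\<in>modes m. (u i)\<^sup>2)" using norm_sum_cas[of "modes m" u] by (simp add: power2_norm_eq_inner)
 then have "distr (distr M borel (\<lambda>w. \<Theta> w 0)) borel (\<lambda>x. x \<bullet> ?h) = centred_normal (ep / 2 * (\<Sum>i\<in>modes m. (u i)\<^sup>2))"
  using initial Hm_H[OF h] unfolding gaussian_on_H_def by (simp add: Ph)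
 moreover have im: "(\<lambda>y. y \<bullet> ?h) \<in> borel_measurable borel"
  by (intro borel_measurable_continuous_onI continuous_intros)
 ultimately show ?thesis unfolding distr_distr[OF im \<Theta>_0_measurable] by (simp only: o_def)
qed

lemma noise_law:
 assumes N: "0 < N"
 defines "dt \<equiv> T / real N"
 shows "distr M borel (\<lambda>w. \<Sum>p\<in>{..<N} \<times> modes m. u p * (noise w (real (Suc (fst p)) * dt) (snd p) - noise w (real (fst p) * dt) (snd p)))
  = centred_normal (\<Sum>p\<in>{..<N} \<times> modes m. ep * lam (2 * al) (snd p) * dt * (u p)\<^sup>2)" (is ?law)
  and "indep_var borel (\<lambda>w. \<Theta> w 0 \<bullet> x) borel (\<lambda>w. \<Sum>p\<in>{..<N} \<times> modes m. u p * (noise w (real (Suc (fst p)) * dt) (snd p) - noise w (real (fst p) * dt) (snd p)))" (is ?ind)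
proof -
 have dt: "0 \<le> dt" using T_pos by (simp add: dt_def)
 let ?P = "{..<N} \<times> modes m"
 \<comment> \<open>Each increment is a difference of two noise values; the Boolean selects the later
   or the earlier one, which turns the sum into a single linear combination covered by the law of
   the Wiener process.\<close>
 let ?A = "?P \<times> (UNIV :: bool set)"
 define c where "c q = u (fst q) * sqrt ep * (if snd q then 1 else - 1)" for q :: "(nat \<times> int \<times> int) \<times> bool"
 define t where "t q = real (if snd q then Suc (fst (fst q)) else fst (fst q)) * dt" for q :: "(nat \<times> int \<times> int) \<times> bool"
 define h where "h q = lam al (snd (fst q)) *\<^sub>R cas (snd (fst q))" for q :: "(nat \<times> int \<times> int) \<times> bool"
 have split: "(\<Sum>q\<in>?A. f q) = (\<Sum>p\<in>?P. f (p, True) + f (p, False))" for f :: "(nat \<times> int \<times> int) \<times> bool \<Rightarrow> real"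
  using sum.cartesian_product[of "\<lambda>p b. f (p, b)" UNIV ?P] by (simp add: UNIV_bool add.commute)
 have sum_eq: "(\<Sum>q\<in>?A. c q * W (t q) (h q) w)
   = (\<Sum>p\<in>?P. u p * (noise w (real (Suc (fst p)) * dt) (snd p) - noise w (real (fst p) * dt) (snd p)))" for w
  unfolding split by (intro sum.cong refl) (simp add: c_def t_def h_def noise_def algebra_simps)
 have th: "0 \<le> t q \<and> h q \<in> H" if "q \<in> ?A" for q
  using that dt modes_nonzero by (auto simp: t_def h_def intro!: H_scaleR cas_H)
 have fin: "finite ?A" by simp
 have "(\<Sum>q\<in>?A. \<Sum>q'\<in>?A. c q * c q' * min (t q) (t q') * (h q \<bullet> h q')) = (\<Sum>p\<in>?P. ep * lam (2 * al) (snd p) * dt * (u p)\<^sup>2)"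
 proof -
  have hh: "h (p, b) \<bullet> h (p', b') = (if snd p = snd p' then lam (2 * al) (snd p) else 0)" for p p' b b'
   by (simp add: h_def inner_cas_cas lam_sq[symmetric] power2_eq_square)
  have "(\<Sum>q\<in>?A. \<Sum>q'\<in>?A. c q * c q' * min (t q) (t q') * (h q \<bullet> h q'))
   = (\<Sum>p\<in>?P. \<Sum>p'\<in>?P. u p * u p' * ep * (if snd p = snd p' then lam (2 * al) (snd p) else 0) * (if fst p = fst p' then dt else 0))"
   unfolding split sum.distrib[symmetric] hh
  proof (intro sum.cong refl)
   fix p p' :: "nat \<times> int \<times> int"
   have se: "sqrt ep * sqrt ep = ep" using eps_pos by simp
   let ?l = "if snd p = snd p' then lam (2 * al) (snd p) else 0"
   have "c (p, True) * c (p', True) * min (t (p, True)) (t (p', True)) * ?l + c (p, True) * c (p', False) * min (t (p, True)) (t (p', False)) * ?l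
     + (c (p, False) * c (p', True) * min (t (p, False)) (t (p', True)) * ?l + c (p, False) * c (p', False) * min (t (p, False)) (t (p', False)) * ?l)
     = u p * u p' * (sqrt ep * sqrt ep) * ?l * (min (real (Suc (fst p)) * dt) (real (Suc (fst p')) * dt) - min (real (Suc (fst p)) * dt) (real (fst p') * dt)
   - min (real (fst p) * dt) (real (Suc (fst p')) * dt) + min (real (fst p) * dt) (real (fst p') * dt))"
    unfolding c_def t_def fst_conv snd_conv if_True if_False by (simp only: algebra_simps)
   then show "c (p, True) * c (p', True) * min (t (p, True)) (t (p', True)) * ?l + c (p, True) * c (p', False) * min (t (p, True)) (t (p', False)) * ?l
     + (c (p, False) * c (p', True) * min (t (p, False)) (t (p', True)) * ?l + c (p, False) * c (p', False) * min (t (p, False)) (t (p', False)) * ?l)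
     = u p * u p' * ep * ?l * (if fst p = fst p' then dt else 0)"
    unfolding se min_increment[OF dt] .
  qed
  also have "\<dots> = (\<Sum>p\<in>?P. \<Sum>p'\<in>?P. if p' = p then ep * lam (2 * al) (snd p) * dt * (u p)\<^sup>2 else 0)"
   by (intro sum.cong refl) (auto simp: prod_eq_iff power2_eq_square)
  also have "\<dots> = (\<Sum>p\<in>?P. ep * lam (2 * al) (snd p) * dt * (u p)\<^sup>2)"
   by (intro sum.cong refl) simp
  finally show ?thesis .
 qed
 then show ?law
  using cylindrical_wiener_sum[where A="?A" and t=t and h=h and c=c, OF wiener fin th] unfolding sum_eq by (simp only:)
 have "W s g \<in> borel_measurable M" if "0 \<le> s" "g \<in> H" for s g
  using wiener that unfolding cylindrical_wiener_def by (elim conjE) blast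
 from independent_of_noise_indep_var[where A="?A" and t=t and h=h and x=x and c=c, OF independent \<Theta>_0_measurable this fin th]
 show ?ind unfolding sum_eq .
qed

text \<open>The characteristic function splits into the initial and the noise part by independence,
  and each part is one centred normal variable. The quadratic form in \<open>u\<close> comes out
  diagonal, which is all that is needed for independence of all coordinates.\<close>

lemma increments_joint:
 assumes N: "0 < N"
 defines "dt \<equiv> T / real N"
 defines "v \<equiv> \<lambda>p :: nat \<times> int \<times> int. if fst p = 0 then ep / 2 else ep * lam (2 * al) (snd p) * dt"
 shows "expectation (\<lambda>w. cis (\<Sum>p\<in>{..N} \<times> modes m. u p * increments dt (X w) (noise w) p))
   = of_real (exp (- (\<Sum>p\<in>{..N} \<times> modes m. v p * (u p)\<^sup>2) / 2))"
proof -
 have dt: "0 \<le> dt" using T_pos by (simp add: dt_def)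
 let ?I = "modes m"
 define A where "A w = \<Theta> w 0 \<bullet> (\<Sum>i\<in>?I. u (0, i) *\<^sub>R cas i)" for w
 define B where "B w = (\<Sum>p\<in>{..<N} \<times> ?I. u (Suc (fst p), snd p) * (noise w (real (Suc (fst p)) * dt) (snd p) - noise w (real (fst p) * dt) (snd p)))" for w
 have sum_split: "(\<Sum>p\<in>{..N} \<times> ?I. f p) = (\<Sum>i\<in>?I. f (0, i)) + (\<Sum>p\<in>{..<N} \<times> ?I. f (Suc (fst p), snd p))" for f :: "nat \<times> int \<times> int \<Rightarrow> real"
 proof -
  have "(\<Sum>p\<in>{..N} \<times> ?I. f p) = (\<Sum>j\<in>{..N}. \<Sum>i\<in>?I. f (j, i))" by (simp add: sum.cartesian_product)
  also have "\<dots> = (\<Sum>i\<in>?I. f (0, i)) + (\<Sum>j<N. \<Sum>i\<in>?I. f (Suc j, i))" by (rule sum.atMost_shift)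
  also have "(\<Sum>j<N. \<Sum>i\<in>?I. f (Suc j, i)) = (\<Sum>p\<in>{..<N} \<times> ?I. f (Suc (fst p), snd p))"
   by (simp add: sum.cartesian_product case_prod_unfold)
  finally show ?thesis .
 qed
 have AB: "(\<Sum>p\<in>{..N} \<times> ?I. u p * increments dt (X w) (noise w) p) = A w + B w" for w
  unfolding sum_split A_def B_def by (simp add: increments_def X_def coef_def inner_sum_right)
 define a where "a = ep / 2 * (\<Sum>i\<in>?I. (u (0, i))\<^sup>2)"
 define b where "b = (\<Sum>p\<in>{..<N} \<times> ?I. ep * lam (2 * al) (snd p) * dt * (u (Suc (fst p), snd p))\<^sup>2)"
 have ab0: "0 \<le> a" "0 \<le> b"
  unfolding a_def b_def using eps_pos dt by (auto intro!: mult_nonneg_nonneg sum_nonneg)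
 have ab: "(\<Sum>p\<in>{..N} \<times> ?I. v p * (u p)\<^sup>2) = a + b"
  unfolding sum_split a_def b_def v_def by (simp add: sum_distrib_left)
 have ind: "indep_var borel A borel B"
  unfolding A_def B_def dt_def by (rule noise_law(2)[OF N])
 then have rv: "A \<in> borel_measurable M" "B \<in> borel_measurable M" unfolding indep_var_eq by auto
 have lawA: "distr M borel A = centred_normal a" unfolding A_def a_def by (rule initial_law)
 have lawB: "distr M borel B = centred_normal b" unfolding B_def b_def dt_def by (rule noise_law(1)[OF N])
 have char_cis: "char (distr M borel Y) 1 = expectation (\<lambda>w. cis (1 * Y w))" if "Y \<in> borel_measurable M" for Y
  unfolding char_def using that by (subst integral_distr) (auto simp: cis_conv_exp)
 have "expectation (\<lambda>w. cis (1 * (A w + B w))) = char (distr M borel (\<lambda>w. A w + B w)) 1"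
  using rv by (intro char_cis[symmetric]) auto
 also have "\<dots> = char (distr M borel A) 1 * char (distr M borel B) 1"
  by (rule char_distr_add[OF ind])
 also have "\<dots> = of_real (exp (- a * 1\<^sup>2 / 2)) * of_real (exp (- b * 1\<^sup>2 / 2))"
  unfolding char_cis[OF rv(1)] char_cis[OF rv(2)] expectation_cis_centred_normal[OF rv(1) lawA ab0(1)]
   expectation_cis_centred_normal[OF rv(2) lawB ab0(2)] ..
 also have "\<dots> = of_real (exp (- (a + b) / 2))"
  by (simp add: exp_add[symmetric] add_divide_distrib flip: of_real_mult)
 finally show ?thesis unfolding AB ab by simp
qed

lemma increments_measurable:
 assumes "p \<in> {..N} \<times> modes m"
 shows "(\<lambda>w. increments (T / real N) (X w) (noise w) p) \<in> borel_measurable M"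
proof (cases "fst p")
 case 0
 have "(\<lambda>y. y \<bullet> cas (snd p)) \<in> borel_measurable borel"
  by (intro borel_measurable_continuous_onI continuous_intros)
 from measurable_compose[OF \<Theta>_0_measurable this] show ?thesis
  using 0 by (simp add: increments_def X_def coef_def)
next
 case (Suc j)
 have "snd p \<noteq> 0" using assms modes_nonzero by auto
 then have "(\<lambda>w. W t (lam al (snd p) *\<^sub>R cas (snd p)) w) \<in> borel_measurable M" if "0 \<le> t" for t
  using wiener that H_scaleR[OF cas_H] unfolding cylindrical_wiener_def by (elim conjE) blast
 then show ?thesis using Suc T_pos by (simp add: increments_def noise_def)
qed

lemma increments_single:
 assumes N: "0 < N" and p: "p \<in> {..N} \<times> modes m"
 shows "expectation (\<lambda>w. cis (s * increments (T / real N) (X w) (noise w) p))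
   = of_real (exp (- ((if fst p = 0 then ep / 2 else ep * lam (2 * al) (snd p) * (T / real N)) * s\<^sup>2) / 2))"
proof -
 have d: "(\<Sum>q\<in>{..N} \<times> modes m. (if q = p then s else 0) * f q) = s * f p" for f :: "_ \<Rightarrow> real"
  using p by (simp add: if_distrib[where f="\<lambda>t. t * _"] cong: if_cong)
 have d2: "(\<Sum>q\<in>{..N} \<times> modes m. f q * (if q = p then s else 0)\<^sup>2) = f p * s\<^sup>2" for f :: "_ \<Rightarrow> real"
  using p by (simp add: if_distrib[where f="\<lambda>t. t\<^sup>2"] if_distrib[where f="\<lambda>t. _ * t"] cong: if_cong)
 show ?thesis using increments_joint[OF N, of "\<lambda>q. if q = p then s else 0"] unfolding d d2 .
qed

text \<open>A diagonal quadratic form in the exponent factorises, which is the hypothesis of Kac's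
  criterion.\<close>

lemma increments_indep:
 assumes N: "0 < N"
 shows "indep_vars (\<lambda>_. borel) (\<lambda>p w. increments (T / real N) (X w) (noise w) p) ({..N} \<times> modes m)"
proof (rule indep_vars_char)
 fix u
 show "expectation (\<lambda>w. cis (\<Sum>p\<in>{..N} \<times> modes m. u p * increments (T / real N) (X w) (noise w) p))
   = (\<Prod>p\<in>{..N} \<times> modes m. expectation (\<lambda>w. cis (u p * increments (T / real N) (X w) (noise w) p)))"
 proof -
  define v where "v p = (if fst p = 0 then ep / 2 else ep * lam (2 * al) (snd p) * (T / real N))" for p :: "nat \<times> int \<times> int"
  have "(\<Prod>p\<in>{..N} \<times> modes m. expectation (\<lambda>w. cis (u p * increments (T / real N) (X w) (noise w) p)))
    = (\<Prod>p\<in>{..N} \<times> modes m. of_real (exp (- (v p * (u p)\<^sup>2) / 2)))"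
   unfolding v_def by (intro prod.cong refl increments_single[OF N])
  also have "\<dots> = of_real (\<Prod>p\<in>{..N} \<times> modes m. exp (- (v p * (u p)\<^sup>2) / 2))"
   by (rule of_real_prod[symmetric])
  also have "(\<Prod>p\<in>{..N} \<times> modes m. exp (- (v p * (u p)\<^sup>2) / 2)) = exp (\<Sum>p\<in>{..N} \<times> modes m. - (v p * (u p)\<^sup>2) / 2)"
   by (rule exp_sum[symmetric]) simp
  also have "(\<Sum>p\<in>{..N} \<times> modes m. - (v p * (u p)\<^sup>2) / 2) = - (\<Sum>p\<in>{..N} \<times> modes m. v p * (u p)\<^sup>2) / 2"
   unfolding sum_divide_distrib[symmetric] sum_negf ..
  finally show ?thesis unfolding increments_joint[OF N] v_def by (rule sym)
 qed
qed (auto intro: increments_measurable)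

lemma increments_law:
 assumes N: "0 < N" and p: "p \<in> {..N} \<times> modes m"
 shows "distr M borel (\<lambda>w. increments (T / real N) (X w) (noise w) p)
  = centred_normal (if fst p = 0 then ep / 2 else ep * lam (2 * al) (snd p) * (T / real N))" (is "distr M borel ?Y = centred_normal ?v")
proof (rule Levy_uniqueness)
 have v: "0 \<le> ?v" using eps_pos T_pos by simp
 show "real_distribution (distr M borel ?Y)"
  by (rule real_distribution_distr[OF increments_measurable[OF p]])
 show "real_distribution (centred_normal ?v)"
  using prob_space_centred_normal[OF v] by (simp add: real_distribution_def real_distribution_axioms_def)
 show "char (distr M borel ?Y) = char (centred_normal ?v)"
 proof
  fix s
  have "char (distr M borel ?Y) s = expectation (\<lambda>w. cis (s * ?Y w))"
   unfolding char_def using increments_measurable[OF p] by (subst integral_distr) (auto simp: cis_conv_exp)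
  also have "\<dots> = of_real (exp (- ?v * s\<^sup>2 / 2))" using increments_single[OF N p, of s] by simp
  also have "\<dots> = char (centred_normal ?v) s"
   unfolding char_def using char_centred_normal[OF v, of s] by (simp add: cis_conv_exp)
  finally show "char (distr M borel ?Y) s = char (centred_normal ?v) s" .
 qed
qed

lemma modes_nonempty: "modes m \<noteq> {}"
proof -
 have "(1, 0) \<in> modes m" using m_pos by (simp add: modes_def wave_norm_def)
 then show ?thesis by blast
qed

lemma galerkin_bound:
 assumes c: "0 \<le> c" "c < 1" and n0: "0 < n0" and e: "0 < e"
  and A: "AE w in M. w \<in> A \<longrightarrow> \<kappa> \<le> energy_functional c \<psi> n0 T (X w) (noise w)"
 shows "emeasure M A \<le> ennreal (exp ((e - \<kappa>) / ep)
   * ((1 / sqrt (1 - c)) ^ card (modes m) * exp (c * T * (\<Sum>i\<in>modes m. lam (2 * al) i))))"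
proof (rule probability_bound[OF prob_space_axioms modes_nonempty T_pos eps_pos c n0 e AE_solves increments_indep _ _ A])
 fix N :: nat and i assume "0 < N" "i \<in> modes m"
 then show "distr M borel (\<lambda>w. increments (T / real N) (X w) (noise w) (0, i)) = centred_normal (ep / 2)"
  using increments_law[of N "(0, i)"] by simp
next
 fix N j :: nat and i assume "j < N" "i \<in> modes m"
 then show "distr M borel (\<lambda>w. increments (T / real N) (X w) (noise w) (Suc j, i)) = centred_normal (ep * lam (2 * al) i * (T / real N))"
  using increments_law[of N "(Suc j, i)"] by simp
qed

end

section \<open>Path functionals\<close>

lemma integrable_lebesgue_on_iff:
 fixes f :: "real \<Rightarrow> real"
 assumes "S \<in> sets lebesgue"
 shows "integrable (lebesgue_on S) f \<longleftrightarrow> f absolutely_integrable_on S"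
 using assms by (simp add: integrable_restrict_space set_integrable_def)

lemma integrable_lebesgue_on_subinterval:
 fixes f :: "real \<Rightarrow> real"
 assumes f: "integrable (lebesgue_on {u..v}) f" and ab: "{a..b} \<subseteq> {u..v}"
 shows "integrable (lebesgue_on {a..b}) f" "f integrable_on {a..b}"
  "(\<integral>s. f s \<partial>lebesgue_on {a..b}) = integral {a..b} f"
  "\<bar>integral {a..b} f\<bar> \<le> (\<integral>s. \<bar>f s\<bar> \<partial>lebesgue_on {u..v})"
proof -
 have ai: "f absolutely_integrable_on {u..v}" using f by (subst (asm) integrable_lebesgue_on_iff) auto
 then have ai': "f absolutely_integrable_on {a..b}"
  using ab by (rule absolutely_integrable_on_subinterval)
 then show i: "integrable (lebesgue_on {a..b}) f" by (subst integrable_lebesgue_on_iff) auto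
 show io: "f integrable_on {a..b}" using ai' by (rule set_lebesgue_integral_eq_integral)
 show "(\<integral>s. f s \<partial>lebesgue_on {a..b}) = integral {a..b} f" using i by (rule lebesgue_integral_eq_integral) auto
 have abs: "integrable (lebesgue_on {u..v}) (\<lambda>s. \<bar>f s\<bar>)" "integrable (lebesgue_on {a..b}) (\<lambda>s. \<bar>f s\<bar>)" using f i by auto
 have absi: "(\<lambda>s. \<bar>f s\<bar>) integrable_on {u..v}" "(\<lambda>s. \<bar>f s\<bar>) integrable_on {a..b}"
  using abs integrable_lebesgue_on_iff set_lebesgue_integral_eq_integral(1) by auto
 have "\<bar>integral {a..b} f\<bar> \<le> integral {a..b} (\<lambda>s. \<bar>f s\<bar>)"
  using integral_norm_bound_integral[OF io absi(2)] by simp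
 also have "\<dots> \<le> integral {u..v} (\<lambda>s. \<bar>f s\<bar>)" by (rule integral_subset_le[OF ab absi(2) absi(1)]) simp
 also have "\<dots> = (\<integral>s. \<bar>f s\<bar> \<partial>lebesgue_on {u..v})" using abs(1) by (intro lebesgue_integral_eq_integral[symmetric]) auto
 finally show "\<bar>integral {a..b} f\<bar> \<le> (\<integral>s. \<bar>f s\<bar> \<partial>lebesgue_on {u..v})" .
qed

lemma integrable_lebesgue_on_diff:
 fixes f :: "real \<Rightarrow> real"
 assumes f: "integrable (lebesgue_on {0..T}) f" and ab: "0 \<le> a" "a \<le> b" "b \<le> T"
 shows "(\<integral>s. f s \<partial>lebesgue_on {0..b}) - (\<integral>s. f s \<partial>lebesgue_on {0..a}) = integral {a..b} f"
proof -
 have sub: "{0..a} \<subseteq> {0..T}" "{0..b} \<subseteq> {0..T}" using ab by auto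
 show ?thesis
  unfolding integrable_lebesgue_on_subinterval(3)[OF f sub(1)] integrable_lebesgue_on_subinterval(3)[OF f sub(2)]
  using Henstock_Kurzweil_Integration.integral_combine[OF ab(1,2) integrable_lebesgue_on_subinterval(2)[OF f sub(2)]] by simp
qed

lemma integral_piecewise:
 fixes f :: "real \<Rightarrow> real" and h :: "nat \<Rightarrow> real \<Rightarrow> real"
 assumes dt: "0 < dt" and h: "\<And>r. r < n \<Longrightarrow> continuous_on {real r * dt..real (Suc r) * dt} (h r)"
  and f: "\<And>r s. r < n \<Longrightarrow> s \<in> {real r * dt..<real (Suc r) * dt} \<Longrightarrow> f s = h r s"
 shows "integrable (lebesgue_on {0..real n * dt}) f"
  "(\<integral>s. f s \<partial>lebesgue_on {0..real n * dt}) = (\<Sum>r<n. integral {real r * dt..real (Suc r) * dt} (h r))"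
proof -
 have "f absolutely_integrable_on {0..real n * dt} \<and>
   integral {0..real n * dt} f = (\<Sum>r<n. integral {real r * dt..real (Suc r) * dt} (h r))"
  using h f
 proof (induction n)
  case 0
  then show ?case using absolutely_integrable_on_null[of 0 0 f] by simp
 next
  case (Suc n)
  let ?a = "real n * dt" and ?b = "real (Suc n) * dt"
  have IH: "f absolutely_integrable_on {0..?a}" "integral {0..?a} f = (\<Sum>r<n. integral {real r * dt..real (Suc r) * dt} (h r))"
   using Suc.IH Suc.prems by auto
  have ab: "0 \<le> ?a" "?a \<le> ?b" using dt by (auto simp: algebra_simps)
  have eq: "f s = h n s" if "s \<in> {?a..?b} - {?b}" for s
   using Suc.prems(2)[of n s] that by (auto simp del: of_nat_Suc)
  have "h n absolutely_integrable_on {?a..?b}"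
   using Suc.prems(1)[of n] absolutely_integrable_continuous_real by blast
  then have f2: "f absolutely_integrable_on {?a..?b}"
   by (rule absolutely_integrable_spike[of _ _ "{?b}"]) (use eq in auto)
  have "{0..?b} = {0..?a} \<union> {?a..?b}" using ab by auto
  then have f3: "f absolutely_integrable_on {0..?b}" using absolutely_integrable_Un[OF IH(1) f2] by simp
  have "integral {?a..?b} f = integral {?a..?b} (h n)"
   by (rule integral_spike[of "{?b}"]) (use eq in auto)
  moreover have "f integrable_on {0..?b}" using f3 by (rule set_lebesgue_integral_eq_integral)
  then have "integral {0..?a} f + integral {?a..?b} f = integral {0..?b} f"
   by (rule Henstock_Kurzweil_Integration.integral_combine[OF ab])
  ultimately show ?case using f3 IH(2) by simp
 qed
 then show 1: "integrable (lebesgue_on {0..real n * dt}) f"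
  and "(\<integral>s. f s \<partial>lebesgue_on {0..real n * dt}) = (\<Sum>r<n. integral {real r * dt..real (Suc r) * dt} (h r))"
  using integrable_lebesgue_on_iff lebesgue_integral_eq_integral[of "{0..real n * dt}" f] by auto
qed

lemma grid_bounds:
 fixes T :: real
 assumes T: "0 < T" and n0: "0 < n0"
 shows "0 \<le> real r * (T / real n0)" "real r * (T / real n0) \<le> real (Suc r) * (T / real n0)"
  "r < n0 \<Longrightarrow> real (Suc r) * (T / real n0) \<le> T"
proof -
 have D: "0 \<le> T / real n0" using T n0 by simp
 show "0 \<le> real r * (T / real n0)" by (rule mult_nonneg_nonneg[OF _ D]) simp
 show "real r * (T / real n0) \<le> real (Suc r) * (T / real n0)" by (rule mult_right_mono[OF _ D]) simp
 assume "r < n0"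
 then have "real (Suc r) * (T / real n0) \<le> real n0 * (T / real n0)" by (intro mult_right_mono[OF _ D]) simp
 then show "real (Suc r) * (T / real n0) \<le> T" using n0 by simp
qed

text \<open>\<open>energy_functional\<close> with the noise expressed through the path by the
  equation, so that it makes sense for any path, random or not. In \<open>1 - 2 * c\<close> the 1
  comes from the equation and \<open>- 2 * c\<close> from the compensator. The final energy is
  replaced by its tangent \<open>2 * y * x - y^2\<close>, which is weakly continuous.\<close>

definition path_functional :: "real \<Rightarrow> real \<Rightarrow> (int \<times> int) set \<Rightarrow> real \<Rightarrow> (int \<times> int \<Rightarrow> real) \<Rightarrow> nat
  \<Rightarrow> (nat \<Rightarrow> int \<times> int \<Rightarrow> real) \<Rightarrow> (real \<Rightarrow> l2) \<Rightarrow> real" where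
 "path_functional al T F c y n0 \<psi> \<eta> = (\<Sum>k\<in>F. c * (2 * y k * coef (\<eta> T) k - (y k)\<^sup>2))
   + (\<Sum>r<n0. \<Sum>k\<in>F. \<psi> r k * (coef (\<eta> (real (Suc r) * (T / n0))) k - coef (\<eta> (real r * (T / n0))) k
     + integral {real r * (T / n0)..real (Suc r) * (T / n0)} (\<lambda>s. (1 - 2 * c) * lam (2 * al) k * coef (\<eta> s) k + nl k (\<eta> s) (\<eta> s)))
    - lam (2 * al) k * (\<psi> r k)\<^sup>2 / 2 * (T / n0))"

text \<open>The tangent lies below the square, and modes outside \<open>F\<close> contribute only
  nonnegative squares; otherwise there is equality along a solution.\<close>

lemma (in galerkin) energy_functional_ge_path_functional:
 assumes F: "F \<subseteq> modes m" and y: "\<And>k. k \<notin> F \<Longrightarrow> y k = 0" and \<psi>: "\<And>r k. k \<notin> F \<Longrightarrow> \<psi> r k = 0"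
  and c: "0 \<le> c" and n0: "0 < n0"
 shows "AE w in M. path_functional al T F c y n0 \<psi> (\<Theta> w) \<le> energy_functional c \<psi> n0 T (X w) (noise w)"
 using AE_solves AE_space
proof eventually_elim
 case (elim w)
 let ?I = "modes m" and ?t = "\<lambda>r. real r * (T / n0)"
 have dt: "0 < T / n0" using T_pos n0 by simp
 have nT: "real n0 * (T / n0) = T" using n0 by simp
 have tT: "0 \<le> ?t r" "?t r \<le> ?t (Suc r)" "r < n0 \<Longrightarrow> ?t (Suc r) \<le> T" for r
  using grid_bounds[OF T_pos n0] by blast+
 have cX: "continuous_on {?t r..?t (Suc r)} (\<lambda>s. X w s i)" if "r < n0" for r i
  by (rule continuous_on_subset[OF X_continuous[OF elim(2)]]) (use tT(1)[of r] tT(3)[OF that] in \<open>simp only: atLeastatMost_subset_iff, blast\<close>)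
 have cd: "continuous_on {?t r..?t (Suc r)} (\<lambda>s. drift (X w s) i)" if "r < n0" "i \<in> ?I" for r i
  using cX[OF that(1)] that(2) by (intro drift_continuous) auto
 have eq: "X w t i = X w 0 i + integral {0..t} (\<lambda>s. drift (X w s) i) + noise w t i" if "i \<in> ?I" "t \<in> {0..T}" for i t
  using elim(1) that unfolding solves_def by blast
 have noise: "noise w (?t (Suc r)) i - noise w (?t r) i
   = X w (?t (Suc r)) i - X w (?t r) i - integral {?t r..?t (Suc r)} (\<lambda>s. drift (X w s) i)" if r: "r < n0" and i: "i \<in> ?I" for r i
 proof -
  have "continuous_on {0..T} (\<lambda>s. drift (X w s) i)"
   using X_continuous[OF elim(2)] i by (intro drift_continuous) auto
  then have "continuous_on {0..?t (Suc r)} (\<lambda>s. drift (X w s) i)" using tT(3)[OF r] by (rule_tac continuous_on_subset) auto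
  then have "(\<lambda>s. drift (X w s) i) integrable_on {0..?t (Suc r)}" by (rule integrable_continuous_interval)
  then have "integral {0..?t r} (\<lambda>s. drift (X w s) i) + integral {?t r..?t (Suc r)} (\<lambda>s. drift (X w s) i) = integral {0..?t (Suc r)} (\<lambda>s. drift (X w s) i)"
   by (rule Henstock_Kurzweil_Integration.integral_combine[OF tT(1,2)])
  then show ?thesis using eq[OF i, of "?t (Suc r)"] eq[OF i, of "?t r"] tT(1)[of r] tT(2)[of r] tT(3)[OF r] by auto
 qed
 define f where "f s = (\<Sum>i\<in>?I. lam (2 * al) i * (2 * c * \<psi> (nat \<lfloor>s * real n0 / T\<rfloor>) i * X w s i + (\<psi> (nat \<lfloor>s * real n0 / T\<rfloor>) i)\<^sup>2 / 2))" for s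
 define h where "h r s = (\<Sum>i\<in>?I. lam (2 * al) i * (2 * c * \<psi> r i * X w s i + (\<psi> r i)\<^sup>2 / 2))" for r s
 have hc: "continuous_on {?t r..?t (Suc r)} (h r)" if "r < n0" for r
  unfolding h_def using cX[OF that] by (intro continuous_intros)
 have fh: "f s = h r s" if "s \<in> {?t r..<?t (Suc r)}" for r s
 proof -
  have "real r \<le> s * real n0 / T" "s * real n0 / T < real r + 1"
   using that T_pos n0 by (auto simp: field_simps)
  then have "\<lfloor>s * real n0 / T\<rfloor> = int r" by (simp add: floor_eq_iff)
  then show ?thesis by (simp add: f_def h_def)
 qed
 have "(\<integral>s. f s \<partial>lebesgue_on {0..T}) = (\<Sum>r<n0. integral {?t r..?t (Suc r)} (h r))"
  using integral_piecewise(2)[OF dt, of n0 h f] hc fh unfolding nT by blast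
 also have "\<dots> = (\<Sum>r<n0. \<Sum>i\<in>?I. lam (2 * al) i * (2 * c * \<psi> r i * integral {?t r..?t (Suc r)} (\<lambda>s. X w s i) + (\<psi> r i)\<^sup>2 / 2 * (T / n0)))"
 proof (intro sum.cong refl)
  fix r assume "r \<in> {..<n0}"
  then have r: "r < n0" by simp
  have iX: "(\<lambda>s. X w s i) integrable_on {?t r..?t (Suc r)}" for i using cX[OF r] by (rule integrable_continuous_interval)
  have "((\<lambda>s. lam (2 * al) i * (2 * c * \<psi> r i * X w s i + (\<psi> r i)\<^sup>2 / 2)) has_integral
    lam (2 * al) i * (2 * c * \<psi> r i * integral {?t r..?t (Suc r)} (\<lambda>s. X w s i) + (\<psi> r i)\<^sup>2 / 2 * (T / n0))) {?t r..?t (Suc r)}" for i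
  proof -
   have "((\<lambda>s. (\<psi> r i)\<^sup>2 / 2) has_integral (?t (Suc r) - ?t r) *\<^sub>R ((\<psi> r i)\<^sup>2 / 2)) {?t r..?t (Suc r)}"
    using has_integral_const_real[of "(\<psi> r i)\<^sup>2 / 2" "?t r" "?t (Suc r)"] tT(2)[of r] by simp
   moreover have "?t (Suc r) - ?t r = T / n0" by (simp add: algebra_simps add_divide_distrib)
   ultimately have "((\<lambda>s. (\<psi> r i)\<^sup>2 / 2) has_integral (\<psi> r i)\<^sup>2 / 2 * (T / n0)) {?t r..?t (Suc r)}" by (simp only: real_scaleR_def mult.commute)
   then show ?thesis by (intro has_integral_mult_right has_integral_add integrable_integral[OF iX])
  qed
  then have "(h r has_integral (\<Sum>i\<in>?I. lam (2 * al) i * (2 * c * \<psi> r i * integral {?t r..?t (Suc r)} (\<lambda>s. X w s i) + (\<psi> r i)\<^sup>2 / 2 * (T / n0)))) {?t r..?t (Suc r)}"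
   unfolding h_def by (intro has_integral_sum finite_modes)
  then show "integral {?t r..?t (Suc r)} (h r) = (\<Sum>i\<in>?I. lam (2 * al) i * (2 * c * \<psi> r i * integral {?t r..?t (Suc r)} (\<lambda>s. X w s i) + (\<psi> r i)\<^sup>2 / 2 * (T / n0)))"
   by (rule integral_unique)
 qed
 finally have I1: "(\<integral>s. f s \<partial>lebesgue_on {0..T}) = (\<Sum>r<n0. \<Sum>i\<in>?I. lam (2 * al) i * (2 * c * \<psi> r i * integral {?t r..?t (Suc r)} (\<lambda>s. X w s i) + (\<psi> r i)\<^sup>2 / 2 * (T / n0)))" .
 define Q where "Q r i = \<psi> r i * (coef (\<Theta> w (?t (Suc r))) i - coef (\<Theta> w (?t r)) i
     + integral {?t r..?t (Suc r)} (\<lambda>s. (1 - 2 * c) * lam (2 * al) i * coef (\<Theta> w s) i + nl i (\<Theta> w s) (\<Theta> w s)))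
    - lam (2 * al) i * (\<psi> r i)\<^sup>2 / 2 * (T / n0)" for r i
 have Q: "\<psi> r i * (noise w (?t (Suc r)) i - noise w (?t r) i)
   - lam (2 * al) i * (2 * c * \<psi> r i * integral {?t r..?t (Suc r)} (\<lambda>s. X w s i) + (\<psi> r i)\<^sup>2 / 2 * (T / n0)) = Q r i"
  if r: "r < n0" and i: "i \<in> ?I" for r i
 proof -
  have iX: "(\<lambda>s. X w s i) integrable_on {?t r..?t (Suc r)}" using cX[OF r] by (rule integrable_continuous_interval)
  have id: "(\<lambda>s. drift (X w s) i) integrable_on {?t r..?t (Suc r)}" using cd[OF r i] by (rule integrable_continuous_interval)
  have "integral {?t r..?t (Suc r)} (\<lambda>s. (1 - 2 * c) * lam (2 * al) i * coef (\<Theta> w s) i + nl i (\<Theta> w s) (\<Theta> w s))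
   = integral {?t r..?t (Suc r)} (\<lambda>s. (- 2 * c * lam (2 * al) i) * X w s i - drift (X w s) i)"
  proof (rule Henstock_Kurzweil_Integration.integral_cong)
   fix s assume "s \<in> {?t r..?t (Suc r)}"
   then have s: "s \<in> {0..T}" using tT(1)[of r] tT(3)[OF r] by auto
   show "(1 - 2 * c) * lam (2 * al) i * coef (\<Theta> w s) i + nl i (\<Theta> w s) (\<Theta> w s)
     = (- 2 * c * lam (2 * al) i) * X w s i - drift (X w s) i"
    unfolding drift_X[OF elim(2) s] by (simp add: X_def algebra_simps)
  qed
  also have "\<dots> = (- 2 * c * lam (2 * al) i) * integral {?t r..?t (Suc r)} (\<lambda>s. X w s i) - integral {?t r..?t (Suc r)} (\<lambda>s. drift (X w s) i)"
   by (rule integral_unique[OF has_integral_diff[OF has_integral_mult_right[OF integrable_integral[OF iX]] integrable_integral[OF id]]])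
  finally have J: "integral {?t r..?t (Suc r)} (\<lambda>s. (1 - 2 * c) * lam (2 * al) i * coef (\<Theta> w s) i + nl i (\<Theta> w s) (\<Theta> w s)) = \<dots>" .
  show ?thesis unfolding Q_def noise[OF r i] J unfolding X_def by (simp add: algebra_simps)
 qed
 have "(\<Sum>r<n0. \<Sum>i\<in>?I. \<psi> r i * (noise w (?t (Suc r)) i - noise w (?t r) i)) - (\<integral>s. f s \<partial>lebesgue_on {0..T})
   = (\<Sum>r<n0. \<Sum>i\<in>?I. Q r i)"
  unfolding I1 sum_subtractf[symmetric] using Q by (intro sum.cong refl) auto
 also have "\<dots> = (\<Sum>r<n0. \<Sum>i\<in>F. Q r i)"
  using F \<psi> by (intro sum.cong refl sum.mono_neutral_right) (auto simp: Q_def)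
 finally have S: "(\<Sum>r<n0. \<Sum>i\<in>?I. \<psi> r i * (noise w (?t (Suc r)) i - noise w (?t r) i)) - (\<integral>s. f s \<partial>lebesgue_on {0..T})
   = (\<Sum>r<n0. \<Sum>i\<in>F. Q r i)" .
 have "(\<Sum>k\<in>F. c * (2 * y k * coef (\<Theta> w T) k - (y k)\<^sup>2)) = (\<Sum>k\<in>?I. c * (2 * y k * coef (\<Theta> w T) k - (y k)\<^sup>2))"
  using F y by (intro sum.mono_neutral_left) auto
 also have "\<dots> \<le> (\<Sum>i\<in>?I. c * (X w T i)\<^sup>2)"
 proof (intro sum_mono mult_left_mono c)
  fix k
  show "2 * y k * coef (\<Theta> w T) k - (y k)\<^sup>2 \<le> (X w T k)\<^sup>2"
   using sum_squares_bound[of "y k" "X w T k"] by (simp add: X_def)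
 qed
 finally show ?case
  using S unfolding path_functional_def energy_functional_def f_def Q_def by linarith
qed

lemma continuous_nl: "continuous_on UNIV (\<lambda>x. nl k x x)"
proof -
 have "((\<lambda>x. nl k x x) \<longlongrightarrow> nl k a a) (at a)" for a
 proof -
  have "eventually (\<lambda>x. norm (nl k a a - nl k x x) \<le> 2 * (om k)\<^sup>2 * norm (a - x) * (norm a + norm x)) (at a)"
   by (intro always_eventually allI) (use nl_diff_le in simp)
  moreover have "((\<lambda>x. 2 * (om k)\<^sup>2 * norm (a - x) * (norm a + norm x)) \<longlongrightarrow> 2 * (om k)\<^sup>2 * norm (a - a) * (norm a + norm a)) (at a)"
   by (intro tendsto_intros)
  then have "((\<lambda>x. 2 * (om k)\<^sup>2 * norm (a - x) * (norm a + norm x)) \<longlongrightarrow> 0) (at a)" by simp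
  ultimately have "((\<lambda>x. nl k a a - nl k x x) \<longlongrightarrow> 0) (at a)" by (rule Lim_null_comparison)
  from tendsto_diff[OF tendsto_const[of "nl k a a"] this] show ?thesis by simp
 qed
 then show ?thesis by (simp add: continuous_on_def)
qed

lemma measurable_nl [measurable (raw)]: "f \<in> borel_measurable N \<Longrightarrow> (\<lambda>s. nl k (f s) (f s)) \<in> borel_measurable N"
 by (rule measurable_compose[OF _ borel_measurable_continuous_onI[OF continuous_nl]])

lemma measurable_coef [measurable (raw)]: "f \<in> borel_measurable N \<Longrightarrow> (\<lambda>s. coef (f s) k) \<in> borel_measurable N"
 unfolding coef_def
 by (rule measurable_compose[OF _ borel_measurable_continuous_onI]) (auto intro!: continuous_intros)

lemma L2_L2_integrable:
 assumes "\<eta> \<in> L2_L2 T"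
 shows "\<eta> \<in> borel_measurable (lebesgue_on {0..T})" "integrable (lebesgue_on {0..T}) (\<lambda>t. (norm (\<eta> t))\<^sup>2)"
 using assms by (auto simp: L2_L2_def)

lemma abs_coef_le: "\<bar>coef f k\<bar> \<le> norm f"
 unfolding coef_def using Cauchy_Schwarz_ineq2[of f "cas k"] by simp

lemma finite_measure_interval: "finite_measure (lebesgue_on {a..b::real})"
 by (rule finite_measure_lebesgue_on) auto

text \<open>Measurability of the coefficients replaces Borel measurability into \<^typ>\<open>l2\<close>; the class is
 then evidently stable under changes on null sets and under \<^term>\<open>Lam s\<close>.\<close>

definition square_integrable_path :: "real \<Rightarrow> (real \<Rightarrow> l2) \<Rightarrow> bool" where
 "square_integrable_path T f \<longleftrightarrow> (\<forall>k. (\<lambda>t. coef (f t) k) \<in> borel_measurable (lebesgue_on {0..T})) \<and>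
   integrable (lebesgue_on {0..T}) (\<lambda>t. (norm (f t))\<^sup>2)"

lemma square_integrable_pathI:
 "(\<And>k. (\<lambda>t. coef (f t) k) \<in> borel_measurable (lebesgue_on {0..T})) \<Longrightarrow>
  integrable (lebesgue_on {0..T}) (\<lambda>t. (norm (f t))\<^sup>2) \<Longrightarrow> square_integrable_path T f"
 unfolding square_integrable_path_def by blast

lemma square_integrable_pathD:
 assumes "square_integrable_path T f"
 shows "(\<lambda>t. coef (f t) k) \<in> borel_measurable (lebesgue_on {0..T})"
  "integrable (lebesgue_on {0..T}) (\<lambda>t. (norm (f t))\<^sup>2)"
 using assms unfolding square_integrable_path_def by blast+

lemma L2_L2_square_integrable_path: "f \<in> L2_L2 T \<Longrightarrow> square_integrable_path T f"
 by (rule square_integrable_pathI) (auto simp: L2_L2_def)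

lemma measurable_inner_coef:
 assumes "\<And>k. (\<lambda>t. coef (f t) k) \<in> borel_measurable N" "\<And>k. (\<lambda>t. coef (g t) k) \<in> borel_measurable N"
 shows "(\<lambda>t. f t \<bullet> g t) \<in> borel_measurable N"
proof -
 obtain e :: "nat \<Rightarrow> int \<times> int" where e: "bij e" using ex_mode_enumeration by blast
 have "f s \<bullet> g s = (\<Sum>i. coef (f s) (e i) * coef (g s) (e i))" for s using sums_unique[OF parseval_sums[OF e]] .
 then show ?thesis using assms by simp
qed

lemma square_integrable_path_coef:
 assumes "square_integrable_path T f"
 shows "integrable (lebesgue_on {0..T}) (\<lambda>t. coef (f t) k)" "integrable (lebesgue_on {0..T}) (\<lambda>t. (coef (f t) k)\<^sup>2)"
  "(\<lambda>t. coef (f t) k) \<in> borel_measurable (lebesgue_on {0..T})"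
proof -
 interpret finite_measure "lebesgue_on {0..T}" by (rule finite_measure_interval)
 show m: "(\<lambda>t. coef (f t) k) \<in> borel_measurable (lebesgue_on {0..T})"
  by (rule square_integrable_pathD[OF assms])
 have "(coef x k)\<^sup>2 \<le> (norm x)\<^sup>2" for x using power_mono[OF abs_coef_le[of x k], of 2] by simp
 then show i: "integrable (lebesgue_on {0..T}) (\<lambda>t. (coef (f t) k)\<^sup>2)"
  by (intro Bochner_Integration.integrable_bound[OF square_integrable_pathD(2)[OF assms]]) (use m in auto)
 show "integrable (lebesgue_on {0..T}) (\<lambda>t. coef (f t) k)" by (rule square_integrable_imp_integrable[OF m i])
qed

lemma measurable_inner_l2:
 fixes f g :: "_ \<Rightarrow> l2"
 assumes "f \<in> borel_measurable N" "g \<in> borel_measurable N"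
 shows "(\<lambda>s. f s \<bullet> g s) \<in> borel_measurable N"
 by (intro measurable_inner_coef measurable_coef assms)

lemma integrable_nl:
 assumes "\<eta> \<in> L2_L2 T" shows "integrable (lebesgue_on {0..T}) (\<lambda>s. nl k (\<eta> s) (\<eta> s))"
proof (rule Bochner_Integration.integrable_bound)
 note L = L2_L2_integrable[OF assms]
 show "integrable (lebesgue_on {0..T}) (\<lambda>s. 2 * (om k)\<^sup>2 * (norm (\<eta> s))\<^sup>2)" using L(2) by simp
 show "AE s in lebesgue_on {0..T}. norm (nl k (\<eta> s) (\<eta> s)) \<le> norm (2 * (om k)\<^sup>2 * (norm (\<eta> s))\<^sup>2)"
  by (intro AE_I2) (use abs_nl_le[of k] in \<open>simp add: power2_eq_square mult.assoc\<close>)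
 show "(\<lambda>s. nl k (\<eta> s) (\<eta> s)) \<in> borel_measurable (lebesgue_on {0..T})" using L(1) by measurable
qed

lemmas integrable_coef = square_integrable_path_coef(1)[OF L2_L2_square_integrable_path] integrable_nl

text \<open>The point values and the linear term are controlled by the uniform weak seminorms of the
  finitely many modes in \<open>F\<close>, the quadratic term by the strong norm in space and time.
  The resulting bound \<open>\<rho> * K\<close> is linear in the size of the neighbourhood.\<close>

lemma path_functional_continuity:
 assumes T: "0 < T" and n0: "0 < n0" and tet: "tet \<in> L2_L2 T" and e: "0 < e"
 obtains \<rho> where "0 < \<rho>"
  "\<And>\<eta>. \<eta> \<in> L2_L2 T \<Longrightarrow> sqrt (\<integral>t. (norm (\<eta> t - tet t))\<^sup>2 \<partial>lebesgue_on {0..T}) < \<rho> \<Longrightarrow>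
    (\<And>k t. k \<in> F \<Longrightarrow> t \<in> {0..T} \<Longrightarrow> \<bar>(\<eta> t - tet t) \<bullet> cas k\<bar> < \<rho>) \<Longrightarrow>
    path_functional al T F c y n0 \<psi> tet - e \<le> path_functional al T F c y n0 \<psi> \<eta>"
proof -
 let ?M = "lebesgue_on {0..T}" and ?t = "\<lambda>r. real r * (T / n0)"
 note Ltet = L2_L2_integrable[OF tet]
 have dt: "0 < T / n0" using T n0 by simp
 have nT: "real n0 * (T / n0) = T" using n0 by simp
 have tT: "0 \<le> ?t r" "?t r \<le> ?t (Suc r)" "r < n0 \<Longrightarrow> ?t (Suc r) \<le> T" for r
  using grid_bounds[OF T n0] by blast+
 define P where "P = (\<integral>s. (norm (tet s))\<^sup>2 \<partial>?M)"
 have P: "0 \<le> P" by (simp add: P_def)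
 \<comment> \<open>Bounds the change of one time integral per unit of \<open>\<rho>\<close>: the
   linear term over a time at most \<open>T\<close>, and the nonlinear one, for which
   \<open>\<rho> + 1 + P \<le> 2 + P\<close>.\<close>
 define L where "L k = \<bar>1 - 2 * c\<bar> * lam (2 * al) k * T + 2 * (om k)\<^sup>2 * (2 + P)" for k
 have L: "0 \<le> L k" for k unfolding L_def using T P by simp
 define K where "K = (\<Sum>k\<in>F. 2 * \<bar>c\<bar> * \<bar>y k\<bar>) + (\<Sum>r<n0. \<Sum>k\<in>F. \<bar>\<psi> r k\<bar> * (2 + L k))"
 have K: "0 \<le> K" unfolding K_def using L by (intro add_nonneg_nonneg sum_nonneg mult_nonneg_nonneg) auto
 define \<rho> where "\<rho> = min 1 (e / (K + 1))"
 have \<rho>: "0 < \<rho>" "\<rho> \<le> 1" using e K by (auto simp: \<rho>_def)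
 have \<rho>K: "\<rho> * K \<le> e"
 proof -
  have "\<rho> * K \<le> e / (K + 1) * K" using K by (intro mult_right_mono) (auto simp: \<rho>_def)
  also have "\<dots> \<le> e" using K e by (simp add: field_simps)
  finally show ?thesis .
 qed
 show ?thesis
 proof (rule that[OF \<rho>(1)])
  fix \<eta> assume \<eta>: "\<eta> \<in> L2_L2 T" and strong: "sqrt (\<integral>t. (norm (\<eta> t - tet t))\<^sup>2 \<partial>?M) < \<rho>"
   and weak: "\<And>k t. k \<in> F \<Longrightarrow> t \<in> {0..T} \<Longrightarrow> \<bar>(\<eta> t - tet t) \<bullet> cas k\<bar> < \<rho>"
  note L\<eta> = L2_L2_integrable[OF \<eta>]
  have wk: "\<bar>coef (\<eta> t) k - coef (tet t) k\<bar> \<le> \<rho>" if "k \<in> F" "t \<in> {0..T}" for k t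
   using weak[OF that] by (simp add: coef_def inner_diff_left)
  have dm: "(\<lambda>s. (norm (\<eta> s - tet s))\<^sup>2) \<in> borel_measurable ?M"
  proof -
   have "(norm (\<eta> s - tet s))\<^sup>2 = \<eta> s \<bullet> \<eta> s - 2 * (\<eta> s \<bullet> tet s) + tet s \<bullet> tet s" for s
    by (simp add: power2_norm_eq_inner inner_diff_left inner_diff_right inner_commute)
   then show ?thesis using measurable_inner_l2[OF L\<eta>(1) L\<eta>(1)] measurable_inner_l2[OF L\<eta>(1) Ltet(1)] measurable_inner_l2[OF Ltet(1) Ltet(1)]
    by simp
  qed
  have di: "integrable ?M (\<lambda>s. (norm (\<eta> s - tet s))\<^sup>2)"
  proof (rule Bochner_Integration.integrable_bound[OF _ dm])
   show "integrable ?M (\<lambda>s. 2 * (norm (\<eta> s))\<^sup>2 + 2 * (norm (tet s))\<^sup>2)" using L\<eta>(2) Ltet(2) by simp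
   have "(norm (a - b))\<^sup>2 \<le> 2 * (norm a)\<^sup>2 + 2 * (norm b)\<^sup>2" for a b :: l2
   proof -
    have "(norm (a - b))\<^sup>2 \<le> (norm a + norm b)\<^sup>2" by (intro power_mono norm_triangle_ineq4) simp
    also have "\<dots> \<le> 2 * (norm a)\<^sup>2 + 2 * (norm b)\<^sup>2"
     using sum_squares_bound[of "norm a" "norm b"] by (simp add: power2_sum)
    finally show ?thesis .
   qed
   then show "AE s in ?M. norm ((norm (\<eta> s - tet s))\<^sup>2) \<le> norm (2 * (norm (\<eta> s))\<^sup>2 + 2 * (norm (tet s))\<^sup>2)"
    by (intro AE_I2) simp
  qed
  have D: "(\<integral>s. (norm (\<eta> s - tet s))\<^sup>2 \<partial>?M) \<le> \<rho>\<^sup>2"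
  proof -
   have "(sqrt (\<integral>t. (norm (\<eta> t - tet t))\<^sup>2 \<partial>?M))\<^sup>2 \<le> \<rho>\<^sup>2" using strong by (intro power_mono) auto
   then show ?thesis by simp
  qed
  have nl_int: "(\<integral>s. \<bar>nl k (\<eta> s) (\<eta> s) - nl k (tet s) (tet s)\<bar> \<partial>?M) \<le> 2 * (om k)\<^sup>2 * (2 + P) * \<rho>" for k
  proof -
   have "(\<integral>s. \<bar>nl k (\<eta> s) (\<eta> s) - nl k (tet s) (tet s)\<bar> \<partial>?M)
     \<le> (\<integral>s. 2 * (om k)\<^sup>2 * ((1 + 1 / \<rho>) * (norm (\<eta> s - tet s))\<^sup>2 + \<rho> * (norm (tet s))\<^sup>2) \<partial>?M)"
   proof (rule integral_mono)
    show "integrable ?M (\<lambda>s. \<bar>nl k (\<eta> s) (\<eta> s) - nl k (tet s) (tet s)\<bar>)"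
     using integrable_coef(2)[OF \<eta>] integrable_coef(2)[OF tet] by simp
    show "integrable ?M (\<lambda>s. 2 * (om k)\<^sup>2 * ((1 + 1 / \<rho>) * (norm (\<eta> s - tet s))\<^sup>2 + \<rho> * (norm (tet s))\<^sup>2))"
     using di Ltet(2) by simp
    fix s
    let ?d = "norm (\<eta> s - tet s)" and ?b = "norm (tet s)"
    have "norm (\<eta> s) \<le> ?d + ?b" using norm_triangle_ineq[of "\<eta> s - tet s" "tet s"] by simp
    then have "?d * (norm (\<eta> s) + ?b) \<le> ?d * (?d + 2 * ?b)" by (intro mult_left_mono) auto
    \<comment> \<open>Young's inequality with weight \<open>\<rho>\<close>: since the integral of
      \<open>?d\<close> squared is at most \<open>\<rho>\<close> squared, both terms are of order
      \<open>\<rho>\<close> after integration.\<close>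
    also have "\<dots> \<le> (1 + 1 / \<rho>) * ?d\<^sup>2 + \<rho> * ?b\<^sup>2"
    proof -
     have "0 \<le> (?d - \<rho> * ?b)\<^sup>2 / \<rho>" using \<rho> by simp
     also have "(?d - \<rho> * ?b)\<^sup>2 / \<rho> = ?d\<^sup>2 / \<rho> - 2 * ?d * ?b + \<rho> * ?b\<^sup>2"
      using \<rho> by (simp add: power2_eq_square field_simps)
     finally show ?thesis by (simp add: power2_eq_square algebra_simps)
    qed
    finally have "2 * (om k)\<^sup>2 * (?d * (norm (\<eta> s) + ?b)) \<le> 2 * (om k)\<^sup>2 * ((1 + 1 / \<rho>) * ?d\<^sup>2 + \<rho> * ?b\<^sup>2)"
     by (intro mult_left_mono) auto
    then show "\<bar>nl k (\<eta> s) (\<eta> s) - nl k (tet s) (tet s)\<bar> \<le> 2 * (om k)\<^sup>2 * ((1 + 1 / \<rho>) * ?d\<^sup>2 + \<rho> * ?b\<^sup>2)"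
     using nl_diff_le[of k "\<eta> s" "tet s"] by (simp add: mult.assoc)
   qed
   also have "\<dots> = 2 * (om k)\<^sup>2 * ((1 + 1 / \<rho>) * (\<integral>s. (norm (\<eta> s - tet s))\<^sup>2 \<partial>?M) + \<rho> * P)"
    using di Ltet(2) by (simp add: P_def)
   also have "\<dots> \<le> 2 * (om k)\<^sup>2 * ((1 + 1 / \<rho>) * \<rho>\<^sup>2 + \<rho> * P)"
    using D \<rho> by (intro mult_left_mono add_right_mono) auto
   also have "(1 + 1 / \<rho>) * \<rho>\<^sup>2 + \<rho> * P = (\<rho> + 1 + P) * \<rho>" using \<rho> by (simp add: power2_eq_square field_simps)
   also have "2 * (om k)\<^sup>2 * ((\<rho> + 1 + P) * \<rho>) \<le> 2 * (om k)\<^sup>2 * ((2 + P) * \<rho>)"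
    using \<rho> by (intro mult_left_mono mult_right_mono) auto
   finally show ?thesis by (simp add: mult.assoc)
  qed
  have int_le: "\<bar>integral {?t r..?t (Suc r)} (\<lambda>s. (1 - 2 * c) * lam (2 * al) k * coef (\<eta> s) k + nl k (\<eta> s) (\<eta> s))
    - integral {?t r..?t (Suc r)} (\<lambda>s. (1 - 2 * c) * lam (2 * al) k * coef (tet s) k + nl k (tet s) (tet s))\<bar> \<le> L k * \<rho>"
   if r: "r < n0" and k: "k \<in> F" for r k
  proof -
   let ?g = "\<lambda>\<eta> s. (1 - 2 * c) * lam (2 * al) k * coef (\<eta> s) k + nl k (\<eta> s) (\<eta> s)"
   have ig: "integrable ?M (?g \<eta>)" "integrable ?M (?g tet)"
    using integrable_coef[OF \<eta>] integrable_coef[OF tet] by auto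
   then have id: "integrable ?M (\<lambda>s. ?g \<eta> s - ?g tet s)" by simp
   have sub: "{?t r..?t (Suc r)} \<subseteq> {0..T}" using tT(1)[of r] tT(3)[OF r] by auto
   have "integral {?t r..?t (Suc r)} (?g \<eta>) - integral {?t r..?t (Suc r)} (?g tet) = integral {?t r..?t (Suc r)} (\<lambda>s. ?g \<eta> s - ?g tet s)"
    using integrable_lebesgue_on_subinterval(2)[OF ig(1) sub] integrable_lebesgue_on_subinterval(2)[OF ig(2) sub] by (intro Henstock_Kurzweil_Integration.integral_diff[symmetric])
   then have "\<bar>integral {?t r..?t (Suc r)} (?g \<eta>) - integral {?t r..?t (Suc r)} (?g tet)\<bar> \<le> (\<integral>s. \<bar>?g \<eta> s - ?g tet s\<bar> \<partial>?M)"
    using integrable_lebesgue_on_subinterval(4)[OF id sub] by simp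
   also have "\<dots> \<le> (\<integral>s. \<bar>1 - 2 * c\<bar> * lam (2 * al) k * \<rho> + \<bar>nl k (\<eta> s) (\<eta> s) - nl k (tet s) (tet s)\<bar> \<partial>?M)"
   proof (rule integral_mono)
    interpret finite_measure ?M by (rule finite_measure_interval)
    show "integrable ?M (\<lambda>s. \<bar>?g \<eta> s - ?g tet s\<bar>)" using id by simp
    show "integrable ?M (\<lambda>s. \<bar>1 - 2 * c\<bar> * lam (2 * al) k * \<rho> + \<bar>nl k (\<eta> s) (\<eta> s) - nl k (tet s) (tet s)\<bar>)"
     using integrable_coef(2)[OF \<eta>] integrable_coef(2)[OF tet] by simp
    fix s assume "s \<in> space ?M"
    then have "\<bar>coef (\<eta> s) k - coef (tet s) k\<bar> \<le> \<rho>" using wk[OF k] by simp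
    then have "\<bar>(1 - 2 * c) * lam (2 * al) k * (coef (\<eta> s) k - coef (tet s) k)\<bar> \<le> \<bar>1 - 2 * c\<bar> * lam (2 * al) k * \<rho>"
     unfolding abs_mult by (simp add: mult_left_mono)
    moreover have "?g \<eta> s - ?g tet s = (1 - 2 * c) * lam (2 * al) k * (coef (\<eta> s) k - coef (tet s) k) + (nl k (\<eta> s) (\<eta> s) - nl k (tet s) (tet s))"
     by (simp add: algebra_simps)
    ultimately show "\<bar>?g \<eta> s - ?g tet s\<bar> \<le> \<bar>1 - 2 * c\<bar> * lam (2 * al) k * \<rho> + \<bar>nl k (\<eta> s) (\<eta> s) - nl k (tet s) (tet s)\<bar>"
     by linarith
   qed
   also have "\<dots> = \<bar>1 - 2 * c\<bar> * lam (2 * al) k * \<rho> * T + (\<integral>s. \<bar>nl k (\<eta> s) (\<eta> s) - nl k (tet s) (tet s)\<bar> \<partial>?M)"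
   proof -
    interpret finite_measure ?M by (rule finite_measure_interval)
    have "measure ?M (space ?M) = T" using T by (simp add: measure_restrict_space)
    then show ?thesis using integrable_coef(2)[OF \<eta>] integrable_coef(2)[OF tet]
     by (subst Bochner_Integration.integral_add) auto
   qed
   also have "\<dots> \<le> L k * \<rho>" using nl_int[of k] unfolding L_def by (simp add: algebra_simps)
   finally show ?thesis .
  qed
  have "path_functional al T F c y n0 \<psi> tet - path_functional al T F c y n0 \<psi> \<eta> \<le> \<rho> * K"
  proof -
   have A: "c * (2 * y k * coef (tet T) k - (y k)\<^sup>2) - c * (2 * y k * coef (\<eta> T) k - (y k)\<^sup>2) \<le> \<rho> * (2 * \<bar>c\<bar> * \<bar>y k\<bar>)" if "k \<in> F" for k
   proof -
    have "c * (2 * y k * coef (tet T) k - (y k)\<^sup>2) - c * (2 * y k * coef (\<eta> T) k - (y k)\<^sup>2) = - (2 * c * y k * (coef (\<eta> T) k - coef (tet T) k))"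
     by (simp add: algebra_simps)
    also have "\<dots> \<le> \<bar>2 * c * y k * (coef (\<eta> T) k - coef (tet T) k)\<bar>" by simp
    also have "\<dots> \<le> \<bar>2 * c * y k\<bar> * \<rho>"
     unfolding abs_mult[of "2 * c * y k"] using wk[OF that, of T] T by (intro mult_left_mono) auto
    finally show ?thesis by (simp add: abs_mult mult_ac)
   qed
   let ?q = "\<lambda>\<eta> r k. \<psi> r k * (coef (\<eta> (?t (Suc r))) k - coef (\<eta> (?t r)) k
     + integral {?t r..?t (Suc r)} (\<lambda>s. (1 - 2 * c) * lam (2 * al) k * coef (\<eta> s) k + nl k (\<eta> s) (\<eta> s)))
    - lam (2 * al) k * (\<psi> r k)\<^sup>2 / 2 * (T / n0)"
   have B: "?q tet r k - ?q \<eta> r k \<le> \<rho> * (\<bar>\<psi> r k\<bar> * (2 + L k))" if r: "r < n0" and k: "k \<in> F" for r k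
   proof -
    define u where "u \<eta> = coef (\<eta> (?t (Suc r))) k - coef (\<eta> (?t r)) k
     + integral {?t r..?t (Suc r)} (\<lambda>s. (1 - 2 * c) * lam (2 * al) k * coef (\<eta> s) k + nl k (\<eta> s) (\<eta> s))" for \<eta>
    have t1: "?t (Suc r) \<in> {0..T}" "?t r \<in> {0..T}"
     using tT(1)[of r] tT(1)[of "Suc r"] tT(3)[OF r] order_trans[OF tT(2) tT(3)[OF r]] by (simp_all only: atLeastAtMost_iff)
    have "\<bar>u tet - u \<eta>\<bar> \<le> \<rho> * (2 + L k)"
     using wk[OF k t1(1)] wk[OF k t1(2)] int_le[OF r k] unfolding u_def by (simp only: distrib_left mult.commute[of \<rho>])
    then have "\<bar>\<psi> r k\<bar> * \<bar>u tet - u \<eta>\<bar> \<le> \<bar>\<psi> r k\<bar> * (\<rho> * (2 + L k))" by (intro mult_left_mono) auto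
    moreover have "\<psi> r k * u tet - \<psi> r k * u \<eta> \<le> \<bar>\<psi> r k\<bar> * \<bar>u tet - u \<eta>\<bar>"
     unfolding abs_mult[symmetric] right_diff_distrib[symmetric] by (rule abs_ge_self)
    ultimately show ?thesis unfolding u_def[symmetric] by (simp add: mult_ac)
   qed
   have "path_functional al T F c y n0 \<psi> tet - path_functional al T F c y n0 \<psi> \<eta>
    = (\<Sum>k\<in>F. c * (2 * y k * coef (tet T) k - (y k)\<^sup>2) - c * (2 * y k * coef (\<eta> T) k - (y k)\<^sup>2))
     + (\<Sum>r<n0. \<Sum>k\<in>F. ?q tet r k - ?q \<eta> r k)"
    unfolding path_functional_def sum_subtractf by simp
   also have "\<dots> \<le> (\<Sum>k\<in>F. \<rho> * (2 * \<bar>c\<bar> * \<bar>y k\<bar>)) + (\<Sum>r<n0. \<Sum>k\<in>F. \<rho> * (\<bar>\<psi> r k\<bar> * (2 + L k)))"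
    by (intro add_mono sum_mono A B) auto
   also have "\<dots> = \<rho> * K" by (simp add: K_def sum_distrib_left distrib_left)
   finally show ?thesis .
  qed
  then show "path_functional al T F c y n0 \<psi> tet - e \<le> path_functional al T F c y n0 \<psi> \<eta>" using \<rho>K by linarith
 qed
qed

section \<open>The large deviation upper bound\<close>

lemma finite_subset_modes:
 assumes "finite F" "0 \<notin> F"
 obtains N where "\<And>n. N \<le> n \<Longrightarrow> F \<subseteq> modes n"
proof
 fix n assume n: "nat \<lceil>\<Sum>k\<in>F. wave_norm k\<rceil> \<le> n"
 have nn: "0 \<le> wave_norm k" for k by (simp add: wave_norm_def)
 show "F \<subseteq> modes n"
 proof
  fix k assume k: "k \<in> F"
  then have "wave_norm k \<le> (\<Sum>k\<in>F. wave_norm k)" using nn assms(1) by (intro member_le_sum) auto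
  then have "wave_norm k \<le> real n" using n by linarith
  moreover have "k \<noteq> 0" using k assms(2) by blast
  then have "wave_norm k \<noteq> 0" by (cases k) (auto simp: wave_norm_def zero_prod_def)
  then have "0 < wave_norm k" using nn[of k] by linarith
  ultimately show "k \<in> modes n" by (simp add: modes_def)
 qed
qed

text \<open>The lattice points number at most \<open>(2 n + 1)^2 \<le> 9 n^2\<close>, and the symbol
  is at most \<open>(2 * pi * n)\<close> to the power \<open>2 * al\<close>. Their product has
  exactly the order that the scaling assumption makes negligible.\<close>

lemma modes_cost_le:
 assumes al: "0 < al" and n: "0 < n"
 shows "real (card (modes n)) \<le> 9 * real n powr (2 + 2 * al)"
  "(\<Sum>i\<in>modes n. lam (2 * al) i) \<le> 9 * (2 * pi) powr (2 * al) * real n powr (2 + 2 * al)"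
proof -
 have n1: "1 \<le> real n" using n by simp
 have "real (card (modes n)) \<le> (2 * real n + 1)\<^sup>2"
  using of_nat_mono[OF card_modes_le[of n], where ?'a = real] by (simp add: add.commute)
 also have "\<dots> \<le> (3 * real n)\<^sup>2" using n1 by (intro power_mono) auto
 finally have c: "real (card (modes n)) \<le> 9 * (real n)\<^sup>2" by (simp add: power_mult_distrib)
 have p: "real n powr (2 + 2 * al) = (real n)\<^sup>2 * real n powr (2 * al)" using n by (simp add: powr_add)
 have "1 \<le> real n powr (2 * al)" using n1 al by (simp add: ge_one_powr_ge_zero)
 then have "(real n)\<^sup>2 * 1 \<le> (real n)\<^sup>2 * real n powr (2 * al)" by (intro mult_left_mono) auto
 then show "real (card (modes n)) \<le> 9 * real n powr (2 + 2 * al)" using c unfolding p by linarith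
 have "lam (2 * al) i \<le> (2 * pi) powr (2 * al) * real n powr (2 * al)" if "i \<in> modes n" for i
 proof -
  have "lam (2 * al) i = (2 * pi * wave_norm i) powr (2 * al)" using that by (auto simp: lam_def om_def modes_def wave_norm_def)
  also have "\<dots> \<le> (2 * pi * real n) powr (2 * al)" using that al by (intro powr_mono2) (auto simp: modes_def)
  finally show ?thesis by (simp add: powr_mult)
 qed
 then have "(\<Sum>i\<in>modes n. lam (2 * al) i) \<le> real (card (modes n)) * ((2 * pi) powr (2 * al) * real n powr (2 * al))"
  using sum_bounded_above[of "modes n" "lam (2 * al)"] by simp
 also have "\<dots> \<le> 9 * (real n)\<^sup>2 * ((2 * pi) powr (2 * al) * real n powr (2 * al))"
  by (intro mult_right_mono c) auto
 finally show "(\<Sum>i\<in>modes n. lam (2 * al) i) \<le> 9 * (2 * pi) powr (2 * al) * real n powr (2 + 2 * al)"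
  unfolding p by (simp add: mult_ac)
qed

lemma modes_cost_tendsto:
 assumes al: "0 < al" and m: "\<And>ep. 0 < ep \<Longrightarrow> 0 < m ep"
  and scaling: "((\<lambda>ep. ep * real (m ep) powr (2 + 2 * al)) \<longlongrightarrow> 0) (at_right 0)"
  and ab: "0 \<le> a" "0 \<le> b"
 shows "((\<lambda>ep. ep * (real (card (modes (m ep))) * a + b * (\<Sum>i\<in>modes (m ep). lam (2 * al) i))) \<longlongrightarrow> 0) (at_right 0)"
proof (rule tendsto_sandwich[OF _ _ tendsto_const])
 let ?C = "9 * a + b * (9 * (2 * pi) powr (2 * al))"
 show "((\<lambda>ep. ?C * (ep * real (m ep) powr (2 + 2 * al))) \<longlongrightarrow> 0) (at_right 0)"
  using tendsto_mult_right_zero[OF scaling] .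
 have pos: "eventually (\<lambda>ep::real. 0 < ep) (at_right 0)" by (rule eventually_at_right_less)
 show "eventually (\<lambda>ep. 0 \<le> ep * (real (card (modes (m ep))) * a + b * (\<Sum>i\<in>modes (m ep). lam (2 * al) i))) (at_right 0)"
  using pos by eventually_elim (intro mult_nonneg_nonneg add_nonneg_nonneg sum_nonneg lam_nonneg ab; simp)
 show "eventually (\<lambda>ep. ep * (real (card (modes (m ep))) * a + b * (\<Sum>i\<in>modes (m ep). lam (2 * al) i))
   \<le> ?C * (ep * real (m ep) powr (2 + 2 * al))) (at_right 0)"
  using pos
 proof eventually_elim
  case (elim ep)
  let ?p = "real (m ep) powr (2 + 2 * al)"
  have "real (card (modes (m ep))) * a + b * (\<Sum>i\<in>modes (m ep). lam (2 * al) i) \<le> 9 * ?p * a + b * (9 * (2 * pi) powr (2 * al) * ?p)"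
   by (intro add_mono mult_right_mono mult_left_mono modes_cost_le al m elim ab)
  then have "ep * (real (card (modes (m ep))) * a + b * (\<Sum>i\<in>modes (m ep). lam (2 * al) i)) \<le> ep * (9 * ?p * a + b * (9 * (2 * pi) powr (2 * al) * ?p))"
   using elim by (intro mult_left_mono) auto
  then show ?case by (simp add: algebra_simps)
 qed
qed

lemma emeasure_distr_le: "emeasure (distr M N f) A \<le> emeasure M (f -` A \<inter> space M)"
 by (simp add: distr_def emeasure_measure_of_conv)

lemma elog_le:
 assumes "0 \<le> p" "p \<le> exp z" "0 < ep"
 shows "ereal ep * elog p \<le> ereal (ep * z)"
proof (cases "p = 0")
 case True
 then show ?thesis using assms(3) by (simp add: elog_def)
next
 case False
 then have "ln p \<le> ln (exp z)" using assms by (subst ln_le_cancel_iff) auto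
 then show ?thesis using False assms(3) by (simp add: elog_def)
qed

lemma X_space_L2_L2: "tet \<in> X_space al T \<Longrightarrow> tet \<in> L2_L2 T"
 by (auto simp: X_space_def L2_H_def)

text \<open>No measurability of \<^term>\<open>\<Theta> \<epsilon>\<close> into \<^term>\<open>X_borel \<alpha> T\<close> is assumed: if it fails, \<^term>\<open>distr\<close> is
 the null measure and the bound is trivial.\<close>

theorem local_upper_bound:
 fixes M :: "'a measure"
 assumes T: "0 < T" and alpha: "0 < al"
  and M: "prob_space M"
  and W: "cylindrical_wiener M W"
  and m_pos: "\<And>ep. 0 < ep \<Longrightarrow> 0 < m ep"
  and m_at_top: "filterlim m at_top (at_right 0)"
  and scaling: "((\<lambda>ep. ep * real (m ep) powr (2 + 2 * al)) \<longlongrightarrow> 0) (at_right 0)"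
  and Theta: "\<And>ep. 0 < ep \<Longrightarrow> galerkin_solution M W al T ep (m ep) (\<Theta> ep)"
  and initial_law: "\<And>ep. 0 < ep \<Longrightarrow>
     gaussian_on_H (\<lambda>h. (ep / 2) *\<^sub>R Pm (m ep) h) (distr M borel (\<lambda>w. \<Theta> ep w 0))"
  and initial_indep: "\<And>ep. 0 < ep \<Longrightarrow> independent_of_noise M W (\<lambda>w. \<Theta> ep w 0)"
  and mu: "\<And>ep. 0 < ep \<Longrightarrow> \<mu> ep = path_law al T M (\<Theta> ep)"
  and tet: "tet \<in> X_space al T"
  and F: "finite F" "0 \<notin> F" "\<And>k. k \<notin> F \<Longrightarrow> y k = 0" "\<And>r k. k \<notin> F \<Longrightarrow> \<psi> r k = 0"
  and c: "0 \<le> c" "c < 1" and n0: "0 < n0"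
  and \<kappa>: "\<kappa> < path_functional al T F c y n0 \<psi> tet"
 shows "(INF G\<in>{G. openin (X_topology al T) G \<and> tet \<in> G}.
     Liminf (at_right 0) (\<lambda>ep. ereal ep * elog (measure (\<mu> ep) G))) \<le> ereal (- \<kappa>)"
proof -
 let ?pf = "path_functional al T F c y n0 \<psi>"
 \<comment> \<open>Three equal losses: the continuity of the functional, the margin needed for
   Fatou's lemma, and the cost of the modes multiplied by \<epsilon>.\<close>
 define e where "e = (?pf tet - \<kappa>) / 3"
 have e: "0 < e" using \<kappa> by (simp add: e_def)
 note tetL = X_space_L2_L2[OF tet]
 obtain \<rho> where \<rho>: "0 < \<rho>"
  "\<And>\<eta>. \<eta> \<in> L2_L2 T \<Longrightarrow> sqrt (\<integral>t. (norm (\<eta> t - tet t))\<^sup>2 \<partial>lebesgue_on {0..T}) < \<rho> \<Longrightarrow>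
    (\<And>k t. k \<in> F \<Longrightarrow> t \<in> {0..T} \<Longrightarrow> \<bar>(\<eta> t - tet t) \<bullet> cas k\<bar> < \<rho>) \<Longrightarrow> ?pf tet - e \<le> ?pf \<eta>"
  by (rule path_functional_continuity[OF T n0 tetL e, of F al c y \<psi>]) blast
 let ?S = "{\<eta> \<in> X_space al T. sqrt (\<integral>t. (norm (\<eta> t - tet t))\<^sup>2 \<partial>lebesgue_on {0..T}) < \<rho>}"
 let ?C = "\<lambda>k. {\<eta> \<in> X_space al T. \<forall>t\<in>{0..T}. \<bar>(\<eta> t - tet t) \<bullet> cas k\<bar> < \<rho>}"
 \<comment> \<open>For empty \<open>F\<close> the intersection of the \<open>?C k\<close> is the
   universe; intersecting with the top space keeps \<open>G\<close> open in that case as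
   well.\<close>
 define G where "G = ?S \<inter> ((\<Inter>k\<in>F. ?C k) \<inter> topspace (X_topology al T))"
 have S: "openin (X_topology al T) ?S"
  unfolding X_topology_def
  by (rule topology_generated_by_Basis) (use tet \<rho>(1) in \<open>auto simp: X_strong_subbase_def\<close>)
 have C: "openin (X_topology al T) (?C k)" if "k \<in> F" for k
 proof -
  have "k \<noteq> 0" using that F(2) by blast
  then have "cas k \<in> H" by (rule cas_H)
  then have "?C k \<in> X_cont_subbase al T" using tet \<rho>(1) unfolding X_cont_subbase_def by blast
  then show ?thesis unfolding X_topology_def by (intro topology_generated_by_Basis) auto
 qed
 have G: "openin (X_topology al T) G" unfolding G_def by (intro openin_Int[OF S] openin_INT F C)
 have "tet \<in> ?S" using tet \<rho>(1) by simp
 then have tetG: "tet \<in> G" using openin_subset[OF S] tet \<rho>(1) unfolding G_def by auto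
 have Gpf: "?pf tet - e \<le> ?pf \<eta>" if "\<eta> \<in> G" for \<eta>
  using that by (intro \<rho>(2) X_space_L2_L2) (auto simp: G_def)
 \<comment> \<open>The logarithmic cost of the moment: \<open>?a\<close> for each mode from the
   initial Gaussian, \<open>?b\<close> for each unit of the trace from the dynamics.\<close>
 let ?a = "ln (1 / sqrt (1 - c))" and ?b = "c * T"
 let ?R = "\<lambda>ep. real (card (modes (m ep))) * ?a + ?b * (\<Sum>i\<in>modes (m ep). lam (2 * al) i)"
 have sq: "0 < sqrt (1 - c)" "sqrt (1 - c) \<le> 1" using c by auto
 then have a0: "0 \<le> ?a" by simp
 have b0: "0 \<le> ?b" using c T by simp
 obtain N where N: "\<And>n. N \<le> n \<Longrightarrow> F \<subseteq> modes n" using finite_subset_modes[OF F(1,2)] by blast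
 have "eventually (\<lambda>ep. N \<le> m ep) (at_right 0)" using m_at_top by (simp add: filterlim_at_top)
 moreover have "eventually (\<lambda>ep. ep * ?R ep < e) (at_right 0)"
  using modes_cost_tendsto[OF alpha m_pos scaling a0 b0] e by (auto dest: order_tendstoD)
 moreover have "eventually (\<lambda>ep::real. 0 < ep) (at_right 0)" by (rule eventually_at_right_less)
 ultimately have "eventually (\<lambda>ep. ereal ep * elog (measure (\<mu> ep) G) \<le> ereal (- \<kappa>)) (at_right 0)"
 proof eventually_elim
  case (elim ep)
  interpret galerkin M W al T ep "m ep" "\<Theta> ep"
   using T elim m_pos W Theta initial_law initial_indep M by (simp add: galerkin_def galerkin_axioms_def)
  let ?A = "\<Theta> ep -` G \<inter> space M"
  have "AE w in M. w \<in> ?A \<longrightarrow> ?pf tet - e \<le> energy_functional c \<psi> n0 T (X w) (noise w)"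
  proof -
   have "AE w in M. ?pf (\<Theta> ep w) \<le> energy_functional c \<psi> n0 T (X w) (noise w)"
    using N[OF elim(1)] F(3,4) c(1) n0 by (rule energy_functional_ge_path_functional)
   then show ?thesis by eventually_elim (use Gpf in force)
  qed
  then have "emeasure M ?A \<le> ennreal (exp ((e - (?pf tet - e)) / ep)
    * ((1 / sqrt (1 - c)) ^ card (modes (m ep)) * exp (c * T * (\<Sum>i\<in>modes (m ep). lam (2 * al) i))))"
   by (rule galerkin_bound[OF c n0 e])
  also have "(1 / sqrt (1 - c)) ^ card (modes (m ep)) = exp (real (card (modes (m ep))) * ?a)"
   using sq by (subst exp_of_nat_mult) simp
  also have "exp ((e - (?pf tet - e)) / ep) * (exp (real (card (modes (m ep))) * ?a) * exp (c * T * (\<Sum>i\<in>modes (m ep). lam (2 * al) i)))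
    = exp ((e - (?pf tet - e)) / ep + ?R ep)"
   by (simp add: exp_add)
  finally have "emeasure (\<mu> ep) G \<le> ennreal (exp ((e - (?pf tet - e)) / ep + ?R ep))"
   using emeasure_distr_le[of M "X_borel al T" "\<Theta> ep" G] unfolding mu[OF elim(3)] path_law_def by (rule order_trans[rotated])
  then have "measure (\<mu> ep) G \<le> exp ((e - (?pf tet - e)) / ep + ?R ep)"
   unfolding measure_def by (intro enn2real_leI) auto
  then have "ereal ep * elog (measure (\<mu> ep) G) \<le> ereal (ep * ((e - (?pf tet - e)) / ep + ?R ep))"
   using elim(3) by (intro elog_le) auto
  also have "ep * ((e - (?pf tet - e)) / ep + ?R ep) = 2 * e - ?pf tet + ep * ?R ep" using elim(3) by (simp add: field_simps)
  also have "2 * e - ?pf tet = - \<kappa> - e" by (simp add: e_def field_simps)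
  also have "- \<kappa> - e + ep * ?R ep \<le> - \<kappa>" using elim(2) by (simp only: diff_add_eq diff_le_eq add_le_cancel_left less_imp_le)
  finally show ?case by simp
 qed
 then have "Limsup (at_right 0) (\<lambda>ep. ereal ep * elog (measure (\<mu> ep) G)) \<le> ereal (- \<kappa>)"
  by (rule Limsup_bounded)
 then have "Liminf (at_right 0) (\<lambda>ep. ereal ep * elog (measure (\<mu> ep) G)) \<le> ereal (- \<kappa>)"
  using Liminf_le_Limsup[of "at_right (0::real)" "\<lambda>ep. ereal ep * elog (measure (\<mu> ep) G)"] by (auto intro: order_trans)
 then show ?thesis by (rule INF_lower2[rotated]) (use G tetG in auto)
qed

section \<open>Integrals over a time interval\<close>

text \<open>Holds because Lebesgue measure is complete. It is needed for functions that involve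
  \<open>Lam\<close>, whose values are known only almost everywhere in time.\<close>

lemma borel_measurable_lebesgue_on_AE:
 fixes f g :: "real \<Rightarrow> real"
 assumes f: "f \<in> borel_measurable (lebesgue_on S)" and S: "S \<in> sets lebesgue"
  and ae: "AE x in lebesgue_on S. f x = g x"
 shows "g \<in> borel_measurable (lebesgue_on S)"
proof -
 have "(\<lambda>x. if x \<in> S then f x else 0) \<in> borel_measurable lebesgue" using f borel_measurable_if[OF S] by blast
 moreover have "AE x in lebesgue. x \<in> S \<longrightarrow> f x = g x" using ae S by (simp add: AE_restrict_space_iff)
 then have "AE x in lebesgue. (if x \<in> S then f x else 0) = (if x \<in> S then g x else 0)" by eventually_elim auto
 ultimately have "(\<lambda>x. if x \<in> S then g x else 0) \<in> borel_measurable lebesgue" by (rule borel_measurable_AE)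
 then show ?thesis using borel_measurable_if[OF S] by blast
qed

lemma lebesgue_on_reflect:
 "distr (lebesgue_on {0..T}) (lebesgue_on {0..T}) (\<lambda>s. T - s) = lebesgue_on {0..T::real}" (is "?D = _")
 and measurable_reflect: "(\<lambda>s. T - s) \<in> lebesgue_on {0..T} \<rightarrow>\<^sub>M lebesgue_on {0..T::real}"
proof -
 have m: "(\<lambda>s::real. T + (-1) * s) \<in> lebesgue \<rightarrow>\<^sub>M lebesgue"
  using lebesgue_affine_measurable[where c = "\<lambda>x::real. -1"] by simp
 show mr: "(\<lambda>s. T - s) \<in> lebesgue_on {0..T} \<rightarrow>\<^sub>M lebesgue_on {0..T}"
  using measurable_restrict_space1[OF m, of "{0..T}"] by (intro measurable_restrict_space2) auto
 show "?D = lebesgue_on {0..T}"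
 proof (rule measure_eqI)
  show "sets ?D = sets (lebesgue_on {0..T})" by simp
  fix A assume "A \<in> sets ?D"
  then have A: "A \<in> sets (lebesgue_on {0..T})" by simp
  then have AS: "A \<subseteq> {0..T}" "A \<in> sets lebesgue" using sets.sets_into_space[OF A] by (auto simp: sets_restrict_space)
  have B: "(\<lambda>s. T - s) -` A \<inter> {0..T} = (\<lambda>s. T - s) -` A" using AS(1) by auto
  have "(\<lambda>s. T - s) -` A \<in> sets lebesgue" using measurable_sets[OF m AS(2)] by simp
  have "emeasure ?D A = emeasure (lebesgue_on {0..T}) ((\<lambda>s. T - s) -` A)"
   using A by (simp add: emeasure_distr[OF mr] B)
  also have "\<dots> = emeasure lebesgue ((\<lambda>s. T - s) -` A)" using B by (subst emeasure_restrict_space) auto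
  also have "\<dots> = emeasure (distr lebesgue lebesgue (\<lambda>s. T + (-1) * s)) A"
   by (subst emeasure_distr[OF m AS(2)]) simp
  also have "\<dots> = emeasure (density (distr lebesgue lebesgue (\<lambda>s. T + (-1) * s)) (\<lambda>_. ennreal \<bar>-1\<bar>)) A"
   by (simp add: density_1)
  also have "\<dots> = emeasure lebesgue A" using lebesgue_real_affine[of "-1" T] by simp
  also have "\<dots> = emeasure (lebesgue_on {0..T}) A" using AS by (subst emeasure_restrict_space) auto
  finally show "emeasure ?D A = emeasure (lebesgue_on {0..T}) A" .
 qed
qed

lemma AE_reflect:
 assumes "AE s in lebesgue_on {0..T::real}. P s"
 shows "AE s in lebesgue_on {0..T}. P (T - s)"
 by (rule AE_distrD[OF measurable_reflect[of T]]) (subst lebesgue_on_reflect, rule assms)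

lemma integrable_reflect:
 fixes f :: "real \<Rightarrow> real"
 assumes "integrable (lebesgue_on {0..T}) f"
 shows "integrable (lebesgue_on {0..T}) (\<lambda>s. f (T - s))"
  "(\<integral>s. f (T - s) \<partial>lebesgue_on {0..T}) = (\<integral>s. f s \<partial>lebesgue_on {0..T})"
proof -
 have f: "f \<in> borel_measurable (lebesgue_on {0..T})" using assms by simp
 show "integrable (lebesgue_on {0..T}) (\<lambda>s. f (T - s))"
  by (rule integrable_distr[OF measurable_reflect[of T]]) (subst lebesgue_on_reflect, rule assms)
 show "(\<integral>s. f (T - s) \<partial>lebesgue_on {0..T}) = (\<integral>s. f s \<partial>lebesgue_on {0..T})"
  using integral_distr[OF measurable_reflect f] unfolding lebesgue_on_reflect by simp
qed

lemma integral_reflect_end: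
 fixes f :: "real \<Rightarrow> real"
 assumes "f integrable_on {T - t..T}"
 shows "integral {0..t} (\<lambda>s. f (T - s)) = integral {T - t..T} f"
proof -
 have "(\<lambda>x. (1 / (-1)) *\<^sub>R x + - ((1 / (-1)) *\<^sub>R T)) ` cbox (T - t) T = {0..t}"
  by (auto simp: image_iff intro!: bexI[of _ "T - _"])
 then show ?thesis
  using has_integral_affinity[of f "integral {T - t..T} f" "T - t" T "-1" T] assms
  by (intro integral_unique) (simp add: integrable_integral)
qed

lemma abs_diff_half_le: "\<bar>a\<bar> \<le> K \<Longrightarrow> 0 \<le> b \<Longrightarrow> b \<le> L \<Longrightarrow> \<bar>a - b / 2\<bar> \<le> K + L" for a b K L :: real
 by linarith

lemma abs_diff_mean_le:
 fixes a b x B :: real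
 assumes "\<bar>a\<bar> \<le> B" "\<bar>b\<bar> \<le> B" shows "\<bar>x - (a + b) / 2\<bar> \<le> \<bar>x\<bar> + B"
proof -
 have "\<bar>a + b\<bar> / 2 \<le> B" using order_trans[OF abs_triangle_ineq add_mono[OF assms]] by simp
 then show ?thesis using abs_triangle_ineq4[of x "(a + b) / 2"] by simp
qed

text \<open>Every piecewise constant approximation \<open>w\<close> bounds \<open>\<integral>f\<^sup>2/2\<close> from below; sampling a continuous
 approximation of \<open>f\<close> makes the loss arbitrarily small.\<close>

lemma continuous_approximation:
 fixes f :: "real \<Rightarrow> real"
 assumes m: "f \<in> borel_measurable (lebesgue_on {0..T})" and i2: "integrable (lebesgue_on {0..T}) (\<lambda>s. (f s)\<^sup>2)"
  and e: "0 < e"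
 obtains u where "continuous_on UNIV u" "bounded (range u)"
  "(\<integral>s. (f s)\<^sup>2 / 2 \<partial>lebesgue_on {0..T}) - e < (\<integral>s. u s * f s - (u s)\<^sup>2 / 2 \<partial>lebesgue_on {0..T})"
proof -
 let ?M = "lebesgue_on {0..T}"
 \<comment> \<open>Clamping at level \<open>B\<close> is used twice: on \<open>f\<close>, and at the
   same level on continuous functions converging to \<open>f\<close>, which are thereby
   dominated.\<close>
 define cl where "cl B x = max (- B) (min B x)" for B x :: real
 interpret finite_measure ?M by (rule finite_measure_interval)
 have clb: "\<bar>cl B x\<bar> \<le> B" if "0 \<le> B" for B x using that by (auto simp: cl_def)
 have clf: "\<bar>cl B x\<bar> \<le> \<bar>x\<bar>" if "0 \<le> B" for B x using that by (auto simp: cl_def)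
 have i1: "integrable ?M f" by (rule square_integrable_imp_integrable[OF m i2])
 have "(\<lambda>n. \<integral>s. cl (real n) (f s) * f s - (cl (real n) (f s))\<^sup>2 / 2 \<partial>?M) \<longlonglongrightarrow> (\<integral>s. (f s)\<^sup>2 / 2 \<partial>?M)"
 proof (rule integral_dominated_convergence)
  show "(\<lambda>s. (f s)\<^sup>2 / 2) \<in> borel_measurable ?M" using m by simp
  show "(\<lambda>s. cl (real n) (f s) * f s - (cl (real n) (f s))\<^sup>2 / 2) \<in> borel_measurable ?M" for n using m by (simp add: cl_def)
  show "integrable ?M (\<lambda>s. 2 * (f s)\<^sup>2)" using i2 by simp
  show "AE s in ?M. (\<lambda>n. cl (real n) (f s) * f s - (cl (real n) (f s))\<^sup>2 / 2) \<longlonglongrightarrow> (f s)\<^sup>2 / 2"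
  proof (rule AE_I2)
   fix s
   have "eventually (\<lambda>n. cl (real n) (f s) = f s) sequentially"
    using eventually_ge_at_top[of "nat \<lceil>\<bar>f s\<bar>\<rceil>"] by eventually_elim (auto simp: cl_def)
   then have "eventually (\<lambda>n. cl (real n) (f s) * f s - (cl (real n) (f s))\<^sup>2 / 2 = (f s)\<^sup>2 / 2) sequentially"
    by eventually_elim (simp add: power2_eq_square)
   then show "(\<lambda>n. cl (real n) (f s) * f s - (cl (real n) (f s))\<^sup>2 / 2) \<longlonglongrightarrow> (f s)\<^sup>2 / 2"
    by (rule tendsto_eventually)
  qed
  show "AE s in ?M. norm (cl (real n) (f s) * f s - (cl (real n) (f s))\<^sup>2 / 2) \<le> 2 * (f s)\<^sup>2" for n
  proof (rule AE_I2)
   fix s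
   have c: "\<bar>cl (real n) (f s)\<bar> \<le> \<bar>f s\<bar>" by (rule clf) simp
   have "\<bar>cl (real n) (f s) * f s\<bar> \<le> \<bar>f s\<bar> * \<bar>f s\<bar>" unfolding abs_mult using c by (intro mult_right_mono) auto
   moreover have "(cl (real n) (f s))\<^sup>2 \<le> (f s)\<^sup>2" using power_mono[OF c, of 2] by simp
   ultimately show "norm (cl (real n) (f s) * f s - (cl (real n) (f s))\<^sup>2 / 2) \<le> 2 * (f s)\<^sup>2"
    using abs_diff_half_le[of "cl (real n) (f s) * f s" "(f s)\<^sup>2" "(cl (real n) (f s))\<^sup>2" "(f s)\<^sup>2"]
    by (simp add: power2_eq_square)
  qed
 qed
 from order_tendstoD(1)[OF this, of "(\<integral>s. (f s)\<^sup>2 / 2 \<partial>?M) - e"] e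
 obtain n where n: "(\<integral>s. (f s)\<^sup>2 / 2 \<partial>?M) - e < (\<integral>s. cl (real n) (f s) * f s - (cl (real n) (f s))\<^sup>2 / 2 \<partial>?M)"
  by (auto simp: eventually_sequentially)
 have S: "{0..T} \<in> sets lebesgue" by simp
 have "(\<lambda>x. if x \<in> {0..T} then f x else 0) \<in> borel_measurable lebesgue" using m borel_measurable_if[OF S] by blast
 \<comment> \<open>This form of Lebesgue measurability supplies continuous functions that converge
   to \<open>f\<close> off a negligible set.\<close>
 then have "(\<lambda>x. if x \<in> {0..T} then f x else 0) measurable_on UNIV" by (rule lebesgue_measurable_imp_measurable_on) simp
 then obtain N h where N: "negligible N" and h: "\<And>j::nat. continuous_on UNIV (h j)"
  "\<And>x. x \<notin> N \<Longrightarrow> (\<lambda>j. h j x) \<longlonglongrightarrow> (if x \<in> {0..T} then f x else 0)"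
  unfolding measurable_on_def by auto
 have hc: "continuous_on UNIV (\<lambda>x. cl (real n) (h j x))" for j
  unfolding cl_def by (intro continuous_intros h)
 have hm: "(\<lambda>x. cl (real n) (h j x)) \<in> borel_measurable ?M" for j
  by (rule continuous_imp_measurable_on_sets_lebesgue[OF continuous_on_subset[OF hc]]) auto
 have "AE x in lebesgue. x \<notin> N" using N by (simp add: negligible_iff_null_sets AE_not_in)
 then have AEN: "AE x in ?M. x \<notin> N" by (subst AE_restrict_space_iff) (auto elim: eventually_mono)
 have "(\<lambda>j. \<integral>s. cl (real n) (h j s) * f s - (cl (real n) (h j s))\<^sup>2 / 2 \<partial>?M)
   \<longlonglongrightarrow> (\<integral>s. cl (real n) (f s) * f s - (cl (real n) (f s))\<^sup>2 / 2 \<partial>?M)"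
 proof (rule integral_dominated_convergence)
  show "(\<lambda>s. cl (real n) (f s) * f s - (cl (real n) (f s))\<^sup>2 / 2) \<in> borel_measurable ?M" using m by (simp add: cl_def)
  show "(\<lambda>s. cl (real n) (h j s) * f s - (cl (real n) (h j s))\<^sup>2 / 2) \<in> borel_measurable ?M" for j using m hm[of j] by simp
  show "integrable ?M (\<lambda>s. real n * \<bar>f s\<bar> + (real n)\<^sup>2)" using i1 by simp
  show "AE s in ?M. (\<lambda>j. cl (real n) (h j s) * f s - (cl (real n) (h j s))\<^sup>2 / 2) \<longlonglongrightarrow> cl (real n) (f s) * f s - (cl (real n) (f s))\<^sup>2 / 2"
   using AEN AE_space
  proof eventually_elim
   case (elim s)
   have "(\<lambda>j. h j s) \<longlonglongrightarrow> f s" using h(2)[OF elim(1)] elim(2) by simp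
   then show ?case unfolding cl_def by (auto intro!: tendsto_intros)
  qed
  show "AE s in ?M. norm (cl (real n) (h j s) * f s - (cl (real n) (h j s))\<^sup>2 / 2) \<le> real n * \<bar>f s\<bar> + (real n)\<^sup>2" for j
  proof (rule AE_I2)
   fix s
   have c: "\<bar>cl (real n) (h j s)\<bar> \<le> real n" by (rule clb) simp
   have "\<bar>cl (real n) (h j s) * f s\<bar> \<le> real n * \<bar>f s\<bar>" unfolding abs_mult using c by (intro mult_right_mono) auto
   moreover have "(cl (real n) (h j s))\<^sup>2 \<le> (real n)\<^sup>2" using power_mono[OF c, of 2] by simp
   ultimately show "norm (cl (real n) (h j s) * f s - (cl (real n) (h j s))\<^sup>2 / 2) \<le> real n * \<bar>f s\<bar> + (real n)\<^sup>2"
    using abs_diff_half_le[of "cl (real n) (h j s) * f s" "real n * \<bar>f s\<bar>" "(cl (real n) (h j s))\<^sup>2" "(real n)\<^sup>2"] by simp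
  qed
 qed
 from order_tendstoD(1)[OF this n]
 obtain j where j: "(\<integral>s. (f s)\<^sup>2 / 2 \<partial>?M) - e < (\<integral>s. cl (real n) (h j s) * f s - (cl (real n) (h j s))\<^sup>2 / 2 \<partial>?M)"
  by (auto simp: eventually_sequentially)
 show ?thesis
 proof (rule that[OF hc[of j] _ j])
  show "bounded (range (\<lambda>x. cl (real n) (h j x)))" using clb[of "real n"] by (auto simp: bounded_iff)
 qed
qed

lemma sum_integral_grid:
 fixes f :: "real \<Rightarrow> real"
 assumes T: "0 < T" and n: "0 < n" and f: "integrable (lebesgue_on {0..T}) f"
 shows "(\<Sum>r<n. integral {real r * (T / real n)..real (Suc r) * (T / real n)} f) = (\<integral>s. f s \<partial>lebesgue_on {0..T})"
proof -
 let ?t = "\<lambda>r. real r * (T / real n)" and ?J = "\<lambda>b. \<integral>s. f s \<partial>lebesgue_on {0..b}"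
 have "(\<Sum>r<n. integral {?t r..?t (Suc r)} f) = (\<Sum>r<n. ?J (?t (Suc r)) - ?J (?t r))"
  by (intro sum.cong refl integrable_lebesgue_on_diff[symmetric, OF f] grid_bounds[OF T n]) auto
 also have "\<dots> = ?J (?t n) - ?J (?t 0)" by (rule sum_lessThan_telescope)
 also have "?J (?t 0) = 0"
 proof -
  have "f absolutely_integrable_on {0..0}" using absolutely_integrable_on_null[of 0 0 f] by simp
  then have "integrable (lebesgue_on {0..0}) f" by (subst integrable_lebesgue_on_iff) auto
  then have "?J 0 = integral {0..0} f" by (rule lebesgue_integral_eq_integral) simp
  then show ?thesis by simp
 qed
 finally show ?thesis using n by simp
qed

text \<open>Valid for all large \<open>n\<close>, not merely for some: the finitely many modes of a
  truncation must share a single time grid.\<close>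

lemma step_approximation:
 fixes f :: "real \<Rightarrow> real"
 assumes T: "0 < T" and m: "f \<in> borel_measurable (lebesgue_on {0..T})"
  and i2: "integrable (lebesgue_on {0..T}) (\<lambda>s. (f s)\<^sup>2)" and e: "0 < e"
 shows "eventually (\<lambda>n. \<exists>w. (\<integral>s. (f s)\<^sup>2 / 2 \<partial>lebesgue_on {0..T}) - e
   < (\<Sum>r<n. w r * integral {real r * (T / real n)..real (Suc r) * (T / real n)} f - (w r)\<^sup>2 / 2 * (T / real n))) sequentially"
proof -
 let ?M = "lebesgue_on {0..T}"
 interpret finite_measure ?M by (rule finite_measure_interval)
 have i1: "integrable ?M f" by (rule square_integrable_imp_integrable[OF m i2])
 obtain u where u: "continuous_on UNIV u" "bounded (range u)"
  "(\<integral>s. (f s)\<^sup>2 / 2 \<partial>?M) - e / 2 < (\<integral>s. u s * f s - (u s)\<^sup>2 / 2 \<partial>?M)"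
  using continuous_approximation[OF m i2, of "e / 2"] e by auto
 obtain B where B: "0 < B" "\<And>s. \<bar>u s\<bar> \<le> B" using u(2) unfolding bounded_pos by auto
 define C where "C = (\<integral>s. \<bar>f s\<bar> + B \<partial>?M)"
 have iC: "integrable ?M (\<lambda>s. \<bar>f s\<bar> + B)" using i1 by simp
 have C: "0 \<le> C" unfolding C_def using B by (intro Bochner_Integration.integral_nonneg) (auto intro: add_nonneg_nonneg)
 define d where "d = e / (2 * (C + 1))"
 have d: "0 < d" "d * C < e / 2" using e C by (auto simp: d_def field_simps)
 have "uniformly_continuous_on {0..T} u"
  by (rule compact_uniformly_continuous[OF continuous_on_subset[OF u(1)]]) auto
 then obtain \<delta> where \<delta>: "0 < \<delta>" "\<And>s t. s \<in> {0..T} \<Longrightarrow> t \<in> {0..T} \<Longrightarrow> \<bar>s - t\<bar> < \<delta> \<Longrightarrow> \<bar>u s - u t\<bar> < d"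
  using d(1) unfolding uniformly_continuous_on_def dist_real_def by metis
 have um: "u \<in> borel_measurable ?M" by (rule continuous_imp_measurable_on_sets_lebesgue[OF continuous_on_subset[OF u(1)]]) auto
 have iu: "integrable ?M (\<lambda>s. u s * f s - (u s)\<^sup>2 / 2)"
 proof (rule Bochner_Integration.integrable_bound)
  show "integrable ?M (\<lambda>s. B * \<bar>f s\<bar> + B\<^sup>2)" using i1 by simp
  show "(\<lambda>s. u s * f s - (u s)\<^sup>2 / 2) \<in> borel_measurable ?M" using m um by simp
  show "AE s in ?M. norm (u s * f s - (u s)\<^sup>2 / 2) \<le> norm (B * \<bar>f s\<bar> + B\<^sup>2)"
  proof (rule AE_I2)
   fix s
   have "\<bar>u s * f s\<bar> \<le> B * \<bar>f s\<bar>" unfolding abs_mult using B(2) by (intro mult_right_mono) auto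
   moreover have "(u s)\<^sup>2 \<le> B\<^sup>2" using power_mono[OF B(2), of s 2] by simp
   moreover have "0 \<le> B * \<bar>f s\<bar>" using B by simp
   ultimately show "norm (u s * f s - (u s)\<^sup>2 / 2) \<le> norm (B * \<bar>f s\<bar> + B\<^sup>2)"
    using abs_diff_half_le[of "u s * f s" "B * \<bar>f s\<bar>" "(u s)\<^sup>2" "B\<^sup>2"] by simp
  qed
 qed
 obtain n1 where n1: "T / \<delta> < real n1" using reals_Archimedean2 by blast
 have "eventually (\<lambda>n. max 1 n1 \<le> n) sequentially" by (rule eventually_ge_at_top)
 then show ?thesis
 proof eventually_elim
  case (elim n)
  then have n: "0 < n" "n1 \<le> n" by auto
  let ?t = "\<lambda>r. real r * (T / real n)"
  note tT = grid_bounds[OF T n(1)]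
  have dt: "?t (Suc r) - ?t r = T / real n" for r by (simp add: algebra_simps add_divide_distrib)
  have "T < \<delta> * real n1" using n1 \<delta>(1) by (simp add: field_simps)
  also have "\<dots> \<le> \<delta> * real n" using n \<delta>(1) by (intro mult_left_mono) auto
  finally have dt\<delta>: "T / real n < \<delta>" using n by (simp add: field_simps)
  let ?g = "\<lambda>s. u s * f s - (u s)\<^sup>2 / 2"
  have piece: "integral {?t r..?t (Suc r)} ?g - d * integral {?t r..?t (Suc r)} (\<lambda>s. \<bar>f s\<bar> + B)
    \<le> u (?t r) * integral {?t r..?t (Suc r)} f - (u (?t r))\<^sup>2 / 2 * (T / real n)" if r: "r < n" for r
  proof -
   have sub: "{?t r..?t (Suc r)} \<subseteq> {0..T}" using tT(1)[of r] tT(3)[OF r] by (simp only: atLeastatMost_subset_iff) blast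
   have ig: "?g integrable_on {?t r..?t (Suc r)}" "f integrable_on {?t r..?t (Suc r)}" "(\<lambda>s. \<bar>f s\<bar> + B) integrable_on {?t r..?t (Suc r)}"
    by (rule integrable_lebesgue_on_subinterval(2)[OF _ sub], fact)+
   have cst: "((\<lambda>s. (u (?t r))\<^sup>2 / 2) has_integral (u (?t r))\<^sup>2 / 2 * (T / real n)) {?t r..?t (Suc r)}"
    using has_integral_const_real[of "(u (?t r))\<^sup>2 / 2" "?t r" "?t (Suc r)"] tT(2)[of r] dt[of r] by (simp add: mult.commute)
   have h1: "((\<lambda>s. u (?t r) * f s - (u (?t r))\<^sup>2 / 2) has_integral (u (?t r) * integral {?t r..?t (Suc r)} f - (u (?t r))\<^sup>2 / 2 * (T / real n))) {?t r..?t (Suc r)}"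
    by (intro has_integral_diff has_integral_mult_right integrable_integral ig cst)
   have h2: "((\<lambda>s. ?g s - d * (\<bar>f s\<bar> + B)) has_integral (integral {?t r..?t (Suc r)} ?g - d * integral {?t r..?t (Suc r)} (\<lambda>s. \<bar>f s\<bar> + B))) {?t r..?t (Suc r)}"
    by (intro has_integral_diff has_integral_mult_right integrable_integral ig)
   show ?thesis
   proof (rule has_integral_le[OF h2 h1])
    fix s assume s: "s \<in> {?t r..?t (Suc r)}"
    then have "\<bar>s - ?t r\<bar> < \<delta>" using dt[of r] dt\<delta> unfolding atLeastAtMost_iff by linarith
    moreover have "s \<in> {0..T}" using s sub by blast
    moreover have "?t r \<in> {0..T}" using sub tT(2)[of r] by (meson atLeastAtMost_iff order_refl subsetD)
    ultimately have ud: "\<bar>u s - u (?t r)\<bar> \<le> d" using \<delta>(2) by (meson less_imp_le)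
    \<comment> \<open>The difference factors as the oscillation of \<open>u\<close> times
      \<open>f\<close> minus a mean value of \<open>u\<close>; the first factor is below
      \<open>d\<close>, the second is integrable.\<close>
    have "?g s - (u (?t r) * f s - (u (?t r))\<^sup>2 / 2) = (u s - u (?t r)) * (f s - (u s + u (?t r)) / 2)"
     by (simp add: power2_eq_square field_simps)
    also have "\<dots> \<le> \<bar>u s - u (?t r)\<bar> * \<bar>f s - (u s + u (?t r)) / 2\<bar>" unfolding abs_mult[symmetric] by (rule abs_ge_self)
    also have "\<dots> \<le> d * (\<bar>f s\<bar> + B)"
    proof (rule mult_mono[OF ud])
     show "\<bar>f s - (u s + u (?t r)) / 2\<bar> \<le> \<bar>f s\<bar> + B" by (rule abs_diff_mean_le) (rule B(2))+
    qed (use d(1) in auto)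
    finally show "?g s - d * (\<bar>f s\<bar> + B) \<le> u (?t r) * f s - (u (?t r))\<^sup>2 / 2" by linarith
   qed
  qed
  have "(\<integral>s. ?g s \<partial>?M) - d * C = (\<Sum>r<n. integral {?t r..?t (Suc r)} ?g - d * integral {?t r..?t (Suc r)} (\<lambda>s. \<bar>f s\<bar> + B))"
   unfolding C_def sum_subtractf sum_distrib_left[symmetric] sum_integral_grid[OF T n(1) iu] sum_integral_grid[OF T n(1) iC] ..
  also have "\<dots> \<le> (\<Sum>r<n. u (?t r) * integral {?t r..?t (Suc r)} f - (u (?t r))\<^sup>2 / 2 * (T / real n))"
   by (intro sum_mono piece) auto
  finally have "(\<integral>s. (f s)\<^sup>2 / 2 \<partial>?M) - e < (\<Sum>r<n. u (?t r) * integral {?t r..?t (Suc r)} f - (u (?t r))\<^sup>2 / 2 * (T / real n))"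
   using u(3) d(2) by linarith
  then show ?case by (intro exI[of _ "\<lambda>r. u (?t r)"])
 qed
qed

section \<open>Square-integrable paths and the mean-zero part of the control\<close>

lemma square_integrable_path_inner:
 assumes f: "square_integrable_path T f" and g: "square_integrable_path T g"
 shows "integrable (lebesgue_on {0..T}) (\<lambda>t. f t \<bullet> g t)"
proof (rule Bochner_Integration.integrable_bound)
 show "integrable (lebesgue_on {0..T}) (\<lambda>t. (norm (f t))\<^sup>2 + (norm (g t))\<^sup>2)"
  using f g by (simp add: square_integrable_path_def)
 show "(\<lambda>t. f t \<bullet> g t) \<in> borel_measurable (lebesgue_on {0..T})"
  by (intro measurable_inner_coef square_integrable_pathD f g)
 have "\<bar>x \<bullet> y\<bar> \<le> (norm x)\<^sup>2 + (norm y)\<^sup>2" for x y :: l2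
  using Cauchy_Schwarz_ineq2[of x y] sum_squares_bound[of "norm x" "norm y"] mult_nonneg_nonneg[of "norm x" "norm y"] by simp
 then show "AE t in lebesgue_on {0..T}. norm (f t \<bullet> g t) \<le> norm ((norm (f t))\<^sup>2 + (norm (g t))\<^sup>2)"
  by (intro AE_I2) simp
qed

lemma square_integrable_path_add:
 assumes f: "square_integrable_path T f" and g: "square_integrable_path T g"
 shows "square_integrable_path T (\<lambda>t. f t + g t)"
proof -
 have "(norm (f t + g t))\<^sup>2 = (norm (f t))\<^sup>2 + 2 * (f t \<bullet> g t) + (norm (g t))\<^sup>2" for t
  by (simp add: power2_norm_eq_inner inner_add_left inner_add_right inner_commute)
 then show ?thesis
  using square_integrable_pathD[OF f] square_integrable_pathD[OF g] square_integrable_path_inner[OF f g]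
  by (intro square_integrable_pathI) (simp_all add: coef_add)
qed

lemma square_integrable_path_scaleR:
 "square_integrable_path T f \<Longrightarrow> square_integrable_path T (\<lambda>t. c *\<^sub>R f t)"
 using square_integrable_pathD by (intro square_integrable_pathI) (auto simp: coef_scaleR power_mult_distrib)

lemma square_integrable_path_diff:
 assumes f: "square_integrable_path T f" and g: "square_integrable_path T g"
 shows "square_integrable_path T (\<lambda>t. f t - g t)"
 using square_integrable_path_add[OF f square_integrable_path_scaleR[OF g, of "-1"]] by simp

text \<open>At times where the path is not in the domain \<open>Lam al (tet s)\<close> is
  unspecified. Such times form a null set, so the coefficients are measurable by completeness of
  Lebesgue measure.\<close>

lemma square_integrable_path_Lam:
 assumes tet: "tet \<in> L2_Hs T al"
 shows "square_integrable_path T (\<lambda>s. Lam al (tet s))"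
  "(\<integral>s. (Hs_norm al (tet s))\<^sup>2 \<partial>lebesgue_on {0..T}) = (\<integral>s. (norm (Lam al (tet s)))\<^sup>2 \<partial>lebesgue_on {0..T})"
proof -
 let ?M = "lebesgue_on {0..T}"
 have m: "tet \<in> borel_measurable ?M" and ae: "AE s in ?M. tet s \<in> Lam_dom al"
  and n: "integrable ?M (\<lambda>s. (Hs_norm al (tet s))\<^sup>2)"
  using tet by (auto simp: L2_Hs_def Hs_iff elim: eventually_mono)
 have S: "{0..T} \<in> sets lebesgue" by simp
 have c: "(\<lambda>s. coef (Lam al (tet s)) k) \<in> borel_measurable ?M" for k
 proof (rule borel_measurable_lebesgue_on_AE[OF _ S])
  show "(\<lambda>s. lam al k * coef (tet s) k) \<in> borel_measurable ?M" using m by simp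
  show "AE s in ?M. lam al k * coef (tet s) k = coef (Lam al (tet s)) k"
   using ae by eventually_elim (simp add: coef_Lam)
 qed
 have nm: "(\<lambda>s. (norm (Lam al (tet s)))\<^sup>2) \<in> borel_measurable ?M"
  unfolding power2_norm_eq_inner by (rule measurable_inner_coef[OF c c])
 have eq: "AE s in ?M. (Hs_norm al (tet s))\<^sup>2 = (norm (Lam al (tet s)))\<^sup>2"
  using ae by eventually_elim (simp add: Hs_norm_eq)
 show "square_integrable_path T (\<lambda>s. Lam al (tet s))"
  by (rule square_integrable_pathI[OF c integrable_cong_AE_imp[OF n nm]]) (use eq in \<open>auto elim: eventually_mono\<close>)
 show "(\<integral>s. (Hs_norm al (tet s))\<^sup>2 \<partial>?M) = (\<integral>s. (norm (Lam al (tet s)))\<^sup>2 \<partial>?M)"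
  using n nm eq by (intro integral_cong_AE) auto
qed

text \<open>The control takes values in all of \<open>l2\<close>, but it acts only through
  \<Lambda>^\<alpha>, which annihilates constants. Its mean must be removed before its norm can be
  compared with the rate function.\<close>

definition mean_zero_part :: "l2 \<Rightarrow> l2" where
 "mean_zero_part f = f - coef f 0 *\<^sub>R cas 0"

lemma coef_mean_zero_part: "coef (mean_zero_part f) k = (if k = 0 then 0 else coef f k)"
 by (simp add: mean_zero_part_def coef_diff coef_scaleR coef_cas)

lemma inner_mean_zero_part: "h \<in> H \<Longrightarrow> mean_zero_part f \<bullet> h = f \<bullet> h"
 by (simp add: mean_zero_part_def inner_diff_left H_iff coef_def inner_commute[of h "cas 0"])

lemma norm_mean_zero_part_le: "norm (mean_zero_part f) \<le> norm f"
proof -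
 have "mean_zero_part f \<bullet> cas 0 = 0"
  using coef_mean_zero_part[of f 0] by (simp add: coef_def)
 then have "f \<bullet> f = mean_zero_part f \<bullet> mean_zero_part f + (coef f 0)\<^sup>2 * (cas 0 \<bullet> cas 0)"
  by (subst (1 2) diff_add_cancel[of f "coef f 0 *\<^sub>R cas 0", symmetric])
    (simp add: mean_zero_part_def[symmetric] inner_add_left inner_add_right inner_commute power2_eq_square)
 then have "(norm (mean_zero_part f))\<^sup>2 \<le> (norm f)\<^sup>2" by (simp add: power2_norm_eq_inner)
 then show ?thesis by (rule power2_le_imp_le) simp
qed

lemma square_integrable_path_mean_zero_part:
 assumes f: "square_integrable_path T f"
 shows "square_integrable_path T (\<lambda>t. mean_zero_part (f t))"
proof -
 have c: "(\<lambda>t. coef (mean_zero_part (f t)) k) \<in> borel_measurable (lebesgue_on {0..T})" for k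
  using square_integrable_path_coef(3)[OF f, of k] by (simp add: coef_mean_zero_part)
 have n: "integrable (lebesgue_on {0..T}) (\<lambda>t. (norm (f t))\<^sup>2)" using f by (simp add: square_integrable_path_def)
 have "integrable (lebesgue_on {0..T}) (\<lambda>t. (norm (mean_zero_part (f t)))\<^sup>2)"
 proof (rule Bochner_Integration.integrable_bound[OF n])
  show "(\<lambda>t. (norm (mean_zero_part (f t)))\<^sup>2) \<in> borel_measurable (lebesgue_on {0..T})"
   unfolding power2_norm_eq_inner by (rule measurable_inner_coef[OF c c])
  show "AE t in lebesgue_on {0..T}. norm ((norm (mean_zero_part (f t)))\<^sup>2) \<le> norm ((norm (f t))\<^sup>2)"
   by (intro AE_I2) (simp add: power_mono norm_mean_zero_part_le)
 qed
 then show ?thesis by (rule square_integrable_pathI[OF c])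
qed

section \<open>Weak solutions of the skeleton equation\<close>

lemma const_Cinf_Hinf:
 assumes "f \<in> Hinf" shows "(\<lambda>s. f) \<in> Cinf_Hinf T"
proof -
 define D where "D n = (\<lambda>s::real. if n = 0 then f else 0)" for n :: nat
 have z: "Hs_norm r 0 = 0" for r
  by (subst Hs_norm_eq) (auto intro!: Lam_eqI simp: coef_simps)
 have "D 0 = (\<lambda>s. f)" by (simp add: D_def)
 moreover have "D n t \<in> Hinf" for n t using assms Hinf_zero by (simp add: D_def)
 moreover have "(D n s - D n t) /\<^sub>R (s - t) - D (Suc n) t = 0" for n s t by (simp add: D_def)
 then have "((\<lambda>s. Hs_norm r ((D n s - D n t) /\<^sub>R (s - t) - D (Suc n) t)) \<longlongrightarrow> 0) (at t within {0..T})" for n t r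
  by (simp add: z)
 ultimately show ?thesis unfolding Cinf_Hinf_def by blast
qed

lemma time_deriv_eqI:
 assumes "0 < T" "s \<in> {0..T}" "(f has_vector_derivative D) (at s within {0..T})"
 shows "time_deriv T f s = D"
 unfolding time_deriv_def using assms by (metis islimpt_Icc trivial_limit_within vector_derivative_within)

lemma time_deriv_const: "0 < T \<Longrightarrow> s \<in> {0..T} \<Longrightarrow> time_deriv T (\<lambda>s. f) s = 0"
 by (rule time_deriv_eqI) (auto intro: has_vector_derivative_const)

text \<open>The reversed path has to be an instance again. Its control contains
  \<open>Lam al\<close> of the path, unspecified on a null set, so for \<open>g\<close> only
  \<open>square_integrable_path\<close> is asked, a class insensitive to such values.\<close>

locale skeleton_solution =
 fixes al T :: real and g tet :: "real \<Rightarrow> l2" and tet0 :: l2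
 assumes T: "0 < T" and alpha: "0 < al"
  and weak: "weak_solution al T tet0 g tet" and g: "square_integrable_path T g"
begin

lemma theta_H: "t \<in> {0..T} \<Longrightarrow> tet t \<in> H"
 using weak by (auto simp: weak_solution_def C_Hw_def)

lemma theta_L2_Hs: "tet \<in> L2_Hs T al"
 using weak by (auto simp: weak_solution_def)

lemma theta_bounded: obtains C where "0 \<le> C" "AE t in lebesgue_on {0..T}. norm (tet t) \<le> C"
proof -
 obtain C where "AE t in lebesgue_on {0..T}. tet t \<in> H \<and> norm (tet t) \<le> C"
  using weak by (auto simp: weak_solution_def Linf_H_def)
 then have "AE t in lebesgue_on {0..T}. norm (tet t) \<le> max C 0" by eventually_elim auto
 then show ?thesis by (rule that[rotated]) simp
qed

lemma theta_measurable: "tet \<in> borel_measurable (lebesgue_on {0..T})"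
 using weak by (auto simp: weak_solution_def Linf_H_def)

lemma theta_L2_L2: "tet \<in> L2_L2 T"
proof -
 interpret finite_measure "lebesgue_on {0..T}" by (rule finite_measure_interval)
 obtain C where C: "0 \<le> C" "AE t in lebesgue_on {0..T}. norm (tet t) \<le> C" by (rule theta_bounded)
 have "AE t in lebesgue_on {0..T}. norm ((norm (tet t))\<^sup>2) \<le> C\<^sup>2"
  using C(2) by eventually_elim (simp add: power_mono)
 then have "integrable (lebesgue_on {0..T}) (\<lambda>t. (norm (tet t))\<^sup>2)"
  using theta_measurable measurable_inner_l2[OF theta_measurable theta_measurable]
  by (intro integrable_const_bound) (simp_all add: power2_norm_eq_inner)
 then show ?thesis using theta_measurable by (simp add: L2_L2_def)
qed

lemmas theta_path = L2_L2_square_integrable_path[OF theta_L2_L2]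
 and Lam_theta_path = square_integrable_path_Lam(1)[OF theta_L2_Hs]

lemma theta_X_space: "tet \<in> X_space al T"
proof -
 have "tet \<in> L2_H T" using theta_L2_L2 theta_H by (auto simp: L2_H_def intro!: AE_I2)
 then show ?thesis using weak by (auto simp: X_space_def weak_solution_def)
qed

lemma AE_Lam_dom: "AE s in lebesgue_on {0..T}. tet s \<in> Lam_dom al"
 using theta_L2_Hs by (auto simp: L2_Hs_def Hs_iff elim: eventually_mono)

lemma coef_equation:
 assumes k: "k \<noteq> 0" and t: "t \<in> {0..T}"
 shows "coef (tet t) k = coef tet0 k + (\<integral>s. (- lam (2 * al) k * coef (tet s) k - nl k (tet s) (tet s) + lam al k * coef (g s) k) \<partial>lebesgue_on {0..t})"
proof -
 have "tet t \<bullet> cas k = tet0 \<bullet> cas k +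
     (\<integral>s. (tet s \<bullet> time_deriv T (\<lambda>s. cas k) s - tet s \<bullet> Lam (2 * al) (cas k) - nonlin (tet s) (cas k)
         + Lam al (cas k) \<bullet> g s) \<partial>lebesgue_on {0..t})"
 proof -
  have "\<forall>\<phi>\<in>Cinf_Hinf T. \<forall>t\<in>{0..T}. tet t \<bullet> \<phi> t = tet0 \<bullet> \<phi> 0 +
     (\<integral>s. (tet s \<bullet> time_deriv T \<phi> s - tet s \<bullet> Lam (2 * al) (\<phi> s) - nonlin (tet s) (\<phi> s)
         + Lam al (\<phi> s) \<bullet> g s) \<partial>lebesgue_on {0..t})"
   using weak unfolding weak_solution_def by (elim conjE)
  from bspec[OF bspec[OF this const_Cinf_Hinf[OF cas_Hinf[OF k]]] t] show ?thesis .
 qed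
 also have "(\<integral>s. (tet s \<bullet> time_deriv T (\<lambda>s. cas k) s - tet s \<bullet> Lam (2 * al) (cas k) - nonlin (tet s) (cas k)
         + Lam al (cas k) \<bullet> g s) \<partial>lebesgue_on {0..t})
   = (\<integral>s. (- lam (2 * al) k * coef (tet s) k - nl k (tet s) (tet s) + lam al k * coef (g s) k) \<partial>lebesgue_on {0..t})"
 proof (rule Bochner_Integration.integral_cong[OF refl])
  fix s assume "s \<in> space (lebesgue_on {0..t})"
  then have s: "s \<in> {0..T}" using t by auto
  show "tet s \<bullet> time_deriv T (\<lambda>s. cas k) s - tet s \<bullet> Lam (2 * al) (cas k) - nonlin (tet s) (cas k) + Lam al (cas k) \<bullet> g s
    = - lam (2 * al) k * coef (tet s) k - nl k (tet s) (tet s) + lam al k * coef (g s) k"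
   by (simp add: time_deriv_const[OF T s] Lam_cas nonlin_cas[OF theta_H[OF s]] coef_def inner_commute)
 qed
 finally show ?thesis by (simp add: coef_def)
qed

lemma coef_increment:
 assumes k: "k \<noteq> 0" and ab: "0 \<le> a" "a \<le> b" "b \<le> T"
 shows "coef (tet b) k - coef (tet a) k
   = integral {a..b} (\<lambda>s. - lam (2 * al) k * coef (tet s) k - nl k (tet s) (tet s) + lam al k * coef (g s) k)"
proof -
 have i: "integrable (lebesgue_on {0..T}) (\<lambda>s. - lam (2 * al) k * coef (tet s) k - nl k (tet s) (tet s) + lam al k * coef (g s) k)"
  using integrable_coef[OF theta_L2_L2] square_integrable_path_coef(1)[OF g] by simp
 show ?thesis
  using coef_equation[OF k, of b] coef_equation[OF k, of a] ab integrable_lebesgue_on_diff[OF i ab] by simp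
qed

text \<open>Dividing the test step function by the symbol of \<Lambda>^\<alpha> turns the cost into
  \<open>w^2 / 2\<close>. Inserting the equation for the path cancels the nonlinearity and leaves
  the control minus \<open>2 * c\<close> times \<Lambda>^\<alpha> of the path; the deviation from
  \<open>c = 1\<close> is collected in the last term.\<close>

lemma path_functional_eq:
 assumes F: "0 \<notin> F" and n0: "0 < n0"
 shows "path_functional al T F c y n0 (\<lambda>r k. if k \<in> F then w k r / lam al k else 0) tet
  = (\<Sum>k\<in>F. c * (2 * y k * coef (tet T) k - (y k)\<^sup>2))
   + (\<Sum>k\<in>F. \<Sum>r<n0. w k r * integral {real r * (T / real n0)..real (Suc r) * (T / real n0)} (\<lambda>s. coef (g s) k - 2 * lam al k * coef (tet s) k)
     - (w k r)\<^sup>2 / 2 * (T / real n0))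
   + (1 - c) * (\<Sum>k\<in>F. \<Sum>r<n0. w k r * (2 * lam al k * integral {real r * (T / real n0)..real (Suc r) * (T / real n0)} (\<lambda>s. coef (tet s) k)))"
proof -
 let ?t = "\<lambda>r. real r * (T / real n0)"
 have "w k r / lam al k * (coef (tet (?t (Suc r))) k - coef (tet (?t r)) k
     + integral {?t r..?t (Suc r)} (\<lambda>s. (1 - 2 * c) * lam (2 * al) k * coef (tet s) k + nl k (tet s) (tet s)))
    - lam (2 * al) k * (w k r / lam al k)\<^sup>2 / 2 * (T / n0)
   = (w k r * integral {?t r..?t (Suc r)} (\<lambda>s. coef (g s) k - 2 * lam al k * coef (tet s) k) - (w k r)\<^sup>2 / 2 * (T / real n0))
    + (1 - c) * (w k r * (2 * lam al k * integral {?t r..?t (Suc r)} (\<lambda>s. coef (tet s) k)))"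
  if r: "r < n0" and kF: "k \<in> F" for k r
 proof -
  have k: "k \<noteq> 0" using F kF by blast
  note tT = grid_bounds[OF T n0]
  have sub: "{?t r..?t (Suc r)} \<subseteq> {0..T}" using tT(1)[of r] tT(3)[OF r] by (simp only: atLeastatMost_subset_iff) blast
  have itet: "(\<lambda>s. coef (tet s) k) integrable_on {?t r..?t (Suc r)}"
   by (rule integrable_lebesgue_on_subinterval(2)[OF integrable_coef(1)[OF theta_L2_L2] sub])
  have intet: "(\<lambda>s. nl k (tet s) (tet s)) integrable_on {?t r..?t (Suc r)}"
   by (rule integrable_lebesgue_on_subinterval(2)[OF integrable_coef(2)[OF theta_L2_L2] sub])
  have ig: "(\<lambda>s. coef (g s) k) integrable_on {?t r..?t (Suc r)}"
   by (rule integrable_lebesgue_on_subinterval(2)[OF square_integrable_path_coef(1)[OF g] sub])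
  define Itet In Ig where "Itet = integral {?t r..?t (Suc r)} (\<lambda>s. coef (tet s) k)"
   and "In = integral {?t r..?t (Suc r)} (\<lambda>s. nl k (tet s) (tet s))" and "Ig = integral {?t r..?t (Suc r)} (\<lambda>s. coef (g s) k)"
  note hi = integrable_integral[OF itet, folded Itet_def] integrable_integral[OF intet, folded In_def] integrable_integral[OF ig, folded Ig_def]
  have 1: "coef (tet (?t (Suc r))) k - coef (tet (?t r)) k = - lam (2 * al) k * Itet - In + lam al k * Ig"
   unfolding coef_increment[OF k tT(1,2) tT(3)[OF r]]
   by (intro integral_unique has_integral_add has_integral_diff has_integral_mult_right hi)
  have 2: "integral {?t r..?t (Suc r)} (\<lambda>s. (1 - 2 * c) * lam (2 * al) k * coef (tet s) k + nl k (tet s) (tet s)) = (1 - 2 * c) * lam (2 * al) k * Itet + In"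
   by (intro integral_unique has_integral_add has_integral_diff has_integral_mult_right hi)
  have 3: "integral {?t r..?t (Suc r)} (\<lambda>s. coef (g s) k - 2 * lam al k * coef (tet s) k) = Ig - 2 * lam al k * Itet"
   by (intro integral_unique has_integral_add has_integral_diff has_integral_mult_right hi)
  have l: "0 < lam al k" by (rule lam_pos[OF k])
  show ?thesis unfolding 1 2 3 Itet_def[symmetric] unfolding lam_sq[symmetric]
   using l by (simp add: field_simps power2_eq_square)
 qed
 note eq = this
 have "(\<Sum>r<n0. \<Sum>k\<in>F. (if k \<in> F then w k r / lam al k else 0) * (coef (tet (?t (Suc r))) k - coef (tet (?t r)) k
     + integral {?t r..?t (Suc r)} (\<lambda>s. (1 - 2 * c) * lam (2 * al) k * coef (tet s) k + nl k (tet s) (tet s)))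
    - lam (2 * al) k * (if k \<in> F then w k r / lam al k else 0)\<^sup>2 / 2 * (T / n0))
   = (\<Sum>r<n0. \<Sum>k\<in>F. (w k r * integral {?t r..?t (Suc r)} (\<lambda>s. coef (g s) k - 2 * lam al k * coef (tet s) k) - (w k r)\<^sup>2 / 2 * (T / real n0))
    + (1 - c) * (w k r * (2 * lam al k * integral {?t r..?t (Suc r)} (\<lambda>s. coef (tet s) k))))"
 proof (intro sum.cong refl)
  fix r k assume "r \<in> {..<n0}" and kF: "k \<in> F"
  then have r: "r < n0" by simp
  show "(if k \<in> F then w k r / lam al k else 0) * (coef (tet (?t (Suc r))) k - coef (tet (?t r)) k
     + integral {?t r..?t (Suc r)} (\<lambda>s. (1 - 2 * c) * lam (2 * al) k * coef (tet s) k + nl k (tet s) (tet s)))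
    - lam (2 * al) k * (if k \<in> F then w k r / lam al k else 0)\<^sup>2 / 2 * (T / n0) =
    (w k r * integral {?t r..?t (Suc r)} (\<lambda>s. coef (g s) k - 2 * lam al k * coef (tet s) k) - (w k r)\<^sup>2 / 2 * (T / real n0))
    + (1 - c) * (w k r * (2 * lam al k * integral {?t r..?t (Suc r)} (\<lambda>s. coef (tet s) k)))"
   unfolding if_P[OF kF] by (rule eq[OF r kF])
 qed
 then show ?thesis unfolding path_functional_def
  by (simp only: sum.swap[of _ F "{..<n0}"] sum.distrib sum_distrib_left add.assoc)
qed

text \<open>Up to the direction of time, the mean-zero part of the control that drives the reversed
  path.\<close>

definition reversed_forcing :: "real \<Rightarrow> l2" where
 "reversed_forcing s = mean_zero_part (g s) - 2 *\<^sub>R Lam al (tet s)"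

lemma reversed_forcing_path: "square_integrable_path T reversed_forcing"
 unfolding reversed_forcing_def
 by (intro square_integrable_path_diff square_integrable_path_scaleR square_integrable_path_mean_zero_part g Lam_theta_path)

lemma integral_reversed_forcing:
 "(\<integral>s. (norm (reversed_forcing s))\<^sup>2 \<partial>lebesgue_on {0..T})
  = (\<integral>s. (norm (mean_zero_part (g s)))\<^sup>2 \<partial>lebesgue_on {0..T})
   - 4 * (\<integral>s. Lam al (tet s) \<bullet> g s \<partial>lebesgue_on {0..T})
   + 4 * (\<integral>s. (Hs_norm al (tet s))\<^sup>2 \<partial>lebesgue_on {0..T})"
proof -
 let ?M = "lebesgue_on {0..T}"
 have i0: "integrable ?M (\<lambda>s. (norm (mean_zero_part (g s)))\<^sup>2)"
  using square_integrable_path_mean_zero_part[OF g] by (simp add: square_integrable_path_def)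
 have i1: "integrable ?M (\<lambda>s. Lam al (tet s) \<bullet> g s)" by (rule square_integrable_path_inner[OF Lam_theta_path g])
 have i2: "integrable ?M (\<lambda>s. (norm (Lam al (tet s)))\<^sup>2)" using Lam_theta_path by (simp add: square_integrable_path_def)
 have i3: "integrable ?M (\<lambda>s. (norm (reversed_forcing s))\<^sup>2)" using reversed_forcing_path by (simp add: square_integrable_path_def)
 have "(\<integral>s. (norm (reversed_forcing s))\<^sup>2 \<partial>?M)
   = (\<integral>s. (norm (mean_zero_part (g s)))\<^sup>2 - 4 * (Lam al (tet s) \<bullet> g s) + 4 * (norm (Lam al (tet s)))\<^sup>2 \<partial>?M)"
 proof (rule integral_cong_AE)
  show "AE s in ?M. (norm (reversed_forcing s))\<^sup>2 = (norm (mean_zero_part (g s)))\<^sup>2 - 4 * (Lam al (tet s) \<bullet> g s) + 4 * (norm (Lam al (tet s)))\<^sup>2"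
   using AE_Lam_dom
  proof eventually_elim
   case (elim s)
   have "mean_zero_part (g s) \<bullet> Lam al (tet s) = Lam al (tet s) \<bullet> g s"
    using inner_mean_zero_part[OF Lam_H[OF elim], of "g s"] by (simp add: inner_commute)
   then show ?case
    unfolding reversed_forcing_def power2_norm_eq_inner
    by (simp add: inner_diff_left inner_diff_right inner_commute[of "Lam al (tet s)" "mean_zero_part (g s)"])
  qed
 qed (use i0 i1 i2 i3 in auto)
 also have "\<dots> = (\<integral>s. (norm (mean_zero_part (g s)))\<^sup>2 \<partial>?M) - 4 * (\<integral>s. Lam al (tet s) \<bullet> g s \<partial>?M) + 4 * (\<integral>s. (norm (Lam al (tet s)))\<^sup>2 \<partial>?M)"
  using i0 i1 i2 by simp
 finally show ?thesis unfolding square_integrable_path_Lam(2)[OF theta_L2_Hs] .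
qed

text \<open>Three successive approximations, each losing arbitrarily little: finitely many modes by
  Parseval, piecewise constant tests on a common grid, and finally \<open>c\<close> increasing to
  1.\<close>

lemma ex_path_functional:
 assumes K: "K < (norm (tet T))\<^sup>2 + (\<integral>s. (norm (reversed_forcing s))\<^sup>2 / 2 \<partial>lebesgue_on {0..T})"
 obtains F c y n0 \<psi> where "finite F" "0 \<notin> F" "\<And>k. k \<notin> F \<Longrightarrow> y k = 0" "\<And>r k. k \<notin> F \<Longrightarrow> \<psi> r k = 0"
  "0 \<le> c" "c < 1" "0 < n0" "K < path_functional al T F c y n0 \<psi> tet"
proof -
 let ?M = "lebesgue_on {0..T}"
 note u = reversed_forcing_path
 \<comment> \<open>A version of the coefficients of \<open>reversed_forcing\<close> that avoids
   \<open>Lam\<close> and is visibly measurable; for \<open>k \<noteq> 0\<close> the two agree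
   almost everywhere.\<close>
 define q where "q k s = coef (g s) k - 2 * lam al k * coef (tet s) k" for k s
 have qm: "q k \<in> borel_measurable ?M" for k
  unfolding q_def using square_integrable_path_coef(3)[OF g] square_integrable_path_coef(3)[OF theta_path] by simp
 have qu: "AE s in ?M. coef (reversed_forcing s) k = (if k = 0 then 0 else q k s)" for k
  using AE_Lam_dom
  by eventually_elim (simp add: reversed_forcing_def q_def coef_diff coef_scaleR coef_mean_zero_part coef_Lam lam_def)
 have qi: "integrable ?M (\<lambda>s. (q k s)\<^sup>2)" "(\<integral>s. (coef (reversed_forcing s) k)\<^sup>2 / 2 \<partial>?M) = (\<integral>s. (q k s)\<^sup>2 / 2 \<partial>?M)" if k: "k \<noteq> 0" for k
 proof -
  have ae: "AE s in ?M. (coef (reversed_forcing s) k)\<^sup>2 = (q k s)\<^sup>2" using qu[of k] k by (auto elim: eventually_mono)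
  show "integrable ?M (\<lambda>s. (q k s)\<^sup>2)"
   using square_integrable_path_coef(2)[OF u] _ ae by (rule integrable_cong_AE_imp) (use qm[of k] in simp)
  show "(\<integral>s. (coef (reversed_forcing s) k)\<^sup>2 / 2 \<partial>?M) = (\<integral>s. (q k s)\<^sup>2 / 2 \<partial>?M)"
   using ae qm[of k] square_integrable_path_coef(3)[OF u, of k]
   by (intro integral_cong_AE) (auto elim: eventually_mono)
 qed
 have q0: "(\<integral>s. (coef (reversed_forcing s) 0)\<^sup>2 / 2 \<partial>?M) = 0"
 proof -
  have "(\<integral>s. (coef (reversed_forcing s) 0)\<^sup>2 / 2 \<partial>?M) = (\<integral>s. 0 \<partial>?M)"
   using qu[of 0] square_integrable_path_coef(3)[OF u, of 0]
   by (intro integral_cong_AE) (auto elim: eventually_mono)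
  then show ?thesis by simp
 qed
 obtain e :: "nat \<Rightarrow> int \<times> int" where e: "bij e" using ex_mode_enumeration by blast
 define S where "S k = (coef (tet T) k)\<^sup>2 + (\<integral>s. (coef (reversed_forcing s) k)\<^sup>2 / 2 \<partial>?M)" for k
 have ps: "(\<lambda>i. (coef x (e i))\<^sup>2) sums (norm x)\<^sup>2" for x
  using parseval_sums[OF e, of x x] by (simp add: power2_eq_square power2_norm_eq_inner[symmetric])
 have "(\<lambda>N. \<Sum>i<N. S (e i)) \<longlonglongrightarrow> (norm (tet T))\<^sup>2 + (\<integral>s. (norm (reversed_forcing s))\<^sup>2 / 2 \<partial>?M)"
 proof -
  have "(\<lambda>N. \<integral>s. (\<Sum>i<N. (coef (reversed_forcing s) (e i))\<^sup>2 / 2) \<partial>?M) \<longlonglongrightarrow> (\<integral>s. (norm (reversed_forcing s))\<^sup>2 / 2 \<partial>?M)"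
  proof (rule integral_dominated_convergence)
   show i: "integrable ?M (\<lambda>s. (norm (reversed_forcing s))\<^sup>2 / 2)" using u by (simp add: square_integrable_path_def)
   then show "(\<lambda>s. (norm (reversed_forcing s))\<^sup>2 / 2) \<in> borel_measurable ?M" by (rule borel_measurable_integrable)
   show "(\<lambda>s. \<Sum>i<N. (coef (reversed_forcing s) (e i))\<^sup>2 / 2) \<in> borel_measurable ?M" for N
    using square_integrable_path_coef(3)[OF u] by simp
   show "AE s in ?M. (\<lambda>N. \<Sum>i<N. (coef (reversed_forcing s) (e i))\<^sup>2 / 2) \<longlonglongrightarrow> (norm (reversed_forcing s))\<^sup>2 / 2"
    using sums_divide[OF ps, of _ 2] by (intro AE_I2) (simp add: sums_def)
   show "AE s in ?M. norm (\<Sum>i<N. (coef (reversed_forcing s) (e i))\<^sup>2 / 2) \<le> (norm (reversed_forcing s))\<^sup>2 / 2" for N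
   proof (rule AE_I2)
    fix s
    have "(\<Sum>i<N. (coef (reversed_forcing s) (e i))\<^sup>2 / 2) \<le> (\<Sum>i. (coef (reversed_forcing s) (e i))\<^sup>2 / 2)"
     using sums_divide[OF ps, of "reversed_forcing s" 2] by (intro sum_le_suminf) (auto simp: sums_iff)
    also have "\<dots> = (norm (reversed_forcing s))\<^sup>2 / 2" using sums_divide[OF ps, of "reversed_forcing s" 2] by (simp add: sums_iff)
    finally show "norm (\<Sum>i<N. (coef (reversed_forcing s) (e i))\<^sup>2 / 2) \<le> (norm (reversed_forcing s))\<^sup>2 / 2"
     by (simp add: sum_nonneg)
   qed
  qed
  moreover have "(\<integral>s. (\<Sum>i<N. (coef (reversed_forcing s) (e i))\<^sup>2 / 2) \<partial>?M) = (\<Sum>i<N. \<integral>s. (coef (reversed_forcing s) (e i))\<^sup>2 / 2 \<partial>?M)" for N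
   using square_integrable_path_coef(2)[OF u] by (intro Bochner_Integration.integral_sum) simp
  ultimately show ?thesis unfolding S_def sum.distrib using ps[of "tet T"] by (intro tendsto_add) (simp_all add: sums_def)
 qed
 from order_tendstoD(1)[OF this K] obtain N where N: "K < (\<Sum>i<N. S (e i))" by (auto simp: eventually_sequentially)
 define F where "F = e ` {..<N} - {0}"
 have F: "finite F" "0 \<notin> F" by (auto simp: F_def)
 have S0: "S 0 = 0" using theta_H[of T] T q0 by (simp add: S_def H_iff)
 have "(\<Sum>i<N. S (e i)) = (\<Sum>k\<in>e ` {..<N}. S k)"
  using e by (subst sum.reindex) (auto simp: bij_def intro: inj_on_subset)
 also have "\<dots> = (\<Sum>k\<in>F. S k)" unfolding F_def using S0 by (intro sum.mono_neutral_right) auto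
 finally have KF: "K < (\<Sum>k\<in>F. S k)" using N by simp
 \<comment> \<open>The total loss over the modes of \<open>F\<close> is then at most half of the
   slack; the 1 in the denominator covers empty \<open>F\<close>.\<close>
 define d where "d = ((\<Sum>k\<in>F. S k) - K) / (2 * (real (card F) + 1))"
 have d: "0 < d" using KF by (simp add: d_def)
 have dc: "real (card F) * d \<le> ((\<Sum>k\<in>F. S k) - K) / 2" using KF by (simp add: d_def field_simps)
 have "eventually (\<lambda>n. \<forall>k\<in>F. \<exists>w. (\<integral>s. (q k s)\<^sup>2 / 2 \<partial>?M) - d
   < (\<Sum>r<n. w r * integral {real r * (T / real n)..real (Suc r) * (T / real n)} (q k) - (w r)\<^sup>2 / 2 * (T / real n))) sequentially"
  using F by (intro eventually_ball_finite ballI step_approximation T qm qi d) auto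
 then have "eventually (\<lambda>n. 0 < n \<and> (\<forall>k\<in>F. \<exists>w. (\<integral>s. (q k s)\<^sup>2 / 2 \<partial>?M) - d
   < (\<Sum>r<n. w r * integral {real r * (T / real n)..real (Suc r) * (T / real n)} (q k) - (w r)\<^sup>2 / 2 * (T / real n)))) sequentially"
  using eventually_gt_at_top[of 0] by eventually_elim blast
 then obtain n0 where n0: "0 < n0" and ex: "\<forall>k\<in>F. \<exists>w. (\<integral>s. (q k s)\<^sup>2 / 2 \<partial>?M) - d
   < (\<Sum>r<n0. w r * integral {real r * (T / real n0)..real (Suc r) * (T / real n0)} (q k) - (w r)\<^sup>2 / 2 * (T / real n0))"
  by (auto simp: eventually_sequentially)
 obtain w where w: "\<And>k. k \<in> F \<Longrightarrow> (\<integral>s. (q k s)\<^sup>2 / 2 \<partial>?M) - d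
   < (\<Sum>r<n0. w k r * integral {real r * (T / real n0)..real (Suc r) * (T / real n0)} (q k) - (w k r)\<^sup>2 / 2 * (T / real n0))"
  using bchoice[OF ex] by blast
 \<comment> \<open>The point of tangency: for this \<open>y\<close> the affine bound
   \<open>2 * y * x - y^2\<close> equals the square at the path under consideration.\<close>
 define y where "y k = (if k \<in> F then coef (tet T) k else 0)" for k
 define \<psi> where "\<psi> r k = (if k \<in> F then w k r / lam al k else 0)" for r k
 define A where "A = (\<Sum>k\<in>F. (coef (tet T) k)\<^sup>2)"
 define B where "B = (\<Sum>k\<in>F. \<Sum>r<n0. w k r * integral {real r * (T / real n0)..real (Suc r) * (T / real n0)} (q k) - (w k r)\<^sup>2 / 2 * (T / real n0))"
 define E where "E = (\<Sum>k\<in>F. \<Sum>r<n0. w k r * (2 * lam al k * integral {real r * (T / real n0)..real (Suc r) * (T / real n0)} (\<lambda>s. coef (tet s) k)))"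
 have pf: "path_functional al T F c y n0 \<psi> tet = c * A + B + (1 - c) * E" for c
 proof -
  have "(\<Sum>k\<in>F. c * (2 * y k * coef (tet T) k - (y k)\<^sup>2)) = c * A"
   unfolding A_def sum_distrib_left by (intro sum.cong refl) (simp add: y_def power2_eq_square)
  then show ?thesis unfolding \<psi>_def[abs_def] path_functional_eq[OF F(2) n0] B_def E_def q_def[abs_def] by simp
 qed
 have "K < A + B"
 proof -
  have "(\<Sum>k\<in>F. S k) = A + (\<Sum>k\<in>F. \<integral>s. (q k s)\<^sup>2 / 2 \<partial>?M)"
   unfolding S_def sum.distrib A_def using F(2) qi(2) by (intro arg_cong2[where f = "(+)"] sum.cong refl) metis
  moreover have "(\<Sum>k\<in>F. (\<integral>s. (q k s)\<^sup>2 / 2 \<partial>?M) - d) \<le> B"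
   unfolding B_def using w by (intro sum_mono less_imp_le) auto
  then have "(\<Sum>k\<in>F. \<integral>s. (q k s)\<^sup>2 / 2 \<partial>?M) - real (card F) * d \<le> B" by (simp add: sum_subtractf)
  ultimately show ?thesis using dc KF by (simp add: field_simps)
 qed
 \<comment> \<open>At \<open>c = 1\<close> the error \<open>E\<close> disappears, but that value is
   excluded by the Gaussian moment. With all other parameters fixed the expression is continuous in
   \<open>c\<close>, so some \<open>c < 1\<close> works.\<close>
 moreover have "((\<lambda>c. c * A + B + (1 - c) * E) \<longlongrightarrow> 1 * A + B + (1 - 1) * E) (at_left 1)"
  by (intro tendsto_intros)
 ultimately have "eventually (\<lambda>c. K < c * A + B + (1 - c) * E) (at_left 1)" by (intro order_tendstoD(1)) auto
 moreover have "eventually (\<lambda>c::real. 0 < c \<and> c < 1) (at_left 1)"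
  using eventually_at_left_real[of 0 1] by (auto elim: eventually_mono)
 ultimately have "eventually (\<lambda>c. K < c * A + B + (1 - c) * E \<and> 0 < c \<and> c < 1) (at_left 1)" by (rule eventually_conj)
 then obtain c where c: "K < c * A + B + (1 - c) * E" "0 < c" "c < 1"
  using eventually_happens[of _ "at_left (1::real)"] by (auto simp: trivial_limit_at_left_real)
 show ?thesis
  using F c n0 pf[of c] by (intro that[of F y \<psi> c n0]) (auto simp: y_def \<psi>_def)
qed

end

section \<open>Smooth test functions\<close>

lemma norm_Lam_le:
 assumes "s \<le> 0" shows "norm (Lam s h) \<le> norm h"
proof -
 have "(norm (Lam s h))\<^sup>2 \<le> (norm h)\<^sup>2"
 proof (rule has_sum_mono[OF parseval_norm parseval_norm])
  fix k
  have "(lam s k)\<^sup>2 \<le> 1" using lam_le_1[OF assms, of k] by (simp add: power_le_one)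
  then have "(lam s k)\<^sup>2 * (coef h k)\<^sup>2 \<le> 1 * (coef h k)\<^sup>2" by (intro mult_right_mono) auto
  then show "(coef (Lam s h) k)\<^sup>2 \<le> (coef h k)\<^sup>2"
   by (simp add: coef_Lam[OF Lam_dom_nonpos[OF assms]] power_mult_distrib)
 qed
 then show ?thesis by (rule power2_le_imp_le) simp
qed

lemma norm_Lam_mono:
 assumes "f \<in> Hinf" "r \<le> s" shows "norm (Lam r f) \<le> norm (Lam s f)"
proof -
 have d: "f \<in> Lam_dom t" for t using assms(1) by (simp add: Hinf_iff)
 have "Lam (r - s) (Lam s f) = Lam r f"
  by (rule Lam_eqI) (simp add: coef_Lam[OF d] lam_mult mult.assoc[symmetric])
 then show ?thesis using norm_Lam_le[of "r - s" "Lam s f"] assms(2) by simp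
qed

lemma Lam_0:
 assumes "f \<in> H" shows "Lam 0 f = f"
proof (rule Lam_eqI)
 fix k show "coef f k = lam 0 k * coef f k"
  using assms by (cases "k = 0") (simp_all add: H_iff lam_zero_exponent)
qed

lemma Hinf_diff: "f \<in> Hinf \<Longrightarrow> g \<in> Hinf \<Longrightarrow> f - g \<in> Hinf"
 using Hinf_add[of f "(-1) *\<^sub>R g"] Hinf_scaleR[of g "-1"] by simp

lemma Hs_norm_minus: "Hs_norm r (- f) = Hs_norm r f"
 by (simp add: Hs_norm_def sobolev_norm_def cmod_fourier_sq coef_minus)

text \<open>Convergence of difference quotients in every positive Sobolev norm becomes
  differentiability of \<open>Lam r\<close> of the test function in \<open>l2\<close> for every real
  \<open>r\<close>; orders below 1 are dominated by \<open>max r 1\<close>.\<close>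

lemma test_function_derivatives:
 assumes "\<phi> \<in> Cinf_Hinf T"
 obtains D where "D 0 = \<phi>" "\<And>n t. t \<in> {0..T} \<Longrightarrow> D n t \<in> Hinf"
  "\<And>n r t. 0 < r \<Longrightarrow> t \<in> {0..T} \<Longrightarrow>
    ((\<lambda>s. Hs_norm r ((D n s - D n t) /\<^sub>R (s - t) - D (Suc n) t)) \<longlongrightarrow> 0) (at t within {0..T})"
  "\<And>n r t. t \<in> {0..T} \<Longrightarrow> ((\<lambda>s. Lam r (D n s)) has_vector_derivative Lam r (D (Suc n) t)) (at t within {0..T})"
proof -
 obtain D where D: "D 0 = \<phi>" "\<forall>n. \<forall>t\<in>{0..T}. D n t \<in> Hinf \<and>
    (\<forall>r>0. ((\<lambda>s. Hs_norm r ((D n s - D n t) /\<^sub>R (s - t) - D (Suc n) t)) \<longlongrightarrow> 0) (at t within {0..T}))"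
  using assms unfolding Cinf_Hinf_def by blast
 show ?thesis
 proof (rule that[of D])
  fix n r t assume t: "t \<in> {0..T}"
  define h where "h s = (D n s - D n t) /\<^sub>R (s - t) - D (Suc n) t" for s
  have DH: "D n s \<in> Hinf" if "s \<in> {0..T}" for n s using D(2) that by blast
  have Ld: "x \<in> Lam_dom r'" if "x \<in> Hinf" for x r' using that by (simp add: Hinf_iff)
  have lim: "((\<lambda>s. Hs_norm (max r 1) (h s)) \<longlongrightarrow> 0) (at t within {0..T})"
   using D(2) t unfolding h_def by simp
  have ev: "eventually (\<lambda>s. norm ((1 / norm (s - t)) *\<^sub>R (Lam r (D n s) - (Lam r (D n t) + (s - t) *\<^sub>R Lam r (D (Suc n) t))))
    \<le> Hs_norm (max r 1) (h s)) (at t within {0..T})"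
   unfolding eventually_at_filter
  proof (intro always_eventually allI impI)
   fix s assume s: "s \<noteq> t" "s \<in> {0..T}"
   have hH: "h s \<in> Hinf" unfolding h_def by (intro Hinf_diff Hinf_scaleR DH s t)
   have "Lam r (h s) = (Lam r (D n s) - Lam r (D n t)) /\<^sub>R (s - t) - Lam r (D (Suc n) t)"
    unfolding h_def using s t
    by (simp add: Lam_diff Lam_scaleR Lam_dom_diff Lam_dom_scaleR Ld DH)
   then have "Lam r (D n s) - (Lam r (D n t) + (s - t) *\<^sub>R Lam r (D (Suc n) t)) = (s - t) *\<^sub>R Lam r (h s)"
    using s(1) by (simp add: scaleR_right_diff_distrib)
   then have "norm ((1 / norm (s - t)) *\<^sub>R (Lam r (D n s) - (Lam r (D n t) + (s - t) *\<^sub>R Lam r (D (Suc n) t)))) = norm (Lam r (h s))"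
    using s(1) by simp
   also have "\<dots> \<le> norm (Lam (max r 1) (h s))" by (rule norm_Lam_mono[OF hH]) simp
   also have "\<dots> = Hs_norm (max r 1) (h s)" by (rule Hs_norm_eq[OF Ld[OF hH], symmetric])
   finally show "norm ((1 / norm (s - t)) *\<^sub>R (Lam r (D n s) - (Lam r (D n t) + (s - t) *\<^sub>R Lam r (D (Suc n) t)))) \<le> Hs_norm (max r 1) (h s)" .
  qed
  show "((\<lambda>s. Lam r (D n s)) has_vector_derivative Lam r (D (Suc n) t)) (at t within {0..T})"
   unfolding has_vector_derivative_def has_derivative_within
   by (intro conjI bounded_linear_scaleR_left Lim_null_comparison[OF ev lim])
 qed (use D in auto)
qed

lemma test_function_regular:
 assumes T: "0 < T" and \<phi>: "\<phi> \<in> Cinf_Hinf T"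
 shows "s \<in> {0..T} \<Longrightarrow> \<phi> s \<in> Hinf" "continuous_on {0..T} (\<lambda>s. Lam r (\<phi> s))" "continuous_on {0..T} \<phi>"
  "continuous_on {0..T} (time_deriv T \<phi>)" "s \<in> {0..T} \<Longrightarrow> (\<phi> has_vector_derivative time_deriv T \<phi> s) (at s within {0..T})"
proof -
 obtain D where D: "D 0 = \<phi>" "\<And>n t. t \<in> {0..T} \<Longrightarrow> D n t \<in> Hinf"
  "\<And>n r t. t \<in> {0..T} \<Longrightarrow> ((\<lambda>s. Lam r (D n s)) has_vector_derivative Lam r (D (Suc n) t)) (at t within {0..T})"
  by (rule test_function_derivatives[OF \<phi>]) blast
 have L0: "Lam 0 (D n t) = D n t" if "t \<in> {0..T}" for n t using D(2)[OF that] by (intro Lam_0) (simp add: Hinf_iff)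
 have dD: "(D n has_vector_derivative D (Suc n) t) (at t within {0..T})" if t: "t \<in> {0..T}" for n t
  using D(3)[OF t, of 0 n] unfolding L0[OF t] by (rule has_vector_derivative_transform[OF t, rotated]) (simp add: L0)
 have cL: "continuous_on {0..T} (\<lambda>s. Lam r (D n s))" for n r
  using has_vector_derivative_continuous[OF D(3)] by (simp add: continuous_on_eq_continuous_within)
 have cD: "continuous_on {0..T} (D n)" for n
  using has_vector_derivative_continuous[OF dD] by (simp add: continuous_on_eq_continuous_within)
 have td: "time_deriv T \<phi> t = D (Suc 0) t" if "t \<in> {0..T}" for t
  using dD[OF that, of 0] unfolding D(1) by (rule time_deriv_eqI[OF T that])
 show "\<phi> s \<in> Hinf" if "s \<in> {0..T}" using D(1,2) that by metis
 show "continuous_on {0..T} (\<lambda>s. Lam r (\<phi> s))" using cL[of r 0] D(1) by simp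
 show "continuous_on {0..T} \<phi>" using cD[of 0] D(1) by simp
 show "continuous_on {0..T} (time_deriv T \<phi>)" using cD[of 1] by (rule continuous_on_eq) (simp add: td)
 show "(\<phi> has_vector_derivative time_deriv T \<phi> s) (at s within {0..T})" if "s \<in> {0..T}"
  using dD[OF that, of 0] unfolding D(1) td[OF that] .
qed

lemma filterlim_reflect:
 fixes t T :: real
 shows "filterlim (\<lambda>s. T - s) (at (T - t) within {0..T}) (at t within {0..T})"
 unfolding filterlim_at
proof
 show "((\<lambda>s. T - s) \<longlongrightarrow> T - t) (at t within {0..T})" by (intro tendsto_intros)
 show "\<forall>\<^sub>F s in at t within {0..T}. T - s \<in> {0..T} \<and> T - s \<noteq> T - t"
  unfolding eventually_at_filter by (intro always_eventually) auto
qed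

lemma reflect_test_function:
 assumes T: "0 < T" and \<phi>: "\<phi> \<in> Cinf_Hinf T"
 shows "(\<lambda>s. \<phi> (T - s)) \<in> Cinf_Hinf T"
  "s \<in> {0..T} \<Longrightarrow> time_deriv T (\<lambda>s. \<phi> (T - s)) s = - time_deriv T \<phi> (T - s)"
proof -
 obtain D where D: "D 0 = \<phi>" "\<And>n t. t \<in> {0..T} \<Longrightarrow> D n t \<in> Hinf"
  "\<And>n r t. 0 < r \<Longrightarrow> t \<in> {0..T} \<Longrightarrow>
    ((\<lambda>s. Hs_norm r ((D n s - D n t) /\<^sub>R (s - t) - D (Suc n) t)) \<longlongrightarrow> 0) (at t within {0..T})"
  by (rule test_function_derivatives[OF \<phi>]) blast
 \<comment> \<open>The sign is the chain rule for \<open>s\<close> to \<open>T - s\<close>, applied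
   \<open>n\<close> times.\<close>
 define E where "E n s = (-1) ^ n *\<^sub>R D n (T - s)" for n :: nat and s
 have E0: "E 0 = (\<lambda>s. \<phi> (T - s))" by (rule ext) (simp add: E_def D(1))
 have EH: "E n t \<in> Hinf" if "t \<in> {0..T}" for n t
  unfolding E_def using that by (intro Hinf_scaleR D(2)) auto
 have lim: "((\<lambda>s. Hs_norm r ((E n s - E n t) /\<^sub>R (s - t) - E (Suc n) t)) \<longlongrightarrow> 0) (at t within {0..T})"
  if r: "0 < r" and t: "t \<in> {0..T}" for n r t
 proof -
  have t': "T - t \<in> {0..T}" using t by auto
  have "(E n s - E n t) /\<^sub>R (s - t) - E (Suc n) t
    = (-1) ^ Suc n *\<^sub>R ((D n (T - s) - D n (T - t)) /\<^sub>R ((T - s) - (T - t)) - D (Suc n) (T - t))" for s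
  proof -
   have "inverse (t - s) = - inverse (s - t)" using inverse_minus_eq[of "s - t"] by simp
   then show ?thesis by (simp add: E_def scaleR_right_diff_distrib mult.commute)
  qed
  moreover have "Hs_norm r ((-1) ^ Suc n *\<^sub>R f) = Hs_norm r f" for f
   by (cases "even n") (simp_all add: Hs_norm_minus)
  ultimately have "Hs_norm r ((E n s - E n t) /\<^sub>R (s - t) - E (Suc n) t)
    = Hs_norm r ((D n (T - s) - D n (T - t)) /\<^sub>R ((T - s) - (T - t)) - D (Suc n) (T - t))" for s
   by simp
  then show ?thesis using filterlim_compose[OF D(3)[OF r t', of n] filterlim_reflect[of T t]] by simp
 qed
 show "(\<lambda>s. \<phi> (T - s)) \<in> Cinf_Hinf T" unfolding Cinf_Hinf_def using E0 EH lim by blast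
 assume s: "s \<in> {0..T}"
 then have s': "T - s \<in> {0..T}" by auto
 have im: "(\<lambda>s. T - s) ` {0..T} = {0..T}" by (auto simp: image_iff intro!: bexI[of _ "T - _"])
 have "((\<lambda>s. T - s) has_vector_derivative - 1) (at s within {0..T})"
  by (auto intro!: derivative_eq_intros)
 moreover have "(\<phi> has_vector_derivative time_deriv T \<phi> (T - s)) (at (T - s) within (\<lambda>s. T - s) ` {0..T})"
  unfolding im by (rule test_function_regular(5)[OF T \<phi> s'])
 ultimately have "((\<phi> \<circ> (\<lambda>s. T - s)) has_vector_derivative (-1) *\<^sub>R time_deriv T \<phi> (T - s)) (at s within {0..T})"
  by (rule vector_diff_chain_within)
 then show "time_deriv T (\<lambda>s. \<phi> (T - s)) s = - time_deriv T \<phi> (T - s)"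
  by (intro time_deriv_eqI[OF T s]) (simp add: o_def)
qed

lemma continuous_square_integrable_path:
 assumes "continuous_on {0..T} f" shows "square_integrable_path T f"
proof (rule square_integrable_pathI)
 show "(\<lambda>t. coef (f t) k) \<in> borel_measurable (lebesgue_on {0..T})" for k
  unfolding coef_def by (intro continuous_imp_measurable_on_sets_lebesgue continuous_intros assms) auto
 show "integrable (lebesgue_on {0..T}) (\<lambda>t. (norm (f t))\<^sup>2)"
  by (intro continuous_imp_integrable_real continuous_intros assms)
qed

lemma nl_minus: "nl k (- x) (- x) = nl k x x"
 using linear_neg[OF nl_linear(1), of k x "- x"] linear_neg[OF nl_linear(2), of k x x] by simp

lemma nonlin_sums_Hinf:
 assumes "bij e" "\<phi> \<in> Hinf" "tet \<in> H"
 shows "(\<lambda>i. coef \<phi> (e i) * nl (e i) tet tet) sums nonlin tet \<phi>"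
 using assms Hinf_nonlin(1)[OF assms(2,1)] by (intro nonlin_sums) (auto simp: Hinf_iff)

text \<open>The nonlinearity is even. Reversing time together with the sign of the path therefore
  keeps its sign in the equation, and only the dissipation changes sign.\<close>

lemma nonlin_minus:
 assumes "\<phi> \<in> Hinf" "tet \<in> H" shows "nonlin (- tet) \<phi> = nonlin tet \<phi>"
proof -
 obtain e :: "nat \<Rightarrow> int \<times> int" where e: "bij e" using ex_mode_enumeration by blast
 show ?thesis
  using nonlin_sums_Hinf[OF e assms] nonlin_sums_Hinf[OF e assms(1) H_minus[OF assms(2)]]
  unfolding nl_minus by (rule sums_unique2[rotated])
qed

section \<open>The rate function of a weak solution\<close>

text \<open>The functional is \<Lambda>^\<alpha> applied to \<open>h\<close> as a distribution: the
  weight of order \<open>- al\<close> undoes the symbol, so \<Lambda>^\<alpha> maps the mean-zero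
  part of \<open>h\<close> isometrically into the space of order \<open>- al\<close>.\<close>

lemma Lam_inner_dist:
 assumes al: "0 < al"
 shows "(\<lambda>f. Lam al f \<bullet> h) \<in> Hs_dist (- al)" "Hs_dist_norm (- al) (\<lambda>f. Lam al f \<bullet> h) = norm (mean_zero_part h)"
proof -
 let ?u = "\<lambda>f. Lam al f \<bullet> h" and ?h = "mean_zero_part h"
 have Ld: "x \<in> Lam_dom r'" if "x \<in> Hinf" for x r' using that by (simp add: Hinf_iff)
 have mzd: "mean_zero_distribution ?u"
  unfolding mean_zero_distribution_def
 proof (intro conjI ballI allI)
  show "?u (f + g) = ?u f + ?u g" if "f \<in> Hinf" "g \<in> Hinf" for f g
   using that by (simp add: Lam_add Ld inner_add_left)
  show "?u (c *\<^sub>R f) = c * ?u f" if "f \<in> Hinf" for c f using that by (simp add: Lam_scaleR Ld)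
  have "\<bar>?u f\<bar> \<le> norm h * Hs_norm al f" if "f \<in> Hinf" for f
   using Cauchy_Schwarz_ineq2[of "Lam al f" h] that by (simp add: Hs_norm_eq Ld mult.commute)
  then show "\<exists>C. \<exists>r>0. \<forall>f\<in>Hinf. \<bar>?u f\<bar> \<le> C * Hs_norm r f" using al by blast
 qed
 have cm: "Lam al (cos_mode k) = (lam al k / 2) *\<^sub>R (cas k + cas (- k))"
  and sm: "Lam al (sin_mode k) = (lam al k / 2) *\<^sub>R (cas k - cas (- k))" for k
  unfolding cos_mode_eq sin_mode_eq
  by (simp_all add: Lam_scaleR Lam_add Lam_diff Lam_dom_add Lam_dom_diff Lam_dom_scaleR coef_Lam_dom_cas Lam_cas scaleR_add_right scaleR_diff_right)
 have ci: "cas l \<bullet> x = coef x l" for l x by (simp add: coef_def inner_commute)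
 have df: "dist_fourier ?u k = of_real (lam al k) * fourier ?h k" if k: "k \<noteq> 0" for k
  using k unfolding dist_fourier_def cm sm fourier_coef
  by (simp add: ci coef_mean_zero_part complex_eq_iff inner_add_left inner_diff_left algebra_simps)
 have term_eq: "(2 * pi * wave_norm k) powr (2 * (- al)) * (cmod (dist_fourier ?u k))\<^sup>2
   = (2 * pi * wave_norm k) powr (2 * 0) * (cmod (fourier ?h k))\<^sup>2" if "k \<in> - {(0, 0)}" for k
 proof -
  have k: "k \<noteq> 0" using that by (simp add: zero_prod_def)
  then have om: "0 < om k" using om_ge_1[of k] by linarith
  have "om k powr (2 * (- al)) * (lam al k)\<^sup>2 = 1"
  proof -
   have "(lam al k)\<^sup>2 = om k powr (2 * al)" unfolding lam_sq using k by (simp add: lam_def)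
   then have "om k powr (2 * (- al)) * (lam al k)\<^sup>2 = om k powr (2 * (- al) + 2 * al)" by (simp only: powr_add)
   then show ?thesis using om k by simp
  qed
  then have "om k powr (2 * (- al)) * (cmod (of_real (lam al k) * fourier ?h k))\<^sup>2 = (cmod (fourier ?h k))\<^sup>2"
   by (simp add: norm_mult power_mult_distrib mult.assoc[symmetric])
  then show ?thesis unfolding df[OF k] using om k by (simp add: om_def)
 qed
 have hH: "?h \<in> Hs 0" by (simp add: Hs_iff Lam_dom_nonpos H_iff coef_mean_zero_part)
 have "sobolev_finite (- al) (dist_fourier ?u) \<longleftrightarrow> sobolev_finite 0 (fourier ?h)"
  unfolding sobolev_finite_def by (rule summable_on_cong) (rule term_eq)
 then show "?u \<in> Hs_dist (- al)" using mzd hH by (simp add: Hs_dist_def Hs_def)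
 have "Hs_dist_norm (- al) ?u = Hs_norm 0 ?h"
  unfolding Hs_dist_norm_def Hs_norm_def sobolev_norm_def using term_eq by (intro arg_cong[where f = sqrt] infsum_cong)
 also have "\<dots> = norm ?h" using hH by (simp add: Hs_iff Hs_norm_eq Lam_0)
 finally show "Hs_dist_norm (- al) ?u = norm ?h" .
qed

context skeleton_solution
begin

text \<open>The nonlinear term is measurable in time as a series over the modes and essentially
  bounded by \<open>abs_nonlin_le\<close>; the other terms are products of square-integrable
  paths.\<close>

lemma equation_integrable:
 assumes \<phi>: "\<phi> \<in> Cinf_Hinf T"
 shows "integrable (lebesgue_on {0..T}) (\<lambda>s. tet s \<bullet> time_deriv T \<phi> s - tet s \<bullet> Lam (2 * al) (\<phi> s) - nonlin (tet s) (\<phi> s))"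
  "integrable (lebesgue_on {0..T}) (\<lambda>s. Lam al (\<phi> s) \<bullet> g s)"
proof -
 let ?M = "lebesgue_on {0..T}"
 interpret finite_measure ?M by (rule finite_measure_interval)
 note reg = test_function_regular[OF T \<phi>]
 note path = reg(2-4)[THEN continuous_square_integrable_path]
 have "integrable ?M (\<lambda>s. nonlin (tet s) (\<phi> s))"
 proof -
  obtain C where C: "0 \<le> C" "AE t in ?M. norm (tet t) \<le> C" by (rule theta_bounded)
  have "bounded ((\<lambda>s. Lam 4 (\<phi> s)) ` {0..T})"
   by (intro compact_imp_bounded compact_continuous_image reg(2)) simp
  then obtain L where L: "0 < L" "\<And>s. s \<in> {0..T} \<Longrightarrow> norm (Lam 4 (\<phi> s)) \<le> L"
   unfolding bounded_pos by auto
  obtain e :: "nat \<Rightarrow> int \<times> int" where e: "bij e" using ex_mode_enumeration by blast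
  have "(\<lambda>s. \<Sum>i. coef (\<phi> s) (e i) * nl (e i) (tet s) (tet s)) \<in> borel_measurable ?M"
   using square_integrable_pathD(1)[OF path(2)] theta_measurable by measurable
  moreover have "(\<Sum>i. coef (\<phi> s) (e i) * nl (e i) (tet s) (tet s)) = nonlin (tet s) (\<phi> s)" if "s \<in> space ?M" for s
   using that by (intro sums_unique[symmetric] nonlin_sums_Hinf e reg(1) theta_H) auto
  ultimately have m: "(\<lambda>s. nonlin (tet s) (\<phi> s)) \<in> borel_measurable ?M"
   by (subst measurable_cong) (auto intro: sym)
  have "AE s in ?M. norm (nonlin (tet s) (\<phi> s)) \<le> 2 * C\<^sup>2 * (L\<^sup>2 + lam4_total)"
   using C(2) AE_space
  proof eventually_elim
   case (elim s)
   then have s: "s \<in> {0..T}" by simp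
   have nn: "0 \<le> lam4_total" unfolding lam4_total_def by (intro infsum_nonneg) simp
   have "\<bar>nonlin (tet s) (\<phi> s)\<bar> \<le> 2 * (norm (tet s))\<^sup>2 * ((norm (Lam 4 (\<phi> s)))\<^sup>2 + lam4_total)"
    by (rule abs_nonlin_le[OF reg(1)[OF s] theta_H[OF s]])
   also have "\<dots> \<le> 2 * C\<^sup>2 * (L\<^sup>2 + lam4_total)"
    using elim L(2)[OF s] nn by (intro mult_mono add_mono power_mono) auto
   finally show ?case by simp
  qed
  then show ?thesis using m by (rule integrable_const_bound)
 qed
 then show "integrable ?M (\<lambda>s. tet s \<bullet> time_deriv T \<phi> s - tet s \<bullet> Lam (2 * al) (\<phi> s) - nonlin (tet s) (\<phi> s))"
  using square_integrable_path_inner[OF theta_path path(3)] square_integrable_path_inner[OF theta_path path(1)] by simp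
 show "integrable ?M (\<lambda>s. Lam al (\<phi> s) \<bullet> g s)" by (rule square_integrable_path_inner[OF path(1) g])
qed

lemma weak_equation:
 assumes "\<phi> \<in> Cinf_Hinf T" "t \<in> {0..T}"
 shows "tet t \<bullet> \<phi> t = tet0 \<bullet> \<phi> 0 + (\<integral>s. (tet s \<bullet> time_deriv T \<phi> s - tet s \<bullet> Lam (2 * al) (\<phi> s) - nonlin (tet s) (\<phi> s)
         + Lam al (\<phi> s) \<bullet> g s) \<partial>lebesgue_on {0..t})"
proof -
 have "\<forall>\<phi>\<in>Cinf_Hinf T. \<forall>t\<in>{0..T}. tet t \<bullet> \<phi> t = tet0 \<bullet> \<phi> 0 +
    (\<integral>s. (tet s \<bullet> time_deriv T \<phi> s - tet s \<bullet> Lam (2 * al) (\<phi> s) - nonlin (tet s) (\<phi> s)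
        + Lam al (\<phi> s) \<bullet> g s) \<partial>lebesgue_on {0..t})"
  using weak unfolding weak_solution_def by (elim conjE)
 from bspec[OF bspec[OF this assms(1)] assms(2)] show ?thesis .
qed

text \<open>The control itself supplies a competitor in the infimum defining the residual norm. This
  direction suffices, because a strict upper bound below minus the rate is wanted.\<close>

lemma rate_function_le:
 "rate_function al T tet \<le> ereal ((norm (tet 0))\<^sup>2 + (\<integral>s. (norm (mean_zero_part (g s)))\<^sup>2 \<partial>lebesgue_on {0..T}) / 2)"
proof -
 let ?M = "lebesgue_on {0..T}"
 define u where "u t = (\<lambda>f. Lam al f \<bullet> g t)" for t
 have u: "u \<in> L2_Hs_dist T (- al)"
  unfolding L2_Hs_dist_def mem_Collect_eq
 proof (intro conjI ballI)
  show "(\<lambda>t. u t f) \<in> borel_measurable ?M" for f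
   unfolding u_def by (intro measurable_inner_coef square_integrable_pathD[OF g]) simp
  show "AE t in ?M. u t \<in> Hs_dist (- al)" unfolding u_def using Lam_inner_dist(1)[OF alpha] by simp
  show "integrable ?M (\<lambda>t. (Hs_dist_norm (- al) (u t))\<^sup>2)"
   unfolding u_def Lam_inner_dist(2)[OF alpha] by (rule square_integrable_pathD[OF square_integrable_path_mean_zero_part[OF g]])
 qed
 have res: "skeleton_residual al T tet u"
  unfolding skeleton_residual_def
 proof (intro ballI impI)
  fix \<phi> assume \<phi>: "\<phi> \<in> Cinf_Hinf T" and "\<exists>\<delta>>0. \<forall>t\<in>{0..T}. t < \<delta> \<or> T - \<delta> < t \<longrightarrow> \<phi> t = 0"
  \<comment> \<open>Test functions vanishing near both ends remove the boundary terms of the weak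
    equation.\<close>
  then have 0: "\<phi> 0 = 0" "\<phi> T = 0" using T by auto
  note i = equation_integrable[OF \<phi>]
  have "0 = (\<integral>s. (tet s \<bullet> time_deriv T \<phi> s - tet s \<bullet> Lam (2 * al) (\<phi> s) - nonlin (tet s) (\<phi> s)) + Lam al (\<phi> s) \<bullet> g s \<partial>?M)"
   using weak_equation[OF \<phi>, of T] T by (simp add: 0)
  also have "\<dots> = (\<integral>s. tet s \<bullet> time_deriv T \<phi> s - tet s \<bullet> Lam (2 * al) (\<phi> s) - nonlin (tet s) (\<phi> s) \<partial>?M) + (\<integral>s. Lam al (\<phi> s) \<bullet> g s \<partial>?M)"
   using i by (rule Bochner_Integration.integral_add)
  finally have "(\<integral>s. Lam al (\<phi> s) \<bullet> g s \<partial>?M) = - (\<integral>s. tet s \<bullet> time_deriv T \<phi> s - tet s \<bullet> Lam (2 * al) (\<phi> s) - nonlin (tet s) (\<phi> s) \<partial>?M)"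
   by simp
  also have "\<dots> = (\<integral>s. - (tet s \<bullet> time_deriv T \<phi> s) + tet s \<bullet> Lam (2 * al) (\<phi> s) + nonlin (tet s) (\<phi> s) \<partial>?M)"
   unfolding Bochner_Integration.integral_minus[symmetric] by (intro Bochner_Integration.integral_cong) auto
  finally show "(\<integral>s. - (tet s \<bullet> time_deriv T \<phi> s) + tet s \<bullet> Lam (2 * al) (\<phi> s) + nonlin (tet s) (\<phi> s) \<partial>?M) = (\<integral>s. u s (\<phi> s) \<partial>?M)"
   by (simp add: u_def)
 qed
 have "residual_norm_sq al T tet \<le> ereal (\<integral>t. (Hs_dist_norm (- al) (u t))\<^sup>2 \<partial>?M)"
  unfolding residual_norm_sq_def by (rule INF_lower) (use u res in simp)
 then have "residual_norm_sq al T tet \<le> ereal (\<integral>s. (norm (mean_zero_part (g s)))\<^sup>2 \<partial>?M)"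
  unfolding u_def Lam_inner_dist(2)[OF alpha] .
 then have "ereal (1/2) * residual_norm_sq al T tet \<le> ereal (1/2) * ereal (\<integral>s. (norm (mean_zero_part (g s)))\<^sup>2 \<partial>?M)"
  by (rule ereal_mult_left_mono) simp
 then have "rate_function al T tet \<le> ereal ((norm (tet 0))\<^sup>2) + ereal (1/2) * ereal (\<integral>s. (norm (mean_zero_part (g s)))\<^sup>2 \<partial>?M)"
  unfolding rate_function_def by (rule add_left_mono)
 then show ?thesis by simp
qed

section \<open>Time reversal\<close>

definition theta_rev :: "real \<Rightarrow> l2" where "theta_rev = time_reversal T tet"
text \<open>For the path \<open>- tet (T - s)\<close> the dissipation has the wrong sign. Writing it
  as the right one plus twice the opposite moves the excess into the control.\<close>

definition grev :: "real \<Rightarrow> l2" where "grev s = g (T - s) - 2 *\<^sub>R Lam al (tet (T - s))"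

lemma theta_rev: "s \<in> {0..T} \<Longrightarrow> theta_rev s = - tet (T - s)"
 by (simp add: theta_rev_def time_reversal_def)

lemma square_integrable_path_reflect:
 assumes "square_integrable_path T f" shows "square_integrable_path T (\<lambda>s. f (T - s))"
 using measurable_compose[OF measurable_reflect square_integrable_pathD(1)[OF assms]]
  integrable_reflect(1)[OF square_integrable_pathD(2)[OF assms]]
 by (rule square_integrable_pathI)

lemma grev_path: "square_integrable_path T grev"
 unfolding grev_def
 by (intro square_integrable_path_diff square_integrable_path_scaleR square_integrable_path_reflect[of g]
   square_integrable_path_reflect[of "\<lambda>s. Lam al (tet s)"] g Lam_theta_path)

lemma theta_rev_L2_Hs: "theta_rev \<in> L2_Hs T al" and theta_rev_Linf_H: "theta_rev \<in> Linf_H T"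
proof -
 let ?M = "lebesgue_on {0..T}"
 have "(\<lambda>s. - tet (T - s)) \<in> borel_measurable ?M"
  by (rule measurable_compose[OF measurable_compose[OF measurable_reflect theta_measurable] borel_measurable_continuous_onI])
    (intro continuous_intros)
 then have m: "theta_rev \<in> borel_measurable ?M"
  by (subst measurable_cong[of ?M theta_rev "\<lambda>s. - tet (T - s)"]) (auto simp: theta_rev)
 have n: "integrable ?M (\<lambda>s. (Hs_norm al (tet s))\<^sup>2)" using theta_L2_Hs by (simp add: L2_Hs_def)
 have "AE s in ?M. tet (T - s) \<in> Hs al" using theta_L2_Hs by (intro AE_reflect) (simp add: L2_Hs_def)
 then have ae: "AE s in ?M. theta_rev s \<in> Hs al"
  using AE_space by eventually_elim (auto simp: theta_rev Hs_iff H_minus Lam_dom_minus)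
 have "integrable ?M (\<lambda>s. (Hs_norm al (theta_rev s))\<^sup>2)"
  using integrable_reflect(1)[OF n] by (subst Bochner_Integration.integrable_cong[OF refl, of _ _ "\<lambda>s. (Hs_norm al (tet (T - s)))\<^sup>2"])
   (auto simp: theta_rev Hs_norm_minus)
 then show "theta_rev \<in> L2_Hs T al" using m ae by (simp add: L2_Hs_def)
 obtain C where "AE t in ?M. norm (tet t) \<le> C" by (rule theta_bounded)
 then have "AE t in ?M. norm (tet (T - t)) \<le> C" by (rule AE_reflect)
 then have "AE t in ?M. theta_rev t \<in> H \<and> norm (theta_rev t) \<le> C"
  using AE_space by eventually_elim (auto simp: theta_rev H_minus theta_H)
 then show "theta_rev \<in> Linf_H T" using m by (auto simp: Linf_H_def)
qed

lemma theta_rev_C_Hw: "theta_rev \<in> C_Hw T"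
 unfolding C_Hw_def mem_Collect_eq
proof (intro conjI ballI)
 show "theta_rev \<in> extensional {0..T}" unfolding theta_rev_def time_reversal_def by (rule restrict_extensional)
 show "theta_rev t \<in> H" if "t \<in> {0..T}" for t using that by (auto simp: theta_rev H_minus theta_H)
 fix y assume "y \<in> H"
 then have "continuous_on {0..T} (\<lambda>t. tet t \<bullet> y)" using weak by (auto simp: weak_solution_def C_Hw_def)
 then have "continuous_on {0..T} (\<lambda>t. tet (T - t) \<bullet> y)"
  by (rule continuous_on_compose2) (auto intro!: continuous_intros)
 then have "continuous_on {0..T} (\<lambda>t. - (tet (T - t) \<bullet> y))" by (rule continuous_on_minus)
 then show "continuous_on {0..T} (\<lambda>t. theta_rev t \<bullet> y)" by (rule continuous_on_eq) (simp add: theta_rev)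
qed

text \<open>The equation of \<open>tet\<close> is tested with the reflected test function, and its
  form at time \<open>T - t\<close> is subtracted from its form at \<open>T\<close>; reflection of
  the remaining integral over \<open>{T - t..T}\<close> gives the claim.\<close>

lemma theta_rev_equation:
 assumes \<phi>: "\<phi> \<in> Cinf_Hinf T" and t: "t \<in> {0..T}"
 shows "theta_rev t \<bullet> \<phi> t = - tet T \<bullet> \<phi> 0 + (\<integral>s. (theta_rev s \<bullet> time_deriv T \<phi> s - theta_rev s \<bullet> Lam (2 * al) (\<phi> s) - nonlin (theta_rev s) (\<phi> s)
         + Lam al (\<phi> s) \<bullet> grev s) \<partial>lebesgue_on {0..t})"
proof -
 let ?M = "lebesgue_on {0..T}"
 define \<phi>' where "\<phi>' s = \<phi> (T - s)" for s
 have \<phi>': "\<phi>' \<in> Cinf_Hinf T" "\<And>s. s \<in> {0..T} \<Longrightarrow> time_deriv T \<phi>' s = - time_deriv T \<phi> (T - s)"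
  unfolding \<phi>'_def[abs_def] using reflect_test_function[OF T \<phi>] by auto
 define K where "K s = tet s \<bullet> time_deriv T \<phi>' s - tet s \<bullet> Lam (2 * al) (\<phi>' s) - nonlin (tet s) (\<phi>' s) + Lam al (\<phi>' s) \<bullet> g s" for s
 define K' where "K' s = theta_rev s \<bullet> time_deriv T \<phi> s - theta_rev s \<bullet> Lam (2 * al) (\<phi> s) - nonlin (theta_rev s) (\<phi> s) + Lam al (\<phi> s) \<bullet> grev s" for s
 have iK: "integrable ?M K"
  unfolding K_def[abs_def] using equation_integrable[OF \<phi>'(1)] by (rule Bochner_Integration.integrable_add)
 have iK': "integrable ?M (\<lambda>s. K (T - s))" by (rule integrable_reflect(1)[OF iK])
 have sub: "{0..t} \<subseteq> {0..T}" using t by auto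
 have "AE s in ?M. tet (T - s) \<in> Lam_dom al" by (rule AE_reflect[OF AE_Lam_dom])
 then have "AE s in ?M. K (T - s) = K' s"
  using AE_space
 proof eventually_elim
  case (elim s)
  then have s: "s \<in> {0..T}" "T - s \<in> {0..T}" by auto
  note pH = test_function_regular(1)[OF T \<phi> s(1)]
  have Ld: "\<phi> s \<in> Lam_dom r" for r using pH by (simp add: Hinf_iff)
  have td: "time_deriv T \<phi>' (T - s) = - time_deriv T \<phi> s" using \<phi>'(2)[OF s(2)] by simp
  \<comment> \<open>The path lies only in the domain of order \<open>al\<close>, so one factor
    \<Lambda>^\<alpha> stays on it inside the control; moving it to the test function produces the
    sign change of the dissipation.\<close>
  have "Lam al (tet (T - s)) \<bullet> Lam al (\<phi> s) = tet (T - s) \<bullet> Lam (2 * al) (\<phi> s)"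
   using inner_Lam_Lam[OF elim(1) Ld Ld] by simp
  then show ?case
   unfolding K_def K'_def td theta_rev[OF s(1)] grev_def nonlin_minus[OF pH theta_H[OF s(2)]]
   by (simp add: \<phi>'_def inner_diff_right inner_commute[of "Lam al (\<phi> s)" "Lam al (tet (T - s))"])
 qed
 then have ae: "AE s in lebesgue_on {0..t}. K (T - s) = K' s"
  using sub by (simp add: AE_restrict_space_iff) (auto elim: eventually_mono)
 note it = integrable_lebesgue_on_subinterval[OF iK' sub]
 have mK: "(\<lambda>s. K (T - s)) \<in> borel_measurable (lebesgue_on {0..t})" using it(1) by simp
 have "(\<integral>s. K' s \<partial>lebesgue_on {0..t}) = (\<integral>s. K (T - s) \<partial>lebesgue_on {0..t})"
  using borel_measurable_lebesgue_on_AE[OF mK _ ae] mK ae by (intro integral_cong_AE) (auto elim: eventually_mono)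
 also have "\<dots> = integral {0..t} (\<lambda>s. K (T - s))" by (rule it(3))
 also have "\<dots> = integral {T - t..T} K"
  using t by (intro integral_reflect_end integrable_lebesgue_on_subinterval(2)[OF iK]) auto
 also have "\<dots> = (\<integral>s. K s \<partial>lebesgue_on {0..T}) - (\<integral>s. K s \<partial>lebesgue_on {0..T - t})"
  using t by (intro integrable_lebesgue_on_diff[OF iK, symmetric]) auto
 also have "\<dots> = tet T \<bullet> \<phi>' T - tet (T - t) \<bullet> \<phi>' (T - t)"
  using weak_equation[OF \<phi>'(1), of T] weak_equation[OF \<phi>'(1), of "T - t"] t T unfolding K_def by simp
 also have "\<dots> = tet T \<bullet> \<phi> 0 - tet (T - t) \<bullet> \<phi> t" by (simp add: \<phi>'_def)
 finally show ?thesis unfolding K'_def theta_rev[OF t] by simp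
qed

lemma reversed: "skeleton_solution al T grev theta_rev (- tet T)"
proof
 show "weak_solution al T (- tet T) grev theta_rev"
  unfolding weak_solution_def
  using theta_rev_equation theta_rev_C_Hw theta_rev_L2_Hs theta_rev_Linf_H H_minus[OF theta_H[of T]] T by auto
qed (use T alpha grev_path in auto)

text \<open>Writing \<open>E\<close> for the dissipation integral and \<open>P\<close> for the work
  of the control, reversal keeps \<open>E\<close> and turns \<open>P\<close> into
  \<open>2 * E - P\<close>. Hence \<open>E - P\<close> changes sign, and so does the difference of
  the end point energies.\<close>

lemma reversed_energy:
 "(\<integral>s. (Hs_norm al (theta_rev s))\<^sup>2 \<partial>lebesgue_on {0..T}) = (\<integral>s. (Hs_norm al (tet s))\<^sup>2 \<partial>lebesgue_on {0..T})"
 "(\<integral>s. Lam al (theta_rev s) \<bullet> grev s \<partial>lebesgue_on {0..T})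
  = 2 * (\<integral>s. (Hs_norm al (tet s))\<^sup>2 \<partial>lebesgue_on {0..T}) - (\<integral>s. Lam al (tet s) \<bullet> g s \<partial>lebesgue_on {0..T})"
proof -
 let ?M = "lebesgue_on {0..T}"
 have n: "integrable ?M (\<lambda>s. (Hs_norm al (tet s))\<^sup>2)" using theta_L2_Hs by (simp add: L2_Hs_def)
 have "(\<integral>s. (Hs_norm al (theta_rev s))\<^sup>2 \<partial>?M) = (\<integral>s. (Hs_norm al (tet (T - s)))\<^sup>2 \<partial>?M)"
  by (intro Bochner_Integration.integral_cong) (auto simp: theta_rev Hs_norm_minus)
 then show "(\<integral>s. (Hs_norm al (theta_rev s))\<^sup>2 \<partial>?M) = (\<integral>s. (Hs_norm al (tet s))\<^sup>2 \<partial>?M)"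
  using integrable_reflect(2)[OF n] by simp
 have i1: "integrable ?M (\<lambda>s. (norm (Lam al (tet s)))\<^sup>2)" by (rule square_integrable_pathD[OF Lam_theta_path])
 have i2: "integrable ?M (\<lambda>s. Lam al (tet s) \<bullet> g s)" by (rule square_integrable_path_inner[OF Lam_theta_path g])
 define h where "h s = 2 * (norm (Lam al (tet s)))\<^sup>2 - Lam al (tet s) \<bullet> g s" for s
 have ih: "integrable ?M h" unfolding h_def using i1 i2 by simp
 have "(\<integral>s. Lam al (theta_rev s) \<bullet> grev s \<partial>?M) = (\<integral>s. h (T - s) \<partial>?M)"
 proof (rule integral_cong_AE)
  show "(\<lambda>s. Lam al (theta_rev s) \<bullet> grev s) \<in> borel_measurable ?M"
   using square_integrable_path_inner[OF square_integrable_path_Lam(1)[OF theta_rev_L2_Hs] grev_path] by simp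
  show "(\<lambda>s. h (T - s)) \<in> borel_measurable ?M" using integrable_reflect(1)[OF ih] by simp
  have "AE s in ?M. tet (T - s) \<in> Lam_dom al" by (rule AE_reflect[OF AE_Lam_dom])
  then show "AE s in ?M. Lam al (theta_rev s) \<bullet> grev s = h (T - s)"
   using AE_space
  proof eventually_elim
   case (elim s)
   then have s: "s \<in> {0..T}" by simp
   show ?case unfolding theta_rev[OF s] Lam_minus[OF elim(1)] grev_def h_def power2_norm_eq_inner by (simp add: inner_diff_right)
  qed
 qed
 also have "\<dots> = (\<integral>s. h s \<partial>?M)" by (rule integrable_reflect(2)[OF ih])
 also have "\<dots> = 2 * (\<integral>s. (norm (Lam al (tet s)))\<^sup>2 \<partial>?M) - (\<integral>s. Lam al (tet s) \<bullet> g s \<partial>?M)"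
  unfolding h_def using i1 i2 by simp
 finally show "(\<integral>s. Lam al (theta_rev s) \<bullet> grev s \<partial>?M)
  = 2 * (\<integral>s. (Hs_norm al (tet s))\<^sup>2 \<partial>?M) - (\<integral>s. Lam al (tet s) \<bullet> g s \<partial>?M)"
  unfolding square_integrable_path_Lam(2)[OF theta_L2_Hs] .
qed

text \<open>Expanding the square in \<open>reversed_forcing\<close> shows that \<open>J - L\<close>
  is twice the energy defect, thus positive. As \<open>L\<close> bounds the rate function and every
  level below \<open>J\<close> is exceeded by some functional, the midpoint can serve as
  \<open>\<kappa>\<close>.\<close>

lemma ex_path_functional_above_rate:
 assumes energy: "(1/2) * (norm (tet T))\<^sup>2 + (\<integral>s. (Hs_norm al (tet s))\<^sup>2 \<partial>lebesgue_on {0..T})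
    > (1/2) * (norm (tet 0))\<^sup>2 + (\<integral>s. Lam al (tet s) \<bullet> g s \<partial>lebesgue_on {0..T})"
 obtains \<kappa> F c y n0 \<psi> where "rate_function al T tet < ereal \<kappa>"
  "finite F" "0 \<notin> F" "\<And>k. k \<notin> F \<Longrightarrow> y k = 0" "\<And>r k. k \<notin> F \<Longrightarrow> \<psi> r k = 0"
  "0 \<le> c" "c < 1" "0 < n0" "\<kappa> < path_functional al T F c y n0 \<psi> tet"
proof -
 let ?M = "lebesgue_on {0..T}"
 define J where "J = (norm (tet T))\<^sup>2 + (\<integral>s. (norm (reversed_forcing s))\<^sup>2 / 2 \<partial>?M)"
 define L where "L = (norm (tet 0))\<^sup>2 + (\<integral>s. (norm (mean_zero_part (g s)))\<^sup>2 \<partial>?M) / 2"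
 have "J = (norm (tet T))\<^sup>2 + ((\<integral>s. (norm (mean_zero_part (g s)))\<^sup>2 \<partial>?M)
   - 4 * (\<integral>s. Lam al (tet s) \<bullet> g s \<partial>?M) + 4 * (\<integral>s. (Hs_norm al (tet s))\<^sup>2 \<partial>?M)) / 2"
  unfolding J_def integral_reversed_forcing[symmetric] by simp
 then have LJ: "L < J" using energy unfolding L_def by (simp add: field_simps)
 define \<kappa> where "\<kappa> = (J + L) / 2"
 have "\<kappa> < J" "L < \<kappa>" using LJ by (simp_all add: \<kappa>_def)
 then have "\<kappa> < (norm (tet T))\<^sup>2 + (\<integral>s. (norm (reversed_forcing s))\<^sup>2 / 2 \<partial>?M)" by (simp add: J_def)
 then obtain F c y n0 \<psi> where *: "finite F" "0 \<notin> F" "\<And>k. k \<notin> F \<Longrightarrow> y k = 0" "\<And>r k. k \<notin> F \<Longrightarrow> \<psi> r k = 0"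
  "0 \<le> c" "c < 1" "0 < n0" "\<kappa> < path_functional al T F c y n0 \<psi> tet"
  by (rule ex_path_functional) blast
 have "rate_function al T tet < ereal \<kappa>"
  using rate_function_le \<open>L < \<kappa>\<close> unfolding L_def[symmetric] by (meson ereal_less(2) le_less_trans less_ereal.simps(1))
 from that[OF this *] show ?thesis .
qed

end

section \<open>The two inequalities for a weak solution and its time reversal\<close>

theorem corollary1p5:
  fixes \<alpha> T :: real
    and M :: "'a measure"
    and W :: "real \<Rightarrow> l2 \<Rightarrow> 'a \<Rightarrow> real"
    and m :: "real \<Rightarrow> nat"
    and \<Theta> :: "real \<Rightarrow> 'a \<Rightarrow> real \<Rightarrow> l2"
    and \<mu> :: "real \<Rightarrow> (real \<Rightarrow> l2) measure"
    and \<theta>0 :: l2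
    and \<theta> g :: "real \<Rightarrow> l2"
  assumes T: "0 < T"
    and alpha: "0 < \<alpha>" "\<alpha> < 1"
    and M: "prob_space M"
    and W: "cylindrical_wiener M W"
    and m_pos: "\<And>\<epsilon>. 0 < \<epsilon> \<Longrightarrow> 0 < m \<epsilon>"
    and m_at_top: "filterlim m at_top (at_right 0)"
    and scaling: "((\<lambda>\<epsilon>. \<epsilon> * real (m \<epsilon>) powr (2 + 2 * \<alpha>)) \<longlongrightarrow> 0) (at_right 0)"
    and Theta: "\<And>\<epsilon>. 0 < \<epsilon> \<Longrightarrow> galerkin_solution M W \<alpha> T \<epsilon> (m \<epsilon>) (\<Theta> \<epsilon>)"
    and initial_law: "\<And>\<epsilon>. 0 < \<epsilon> \<Longrightarrow>
          gaussian_on_H (\<lambda>h. (\<epsilon> / 2) *\<^sub>R Pm (m \<epsilon>) h) (distr M borel (\<lambda>\<omega>. \<Theta> \<epsilon> \<omega> 0))"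
    and initial_indep: "\<And>\<epsilon>. 0 < \<epsilon> \<Longrightarrow> independent_of_noise M W (\<lambda>\<omega>. \<Theta> \<epsilon> \<omega> 0)"
    and mu: "\<And>\<epsilon>. 0 < \<epsilon> \<Longrightarrow> \<mu> \<epsilon> = path_law \<alpha> T M (\<Theta> \<epsilon>)"
    and g: "g \<in> L2_L2 T"
    and theta: "weak_solution \<alpha> T \<theta>0 g \<theta>"
  shows
    "((1/2) * (norm (\<theta> T))\<^sup>2 + (\<integral>s. (Hs_norm \<alpha> (\<theta> s))\<^sup>2 \<partial>lebesgue_on {0..T})
        > (1/2) * (norm (\<theta> 0))\<^sup>2 + (\<integral>s. Lam \<alpha> (\<theta> s) \<bullet> g s \<partial>lebesgue_on {0..T})
      \<longrightarrow>
      (INF G\<in>{G. openin (X_topology \<alpha> T) G \<and> \<theta> \<in> G}.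
         Liminf (at_right 0) (\<lambda>\<epsilon>. ereal \<epsilon> * elog (measure (\<mu> \<epsilon>) G)))
        < - rate_function \<alpha> T \<theta>)
     \<and>
     ((1/2) * (norm (\<theta> T))\<^sup>2 + (\<integral>s. (Hs_norm \<alpha> (\<theta> s))\<^sup>2 \<partial>lebesgue_on {0..T})
        < (1/2) * (norm (\<theta> 0))\<^sup>2 + (\<integral>s. Lam \<alpha> (\<theta> s) \<bullet> g s \<partial>lebesgue_on {0..T})
      \<longrightarrow>
      (INF G\<in>{G. openin (X_topology \<alpha> T) G \<and> time_reversal T \<theta> \<in> G}.
         Liminf (at_right 0) (\<lambda>\<epsilon>. ereal \<epsilon> * elog (measure (\<mu> \<epsilon>) G)))
        < - rate_function \<alpha> T (time_reversal T \<theta>))"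
proof -
  interpret skeleton_solution \<alpha> T g \<theta> \<theta>0
    using T alpha(1) theta L2_L2_square_integrable_path[OF g] by unfold_locales
  \<comment> \<open>Formulated for an arbitrary solution of the skeleton equation with positive
    energy defect, so as to apply to the given path and to its reversal alike.\<close>
  have bound: "(INF G\<in>{G. openin (X_topology \<alpha> T) G \<and> \<eta> \<in> G}.
         Liminf (at_right 0) (\<lambda>\<epsilon>. ereal \<epsilon> * elog (measure (\<mu> \<epsilon>) G)))
        < - rate_function \<alpha> T \<eta>"
    if \<eta>: "skeleton_solution \<alpha> T h \<eta> \<eta>0"
      and energy: "(1/2) * (norm (\<eta> T))\<^sup>2 + (\<integral>s. (Hs_norm \<alpha> (\<eta> s))\<^sup>2 \<partial>lebesgue_on {0..T})
        > (1/2) * (norm (\<eta> 0))\<^sup>2 + (\<integral>s. Lam \<alpha> (\<eta> s) \<bullet> h s \<partial>lebesgue_on {0..T})"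
    for h \<eta> \<eta>0
  proof -
    obtain \<kappa> F c y n0 \<psi> where \<kappa>: "rate_function \<alpha> T \<eta> < ereal \<kappa>"
      and F: "finite F" "0 \<notin> F" "\<And>k. k \<notin> F \<Longrightarrow> y k = 0" "\<And>r k. k \<notin> F \<Longrightarrow> \<psi> r k = 0"
      and c: "0 \<le> c" "c < 1" "0 < n0" "\<kappa> < path_functional \<alpha> T F c y n0 \<psi> \<eta>"
      by (rule skeleton_solution.ex_path_functional_above_rate[OF \<eta> energy]) blast
    have "(INF G\<in>{G. openin (X_topology \<alpha> T) G \<and> \<eta> \<in> G}.
         Liminf (at_right 0) (\<lambda>\<epsilon>. ereal \<epsilon> * elog (measure (\<mu> \<epsilon>) G))) \<le> ereal (- \<kappa>)"
      by (rule local_upper_bound[OF T alpha(1) M W m_pos m_at_top scaling Theta initial_law initial_indep mu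
            skeleton_solution.theta_X_space[OF \<eta>] F c])
    also have "ereal (- \<kappa>) < - rate_function \<alpha> T \<eta>"
      using \<kappa> ereal_minus_less_minus[of "ereal \<kappa>" "rate_function \<alpha> T \<eta>"] by simp
    finally show ?thesis .
  qed
  have 2: "(1/2) * (norm (theta_rev T))\<^sup>2 + (\<integral>s. (Hs_norm \<alpha> (theta_rev s))\<^sup>2 \<partial>lebesgue_on {0..T})
        > (1/2) * (norm (theta_rev 0))\<^sup>2 + (\<integral>s. Lam \<alpha> (theta_rev s) \<bullet> grev s \<partial>lebesgue_on {0..T})"
    if "(1/2) * (norm (\<theta> T))\<^sup>2 + (\<integral>s. (Hs_norm \<alpha> (\<theta> s))\<^sup>2 \<partial>lebesgue_on {0..T})
        < (1/2) * (norm (\<theta> 0))\<^sup>2 + (\<integral>s. Lam \<alpha> (\<theta> s) \<bullet> g s \<partial>lebesgue_on {0..T})"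
    using that T unfolding reversed_energy by (simp add: theta_rev)
  show ?thesis
    using bound[OF skeleton_solution_axioms] bound[OF reversed 2] unfolding theta_rev_def by blast
qed

end
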